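(* Let $\rho_0,\rho_1>0$, $\xi_\delta>0$, $u_0,u_1\in\mathbb{R}$, and consider the pressureless gas dynamics system $$\partial_t\rho+\partial_x(\rho u)=0,\qquad \partial_t(\rho u)+\partial_x(\rho u^2)=0$$ with initial data $$(\rho,u)(x,0)=\begin{cases}(\rho_0,u_0),&x<0\\(\rho_1,u_1),&x>0\end{cases}+(\xi_\delta,0)\delta .$$ (i) If $u_0>u_1$, the admissible weak solution satisfying the backward energy condition is the delta shock wave propagating with constant speed $y$ given by $$U(x,t)=\begin{cases}(\rho_0,u_0),&x<yt\\(\rho_1,u_1),&x>yt\end{cases}+(\xi_\delta+\xi t,0)\,\delta(x-yt),$$ where $\xi=\sqrt{\rho_0\rho_1}(u_0-u_1)$ and $y=\frac{u_0\sqrt{\rho_0}+u_1\sqrt{\rho_1}}{\sqrt{\rho_0}+\sqrt{\rho_1}}$. (ii) If $u_0\le u_1$, the admissible solution satisfying the backward energy condition locally conserves energy in the sense of distributions and it is given by $$U(x,t)=\begin{cases}(\rho_0,u_0),&x<u_0t\\(0,\frac{x}{t}),&u_0t<x<u_\delta t\\(0,\frac{x}{t}),&u_\delta t<x<u_1t\\(\rho_1,u_1),&x>u_1t\end{cases}+(\xi_\delta,0)\,\delta(x-u_\delta t),$$ where $u_\delta\in[u_0,u_1]$ is the value minimizing the total initial energy, i.e. $u_\delta=0$ if $\mathrm{sign}(u_0u_1)<0$, $u_\delta=\min\{u_0,u_1\}$ if $\mathrm{sign}(u_0),\mathrm{sign}(u_1)\ge0$, and $u_\delta=\max\{u_0,u_1\}$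 if $\mathrm{sign}(u_0),\mathrm{sign}(u_1)\le0$.
   Context: Energy pair: $\eta=\frac12\rho u^2$, $Q=\eta u$. Both characteristic speeds equal $u$. Shadow wave: a net $$U^\varepsilon(x,t)=\begin{cases} U_0(x,t),&x<c(t)-\frac\varepsilon2t-x_\varepsilon \\ U_{0,\varepsilon}(t),&c(t)-\frac\varepsilon2t-x_\varepsilon<x<c(t) \\ U_{1,\varepsilon}(t),&c(t)<x<c(t)+\frac\varepsilon2t+x_\varepsilon \\ U_1(x,t),&x>c(t)+\frac\varepsilon2t+x_\varepsilon\end{cases}$$ ($U_0,U_1$ smooth solutions, $x_\varepsilon\to 0$) satisfying the system in the limit $\varepsilon\to0$ in the sense of distributions; $x=c(t)$ is its front, $c'(t)$ its speed, and its strength is $\lim_{\varepsilon\to0}(\frac\varepsilon2t+x_\varepsilon)(U_{0,\varepsilon}(t)+U_{1,\varepsilon}(t))$, which for this system is nonzero in the $\rho$-component only, $u$ being bounded. It is overcompressive if all characteristics run into its front (here $u_0\ge c'(t)\ge u_1$ for left and right velocities $u_0,u_1$). Admissible solution of a Riemann problem with left state $(\rho_0,u_0)$ and right state $(\rho_1,u_1)$: if $u_0\le u_1$, two contact discontinuities $x=u_0t$, $x=u_1t$ separated by the vacuum $(0,x/t)$; if $u_0>u_1$, the overcompressive shadow wave with speed $\frac{\sqrt{\rho_0}u_0+\sqrt{\rho_1}u_1}{\sqrt{\rho_0}+\sqrt{\rho_1}}$ and strength $\sqrt{\rho_0\rho_1}(u_0-u_1)t$. Solutions for delta initial data: for a small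 parameter $\mu>0$ (with $\varepsilon\ll\mu\ll 1$) the data are approximated by $$U_\mu(x,0)=\begin{cases}(\rho_0,u_0),&x<-\frac\mu2\\(\frac{\xi_\delta}{\mu},u_\delta),&-\frac\mu2<x<\frac\mu2\\(\rho_1,u_1),&x>\frac\mu2,\end{cases}$$ where the value $u_\delta$ is to be chosen and may depend on $\mu$. The approximate solution corresponding to $u_\delta$ is obtained by solving the two Riemann problems at $x=\mp\mu/2$ admissibly and following all further wave interactions, each resolved admissibly (with overcompressive shadow waves where singular waves arise). The distributional solution of the original problem is the distributional limit as $\mu\to0$ (with $\varepsilon\to 0$ even faster). Energy: $H_{[-L,L]}(U(\cdot,t))=\lim_{\varepsilon\to0}\int_{-L}^L\eta(U^\varepsilon(x,t))\,dx$ with $L$ large. Backward energy condition: a solution $U$ satisfies it if it is an admissible solution of the problem with the delta initial data for some $u_\delta$ such that $$\frac{d}{dt}H_{[-L,L]}(\tilde U(\cdot,0+))\le\frac{d}{dt}H_{[-L,L]}(U(\cdot,0+))\quad\text{for }\mu\text{ small enough},$$ where $\tilde U$ is an admissible solution corresponding to some other initial value $\tilde u_\delta$ (that is, $U$ has minimal energy dissipation at the initial time). Here $U$ and $\tilde U$ are approximate solutions depending on $\varepsilon\ll\mu$. If more than one solution satisfies this, the one corresponding to initial data with minimal total initial energy $\int_{-L}^L\eta(U_\mu(x,0))\,dx$ is chosen. In case (i) the value of $u_\delta$ in the approximate data for which the condition is satisfied is the $\mu$-dependent value $$u_\delta=y^\mu=\frac{u_0\sqrt{r_0^\mu}+u_1\sqrt{r_1^\mu}}{\sqrt{r_0^\mu}+\sqrt{r_1^\mu}},\qquad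 r_i^\mu=\frac{\rho_i\,\xi_\delta/\mu}{(\sqrt{\xi_\delta/\mu}+\sqrt{\rho_i})^2},\ i=0,1,$$ and $y^\mu\to y$ as $\mu\to0$. *)

theory Defs
  imports "HOL-Analysis.Analysis"
begin

section \<open>States, energy pair, test functions\<close>

text \<open>A state is a pair (density, velocity), a field assigns a state to \<open>x\<close> and \<open>t\<close>, and a net
  takes the parameter \<open>\<epsilon>\<close> as its first argument. All limits in \<open>\<epsilon>\<close> and \<open>\<mu>\<close> are along
  \<open>at_right 0\<close>.\<close>

type_synonym state = "real \<times> real"
type_synonym field = "real \<Rightarrow> real \<Rightarrow> state"
type_synonym net = "real \<Rightarrow> field"

definition \<eta> :: "state \<Rightarrow> real" where
  "\<eta> U = fst U * (snd U)\<^sup>2 / 2"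

definition Q :: "state \<Rightarrow> real" where
  "Q U = \<eta> U * snd U"

text \<open>\<open>D i j\<close> is the partial derivative of order \<open>i\<close> in \<open>x\<close> and \<open>j\<close> in \<open>t\<close>. Differentiability of
  all of them makes all of them continuous, so this is the usual class of infinitely
  differentiable functions of two variables.\<close>

definition smooth :: "(real \<times> real \<Rightarrow> real) \<Rightarrow> bool" where
  "smooth \<phi> \<longleftrightarrow> (\<exists>D :: nat \<Rightarrow> nat \<Rightarrow> real \<times> real \<Rightarrow> real. D 0 0 = \<phi> \<and>
     (\<forall>i j z. (D i j has_derivative
        (\<lambda>h. D (Suc i) j z * fst h + D i (Suc j) z * snd h)) (at z)))"

definition test_function :: "(real \<times> real) set \<Rightarrow> (real \<times> real \<Rightarrow> real) \<Rightarrow> bool" where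
  "test_function \<Omega> \<phi> \<longleftrightarrow> smooth \<phi> \<and> compact (closure {z. \<phi> z \<noteq> 0}) \<and> closure {z. \<phi> z \<noteq> 0} \<subseteq> \<Omega>"

definition dx :: "(real \<times> real \<Rightarrow> real) \<Rightarrow> real \<Rightarrow> real \<Rightarrow> real" where
  "dx \<phi> x t = deriv (\<lambda>y. \<phi> (y, t)) x"

definition dt :: "(real \<times> real \<Rightarrow> real) \<Rightarrow> real \<Rightarrow> real \<Rightarrow> real" where
  "dt \<phi> x t = deriv (\<lambda>s. \<phi> (x, s)) t"

text \<open>The integral of \<open>f \<partial>\<^sub>t\<phi> + g \<partial>\<^sub>x\<phi>\<close> over the half plane \<open>t > 0\<close>.\<close>

definition weak_form ::
    "(state \<Rightarrow> real) \<Rightarrow> (state \<Rightarrow> real) \<Rightarrow> field \<Rightarrow> (real \<times> real \<Rightarrow> real) \<Rightarrow> real" where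
  "weak_form f g U \<phi> =
     (LBINT t:{0<..}. (LBINT x. f (U x t) * dt \<phi> x t + g (U x t) * dx \<phi> x t))"

text \<open>The net satisfies the pressureless system in the limit in the sense of distributions, with
  initial data \<open>V\<close>; the test functions need not vanish at \<open>t = 0\<close>.\<close>

definition solves_in_limit :: "net \<Rightarrow> (real \<Rightarrow> state) \<Rightarrow> bool" where
  "solves_in_limit N V \<longleftrightarrow> (\<forall>\<phi>. test_function UNIV \<phi> \<longrightarrow>
     ((\<lambda>\<epsilon>. weak_form fst (\<lambda>U. fst U * snd U) (N \<epsilon>) \<phi>
        + (LBINT x. fst (V x) * \<phi> (x, 0))) \<longlongrightarrow> 0) (at_right 0) \<and>
     ((\<lambda>\<epsilon>. weak_form (\<lambda>U. fst U * snd U) (\<lambda>U. fst U * (snd U)\<^sup>2) (N \<epsilon>) \<phi>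
        + (LBINT x. fst (V x) * snd (V x) * \<phi> (x, 0))) \<longlongrightarrow> 0) (at_right 0))"


section \<open>Waves and wave patterns\<close>

text \<open>\<open>Shadow c s A B\<close> has front \<open>c\<close>, shift \<open>s \<epsilon> = x\<^sub>\<epsilon>\<close>, and intermediate states
  \<open>A \<epsilon> t = U\<^sub>0\<^sub>,\<^sub>\<epsilon>(t)\<close>, \<open>B \<epsilon> t = U\<^sub>1\<^sub>,\<^sub>\<epsilon>(t)\<close>.\<close>

datatype wave =
    Contact (front: "real \<Rightarrow> real")
  | is_Shadow: Shadow (front: "real \<Rightarrow> real") (shift: "real \<Rightarrow> real")
      (lmid: "real \<Rightarrow> real \<Rightarrow> state") (rmid: "real \<Rightarrow> real \<Rightarrow> state")

definition width :: "wave \<Rightarrow> real \<Rightarrow> real \<Rightarrow> real" where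
  "width w \<epsilon> t = \<epsilon> / 2 * t + shift w \<epsilon>"

definition strength :: "wave \<Rightarrow> real \<Rightarrow> real \<Rightarrow> bool" where
  "strength w t m \<longleftrightarrow>
     ((\<lambda>\<epsilon>. width w \<epsilon> t * (fst (lmid w \<epsilon> t) + fst (rmid w \<epsilon> t))) \<longlongrightarrow> m) (at_right 0)"

text \<open>A wave pattern is the field on the far left together with a list of waves, from left to
  right, each paired with the field on its right. For fixed \<open>\<epsilon>\<close> the strips of neighbouring
  shadow waves overlap shortly before the fronts meet; the wave further left then takes
  precedence, which is immaterial as \<open>\<epsilon> \<rightarrow> 0\<close>.\<close>

fun profile :: "field \<Rightarrow> (wave \<times> field) list \<Rightarrow> net" where
  "profile V [] \<epsilon> x t = V x t"
| "profile V ((Contact c, V') # ws) \<epsilon> x t = (if x < c t then V x t else profile V' ws \<epsilon> x t)"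
| "profile V ((Shadow c s A B, V') # ws) \<epsilon> x t =
     (if x < c t - \<epsilon> / 2 * t - s \<epsilon> then V x t
      else if x < c t then A \<epsilon> t
      else if x < c t + \<epsilon> / 2 * t + s \<epsilon> then B \<epsilon> t
      else profile V' ws \<epsilon> x t)"

text \<open>Regularity of a shadow wave during the time interval \<open>J\<close>. The velocities are bounded and the
  densities are such that a strength exists. In a net satisfying the system in the limit,
  intermediate velocities carrying positive mass can only converge to the speed of the front;
  this is required pointwise in \<open>t\<close>, so that the energy has a limit at each time and not just
  at almost every time.\<close>

definition regular_shadow :: "real set \<Rightarrow> wave \<Rightarrow> bool" where
  "regular_shadow J w \<longleftrightarrow>
     continuous_on J (front w) \<and> front w C1_differentiable_on (interior J) \<and>
     (shift w \<longlongrightarrow> 0) (at_right 0) \<and>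
     (\<forall>\<^sub>F \<epsilon> in at_right 0.
        continuous_on (interior J) (lmid w \<epsilon>) \<and> continuous_on (interior J) (rmid w \<epsilon>) \<and>
        (\<forall>t\<in>interior J. width w \<epsilon> t > 0 \<and> fst (lmid w \<epsilon> t) \<ge> 0 \<and> fst (rmid w \<epsilon> t) \<ge> 0)) \<and>
     (\<exists>K. \<forall>\<^sub>F \<epsilon> in at_right 0. \<forall>t\<in>interior J.
        \<bar>snd (lmid w \<epsilon> t)\<bar> \<le> K \<and> \<bar>snd (rmid w \<epsilon> t)\<bar> \<le> K) \<and>
     (\<forall>R. \<exists>K. \<forall>\<^sub>F \<epsilon> in at_right 0. \<forall>t\<in>interior J. t \<le> R \<longrightarrow>
        width w \<epsilon> t * (fst (lmid w \<epsilon> t) + fst (rmid w \<epsilon> t)) \<le> K) \<and>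
     (\<forall>t\<in>interior J. (\<exists>m. strength w t m) \<and>
        ((\<lambda>\<epsilon>. snd (lmid w \<epsilon> t)) \<longlongrightarrow> deriv (front w) t) (at_right 0) \<and>
        ((\<lambda>\<epsilon>. snd (rmid w \<epsilon> t)) \<longlongrightarrow> deriv (front w) t) (at_right 0))"

fun overcompressive :: "real \<Rightarrow> field \<Rightarrow> (wave \<times> field) list \<Rightarrow> bool" where
  "overcompressive t V [] \<longleftrightarrow> True"
| "overcompressive t V ((w, V') # ws) \<longleftrightarrow>
     (is_Shadow w \<longrightarrow> snd (V (front w t) t) \<ge> deriv (front w) t \<and>
                     deriv (front w) t \<ge> snd (V' (front w t) t)) \<and>
     overcompressive t V' ws"

definition ordered :: "real \<Rightarrow> (wave \<times> field) list \<Rightarrow> bool" where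
  "ordered t ws \<longleftrightarrow> sorted_wrt (<) (map (\<lambda>(w, _). front w t) ws)"

definition admissible_on :: "real set \<Rightarrow> field \<Rightarrow> (wave \<times> field) list \<Rightarrow> bool" where
  "admissible_on J V ws \<longleftrightarrow>
     (\<forall>(w, _)\<in>set ws. is_Shadow w \<longrightarrow> regular_shadow J w) \<and>
     (\<forall>t\<in>interior J. ordered t ws \<and> overcompressive t V ws)"

text \<open>Admissible solution of the Riemann problem at \<open>x = a\<close>, \<open>t = 0\<close> (without the left field). For
  equal velocities the two contact discontinuities coincide and are listed as one.\<close>

definition riemann :: "real \<Rightarrow> state \<Rightarrow> state \<Rightarrow> (wave \<times> field) list \<Rightarrow> bool" where
  "riemann a L R ws \<longleftrightarrow>
     (let \<rho>l = fst L; ul = snd L; \<rho>r = fst R; ur = snd R in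
      if ul < ur then
        ws = [(Contact (\<lambda>t. a + ul * t), \<lambda>x t. (0, (x - a) / t)),
              (Contact (\<lambda>t. a + ur * t), \<lambda>x t. R)]
      else if ul = ur then ws = [(Contact (\<lambda>t. a + ur * t), \<lambda>x t. R)]
      else \<exists>w. ws = [(w, \<lambda>x t. R)] \<and> is_Shadow w \<and>
             front w = (\<lambda>t. a + (sqrt \<rho>l * ul + sqrt \<rho>r * ur) / (sqrt \<rho>l + sqrt \<rho>r) * t) \<and>
             (\<forall>t>0. strength w t (sqrt (\<rho>l * \<rho>r) * (ul - ur) * t)))"

text \<open>Interactions at time \<open>T\<close>: waves whose fronts meet are replaced by one shadow wave starting at
  the meeting point. Its speed and strength are determined by requiring that the whole net
  satisfies the system in the limit.\<close>

inductive collide :: "real \<Rightarrow> (wave \<times> field) list \<Rightarrow> (wave \<times> field) list \<Rightarrow> bool" for T where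
  none: "collide T [] []"
| keep: "collide T ws ws' \<Longrightarrow> collide T (p # ws) (p # ws')"
| merge: "\<lbrakk>collide T ws ws'; length g \<ge> 2; \<forall>(v, _)\<in>set g. front v T = front w T; is_Shadow w\<rbrakk>
    \<Longrightarrow> collide T (g @ ws) ((w, snd (last g)) # ws')"

text \<open>Evolution of a pattern from time \<open>T\<close> on, through finitely many interactions; strict ordering
  of the fronts after an interaction forces all waves meeting in a point to be merged.\<close>

inductive evolution :: "real \<Rightarrow> field \<Rightarrow> (wave \<times> field) list \<Rightarrow> net \<Rightarrow> bool" where
  settled: "admissible_on {T..} V ws \<Longrightarrow> evolution T V ws (profile V ws)"
| interaction: "\<lbrakk>T < T'; admissible_on {T..T'} V ws;
      collide T' ws ws'; length ws' < length ws; ordered T' ws'; evolution T' V ws' N\<rbrakk>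
    \<Longrightarrow> evolution T V ws (\<lambda>\<epsilon> x t. if t < T' then profile V ws \<epsilon> x t else N \<epsilon> x t)"


section \<open>Delta initial data and the backward energy condition\<close>

text \<open>In the following \<open>U\<^sub>0\<close>, \<open>U\<^sub>1\<close> are the left and right state, \<open>\<xi>\<close> the strength of the initial
  delta function, and \<open>v\<close> the value of the velocity \<open>u\<^sub>\<delta>\<close> in the approximate data.\<close>

definition initial_data :: "state \<Rightarrow> state \<Rightarrow> real \<Rightarrow> real \<Rightarrow> real \<Rightarrow> real \<Rightarrow> state" where
  "initial_data U0 U1 \<xi> \<mu> v x =
     (if x < - \<mu> / 2 then U0 else if x < \<mu> / 2 then (\<xi> / \<mu>, v) else U1)"

definition approx_solution :: "state \<Rightarrow> state \<Rightarrow> real \<Rightarrow> real \<Rightarrow> real \<Rightarrow> net \<Rightarrow> bool" where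
  "approx_solution U0 U1 \<xi> \<mu> v N \<longleftrightarrow>
     (\<exists>ws ws'. riemann (- \<mu> / 2) U0 (\<xi> / \<mu>, v) ws \<and> riemann (\<mu> / 2) (\<xi> / \<mu>, v) U1 ws' \<and>
        evolution 0 (\<lambda>x t. U0) (ws @ ws') N) \<and>
     solves_in_limit N (initial_data U0 U1 \<xi> \<mu> v)"

definition initial_energy :: "state \<Rightarrow> state \<Rightarrow> real \<Rightarrow> real \<Rightarrow> real \<Rightarrow> real \<Rightarrow> real" where
  "initial_energy U0 U1 \<xi> L \<mu> v = (LBINT x:{-L..L}. \<eta> (initial_data U0 U1 \<xi> \<mu> v x))"

text \<open>\<open>energy L N t h\<close>: the energy of the net on \<open>[-L, L]\<close> at time \<open>t\<close> exists and equals \<open>h\<close>.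
  \<open>energy_rate L N d\<close>: its time derivative at \<open>0+\<close> exists and equals \<open>d\<close>.\<close>

definition energy :: "real \<Rightarrow> net \<Rightarrow> real \<Rightarrow> real \<Rightarrow> bool" where
  "energy L N t h \<longleftrightarrow> ((\<lambda>\<epsilon>. LBINT x:{-L..L}. \<eta> (N \<epsilon> x t)) \<longlongrightarrow> h) (at_right 0)"

definition energy_rate :: "real \<Rightarrow> net \<Rightarrow> real \<Rightarrow> bool" where
  "energy_rate L N d \<longleftrightarrow> (\<exists>H H'.
     (\<forall>\<^sub>F t in at_right 0. energy L N t (H t) \<and> (H has_real_derivative H' t) (at t)) \<and>
     (H' \<longlongrightarrow> d) (at_right 0))"

definition least_dissipation :: "state \<Rightarrow> state \<Rightarrow> real \<Rightarrow> real \<Rightarrow> real \<Rightarrow> net \<Rightarrow> bool" where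
  "least_dissipation U0 U1 \<xi> L \<mu> N \<longleftrightarrow> (\<exists>d. energy_rate L N d \<and>
     (\<forall>v' N'. approx_solution U0 U1 \<xi> \<mu> v' N' \<longrightarrow> (\<exists>d'. energy_rate L N' d' \<and> d' \<le> d)))"

text \<open>The family of approximate solutions \<open>N \<mu>\<close> with \<open>u\<^sub>\<delta> = v \<mu>\<close> satisfies the backward energy
  condition, including the selection by initial energy among several solutions. For each small
  \<open>\<mu>\<close> the competitors range over all values of the velocity, which is the same as comparing with
  all \<open>\<mu>\<close>-dependent choices, each for \<open>\<mu>\<close> small enough.\<close>

definition backward_energy ::
    "state \<Rightarrow> state \<Rightarrow> real \<Rightarrow> (real \<Rightarrow> real) \<Rightarrow> (real \<Rightarrow> net) \<Rightarrow> bool" where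
  "backward_energy U0 U1 \<xi> v N \<longleftrightarrow> (\<forall>\<^sub>F L in at_top. \<forall>\<^sub>F \<mu> in at_right 0.
     approx_solution U0 U1 \<xi> \<mu> (v \<mu>) (N \<mu>) \<and> least_dissipation U0 U1 \<xi> L \<mu> (N \<mu>) \<and>
     (\<forall>v' N'. approx_solution U0 U1 \<xi> \<mu> v' N' \<and> least_dissipation U0 U1 \<xi> L \<mu> N' \<longrightarrow>
        initial_energy U0 U1 \<xi> L \<mu> (v \<mu>) \<le> initial_energy U0 U1 \<xi> L \<mu> v'))"


section \<open>Distributional limits\<close>

text \<open>First \<open>\<epsilon> \<rightarrow> 0\<close>, then \<open>\<mu> \<rightarrow> 0\<close>.\<close>

definition iterated_limit :: "(real \<Rightarrow> real \<Rightarrow> real) \<Rightarrow> real \<Rightarrow> bool" where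
  "iterated_limit F l \<longleftrightarrow> (\<exists>G. (\<forall>\<^sub>F \<mu> in at_right 0. ((\<lambda>\<epsilon>. F \<mu> \<epsilon>) \<longlongrightarrow> G \<mu>) (at_right 0)) \<and>
     (G \<longlongrightarrow> l) (at_right 0))"

text \<open>Convergence of the family \<open>N\<close> to \<open>V(x,t) + (\<sigma>(t), 0) \<delta>(x - c(t))\<close> in the sense of
  distributions on the open half plane.\<close>

definition converges_to_delta ::
    "(real \<Rightarrow> net) \<Rightarrow> field \<Rightarrow> (real \<Rightarrow> real) \<Rightarrow> (real \<Rightarrow> real) \<Rightarrow> bool" where
  "converges_to_delta N V \<sigma> c \<longleftrightarrow> (\<forall>\<phi>. test_function {z. snd z > 0} \<phi> \<longrightarrow>
     iterated_limit (\<lambda>\<mu> \<epsilon>. LBINT t:{0<..}. (LBINT x. fst (N \<mu> \<epsilon> x t) * \<phi> (x, t)))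
       ((LBINT t:{0<..}. (LBINT x. fst (V x t) * \<phi> (x, t)))
        + (LBINT t:{0<..}. \<sigma> t * \<phi> (c t, t))) \<and>
     iterated_limit (\<lambda>\<mu> \<epsilon>. LBINT t:{0<..}. (LBINT x. snd (N \<mu> \<epsilon> x t) * \<phi> (x, t)))
       (LBINT t:{0<..}. (LBINT x. snd (V x t) * \<phi> (x, t))))"

text \<open>\<open>\<partial>\<^sub>t\<eta> + \<partial>\<^sub>xQ = 0\<close> in the sense of distributions. The nonlinear terms of a solution containing
  a delta function are understood as limits along its approximations.\<close>

definition locally_conserves_energy :: "(real \<Rightarrow> net) \<Rightarrow> bool" where
  "locally_conserves_energy N \<longleftrightarrow> (\<forall>\<phi>. test_function {z. snd z > 0} \<phi> \<longrightarrow>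
     iterated_limit (\<lambda>\<mu> \<epsilon>. weak_form \<eta> Q (N \<mu> \<epsilon>) \<phi>) 0)"

text \<open>The \<open>\<mu>\<close>-dependent velocity at which the initial dissipation of the two shadow waves issuing from
  \<open>x = - \<mu>/2\<close> and \<open>x = \<mu>/2\<close> is least; \<open>r \<rho>\<^sub>i\<close> is \<open>r\<^sub>i\<^sup>\<mu>\<close>.\<close>

definition y_mu :: "state \<Rightarrow> state \<Rightarrow> real \<Rightarrow> real \<Rightarrow> real" where
  "y_mu U0 U1 \<xi> \<mu> =
     (let r = (\<lambda>\<rho>. \<rho> * (\<xi> / \<mu>) / (sqrt (\<xi> / \<mu>) + sqrt \<rho>)\<^sup>2) in
      (snd U0 * sqrt (r (fst U0)) + snd U1 * sqrt (r (fst U1)))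
        / (sqrt (r (fst U0)) + sqrt (r (fst U1))))"

end

theory Submission
  imports Defs
begin

text \<open>
  Every statement about an approximate solution is reduced to finitely many numbers attached to
  its fronts. As \<open>\<epsilon> \<rightarrow> 0\<close>, the integral of \<open>\<rho> u\<^sup>k\<close> against a test function tends to the integral
  over the states between the fronts plus one point mass for each front, namely the strength
  times the \<open>k\<close>-th power of the speed (\<open>pattern_limit\<close>). Differentiating in time gives a balance
  law for every front (\<open>front_balance\<close>); the system holds in the limit when the masses and the
  momenta on the fronts obey their Rankine-Hugoniot conditions.

  \<^emph>\<open>Selection.\<close> Before the first interaction the energy is affine in time. Apart from the flux
  through the boundary, which is the same for all competitors, its slope is
  \<open>- (r\<^sub>0 (u\<^sub>0 - u\<^sub>\<delta>)\<^sub>+\<^sup>3 + r\<^sub>1 (u\<^sub>\<delta> - u\<^sub>1)\<^sub>+\<^sup>3) / 2\<close> (\<open>energy_rate_approx_solution\<close>), where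
  \<open>r\<^sub>i = r\<^sub>i\<^sup>\<mu>\<close> is the reduced density of the states that meet. For \<open>u\<^sub>0 > u\<^sub>1\<close> the loss is a
  sum of two convex functions of \<open>u\<^sub>\<delta>\<close>, and \<open>y\<^sup>\<mu>\<close> is its only minimizer because the slopes
  cancel there (\<open>colliding_selection\<close>). For \<open>u\<^sub>0 \<le> u\<^sub>1\<close> the loss vanishes exactly on
  \<open>[u\<^sub>0, u\<^sub>1]\<close>, and the initial energy \<open>\<xi>\<^sub>\<delta> u\<^sub>\<delta>\<^sup>2 / 2 + const\<close> picks the value of least modulus
  (\<open>separating_selection\<close>).

  \<^emph>\<open>Separating states.\<close> All waves are contact discontinuities. They carry no mass, never meet,
  and are transported with the flow, so that the balance laws hold for all moments, in
  particular for the energy. The middle state keeps height \<open>\<xi>\<^sub>\<delta> / \<mu>\<close> and width \<open>\<mu>\<close> and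
  concentrates to the delta function (\<open>separating_limit\<close>).

  \<^emph>\<open>Colliding states.\<close> With the middle velocity \<open>y\<^sup>\<mu>\<close> the two shadow waves have opposite
  velocities relative to the middle state and meet in its centre after a time \<open>T\<close> that tends to
  \<open>0\<close> with \<open>\<mu>\<close>. Afterwards mass and momentum determine the merged wave through a differential
  equation whose first integral is the centre of mass; it is a quadratic equation for the
  position of the front, so there is an explicit trajectory. This gives existence
  (\<open>approx_solution_collision\<close>). Any other merged wave follows the same trajectory: test
  functions that depend only on time near the front show that it carries the required mass and
  momentum for almost every time, and the first integral does the rest (\<open>merged_unique\<close>). As
  \<open>\<mu> \<rightarrow> 0\<close> the constant term of the quadratic equation in the frame of the middle state tends to
  \<open>0\<close>, so the trajectory tends to the line \<open>x = y t\<close> with mass \<open>\<xi>\<^sub>\<delta> + \<xi> t\<close>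
  (\<open>trajectory_limits\<close>), whence \<open>colliding_limit\<close>.
\<close>

section \<open>Limits along the regularization parameter\<close>

text \<open>The filter \<open>at_right 0\<close> is generated by the sequences tending to \<open>0\<close> from above, so the
  sequential theorem carries over.\<close>

lemma dominated_convergence_at_right:
  fixes f :: "real \<Rightarrow> 'a \<Rightarrow> real"
  assumes meas: "\<forall>\<^sub>F \<epsilon> in at_right 0. f \<epsilon> \<in> borel_measurable M"
    and g: "g \<in> borel_measurable M"
    and lim: "AE x in M. ((\<lambda>\<epsilon>. f \<epsilon> x) \<longlongrightarrow> g x) (at_right 0)"
    and bound: "\<forall>\<^sub>F \<epsilon> in at_right 0. AE x in M. \<bar>f \<epsilon> x\<bar> \<le> w x"
    and w: "integrable M w"
  shows "((\<lambda>\<epsilon>. \<integral>x. f \<epsilon> x \<partial>M) \<longlongrightarrow> (\<integral>x. g x \<partial>M)) (at_right 0)"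
    and "integrable M g"
proof -
  have both: "(\<lambda>n. \<integral>x. f (S n) x \<partial>M) \<longlonglongrightarrow> (\<integral>x. g x \<partial>M) \<and> integrable M g"
    if S: "\<And>n. 0 < S n" "S \<longlonglongrightarrow> 0" for S :: "nat \<Rightarrow> real"
  proof -
    have S': "filterlim S (at_right 0) sequentially"
      using S(2) less_imp_neq[OF S(1), symmetric] S(1) by (auto simp: filterlim_at)
    have "\<forall>\<^sub>F n in sequentially. f (S n) \<in> borel_measurable M \<and> (AE x in M. \<bar>f (S n) x\<bar> \<le> w x)"
      using filterlim_iff[THEN iffD1, OF S', rule_format, OF eventually_conj[OF meas bound]] .
    then obtain n0 where n0: "\<And>n. n \<ge> n0 \<Longrightarrow> f (S n) \<in> borel_measurable M"
        "\<And>n. n \<ge> n0 \<Longrightarrow> AE x in M. \<bar>f (S n) x\<bar> \<le> w x"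
      unfolding eventually_sequentially by blast
    have m: "f (S (n + n0)) \<in> borel_measurable M" for n using n0 by simp
    have b: "AE x in M. norm (f (S (n + n0)) x) \<le> w x" for n using n0(2)[of "n + n0"] by simp
    have l: "AE x in M. (\<lambda>n. f (S (n + n0)) x) \<longlonglongrightarrow> g x"
      using lim
    proof eventually_elim
      case (elim x)
      show ?case
        by (rule LIMSEQ_ignore_initial_segment)
          (rule filterlim_compose[OF elim S'])
    qed
    have "(\<lambda>n. \<integral>x. f (S (n + n0)) x \<partial>M) \<longlonglongrightarrow> (\<integral>x. g x \<partial>M)"
      by (rule integral_dominated_convergence[OF g m w l b])
    moreover have "integrable M g"
      by (rule integrable_dominated_convergence[OF g m w l b])
    ultimately show ?thesis
      using LIMSEQ_offset[where f = "\<lambda>n. \<integral>x. f (S n) x \<partial>M" and k = n0] by blast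
  qed
  show "((\<lambda>\<epsilon>. \<integral>x. f \<epsilon> x \<partial>M) \<longlongrightarrow> (\<integral>x. g x \<partial>M)) (at_right 0)"
    by (rule tendsto_at_right_sequentially[of 0 1]) (use both in auto)
  show "integrable M g"
    using both[of "\<lambda>n. inverse (real (Suc n))", OF _ LIMSEQ_inverse_real_of_nat] by simp
qed

lemma borel_measurable_lim_at_right:
  fixes f :: "real \<Rightarrow> 'a \<Rightarrow> real"
  assumes meas: "\<forall>\<^sub>F \<epsilon> in at_right 0. f \<epsilon> \<in> borel_measurable M"
    and lim: "\<And>x. x \<in> space M \<Longrightarrow> ((\<lambda>\<epsilon>. f \<epsilon> x) \<longlongrightarrow> g x) (at_right 0)"
  shows "g \<in> borel_measurable M"
proof -
  define S where "S n = inverse (real (Suc n))" for n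
  have S': "filterlim S (at_right 0) sequentially"
    using LIMSEQ_inverse_real_of_nat unfolding S_def[abs_def] by (auto simp: filterlim_at simp del: of_nat_Suc)
  obtain n0 where n0: "\<And>n. n \<ge> n0 \<Longrightarrow> f (S n) \<in> borel_measurable M"
    using filterlim_iff[THEN iffD1, OF S', rule_format, OF meas]
    unfolding eventually_sequentially by blast
  show ?thesis
  proof (rule borel_measurable_LIMSEQ_real)
    show "(\<lambda>n. f (S (n + n0)) x) \<longlonglongrightarrow> g x" if "x \<in> space M" for x
      by (rule LIMSEQ_ignore_initial_segment)
        (rule filterlim_compose[OF lim[OF that] S'])
    show "f (S (n + n0)) \<in> borel_measurable M" for n
      using n0 by simp
  qed
qed

text \<open>The integrand changes only between \<open>b \<epsilon>\<close> and \<open>c\<close>. This lets the edges of the strips of a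
  shadow wave be replaced by its front.\<close>

lemma tendsto_integral_lessThan:
  fixes G :: "real \<Rightarrow> real"
  assumes G: "integrable lborel G" and b: "(b \<longlongrightarrow> c) (at_right 0)"
  shows "((\<lambda>\<epsilon>. \<integral>x. indicator {..<b \<epsilon>} x * G x \<partial>lborel)
     \<longlongrightarrow> (\<integral>x. indicator {..<c} x * G x \<partial>lborel)) (at_right (0::real))"
proof (rule dominated_convergence_at_right(1))
  have [measurable]: "G \<in> borel_measurable borel" using G by auto
  show "\<forall>\<^sub>F \<epsilon> in at_right 0. (\<lambda>x. indicator {..<b \<epsilon>} x * G x) \<in> borel_measurable lborel"
    by simp
  show "(\<lambda>x. indicator {..<c} x * G x) \<in> borel_measurable lborel"
    by simp
  show "integrable lborel (\<lambda>x. \<bar>G x\<bar>)" using G by simp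
  show "\<forall>\<^sub>F \<epsilon> in at_right 0. AE x in lborel. \<bar>indicator {..<b \<epsilon>} x * G x\<bar> \<le> \<bar>G x\<bar>"
    by (auto simp: indicator_def)
  show "AE x in lborel. ((\<lambda>\<epsilon>. indicator {..<b \<epsilon>} x * G x) \<longlongrightarrow> indicator {..<c} x * G x) (at_right 0)"
    using AE_lborel_singleton[of c]
  proof eventually_elim
    case (elim x)
    have "\<forall>\<^sub>F \<epsilon> in at_right 0. indicator {..<b \<epsilon>} x * G x = indicator {..<c} x * G x"
    proof (cases "x < c")
      case True
      show ?thesis
        using order_tendstoD(1)[OF b True] by eventually_elim (simp add: indicator_def True)
    next
      case False
      then have "c < x" using elim by simp
      show ?thesis
        using order_tendstoD(2)[OF b \<open>c < x\<close>] by eventually_elim (simp add: indicator_def False)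
    qed
    then show ?case by (rule tendsto_eventually)
  qed
qed

text \<open>Two adjacent strips with heights \<open>A\<close>, \<open>B\<close> shrinking to \<open>c\<close> act on \<open>\<psi>\<close> like a point mass,
  since \<open>\<psi>\<close> is nearly constant on them and the total absolute mass stays bounded.\<close>

lemma tendsto_integral_strips:
  fixes h A B :: "real \<Rightarrow> real" and \<psi> :: "real \<Rightarrow> real"
  assumes \<psi>: "integrable lborel \<psi>" and cont: "isCont \<psi> c"
    and h0: "\<forall>\<^sub>F \<epsilon> in at_right 0. h \<epsilon> \<ge> 0" and h: "(h \<longlongrightarrow> 0) (at_right 0)"
    and m: "((\<lambda>\<epsilon>. h \<epsilon> * (A \<epsilon> + B \<epsilon>)) \<longlongrightarrow> m) (at_right 0)"
    and K: "\<forall>\<^sub>F \<epsilon> in at_right 0. h \<epsilon> * (\<bar>A \<epsilon>\<bar> + \<bar>B \<epsilon>\<bar>) \<le> K"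
  shows "((\<lambda>\<epsilon>. A \<epsilon> * (\<integral>x. indicator {c - h \<epsilon>..<c} x * \<psi> x \<partial>lborel)
           + B \<epsilon> * (\<integral>x. indicator {c..<c + h \<epsilon>} x * \<psi> x \<partial>lborel)) \<longlongrightarrow> m * \<psi> c) (at_right 0)"
proof -
  define E where "E \<epsilon> = A \<epsilon> * ((\<integral>x. indicator {c - h \<epsilon>..<c} x * \<psi> x \<partial>lborel) - h \<epsilon> * \<psi> c)
           + B \<epsilon> * ((\<integral>x. indicator {c..<c + h \<epsilon>} x * \<psi> x \<partial>lborel) - h \<epsilon> * \<psi> c)" for \<epsilon>
  have [measurable]: "\<psi> \<in> borel_measurable borel" using \<psi> by auto
  have dev: "\<bar>(\<integral>x. indicator {a..<b} x * \<psi> x \<partial>lborel) - (b - a) * \<psi> c\<bar> \<le> (b - a) * r"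
    if "a \<le> b" and r: "\<And>x. x \<in> {a..<b} \<Longrightarrow> \<bar>\<psi> x - \<psi> c\<bar> \<le> r" for a b r
  proof -
    have i1: "integrable lborel (\<lambda>x. indicator {a..<b} x * \<psi> x)"
      by (rule Bochner_Integration.integrable_bound[OF \<psi>]) (auto simp: indicator_def)
    have i2: "integrable lborel (\<lambda>x. indicator {a..<b} x * \<psi> c)"
      by (rule integrable_mult_left) (use that(1) in \<open>auto simp: integrable_real_indicator\<close>)
    have i3: "integrable lborel (\<lambda>x. indicator {a..<b} x * r)"
      by (rule integrable_mult_left) (use that(1) in \<open>auto simp: integrable_real_indicator\<close>)
    have s: "(\<integral>x. indicator {a..<b} x * k \<partial>lborel) = (b - a) * k" for k :: real
      using \<open>a \<le> b\<close> by (simp add: measure_def)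
    have "(\<integral>x. indicator {a..<b} x * \<psi> x \<partial>lborel) - (b - a) * \<psi> c
        = (\<integral>x. indicator {a..<b} x * \<psi> x - indicator {a..<b} x * \<psi> c \<partial>lborel)"
      by (subst Bochner_Integration.integral_diff[OF i1 i2]) (simp only: s)
    also have "\<bar>\<dots>\<bar> \<le> (\<integral>x. indicator {a..<b} x * r \<partial>lborel)"
    proof (rule integral_abs_bound[THEN order_trans], rule integral_mono)
      show "integrable lborel (\<lambda>x. \<bar>indicator {a..<b} x * \<psi> x - indicator {a..<b} x * \<psi> c\<bar>)"
        using i1 i2 by (intro integrable_abs Bochner_Integration.integrable_diff)
      show "integrable lborel (\<lambda>x. indicator {a..<b} x * r)" by (rule i3)
      show "\<bar>indicator {a..<b} x * \<psi> x - indicator {a..<b} x * \<psi> c\<bar> \<le> indicator {a..<b} x * r" for x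
        using r[of x] by (auto simp: indicator_def)
    qed
    also have "\<dots> = (b - a) * r" by (rule s)
    finally show ?thesis .
  qed
  have "(E \<longlongrightarrow> 0) (at_right 0)"
  proof (rule tendstoI)
    fix e :: real assume "e > 0"
    define r where "r = e / (2 * (\<bar>K\<bar> + 1))"
    have "r > 0" using \<open>e > 0\<close> by (simp add: r_def)
    then obtain d where d: "d > 0" "\<And>x. \<bar>x - c\<bar> < d \<Longrightarrow> \<bar>\<psi> x - \<psi> c\<bar> < r"
      using cont unfolding continuous_at_eps_delta dist_real_def by metis
    have "\<forall>\<^sub>F \<epsilon> in at_right 0. h \<epsilon> < d" using order_tendstoD(2)[OF h d(1)] .
    with h0 K show "\<forall>\<^sub>F \<epsilon> in at_right 0. dist (E \<epsilon>) 0 < e"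
    proof eventually_elim
      case (elim \<epsilon>)
      have 1: "\<bar>(\<integral>x. indicator {c - h \<epsilon>..<c} x * \<psi> x \<partial>lborel) - h \<epsilon> * \<psi> c\<bar> \<le> h \<epsilon> * r"
        using dev[of "c - h \<epsilon>" c r] d(2) elim by (force simp: less_imp_le)
      have 2: "\<bar>(\<integral>x. indicator {c..<c + h \<epsilon>} x * \<psi> x \<partial>lborel) - h \<epsilon> * \<psi> c\<bar> \<le> h \<epsilon> * r"
        using dev[of c "c + h \<epsilon>" r] d(2) elim by (force simp: less_imp_le)
      have "\<bar>E \<epsilon>\<bar> \<le> \<bar>A \<epsilon>\<bar> * (h \<epsilon> * r) + \<bar>B \<epsilon>\<bar> * (h \<epsilon> * r)"
        unfolding E_def
        by (rule order_trans[OF abs_triangle_ineq]) (auto simp: abs_mult intro!: add_mono mult_left_mono 1 2)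
      also have "\<dots> = h \<epsilon> * (\<bar>A \<epsilon>\<bar> + \<bar>B \<epsilon>\<bar>) * r" by (simp add: algebra_simps)
      also have "\<dots> \<le> (\<bar>K\<bar> + 1) * r"
        using elim \<open>r > 0\<close> by (intro mult_right_mono) auto
      also have "\<dots> = e / 2"
      proof -
        have "\<bar>K\<bar> + 1 \<noteq> 0" by linarith
        then show ?thesis by (simp add: r_def field_simps)
      qed
      finally show ?case using \<open>e > 0\<close> by simp
    qed
  qed
  from tendsto_add[OF this tendsto_mult_right[OF m, of "\<psi> c"]] show ?thesis
    by (simp add: E_def algebra_simps)
qed

section \<open>The limit of a wave pattern at a fixed time\<close>

text \<open>A contact discontinuity is a shadow wave of width zero; this makes one recursion equation
  serve both kinds of waves.\<close>

definition half_width :: "wave \<Rightarrow> real \<Rightarrow> real \<Rightarrow> real" where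
  "half_width w \<epsilon> t = (if is_Shadow w then width w \<epsilon> t else 0)"

lemma profile_Cons:
  "profile V ((w, V') # ws) \<epsilon> x t =
     (if x < front w t - half_width w \<epsilon> t then V x t
      else if x < front w t then lmid w \<epsilon> t
      else if x < front w t + half_width w \<epsilon> t then rmid w \<epsilon> t
      else profile V' ws \<epsilon> x t)"
  by (cases w) (auto simp: half_width_def width_def algebra_simps)

definition fields :: "field \<Rightarrow> (wave \<times> field) list \<Rightarrow> field set" where
  "fields V ws = insert V (snd ` set ws)"

lemma fields_simps [simp]:
  "fields V [] = {V}" "fields V ((w, V') # ws) = insert V (fields V' ws)"
  by (auto simp: fields_def)

text \<open>\<open>point_mass F t w m\<close>: the part of \<open>F(U\<^sup>\<epsilon>)\<close> carried by the strips of \<open>w\<close> at time \<open>t\<close> tends to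
  \<open>m\<close> times a unit point mass.\<close>

definition point_mass :: "(state \<Rightarrow> real) \<Rightarrow> real \<Rightarrow> wave \<Rightarrow> real \<Rightarrow> bool" where
  "point_mass F t w m \<longleftrightarrow>
     (\<forall>\<^sub>F \<epsilon> in at_right 0. half_width w \<epsilon> t \<ge> 0) \<and>
     ((\<lambda>\<epsilon>. half_width w \<epsilon> t) \<longlongrightarrow> 0) (at_right 0) \<and>
     ((\<lambda>\<epsilon>. half_width w \<epsilon> t * (F (lmid w \<epsilon> t) + F (rmid w \<epsilon> t))) \<longlongrightarrow> m) (at_right 0) \<and>
     (\<exists>K. \<forall>\<^sub>F \<epsilon> in at_right 0. half_width w \<epsilon> t * (\<bar>F (lmid w \<epsilon> t)\<bar> + \<bar>F (rmid w \<epsilon> t)\<bar>) \<le> K)"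

text \<open>The limit of \<open>\<integral> F(U\<^sup>\<epsilon>) \<psi> dx\<close>. Each front contributes the jump of \<open>F\<close> across it, integrated over
  the half line on its left, and its point mass; in this form the contributions of the fronts can
  be differentiated in time separately.\<close>

fun pairing :: "(state \<Rightarrow> real) \<Rightarrow> (wave \<Rightarrow> real) \<Rightarrow> (real \<Rightarrow> real) \<Rightarrow> real \<Rightarrow> field
    \<Rightarrow> (wave \<times> field) list \<Rightarrow> real" where
  "pairing F m \<psi> t V [] = (\<integral>x. F (V x t) * \<psi> x \<partial>lborel)"
| "pairing F m \<psi> t V ((w, V') # ws) =
     (\<integral>x. indicator {..<front w t} x * ((F (V x t) - F (V' x t)) * \<psi> x) \<partial>lborel)
       + m w * \<psi> (front w t) + pairing F m \<psi> t V' ws"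

lemma integrable_indicator_mult:
  fixes G :: "real \<Rightarrow> real"
  assumes "integrable lborel G" "A \<in> sets borel"
  shows "integrable lborel (\<lambda>x. indicator A x * G x)"
  using integrable_mult_indicator[of A lborel G] assms by simp

lemma profile_left_of_fronts:
  assumes "case ws of [] \<Rightarrow> True | (w, _) # _ \<Rightarrow> x < front w t - half_width w \<epsilon> t"
  shows "profile V ws \<epsilon> x t = V x t"
  using assms by (cases ws) (auto simp: profile_Cons split: prod.splits)

text \<open>Induction over the waves. For small \<open>\<epsilon>\<close> the pattern to the right of the first front agrees
  with its leftmost field up to the end of the first strips, so that adding the first wave changes
  the function only by terms supported to the left of that point: a half line with the jump of
  \<open>F\<close>, and the two strips.\<close>

lemma profile_tendsto:
  assumes "ordered t ws" and "integrable lborel \<psi>"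
    and "\<And>V'. V' \<in> fields V ws \<Longrightarrow> integrable lborel (\<lambda>x. F (V' x t) * \<psi> x)"
    and "\<And>w V'. (w, V') \<in> set ws \<Longrightarrow> isCont \<psi> (front w t) \<and> point_mass F t w (m w)"
  shows "((\<lambda>\<epsilon>. \<integral>x. F (profile V ws \<epsilon> x t) * \<psi> x \<partial>lborel) \<longlongrightarrow> pairing F m \<psi> t V ws) (at_right 0)
    \<and> (\<forall>\<^sub>F \<epsilon> in at_right 0. integrable lborel (\<lambda>x. F (profile V ws \<epsilon> x t) * \<psi> x))"
  using assms
proof (induction ws arbitrary: V)
  case Nil
  then show ?case by simp
next
  case (Cons p ws)
  obtain w V' where p: "p = (w, V')" by (cases p)
  define c where "c = front w t"
  define h where "h \<epsilon> = half_width w \<epsilon> t" for \<epsilon>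
  define A where "A \<epsilon> = F (lmid w \<epsilon> t)" for \<epsilon>
  define B where "B \<epsilon> = F (rmid w \<epsilon> t)" for \<epsilon>
  define rest where "rest \<epsilon> x = F (profile V' ws \<epsilon> x t)" for \<epsilon> x
  have ord: "ordered t ws" using Cons.prems(1) by (simp add: ordered_def)
  have \<psi>: "integrable lborel \<psi>" by (rule Cons.prems(2))
  have IH: "((\<lambda>\<epsilon>. \<integral>x. rest \<epsilon> x * \<psi> x \<partial>lborel) \<longlongrightarrow> pairing F m \<psi> t V' ws) (at_right 0)"
      "\<forall>\<^sub>F \<epsilon> in at_right 0. integrable lborel (\<lambda>x. rest \<epsilon> x * \<psi> x)"
    using Cons.IH[OF ord \<psi>, of V'] Cons.prems(3,4) unfolding rest_def p by auto
  have iV: "integrable lborel (\<lambda>x. F (V x t) * \<psi> x)" using Cons.prems(3) by (simp add: p)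
  have iV': "integrable lborel (\<lambda>x. F (V' x t) * \<psi> x)"
    using Cons.prems(3) by (simp add: p fields_def)
  have cont: "isCont \<psi> c" and pm: "point_mass F t w (m w)"
    using Cons.prems(4)[of w V'] by (auto simp: p c_def)
  have h0: "\<forall>\<^sub>F \<epsilon> in at_right 0. h \<epsilon> \<ge> 0" and h: "(h \<longlongrightarrow> 0) (at_right 0)"
    and hm: "((\<lambda>\<epsilon>. h \<epsilon> * (A \<epsilon> + B \<epsilon>)) \<longlongrightarrow> m w) (at_right 0)"
    and hK: "\<exists>K. \<forall>\<^sub>F \<epsilon> in at_right 0. h \<epsilon> * (\<bar>A \<epsilon>\<bar> + \<bar>B \<epsilon>\<bar>) \<le> K"
    using pm unfolding point_mass_def h_def[abs_def] A_def B_def by blast+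
  \<comment> \<open>For small \<open>\<epsilon>\<close> the strips around the first front do not reach the next ones.\<close>
  have sep: "\<forall>\<^sub>F \<epsilon> in at_right 0. case ws of [] \<Rightarrow> True | (w', _) # _ \<Rightarrow> c + h \<epsilon> < front w' t - half_width w' \<epsilon> t"
  proof (cases ws)
    case (Cons q qs)
    obtain w' V'' where q: "q = (w', V'')" by (cases q)
    have lt: "c < front w' t"
      using Cons.prems(1) by (simp add: ordered_def p q Cons c_def)
    have "((\<lambda>\<epsilon>. half_width w' \<epsilon> t) \<longlongrightarrow> 0) (at_right 0)"
      using Cons.prems(4)[of w' V''] by (auto simp: p q Cons point_mass_def)
    from tendsto_add[OF h this] have "((\<lambda>\<epsilon>. h \<epsilon> + half_width w' \<epsilon> t) \<longlongrightarrow> 0) (at_right 0)" by simp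
    from order_tendstoD(2)[OF this, of "front w' t - c"] lt
    have "\<forall>\<^sub>F \<epsilon> in at_right 0. h \<epsilon> + half_width w' \<epsilon> t < front w' t - c" by simp
    then have "\<forall>\<^sub>F \<epsilon> in at_right 0. c + h \<epsilon> < front w' t - half_width w' \<epsilon> t"
      by eventually_elim simp
    then show ?thesis by (simp add: Cons q)
  qed simp
  have split: "F (profile V (p # ws) \<epsilon> x t) * \<psi> x = rest \<epsilon> x * \<psi> x
      + indicator {..<c - h \<epsilon>} x * (F (V x t) * \<psi> x)
      + A \<epsilon> * (indicator {c - h \<epsilon>..<c} x * \<psi> x) + B \<epsilon> * (indicator {c..<c + h \<epsilon>} x * \<psi> x)
      - indicator {..<c + h \<epsilon>} x * (F (V' x t) * \<psi> x)"
    if "h \<epsilon> \<ge> 0" and "case ws of [] \<Rightarrow> True | (w', _) # _ \<Rightarrow> c + h \<epsilon> < front w' t - half_width w' \<epsilon> t" for \<epsilon> x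
  proof -
    have r: "rest \<epsilon> x = F (V' x t)" if "x < c + h \<epsilon>"
      unfolding rest_def using that \<open>case ws of [] \<Rightarrow> True | _ \<Rightarrow> _\<close>
      by (subst profile_left_of_fronts) (auto split: list.splits)
    have eq: "F (profile V (p # ws) \<epsilon> x t) = (if x < c - h \<epsilon> then F (V x t) else if x < c then A \<epsilon>
        else if x < c + h \<epsilon> then B \<epsilon> else rest \<epsilon> x)"
      unfolding p profile_Cons c_def[symmetric] h_def[symmetric] A_def B_def rest_def by simp
    consider "x < c - h \<epsilon>" | "c - h \<epsilon> \<le> x" "x < c" | "c \<le> x" "x < c + h \<epsilon>" | "c + h \<epsilon> \<le> x"
      by argo
    then show ?thesis
    proof cases
      case 1
      then show ?thesis using \<open>h \<epsilon> \<ge> 0\<close> by (simp add: eq r indicator_def)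
    next
      case 2
      then show ?thesis using \<open>h \<epsilon> \<ge> 0\<close> by (simp add: eq r indicator_def)
    next
      case 3
      then show ?thesis using \<open>h \<epsilon> \<ge> 0\<close> by (simp add: eq r indicator_def)
    next
      case 4
      then show ?thesis using \<open>h \<epsilon> \<ge> 0\<close> by (simp add: eq indicator_def)
    qed
  qed
  define I where "I \<epsilon> = (\<integral>x. rest \<epsilon> x * \<psi> x \<partial>lborel)
      + (\<integral>x. indicator {..<c - h \<epsilon>} x * (F (V x t) * \<psi> x) \<partial>lborel)
      + (A \<epsilon> * (\<integral>x. indicator {c - h \<epsilon>..<c} x * \<psi> x \<partial>lborel)
        + B \<epsilon> * (\<integral>x. indicator {c..<c + h \<epsilon>} x * \<psi> x \<partial>lborel))
      - (\<integral>x. indicator {..<c + h \<epsilon>} x * (F (V' x t) * \<psi> x) \<partial>lborel)" for \<epsilon>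
  have ev: "\<forall>\<^sub>F \<epsilon> in at_right 0. integrable lborel (\<lambda>x. F (profile V (p # ws) \<epsilon> x t) * \<psi> x)
      \<and> I \<epsilon> = (\<integral>x. F (profile V (p # ws) \<epsilon> x t) * \<psi> x \<partial>lborel)"
    using h0 sep IH(2)
  proof eventually_elim
    case (elim \<epsilon>)
    have i1: "integrable lborel (\<lambda>x. indicator {..<c - h \<epsilon>} x * (F (V x t) * \<psi> x))"
      by (rule integrable_indicator_mult[OF iV]) simp
    have i2: "integrable lborel (\<lambda>x. A \<epsilon> * (indicator {c - h \<epsilon>..<c} x * \<psi> x))"
      by (rule integrable_mult_right[OF integrable_indicator_mult[OF \<psi>]]) simp
    have i3: "integrable lborel (\<lambda>x. B \<epsilon> * (indicator {c..<c + h \<epsilon>} x * \<psi> x))"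
      by (rule integrable_mult_right[OF integrable_indicator_mult[OF \<psi>]]) simp
    have i4: "integrable lborel (\<lambda>x. indicator {..<c + h \<epsilon>} x * (F (V' x t) * \<psi> x))"
      by (rule integrable_indicator_mult[OF iV']) simp
    note s1 = Bochner_Integration.integrable_add[OF elim(3) i1]
    note s2 = Bochner_Integration.integrable_add[OF s1 i2]
    note s3 = Bochner_Integration.integrable_add[OF s2 i3]
    have "integrable lborel (\<lambda>x. F (profile V (p # ws) \<epsilon> x t) * \<psi> x)"
      unfolding split[OF elim(1,2)] by (rule Bochner_Integration.integrable_diff[OF s3 i4])
    moreover have "I \<epsilon> = (\<integral>x. F (profile V (p # ws) \<epsilon> x t) * \<psi> x \<partial>lborel)"
      unfolding split[OF elim(1,2)] I_def Bochner_Integration.integral_diff[OF s3 i4]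
        Bochner_Integration.integral_add[OF s2 i3] Bochner_Integration.integral_add[OF s1 i2]
        Bochner_Integration.integral_add[OF elim(3) i1] integral_mult_right_zero
      by simp
    ultimately show ?case by simp
  qed
  have lim0: "(I \<longlongrightarrow> pairing F m \<psi> t V' ws + (\<integral>x. indicator {..<c} x * (F (V x t) * \<psi> x) \<partial>lborel)
      + m w * \<psi> c - (\<integral>x. indicator {..<c} x * (F (V' x t) * \<psi> x) \<partial>lborel)) (at_right 0)"
  proof -
    from hK obtain K where K: "\<forall>\<^sub>F \<epsilon> in at_right 0. h \<epsilon> * (\<bar>A \<epsilon>\<bar> + \<bar>B \<epsilon>\<bar>) \<le> K" by blast
    have m1: "((\<lambda>\<epsilon>. c - h \<epsilon>) \<longlongrightarrow> c) (at_right 0)" and m2: "((\<lambda>\<epsilon>. c + h \<epsilon>) \<longlongrightarrow> c) (at_right 0)"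
      using tendsto_diff[OF tendsto_const h, of c] tendsto_add[OF tendsto_const h, of c] by simp_all
    show ?thesis unfolding I_def
      by (intro tendsto_diff tendsto_add IH(1) tendsto_integral_lessThan iV iV' m1 m2
          tendsto_integral_strips[OF \<psi> cont h0 h hm K])
  qed
  have eq: "(\<integral>x. indicator {..<c} x * ((F (V x t) - F (V' x t)) * \<psi> x) \<partial>lborel)
      = (\<integral>x. indicator {..<c} x * (F (V x t) * \<psi> x) \<partial>lborel)
        - (\<integral>x. indicator {..<c} x * (F (V' x t) * \<psi> x) \<partial>lborel)"
    unfolding left_diff_distrib right_diff_distrib
    by (rule Bochner_Integration.integral_diff) (simp_all add: integrable_indicator_mult iV iV')
  have "(I \<longlongrightarrow> pairing F m \<psi> t V (p # ws)) (at_right 0)"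
  proof -
    have "pairing F m \<psi> t V (p # ws) = pairing F m \<psi> t V' ws
      + (\<integral>x. indicator {..<c} x * (F (V x t) * \<psi> x) \<partial>lborel)
      + m w * \<psi> c - (\<integral>x. indicator {..<c} x * (F (V' x t) * \<psi> x) \<partial>lborel)"
      by (simp add: p eq c_def[symmetric] del: mult.commute)
    with lim0 show ?thesis by simp
  qed
  from Lim_transform_eventually[OF this eventually_mono[OF ev]] ev show ?case
    by (simp add: eventually_conj_iff)
qed

section \<open>The limit of a wave pattern in space and time\<close>

definition strip_mass :: "(state \<Rightarrow> real) \<Rightarrow> real \<Rightarrow> real \<Rightarrow> wave \<Rightarrow> real" where
  "strip_mass F \<epsilon> t w = half_width w \<epsilon> t * (\<bar>F (lmid w \<epsilon> t)\<bar> + \<bar>F (rmid w \<epsilon> t)\<bar>)"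

lemma profile_measurable:
  fixes F :: "state \<Rightarrow> real"
  assumes "\<And>V'. V' \<in> fields V ws \<Longrightarrow> (\<lambda>x. F (V' x t)) \<in> borel_measurable borel"
  shows "(\<lambda>x. F (profile V ws \<epsilon> x t)) \<in> borel_measurable borel"
  using assms
proof (induction ws arbitrary: V)
  case (Cons p ws)
  obtain w V' where p: "p = (w, V')" by (cases p)
  have [measurable]: "(\<lambda>x. F (V x t)) \<in> borel_measurable borel"
    "(\<lambda>x. F (profile V' ws \<epsilon> x t)) \<in> borel_measurable borel"
    using Cons by (auto simp: p)
  show ?case unfolding p profile_Cons by (simp add: if_distrib[of F] cong: if_cong)
qed simp

lemma integrable_mult_indicator_bounded:
  fixes A :: "real set" and k :: real
  assumes "bounded A" "A \<in> sets borel"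
  shows "integrable lborel (\<lambda>x. k * indicator A x)"
  by (intro integrable_mult_right integrable_real_indicator)
    (use assms emeasure_bounded_finite in auto)

lemma integrable_bounded_support:
  fixes g :: "real \<Rightarrow> real"
  assumes [measurable]: "g \<in> borel_measurable borel"
    and B: "\<And>x. \<bar>g x\<bar> \<le> B" and R: "\<And>x. g x \<noteq> 0 \<Longrightarrow> \<bar>x\<bar> \<le> R"
  shows "integrable lborel g"
proof (rule Bochner_Integration.integrable_bound)
  show "integrable lborel (\<lambda>x. B * indicator {-R..R} x)"
    by (rule integrable_mult_indicator_bounded) auto
  have "\<bar>g x\<bar> \<le> \<bar>B * indicator {-R..R} x\<bar>" for x
    using B[of x] R[of x] by (cases "g x = 0") (auto simp: indicator_def abs_le_iff)
  then show "AE x in lborel. norm (g x) \<le> norm (B * indicator {-R..R} x)" by simp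
qed simp

text \<open>Provides the dominating function in time: every field contributes at most its bound over the
  support of \<open>\<psi>\<close>, every wave at most the total mass in its strips.\<close>

lemma profile_bound:
  fixes \<psi> :: "real \<Rightarrow> real" and R B C :: real
  assumes "\<And>V'. V' \<in> fields V ws \<Longrightarrow> (\<lambda>x. F (V' x t)) \<in> borel_measurable borel"
    and "\<And>V' x. V' \<in> fields V ws \<Longrightarrow> \<bar>F (V' x t) * \<psi> x\<bar> \<le> C"
    and "\<And>w V'. (w, V') \<in> set ws \<Longrightarrow> half_width w \<epsilon> t \<ge> 0"
    and \<psi>[measurable]: "\<psi> \<in> borel_measurable borel" and B: "\<And>x. \<bar>\<psi> x\<bar> \<le> B"
    and R: "\<And>x. \<psi> x \<noteq> 0 \<Longrightarrow> \<bar>x\<bar> \<le> R" "R \<ge> 0"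
  shows "integrable lborel (\<lambda>x. F (profile V ws \<epsilon> x t) * \<psi> x) \<and>
    (\<integral>x. \<bar>F (profile V ws \<epsilon> x t) * \<psi> x\<bar> \<partial>lborel)
      \<le> (length ws + 1) * (2 * R * C) + B * (\<Sum>(w, _)\<leftarrow>ws. strip_mass F \<epsilon> t w)"
  using assms(1-3)
proof (induction ws arbitrary: V)
  case Nil
  have [measurable]: "(\<lambda>x. F (V x t)) \<in> borel_measurable borel" using Nil by simp
  have C: "\<bar>F (V x t) * \<psi> x\<bar> \<le> C" for x using Nil by simp
  then have "C \<ge> 0" using abs_ge_zero order_trans by blast
  have i: "integrable lborel (\<lambda>x. C * indicator {-R..R} x)"
    by (rule integrable_mult_indicator_bounded) auto
  have le: "\<bar>F (V x t) * \<psi> x\<bar> \<le> C * indicator {-R..R} x" for x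
  proof (cases "\<psi> x = 0")
    case False
    then show ?thesis using C[of x] R(1)[of x] by (simp add: indicator_def abs_le_iff)
  qed (use \<open>C \<ge> 0\<close> in simp)
  have int: "integrable lborel (\<lambda>x. F (V x t) * \<psi> x)"
    by (rule Bochner_Integration.integrable_bound[OF i]) (use le in \<open>auto intro: order_trans[OF _ abs_ge_self]\<close>)
  have "(\<integral>x. \<bar>F (V x t) * \<psi> x\<bar> \<partial>lborel) \<le> (\<integral>x. C * indicator {-R..R} x \<partial>lborel)"
    by (rule integral_mono[OF integrable_abs[OF int] i le])
  also have "\<dots> = 2 * R * C" using \<open>R \<ge> 0\<close> by (simp add: measure_def)
  finally show ?case using int by simp
next
  case (Cons p ws)
  obtain w V' where p: "p = (w, V')" by (cases p)
  define c where "c = front w t"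
  define h where "h = half_width w \<epsilon> t"
  define a where "a = \<bar>F (lmid w \<epsilon> t)\<bar>"
  define b where "b = \<bar>F (rmid w \<epsilon> t)\<bar>"
  define rest where "rest x = F (profile V' ws \<epsilon> x t) * \<psi> x" for x
  have h: "h \<ge> 0" using Cons.prems(3)[of w V'] by (simp add: p h_def)
  have B0: "B \<ge> 0" using B[of 0] by linarith
  have IH: "integrable lborel rest"
    "(\<integral>x. \<bar>rest x\<bar> \<partial>lborel) \<le> (length ws + 1) * (2 * R * C) + B * (\<Sum>(w, _)\<leftarrow>ws. strip_mass F \<epsilon> t w)"
  proof -
    have "integrable lborel (\<lambda>x. F (profile V' ws \<epsilon> x t) * \<psi> x) \<and>
      (\<integral>x. \<bar>F (profile V' ws \<epsilon> x t) * \<psi> x\<bar> \<partial>lborel)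
        \<le> (length ws + 1) * (2 * R * C) + B * (\<Sum>(w, _)\<leftarrow>ws. strip_mass F \<epsilon> t w)"
    proof (rule Cons.IH)
      show "half_width w' \<epsilon> t \<ge> 0" if "(w', V'') \<in> set ws" for w' V''
        using Cons.prems(3)[of w' V''] that by (simp add: p)
    qed (use Cons.prems(1,2) in \<open>auto simp: p\<close>)
    then show "integrable lborel rest"
      "(\<integral>x. \<bar>rest x\<bar> \<partial>lborel) \<le> (length ws + 1) * (2 * R * C) + B * (\<Sum>(w, _)\<leftarrow>ws. strip_mass F \<epsilon> t w)"
      unfolding rest_def[abs_def] by auto
  qed
  have m: "(\<lambda>x. F (profile V (p # ws) \<epsilon> x t)) \<in> borel_measurable borel"
    by (rule profile_measurable) (use Cons.prems in auto)
  have C: "\<bar>F (V x t) * \<psi> x\<bar> \<le> C" for x using Cons.prems(2)[of V] by (simp add: p)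
  then have "C \<ge> 0" using abs_ge_zero order_trans by blast
  define G where "G x = C * indicator {-R..R} x + a * B * indicator {c - h..<c} x
      + b * B * indicator {c..<c + h} x + \<bar>rest x\<bar>" for x
  have i1: "integrable lborel (\<lambda>x. C * indicator {-R..R} x)"
    by (rule integrable_mult_indicator_bounded) auto
  have i2: "integrable lborel (\<lambda>x. a * B * indicator {c - h..<c} x)"
    by (rule integrable_mult_indicator_bounded) auto
  have i3: "integrable lborel (\<lambda>x. b * B * indicator {c..<c + h} x)"
    by (rule integrable_mult_indicator_bounded) auto
  note s1 = Bochner_Integration.integrable_add[OF i1 i2]
  note s2 = Bochner_Integration.integrable_add[OF s1 i3]
  note s3 = Bochner_Integration.integrable_add[OF s2 integrable_abs[OF IH(1)]]
  have GG: "integrable lborel G" unfolding G_def[abs_def] by (rule s3)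
  have GI: "(\<integral>x. G x \<partial>lborel) = 2 * R * C + B * (h * (a + b)) + (\<integral>x. \<bar>rest x\<bar> \<partial>lborel)"
    unfolding G_def Bochner_Integration.integral_add[OF s2 integrable_abs[OF IH(1)]]
      Bochner_Integration.integral_add[OF s1 i3] Bochner_Integration.integral_add[OF i1 i2]
    using h R(2) by (simp add: measure_def algebra_simps)
  have le: "\<bar>F (profile V (p # ws) \<epsilon> x t) * \<psi> x\<bar> \<le> G x" for x
  proof (cases "\<psi> x = 0")
    case True
    then show ?thesis using \<open>C \<ge> 0\<close> B0 by (simp add: G_def a_def b_def)
  next
    case False
    then have in_R: "x \<in> {-R..R}" using R(1)[of x] by (simp add: abs_le_iff)
    have prof: "F (profile V (p # ws) \<epsilon> x t) = (if x < c - h then F (V x t) else if x < c then F (lmid w \<epsilon> t)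
        else if x < c + h then F (rmid w \<epsilon> t) else F (profile V' ws \<epsilon> x t))"
      unfolding p profile_Cons c_def h_def by simp
    have nn: "C \<le> G x" "\<bar>rest x\<bar> \<le> G x"
      using in_R \<open>C \<ge> 0\<close> B0 by (auto simp: G_def a_def b_def)
    have ab: "a * \<bar>\<psi> x\<bar> \<le> a * B" "b * \<bar>\<psi> x\<bar> \<le> b * B"
      using B[of x] by (auto simp: a_def b_def intro!: mult_left_mono)
    have A: "a * B \<le> G x" if "c - h \<le> x" "x < c"
      using that \<open>C \<ge> 0\<close> B0 by (auto simp: G_def a_def b_def)
    have Bb: "b * B \<le> G x" if "c \<le> x" "x < c + h"
      using that \<open>C \<ge> 0\<close> B0 by (auto simp: G_def a_def b_def)
    show ?thesis
      using C[of x] nn ab A Bb unfolding prof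
      by (auto simp: abs_mult a_def[symmetric] b_def[symmetric] rest_def not_less
          intro: order_trans)
  qed
  have int: "integrable lborel (\<lambda>x. F (profile V (p # ws) \<epsilon> x t) * \<psi> x)"
    by (rule Bochner_Integration.integrable_bound[OF GG])
      (use m le in \<open>auto intro: order_trans[OF _ abs_ge_self]\<close>)
  have "(\<integral>x. \<bar>F (profile V (p # ws) \<epsilon> x t) * \<psi> x\<bar> \<partial>lborel) \<le> (\<integral>x. G x \<partial>lborel)"
    by (rule integral_mono[OF integrable_abs[OF int] GG le])
  also have "\<dots> \<le> (length (p # ws) + 1) * (2 * R * C) + B * (\<Sum>(w, _)\<leftarrow>p # ws. strip_mass F \<epsilon> t w)"
    unfolding GI using IH(2) by (simp add: p strip_mass_def h_def a_def b_def algebra_simps)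
  finally show ?case using int by simp
qed

text \<open>\<open>tame_wave F I m w\<close>: during the times in \<open>I\<close> the strips of \<open>w\<close> tend to a point mass \<open>m w t\<close>,
  with bounds that are uniform on bounded times and thus allow passing to the limit under the
  time integral.\<close>

definition tame_wave ::
    "(state \<Rightarrow> real) \<Rightarrow> real set \<Rightarrow> (wave \<Rightarrow> real \<Rightarrow> real) \<Rightarrow> wave \<Rightarrow> bool" where
  "tame_wave F I m w \<longleftrightarrow>
     (\<lambda>t. indicator I t * front w t) \<in> borel_measurable borel \<and>
     (is_Shadow w \<longrightarrow> (\<forall>\<^sub>F \<epsilon> in at_right 0.
        (\<lambda>t. indicator I t * F (lmid w \<epsilon> t)) \<in> borel_measurable borel \<and>
        (\<lambda>t. indicator I t * F (rmid w \<epsilon> t)) \<in> borel_measurable borel)) \<and>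
     (\<forall>\<^sub>F \<epsilon> in at_right 0. \<forall>t\<in>I. half_width w \<epsilon> t \<ge> 0) \<and>
     (\<forall>t\<in>I. point_mass F t w (m w t)) \<and>
     (\<forall>R. \<exists>K. \<forall>\<^sub>F \<epsilon> in at_right 0. \<forall>t\<in>I. t \<le> R \<longrightarrow> strip_mass F \<epsilon> t w \<le> K)"

lemma profile_measurable_pair:
  fixes F :: "state \<Rightarrow> real"
  assumes I[measurable]: "I \<in> sets borel"
    and "\<And>V'. V' \<in> fields V ws \<Longrightarrow> (\<lambda>z. F (V' (fst z) (snd z))) \<in> borel_measurable borel"
    and "\<And>w V'. (w, V') \<in> set ws \<Longrightarrow> (\<lambda>t. indicator I t * front w t) \<in> borel_measurable borel"
    and "\<And>w V'. (w, V') \<in> set ws \<Longrightarrow> is_Shadow w \<Longrightarrow>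
        (\<lambda>t. indicator I t * F (lmid w \<epsilon> t)) \<in> borel_measurable borel \<and>
        (\<lambda>t. indicator I t * F (rmid w \<epsilon> t)) \<in> borel_measurable borel"
  shows "(\<lambda>z. indicator I (snd z) * F (profile V ws \<epsilon> (fst z) (snd z)))
    \<in> borel_measurable (borel :: (real \<times> real) measure)"
proof -
  have indI: "(\<lambda>z. indicator I (snd z) :: real) \<in> borel_measurable (borel \<Otimes>\<^sub>M borel)"
    by (rule measurable_compose[OF measurable_snd borel_measurable_indicator[OF I]])
  show ?thesis
  using assms(2-)
proof (induction ws arbitrary: V)
  case Nil
  have V: "(\<lambda>z. F (V (fst z) (snd z))) \<in> borel_measurable (borel \<Otimes>\<^sub>M borel)"
    using Nil by (simp add: borel_prod)
  show ?case unfolding borel_prod[symmetric] profile.simps by (intro borel_measurable_times V indI)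
next
  case (Cons p ws)
  obtain w V' where p: "p = (w, V')" by (cases p)
  have V[measurable]: "(\<lambda>z. F (V (fst z) (snd z))) \<in> borel_measurable (borel \<Otimes>\<^sub>M borel)"
    using Cons.prems(1) by (simp add: p borel_prod)
  have IV[measurable]: "(\<lambda>z. indicator I (snd z) * F (V (fst z) (snd z))) \<in> borel_measurable (borel \<Otimes>\<^sub>M borel)"
    by (intro borel_measurable_times V indI)
  have IH[measurable]: "(\<lambda>z. indicator I (snd z) * F (profile V' ws \<epsilon> (fst z) (snd z)))
      \<in> borel_measurable (borel \<Otimes>\<^sub>M borel)"
    unfolding borel_prod
  proof (rule Cons.IH)
    show "(\<lambda>t. indicator I t * F (lmid w' \<epsilon> t)) \<in> borel_measurable borel \<and>
        (\<lambda>t. indicator I t * F (rmid w' \<epsilon> t)) \<in> borel_measurable borel"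
      if "(w', V'') \<in> set ws" "is_Shadow w'" for w' V''
      using Cons.prems(3)[of w' V''] that by (simp add: p)
    show "(\<lambda>t. indicator I t * front w' t) \<in> borel_measurable borel" if "(w', V'') \<in> set ws" for w' V''
      using Cons.prems(2)[of w' V''] that by (simp add: p)
  qed (use Cons.prems(1) in \<open>simp add: p\<close>)
  have [measurable]: "(\<lambda>t. indicator I t * front w t) \<in> borel_measurable borel"
    using Cons.prems(2) by (auto simp: p)
  have [measurable]: "(\<lambda>t. half_width w \<epsilon> t) \<in> borel_measurable borel"
    unfolding half_width_def width_def by (cases "is_Shadow w") simp_all
  show ?case
  proof (cases "is_Shadow w")
    case True
    then have [measurable]: "(\<lambda>t. indicator I t * F (lmid w \<epsilon> t)) \<in> borel_measurable borel"
        "(\<lambda>t. indicator I t * F (rmid w \<epsilon> t)) \<in> borel_measurable borel"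
      using Cons.prems(3)[of w V'] by (auto simp: p)
    have "(\<lambda>z. indicator I (snd z) * F (profile V (p # ws) \<epsilon> (fst z) (snd z))) =
      (\<lambda>z. if fst z < indicator I (snd z) * front w (snd z) - half_width w \<epsilon> (snd z)
         then indicator I (snd z) * F (V (fst z) (snd z))
         else if fst z < indicator I (snd z) * front w (snd z)
         then indicator I (snd z) * F (lmid w \<epsilon> (snd z))
         else if fst z < indicator I (snd z) * front w (snd z) + half_width w \<epsilon> (snd z)
         then indicator I (snd z) * F (rmid w \<epsilon> (snd z))
         else indicator I (snd z) * F (profile V' ws \<epsilon> (fst z) (snd z)))"
      by (rule ext) (auto simp: indicator_def p profile_Cons)
    then show ?thesis unfolding borel_prod[symmetric] by (simp only:) measurable
  next
    case False
    then have "(\<lambda>z. indicator I (snd z) * F (profile V (p # ws) \<epsilon> (fst z) (snd z))) =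
      (\<lambda>z. if fst z < indicator I (snd z) * front w (snd z)
         then indicator I (snd z) * F (V (fst z) (snd z))
         else indicator I (snd z) * F (profile V' ws \<epsilon> (fst z) (snd z)))"
      by (intro ext) (auto simp: indicator_def p profile_Cons half_width_def)
    then show ?thesis unfolding borel_prod[symmetric] by (simp only:) measurable
  qed
qed
qed

lemma eventually_all_strips:
  assumes "\<And>w V'. (w, V') \<in> set ws \<Longrightarrow> tame_wave F I m w"
  shows "\<exists>K. \<forall>\<^sub>F \<epsilon> in at_right 0.
      (\<forall>(w, V')\<in>set ws. (\<forall>t\<in>I. half_width w \<epsilon> t \<ge> 0) \<and> (is_Shadow w \<longrightarrow>
        (\<lambda>t. indicator I t * F (lmid w \<epsilon> t)) \<in> borel_measurable borel \<and>
        (\<lambda>t. indicator I t * F (rmid w \<epsilon> t)) \<in> borel_measurable borel)) \<and>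
      (\<forall>t\<in>I. t \<le> R \<longrightarrow> (\<Sum>(w, _)\<leftarrow>ws. strip_mass F \<epsilon> t w) \<le> K)"
  using assms
proof (induction ws)
  case (Cons p ws)
  obtain w V' where p: "p = (w, V')" by (cases p)
  from Cons obtain K where K: "\<forall>\<^sub>F \<epsilon> in at_right 0.
      (\<forall>(w, V')\<in>set ws. (\<forall>t\<in>I. half_width w \<epsilon> t \<ge> 0) \<and> (is_Shadow w \<longrightarrow>
        (\<lambda>t. indicator I t * F (lmid w \<epsilon> t)) \<in> borel_measurable borel \<and>
        (\<lambda>t. indicator I t * F (rmid w \<epsilon> t)) \<in> borel_measurable borel)) \<and>
      (\<forall>t\<in>I. t \<le> R \<longrightarrow> (\<Sum>(w, _)\<leftarrow>ws. strip_mass F \<epsilon> t w) \<le> K)" by fastforce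
  have w: "tame_wave F I m w" using Cons.prems[of w V'] by (simp add: p)
  then obtain K' where K': "\<forall>\<^sub>F \<epsilon> in at_right 0. \<forall>t\<in>I. t \<le> R \<longrightarrow> strip_mass F \<epsilon> t w \<le> K'"
    unfolding tame_wave_def by blast
  have 1: "\<forall>\<^sub>F \<epsilon> in at_right 0. \<forall>t\<in>I. half_width w \<epsilon> t \<ge> 0"
    using w by (simp add: tame_wave_def)
  have 2: "\<forall>\<^sub>F \<epsilon> in at_right 0. is_Shadow w \<longrightarrow>
        (\<lambda>t. indicator I t * F (lmid w \<epsilon> t)) \<in> borel_measurable borel \<and>
        (\<lambda>t. indicator I t * F (rmid w \<epsilon> t)) \<in> borel_measurable borel"
    using w by (cases "is_Shadow w") (simp_all add: tame_wave_def)
  show ?case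
    by (rule exI[of _ "K' + K"]) (use K K' 1 2 in \<open>eventually_elim, auto simp: p add_mono\<close>)
qed auto

text \<open>At each time this is \<open>profile_tendsto\<close>; the bound \<open>profile_bound\<close>, which is uniform in \<open>\<epsilon>\<close>
  for a tame pattern, permits dominated convergence in time.\<close>

theorem pattern_limit:
  fixes \<psi> :: "real \<times> real \<Rightarrow> real"
  assumes I[measurable]: "I \<in> sets borel"
    and ord: "\<And>t. t \<in> I \<Longrightarrow> ordered t ws"
    and \<psi>: "continuous_on UNIV \<psi>"
    and R: "\<And>z. \<psi> z \<noteq> 0 \<Longrightarrow> \<bar>fst z\<bar> \<le> R \<and> \<bar>snd z\<bar> \<le> R"
    and fm: "\<And>V'. V' \<in> fields V ws \<Longrightarrow> (\<lambda>z. F (V' (fst z) (snd z))) \<in> borel_measurable borel"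
    and C: "\<And>V' t x. V' \<in> fields V ws \<Longrightarrow> t \<in> I \<Longrightarrow> \<bar>F (V' x t) * \<psi> (x, t)\<bar> \<le> C"
    and tame: "\<And>w V'. (w, V') \<in> set ws \<Longrightarrow> tame_wave F I m w"
  shows "((\<lambda>\<epsilon>. LBINT t:I. (LBINT x. F (profile V ws \<epsilon> x t) * \<psi> (x, t)))
      \<longlongrightarrow> (LBINT t:I. pairing F (\<lambda>w. m w t) (\<lambda>x. \<psi> (x, t)) t V ws)) (at_right 0)"
    and "set_integrable lborel I (\<lambda>t. pairing F (\<lambda>w. m w t) (\<lambda>x. \<psi> (x, t)) t V ws)"
    and "\<forall>\<^sub>F \<epsilon> in at_right 0. set_integrable lborel I (\<lambda>t. LBINT x. F (profile V ws \<epsilon> x t) * \<psi> (x, t))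
      \<and> (\<forall>t\<in>I. integrable lborel (\<lambda>x. F (profile V ws \<epsilon> x t) * \<psi> (x, t)))"
proof -
  define R' where "R' = max R 0"
  have R': "R' \<ge> 0" "\<And>z. \<psi> z \<noteq> 0 \<Longrightarrow> \<bar>fst z\<bar> \<le> R' \<and> \<bar>snd z\<bar> \<le> R'"
    using R by (force simp: R'_def)+
  have \<psi>m: "\<psi> \<in> borel_measurable borel" using \<psi> by (rule borel_measurable_continuous_onI)
  then have [measurable]: "\<psi> \<in> borel_measurable (borel \<Otimes>\<^sub>M borel)" by (simp add: borel_prod)
  have \<psi>x: "continuous_on UNIV (\<lambda>x. \<psi> (x, t))" for t
    by (rule continuous_on_compose2[OF \<psi>]) (auto intro!: continuous_intros)
  obtain B where B: "\<And>z. \<bar>\<psi> z\<bar> \<le> B"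
  proof -
    have "compact (\<psi> ` cbox (-R', -R') (R', R'))"
      by (rule compact_continuous_image) (use \<psi> continuous_on_subset in auto)
    then obtain B where B: "\<And>z. z \<in> cbox (-R', -R') (R', R') \<Longrightarrow> \<bar>\<psi> z\<bar> \<le> B"
      using compact_imp_bounded[of "\<psi> ` cbox (-R', -R') (R', R')"] unfolding bounded_real by blast
    have "\<bar>\<psi> z\<bar> \<le> max B 0" for z
    proof (cases "\<psi> z = 0")
      case False
      then have "z \<in> cbox (-R', -R') (R', R')"
        using R'(2)[OF False] by (cases z) (auto simp: abs_le_iff cbox_Pair_eq)
      then show ?thesis using B by fastforce
    qed simp
    then show ?thesis using that by blast
  qed
  have B0: "B \<ge> 0" using B[of 0] by linarith
  obtain K where K: "\<forall>\<^sub>F \<epsilon> in at_right 0.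
      (\<forall>(w, V')\<in>set ws. (\<forall>t\<in>I. half_width w \<epsilon> t \<ge> 0) \<and> (is_Shadow w \<longrightarrow>
        (\<lambda>t. indicator I t * F (lmid w \<epsilon> t)) \<in> borel_measurable borel \<and>
        (\<lambda>t. indicator I t * F (rmid w \<epsilon> t)) \<in> borel_measurable borel)) \<and>
      (\<forall>t\<in>I. t \<le> R' \<longrightarrow> (\<Sum>(w, _)\<leftarrow>ws. strip_mass F \<epsilon> t w) \<le> K)"
    using eventually_all_strips[of ws F I m R'] tame by blast
  define J where "J \<epsilon> t = (LBINT x. F (profile V ws \<epsilon> x t) * \<psi> (x, t))" for \<epsilon> t
  define L where "L t = pairing F (\<lambda>w. m w t) (\<lambda>x. \<psi> (x, t)) t V ws" for t
  define D where "D = \<bar>(length ws + 1) * (2 * R' * C) + B * K\<bar>"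
  have fmt: "(\<lambda>x. F (V' x t)) \<in> borel_measurable borel" if "V' \<in> fields V ws" for V' t
    using measurable_compose[OF _ fm[OF that], of "\<lambda>x. (x, t)" borel] by simp
  have ev: "\<forall>\<^sub>F \<epsilon> in at_right 0. (\<lambda>t. indicator I t * J \<epsilon> t) \<in> borel_measurable borel \<and>
      (\<forall>t\<in>I. integrable lborel (\<lambda>x. F (profile V ws \<epsilon> x t) * \<psi> (x, t))) \<and>
      (\<forall>t. \<bar>indicator I t * J \<epsilon> t\<bar> \<le> D * indicator {-R'..R'} t)"
    using K
  proof eventually_elim
    case (elim \<epsilon>)
    have [measurable]: "(\<lambda>z. indicator I (snd z) * F (profile V ws \<epsilon> (fst z) (snd z)))
        \<in> borel_measurable (borel \<Otimes>\<^sub>M borel)"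
      unfolding borel_prod
      by (rule profile_measurable_pair[OF I fm]) (use elim tame in \<open>auto simp: tame_wave_def\<close>)
    have "(\<lambda>z. (\<lambda>z. indicator I (snd z) * F (profile V ws \<epsilon> (fst z) (snd z))) (snd z, fst z) * \<psi> (snd z, fst z))
        \<in> borel_measurable (borel \<Otimes>\<^sub>M lborel)"
      by measurable
    then have "(\<lambda>t. LBINT x. indicator I t * F (profile V ws \<epsilon> x t) * \<psi> (x, t)) \<in> borel_measurable borel"
      by (intro lborel.borel_measurable_lebesgue_integral) (simp add: split_beta')
    then have meas: "(\<lambda>t. indicator I t * J \<epsilon> t) \<in> borel_measurable borel"
      by (simp add: J_def mult.assoc)
    have bnd: "integrable lborel (\<lambda>x. F (profile V ws \<epsilon> x t) * \<psi> (x, t)) \<and>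
        (LBINT x. \<bar>F (profile V ws \<epsilon> x t) * \<psi> (x, t)\<bar>)
          \<le> (length ws + 1) * (2 * R' * C) + B * (\<Sum>(w, _)\<leftarrow>ws. strip_mass F \<epsilon> t w)" if "t \<in> I" for t
      by (rule profile_bound) (use fmt C that elim B R' \<psi>x in
          \<open>auto intro: borel_measurable_continuous_onI\<close>)
    have "\<bar>indicator I t * J \<epsilon> t\<bar> \<le> D * indicator {-R'..R'} t" for t
    proof (cases "t \<in> I \<and> \<bar>t\<bar> \<le> R'")
      case True
      have "\<bar>J \<epsilon> t\<bar> \<le> (LBINT x. \<bar>F (profile V ws \<epsilon> x t) * \<psi> (x, t)\<bar>)"
        unfolding J_def by (rule integral_abs_bound)
      also have "\<dots> \<le> (length ws + 1) * (2 * R' * C) + B * (\<Sum>(w, _)\<leftarrow>ws. strip_mass F \<epsilon> t w)"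
        using bnd True by simp
      also have "\<dots> \<le> (length ws + 1) * (2 * R' * C) + B * K"
        using elim True B0 by (intro add_left_mono mult_left_mono) auto
      also have "\<dots> \<le> D" by (simp add: D_def)
      finally show ?thesis using True by (simp add: indicator_def abs_le_iff)
    next
      case False
      then consider "t \<notin> I" | "\<not> \<bar>t\<bar> \<le> R'" by blast
      then show ?thesis
      proof cases
        case 2
        then have "\<psi> (x, t) = 0" for x using R'(2)[of "(x, t)"] by force
        then show ?thesis by (simp add: J_def D_def)
      qed (simp add: D_def)
    qed
    with meas bnd show ?case by blast
  qed
  have Dint: "integrable lborel (\<lambda>t. D * indicator {-R'..R'} t)"
    by (rule integrable_mult_indicator_bounded) auto
  have Jt: "((\<lambda>\<epsilon>. J \<epsilon> t) \<longlongrightarrow> L t) (at_right 0)" if "t \<in> I" for t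
  proof -
    have comp: "integrable lborel (\<lambda>x. \<psi> (x, t))"
    proof (rule integrable_bounded_support)
      show "(\<lambda>x. \<psi> (x, t)) \<in> borel_measurable borel"
        by (rule borel_measurable_continuous_onI[OF \<psi>x])
      show "\<bar>x\<bar> \<le> R'" if "\<psi> (x, t) \<noteq> 0" for x
        using R'(2)[OF that] by simp
    qed (rule B)
    have "integrable lborel (\<lambda>x. F (V' x t) * \<psi> (x, t))" if "V' \<in> fields V ws" for V'
    proof (rule integrable_bounded_support)
      show "(\<lambda>x. F (V' x t) * \<psi> (x, t)) \<in> borel_measurable borel"
        using fmt[OF that, of t] borel_measurable_continuous_onI[OF \<psi>x] by (rule borel_measurable_times)
      show "\<bar>x\<bar> \<le> R'" if "F (V' x t) * \<psi> (x, t) \<noteq> 0" for x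
        using R'(2)[of "(x, t)"] that by simp
    qed (rule C[OF that \<open>t \<in> I\<close>])
    moreover have "isCont (\<lambda>x. \<psi> (x, t)) y" for y
      using \<psi>x[of t] by (simp add: continuous_on_eq_continuous_at)
    ultimately show ?thesis
      unfolding J_def L_def
      using profile_tendsto[OF ord[OF that] comp, of V F "\<lambda>w. m w t"] tame that
      by (auto simp: tame_wave_def)
  qed
  have IJ: "((\<lambda>\<epsilon>. indicator I t * J \<epsilon> t) \<longlongrightarrow> indicator I t * L t) (at_right 0)" for t
    using Jt[of t] by (cases "t \<in> I") auto
  have Lm: "(\<lambda>t. indicator I t * L t) \<in> borel_measurable lborel"
    by (rule borel_measurable_lim_at_right[where f = "\<lambda>\<epsilon> t. indicator I t * J \<epsilon> t"])
      (use ev IJ in \<open>auto elim: eventually_mono\<close>)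
  have dc: "((\<lambda>\<epsilon>. \<integral>t. indicator I t * J \<epsilon> t \<partial>lborel) \<longlongrightarrow> (\<integral>t. indicator I t * L t \<partial>lborel)) (at_right 0)
      \<and> integrable lborel (\<lambda>t. indicator I t * L t)"
    by (intro conjI dominated_convergence_at_right[OF _ Lm _ _ Dint])
      (use ev IJ in \<open>auto elim: eventually_mono\<close>)
  from dc show "((\<lambda>\<epsilon>. LBINT t:I. (LBINT x. F (profile V ws \<epsilon> x t) * \<psi> (x, t)))
      \<longlongrightarrow> (LBINT t:I. pairing F (\<lambda>w. m w t) (\<lambda>x. \<psi> (x, t)) t V ws)) (at_right 0)"
    by (simp add: set_lebesgue_integral_def J_def L_def)
  from dc show "set_integrable lborel I (\<lambda>t. pairing F (\<lambda>w. m w t) (\<lambda>x. \<psi> (x, t)) t V ws)"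
    by (simp add: set_integrable_def L_def)
  show "\<forall>\<^sub>F \<epsilon> in at_right 0. set_integrable lborel I (\<lambda>t. LBINT x. F (profile V ws \<epsilon> x t) * \<psi> (x, t))
      \<and> (\<forall>t\<in>I. integrable lborel (\<lambda>x. F (profile V ws \<epsilon> x t) * \<psi> (x, t)))"
    using ev
  proof eventually_elim
    case (elim \<epsilon>)
    have "integrable lborel (\<lambda>t. indicator I t * J \<epsilon> t)"
      by (rule Bochner_Integration.integrable_bound[OF Dint])
        (use elim in \<open>auto intro!: AE_I2 intro: order_trans[OF _ abs_ge_self]\<close>)
    then show ?case using elim by (simp add: set_integrable_def J_def)
  qed
qed

section \<open>Test functions\<close>

lemma test_function_mono: "test_function \<Omega> \<phi> \<Longrightarrow> test_function UNIV \<phi>"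
  by (simp add: test_function_def)

text \<open>The iterated partial derivatives of a smooth function are reduced to the first ones, in the
  form in which the limits below use them. A single \<open>R\<close> bounds the supports of the function and of
  its derivatives.\<close>

lemma test_function_props:
  assumes "test_function UNIV \<phi>"
  obtains R where "R > 0" "continuous_on UNIV \<phi>"
    "continuous_on UNIV (\<lambda>z. dx \<phi> (fst z) (snd z))" "continuous_on UNIV (\<lambda>z. dt \<phi> (fst z) (snd z))"
    "\<And>z. \<phi> z \<noteq> 0 \<Longrightarrow> \<bar>fst z\<bar> \<le> R \<and> \<bar>snd z\<bar> \<le> R"
    "\<And>z. dx \<phi> (fst z) (snd z) \<noteq> 0 \<Longrightarrow> \<bar>fst z\<bar> \<le> R \<and> \<bar>snd z\<bar> \<le> R"
    "\<And>z. dt \<phi> (fst z) (snd z) \<noteq> 0 \<Longrightarrow> \<bar>fst z\<bar> \<le> R \<and> \<bar>snd z\<bar> \<le> R"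
    "\<And>z. (\<phi> has_derivative (\<lambda>h. dx \<phi> (fst z) (snd z) * fst h + dt \<phi> (fst z) (snd z) * snd h)) (at z)"
    "\<And>x t. ((\<lambda>y. \<phi> (y, t)) has_real_derivative dx \<phi> x t) (at x)"
proof -
  from assms obtain D where D0: "D 0 0 = \<phi>"
    and D: "\<And>i j z. (D i j has_derivative (\<lambda>h. D (Suc i) j z * fst h + D i (Suc j) z * snd h)) (at z)"
    and cpt: "compact (closure {z. \<phi> z \<noteq> 0})"
    unfolding test_function_def smooth_def by blast
  have der: "(\<phi> has_derivative (\<lambda>h. D 1 0 z * fst h + D 0 1 z * snd h)) (at z)" for z
    using D[of 0 0 z] by (simp add: D0)
  have Dc: "continuous_on UNIV (D i j)" for i j
    by (rule continuous_at_imp_continuous_on) (use has_derivative_continuous[OF D] in blast)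
  have X: "((\<lambda>y. \<phi> (y, t)) has_real_derivative D 1 0 (x, t)) (at x)" for x t
  proof -
    have "((\<lambda>y. (y, t)) has_derivative (\<lambda>h. (h, 0))) (at x)"
      by (intro has_derivative_Pair has_derivative_ident has_derivative_const)
    from has_derivative_compose[OF this der] show ?thesis
      by (simp add: has_field_derivative_def)
  qed
  have T: "((\<lambda>s. \<phi> (x, s)) has_real_derivative D 0 1 (x, t)) (at t)" for x t
  proof -
    have "((\<lambda>s. (x, s)) has_derivative (\<lambda>h. (0, h))) (at t)"
      by (intro has_derivative_Pair has_derivative_ident has_derivative_const)
    from has_derivative_compose[OF this der] show ?thesis
      by (simp add: has_field_derivative_def)
  qed
  have dx: "dx \<phi> x t = D 1 0 (x, t)" and dt: "dt \<phi> x t = D 0 1 (x, t)" for x t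
    using X T by (auto simp: dx_def dt_def intro!: DERIV_imp_deriv)
  obtain R0 where R0: "\<And>z. z \<in> closure {z. \<phi> z \<noteq> 0} \<Longrightarrow> norm z \<le> R0"
    using compact_imp_bounded[OF cpt] bounded_iff by metis
  define R where "R = \<bar>R0\<bar> + 1"
  have supp: "\<bar>fst z\<bar> \<le> R \<and> \<bar>snd z\<bar> \<le> R" if "\<phi> z \<noteq> 0" for z
  proof -
    have "norm z \<le> R" using R0[of z] that closure_subset[of "{z. \<phi> z \<noteq> 0}"] by (auto simp: R_def)
    then show ?thesis using norm_fst_le[of "fst z" "snd z"] norm_snd_le[of "snd z" "fst z"] by simp
  qed
  have out: "D 1 0 (x, t) = 0 \<and> D 0 1 (x, t) = 0" if "\<not> (\<bar>x\<bar> \<le> R \<and> \<bar>t\<bar> \<le> R)" for x t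
  proof -
    have "open ({z :: real \<times> real. \<bar>fst z\<bar> > R} \<union> {z. \<bar>snd z\<bar> > R})"
      by (intro open_Un open_Collect_less continuous_intros)
    then have ev: "\<forall>\<^sub>F z in nhds (x, t). z \<in> {z. \<bar>fst z\<bar> > R} \<union> {z. \<bar>snd z\<bar> > R}"
      by (rule eventually_nhds_in_open) (use that in auto)
    have "(\<phi> has_derivative (\<lambda>h. 0)) (at (x, t))"
    proof (rule has_derivative_transform_eventually[OF has_derivative_const[of 0]])
      show "\<forall>\<^sub>F z in at (x, t). 0 = \<phi> z"
        unfolding eventually_at_filter using ev
      proof eventually_elim
        case (elim z)
        then have "\<not> (\<bar>fst z\<bar> \<le> R \<and> \<bar>snd z\<bar> \<le> R)" by auto
        then have "\<phi> z = 0" using supp[of z] by blast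
        then show ?case by simp
      qed
      show "0 = \<phi> (x, t)" using supp[of "(x, t)"] that by auto
    qed simp
    from has_derivative_unique[OF this der] have "D 1 0 (x, t) * fst h + D 0 1 (x, t) * snd h = 0" for h
      by (rule fun_cong[of "\<lambda>h. 0", symmetric])
    from this[of "(1, 0)"] this[of "(0, 1)"] show ?thesis by simp
  qed
  show ?thesis
  proof (rule that[of R])
    show "R > 0" by (simp add: R_def)
    show "continuous_on UNIV \<phi>" using Dc[of 0 0] by (simp add: D0)
    show "continuous_on UNIV (\<lambda>z. dx \<phi> (fst z) (snd z))" "continuous_on UNIV (\<lambda>z. dt \<phi> (fst z) (snd z))"
      using Dc by (auto simp: dx dt)
    show "\<bar>fst z\<bar> \<le> R \<and> \<bar>snd z\<bar> \<le> R" if "\<phi> z \<noteq> 0" for z by (rule supp[OF that])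
    show "\<bar>fst z\<bar> \<le> R \<and> \<bar>snd z\<bar> \<le> R" if "dx \<phi> (fst z) (snd z) \<noteq> 0" for z
      using out[of "fst z" "snd z"] that by (auto simp: dx)
    show "\<bar>fst z\<bar> \<le> R \<and> \<bar>snd z\<bar> \<le> R" if "dt \<phi> (fst z) (snd z) \<noteq> 0" for z
      using out[of "fst z" "snd z"] that by (auto simp: dt)
    show "(\<phi> has_derivative (\<lambda>h. dx \<phi> (fst z) (snd z) * fst h + dt \<phi> (fst z) (snd z) * snd h)) (at z)" for z
      using der[of z] by (simp add: dx dt)
    show "((\<lambda>y. \<phi> (y, t)) has_real_derivative dx \<phi> x t) (at x)" for x t
      using X by (simp add: dx)
  qed
qed

text \<open>The time coordinate attains a positive minimum on the compact support.\<close>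

lemma test_function_positive_time:
  assumes "test_function {z. snd z > 0} \<phi>"
  obtains \<delta> where "\<delta> > 0" "\<And>x t. t \<le> \<delta> \<Longrightarrow> \<phi> (x, t) = 0"
proof (cases "{z. \<phi> z \<noteq> 0} = {}")
  case False
  let ?S = "closure {z. \<phi> z \<noteq> 0}"
  have "compact ?S" "?S \<noteq> {}" using assms False by (auto simp: test_function_def)
  then have "\<exists>z\<in>?S. \<forall>y\<in>?S. snd z \<le> snd y"
    by (intro continuous_attains_inf continuous_intros)
  then obtain z0 where z0: "z0 \<in> ?S" "\<And>z. z \<in> ?S \<Longrightarrow> snd z0 \<le> snd z" by blast
  have "snd z0 > 0" using z0(1) assms by (auto simp: test_function_def)
  moreover have "\<phi> (x, t) = 0" if "t \<le> snd z0 / 2" for x t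
  proof (rule ccontr)
    assume "\<phi> (x, t) \<noteq> 0"
    then have "(x, t) \<in> ?S" using closure_subset[of "{z. \<phi> z \<noteq> 0}"] by auto
    from z0(2)[OF this] that \<open>snd z0 > 0\<close> show False by simp
  qed
  ultimately show ?thesis using that[of "snd z0 / 2"] by simp
qed (use that[of 1] in auto)

subsection \<open>Smooth cut-off functions\<close>

text \<open>Differentiability of order \<open>n\<close> on the line, in a recursive form that allows closure
  properties to be proved by induction over \<open>n\<close>.\<close>

fun smooth_upto :: "nat \<Rightarrow> (real \<Rightarrow> real) \<Rightarrow> bool" where
  "smooth_upto 0 f \<longleftrightarrow> True"
| "smooth_upto (Suc n) f \<longleftrightarrow> (\<exists>f'. (\<forall>x. (f has_real_derivative f' x) (at x)) \<and> smooth_upto n f')"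

definition smooth_real :: "(real \<Rightarrow> real) \<Rightarrow> bool" where
  "smooth_real f \<longleftrightarrow> (\<forall>n. smooth_upto n f)"

lemma smooth_upto_Suc_D: "smooth_upto (Suc n) f \<Longrightarrow> smooth_upto n f"
proof (induction n arbitrary: f)
  case (Suc n)
  then show ?case by (metis smooth_upto.simps(2))
qed simp

lemma smooth_upto_const: "smooth_upto n (\<lambda>x. k)"
proof (induction n arbitrary: k)
  case (Suc n)
  then show ?case by (auto intro!: exI[of _ "\<lambda>x. 0"])
qed simp

lemma smooth_upto_add:
  "smooth_upto n f \<Longrightarrow> smooth_upto n g \<Longrightarrow> smooth_upto n (\<lambda>x. f x + g x)"
proof (induction n arbitrary: f g)
  case (Suc n)
  then obtain f' g' where "\<And>x. (f has_real_derivative f' x) (at x)" "smooth_upto n f'"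
    "\<And>x. (g has_real_derivative g' x) (at x)" "smooth_upto n g'" by auto
  then show ?case using Suc.IH[of f' g'] by (auto intro!: exI[of _ "\<lambda>x. f' x + g' x"] DERIV_add)
qed simp

lemma smooth_upto_mult:
  "smooth_upto n f \<Longrightarrow> smooth_upto n g \<Longrightarrow> smooth_upto n (\<lambda>x. f x * g x)"
proof (induction n arbitrary: f g)
  case (Suc n)
  then obtain f' g' where *: "\<And>x. (f has_real_derivative f' x) (at x)" "smooth_upto n f'"
    "\<And>x. (g has_real_derivative g' x) (at x)" "smooth_upto n g'" by auto
  have "smooth_upto n (\<lambda>x. f' x * g x + g' x * f x)"
    by (intro smooth_upto_add Suc.IH * smooth_upto_Suc_D[OF Suc.prems(1)] smooth_upto_Suc_D[OF Suc.prems(2)])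
  then show ?case using DERIV_mult[OF *(1) *(3)] by (auto intro!: exI[of _ "\<lambda>x. f' x * g x + g' x * f x"])
qed simp

lemma smooth_upto_inverse:
  assumes "\<And>x. f x \<noteq> 0" "smooth_upto n f"
  shows "smooth_upto n (\<lambda>x. inverse (f x))"
  using assms(2)
proof (induction n)
  case (Suc n)
  then obtain f' where *: "\<And>x. (f has_real_derivative f' x) (at x)" "smooth_upto n f'" by auto
  have "smooth_upto n (\<lambda>x. (-1) * (inverse (f x) * f' x * inverse (f x)))"
    by (intro smooth_upto_mult Suc.IH * smooth_upto_Suc_D[OF Suc.prems(1)] smooth_upto_const)
  then show ?case using DERIV_inverse'[OF *(1) assms(1)]
    by (auto intro!: exI[of _ "\<lambda>x. (-1) * (inverse (f x) * f' x * inverse (f x))"])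
qed simp

lemma smooth_upto_affine: "smooth_upto n f \<Longrightarrow> smooth_upto n (\<lambda>x. f (a * x + b))"
proof (induction n arbitrary: f)
  case (Suc n)
  then obtain f' where *: "\<And>x. (f has_real_derivative f' x) (at x)" "smooth_upto n f'" by auto
  have "((\<lambda>x. f (a * x + b)) has_real_derivative f' (a * x + b) * a) (at x)" for x
    by (rule DERIV_chain2[OF *(1)]) (auto intro!: derivative_eq_intros)
  moreover have "smooth_upto n (\<lambda>x. f' (a * x + b) * a)"
    by (rule smooth_upto_mult[OF Suc.IH[OF *(2)] smooth_upto_const])
  ultimately show ?case by (auto intro!: exI[of _ "\<lambda>x. f' (a * x + b) * a"])
qed simp

lemma smooth_real_const: "smooth_real (\<lambda>x. k)"
  by (simp add: smooth_real_def smooth_upto_const)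

lemma smooth_real_add: "smooth_real f \<Longrightarrow> smooth_real g \<Longrightarrow> smooth_real (\<lambda>x. f x + g x)"
  by (simp add: smooth_real_def smooth_upto_add)

lemma smooth_real_mult: "smooth_real f \<Longrightarrow> smooth_real g \<Longrightarrow> smooth_real (\<lambda>x. f x * g x)"
  by (simp add: smooth_real_def smooth_upto_mult)

lemma smooth_real_affine:
  assumes "smooth_real f"
  shows "smooth_real (\<lambda>x. f (a * x + b))"
  unfolding smooth_real_def
proof
  show "smooth_upto n (\<lambda>x. f (a * x + b))" for n
    by (rule smooth_upto_affine[of n f a b]) (use assms in \<open>simp add: smooth_real_def\<close>)
qed

lemma smooth_real_inverse: "(\<And>x. f x \<noteq> 0) \<Longrightarrow> smooth_real f \<Longrightarrow> smooth_real (\<lambda>x. inverse (f x))"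
  by (simp add: smooth_real_def smooth_upto_inverse)

lemma smooth_real_diff:
  assumes "smooth_real f" "smooth_real g"
  shows "smooth_real (\<lambda>x. f x - g x)"
  using smooth_real_add[OF assms(1) smooth_real_mult[OF smooth_real_const[of "-1"] assms(2)]] by simp

lemma smooth_real_deriv:
  assumes "smooth_real f"
  shows "(f has_real_derivative deriv f x) (at x)" "smooth_real (deriv f)"
proof -
  have *: "(\<forall>x. (f has_real_derivative deriv f x) (at x)) \<and> smooth_upto n (deriv f)" for n
  proof -
    obtain f' where f': "\<forall>x. (f has_real_derivative f' x) (at x)" "smooth_upto n f'"
      using assms smooth_upto.simps(2) unfolding smooth_real_def by blast
    moreover have "deriv f = f'" using f'(1) by (auto intro: DERIV_imp_deriv)
    ultimately show ?thesis by simp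
  qed
  then show "(f has_real_derivative deriv f x) (at x)" "smooth_real (deriv f)"
    unfolding smooth_real_def by blast+
qed

lemma smooth_realI:
  assumes "\<And>x. (f has_real_derivative f' x) (at x)" "smooth_real f'"
  shows "smooth_real f"
proof -
  have "smooth_upto n f" for n
    using assms by (cases n) (auto simp: smooth_real_def)
  then show ?thesis by (simp add: smooth_real_def)
qed

text \<open>The classical flat function \<open>exp (- 1 / x)\<close>; the additional powers make the family closed
  under differentiation.\<close>

definition flat :: "nat \<Rightarrow> real \<Rightarrow> real" where
  "flat k x = (if x > 0 then inverse x ^ k * exp (- inverse x) else 0)"

lemma flat_deriv:
  "(flat k has_real_derivative flat (k + 2) x - of_nat k * flat (k + 1) x) (at x)"
proof -
  consider "x > 0" | "x < 0" | "x = 0" by linarith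
  then show ?thesis
  proof cases
    case 1
    have "((\<lambda>x. inverse x ^ k * exp (- inverse x)) has_real_derivative
        flat (k + 2) x - of_nat k * flat (k + 1) x) (at x)"
    proof (cases k)
      case 0
      then show ?thesis using 1
        by (auto intro!: derivative_eq_intros simp: flat_def power2_eq_square field_simps)
    next
      case (Suc j)
      have "j = 0 \<or> x * x ^ (j - Suc 0) = x ^ j"
        by (cases j) auto
      with Suc show ?thesis using 1
        by (cases "j = 0") (auto intro!: derivative_eq_intros simp: flat_def field_simps)
    qed
    then show ?thesis
      by (rule has_field_derivative_transform_within[where d = x]) (use 1 in \<open>auto simp: flat_def dist_real_def\<close>)
  next
    case 2
    have "((\<lambda>x. 0) has_real_derivative flat (k + 2) x - of_nat k * flat (k + 1) x) (at x)"
      using 2 by (simp add: flat_def)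
    then show ?thesis
      by (rule has_field_derivative_transform_within[where d = "- x"]) (use 2 in \<open>auto simp: flat_def dist_real_def\<close>)
  next
    case 3
    have "((\<lambda>y. y ^ (k + 1) / exp y) \<longlongrightarrow> (0::real)) at_top" by (rule tendsto_power_div_exp_0)
    then have "((\<lambda>h. inverse h ^ (k + 1) / exp (inverse h)) \<longlongrightarrow> (0::real)) (at_right 0)"
      by (rule filterlim_compose) (rule filterlim_inverse_at_top_right)
    moreover have "\<forall>\<^sub>F h in at_right 0. inverse h ^ (k + 1) / exp (inverse h) = flat k h / h"
      using eventually_at_right_less[of 0]
      by eventually_elim (simp add: flat_def exp_minus field_simps)
    ultimately have r: "((\<lambda>h. flat k h / h) \<longlongrightarrow> 0) (at_right 0)"
      by (rule Lim_transform_eventually)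
    have "\<forall>\<^sub>F h in at_left (0::real). h < 0" by (simp add: eventually_at_filter)
    then have "\<forall>\<^sub>F h in at_left 0. flat k h / h = 0"
      by eventually_elim (simp add: flat_def)
    then have l: "((\<lambda>h. flat k h / h) \<longlongrightarrow> 0) (at_left 0)" by (rule tendsto_eventually)
    have "((\<lambda>h. flat k h / h) \<longlongrightarrow> 0) (at 0)" using l r by (simp add: filterlim_at_split)
    then show ?thesis using 3 by (simp add: DERIV_def flat_def)
  qed
qed

lemma smooth_flat: "smooth_real (flat k)"
proof -
  have "smooth_upto n (flat k)" for n
  proof (induction n arbitrary: k)
    case (Suc n)
    have "smooth_upto n (\<lambda>x. flat (k + 2) x + (- of_nat k) * flat (k + 1) x)"
      by (intro smooth_upto_add smooth_upto_mult smooth_upto_const Suc)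
    then show ?case using flat_deriv[of k]
      by (auto intro!: exI[of _ "\<lambda>x. flat (k + 2) x + (- of_nat k) * flat (k + 1) x"])
  qed simp
  then show ?thesis by (simp add: smooth_real_def)
qed

text \<open>Smooth, \<open>0\<close> for \<open>x \<le> 0\<close> and \<open>1\<close> for \<open>x \<ge> 1\<close>; the building block of all test functions
  below.\<close>

definition step :: "real \<Rightarrow> real" where
  "step x = flat 0 x * inverse (flat 0 x + flat 0 (1 - x))"

lemma step_denominator: "flat 0 x + flat 0 (1 - x) > 0"
  by (cases "x > 0") (auto simp: flat_def add_pos_nonneg)

lemma smooth_step: "smooth_real step"
proof -
  have "smooth_real (\<lambda>x. flat 0 ((-1) * x + 1))" by (rule smooth_real_affine[OF smooth_flat])
  then have "smooth_real (\<lambda>x. flat 0 (1 - x))" by simp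
  then show ?thesis unfolding step_def[abs_def]
    using step_denominator
    by (intro smooth_real_mult smooth_real_inverse smooth_real_add smooth_flat) (auto simp: less_le)
qed

lemma step_le_0: "x \<le> 0 \<Longrightarrow> step x = 0"
  and step_ge_1: "x \<ge> 1 \<Longrightarrow> step x = 1"
  by (auto simp: step_def flat_def)

lemma step_bounds: "0 \<le> step x" "step x \<le> 1"
proof -
  have "flat 0 x \<ge> 0" "flat 0 (1 - x) \<ge> 0" by (auto simp: flat_def)
  then show "0 \<le> step x" "step x \<le> 1"
    using step_denominator[of x] by (auto simp: step_def inverse_eq_divide)
qed

lemma test_function_product:
  assumes \<alpha>: "smooth_real \<alpha>" "\<And>x. \<bar>x\<bar> > R \<Longrightarrow> \<alpha> x = 0"
    and \<beta>: "smooth_real \<beta>" "\<And>t. \<bar>t\<bar> > R \<Longrightarrow> \<beta> t = 0"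
  shows "test_function UNIV (\<lambda>z. \<alpha> (fst z) * \<beta> (snd z))"
    and "dx (\<lambda>z. \<alpha> (fst z) * \<beta> (snd z)) x t = deriv \<alpha> x * \<beta> t"
    and "dt (\<lambda>z. \<alpha> (fst z) * \<beta> (snd z)) x t = \<alpha> x * deriv \<beta> t"
proof -
  have pow: "smooth_real ((deriv ^^ n) f)" if "smooth_real f" for n f
    by (induction n) (use that smooth_real_deriv in auto)
  define D where "D i j z = (deriv ^^ i) \<alpha> (fst z) * (deriv ^^ j) \<beta> (snd z)" for i j and z :: "real \<times> real"
  have D: "(D i j has_derivative (\<lambda>h. D (Suc i) j z * fst h + D i (Suc j) z * snd h)) (at z)" for i j z
  proof -
    have A: "((\<lambda>z. (deriv ^^ i) \<alpha> (fst z)) has_derivative (\<lambda>h. (deriv ^^ Suc i) \<alpha> (fst z) * fst h)) (at z)"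
      using has_derivative_compose[OF has_derivative_fst[OF has_derivative_ident]
        smooth_real_deriv(1)[OF pow[OF \<alpha>(1)], unfolded has_field_derivative_def]] by simp
    have B: "((\<lambda>z. (deriv ^^ j) \<beta> (snd z)) has_derivative (\<lambda>h. (deriv ^^ Suc j) \<beta> (snd z) * snd h)) (at z)"
      using has_derivative_compose[OF has_derivative_snd[OF has_derivative_ident]
        smooth_real_deriv(1)[OF pow[OF \<beta>(1)], unfolded has_field_derivative_def]] by simp
    show ?thesis unfolding D_def
      by (rule has_derivative_eq_rhs[OF has_derivative_mult[OF A B]]) (auto simp: algebra_simps)
  qed
  have "{z. \<alpha> (fst z) * \<beta> (snd z) \<noteq> 0} \<subseteq> cbox (-R, -R) (R, R)"
    using \<alpha>(2) \<beta>(2) by (force simp: cbox_Pair_eq abs_le_iff not_less[symmetric])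
  then have "bounded {z. \<alpha> (fst z) * \<beta> (snd z) \<noteq> 0}" by (rule bounded_subset[OF bounded_cbox])
  then have "compact (closure {z. \<alpha> (fst z) * \<beta> (snd z) \<noteq> 0})" by simp
  moreover have "smooth (\<lambda>z. \<alpha> (fst z) * \<beta> (snd z))"
    unfolding smooth_def by (rule exI[of _ D]) (use D in \<open>auto simp: D_def\<close>)
  ultimately show "test_function UNIV (\<lambda>z. \<alpha> (fst z) * \<beta> (snd z))" by (simp add: test_function_def)
  show "dx (\<lambda>z. \<alpha> (fst z) * \<beta> (snd z)) x t = deriv \<alpha> x * \<beta> t"
    unfolding dx_def by (rule DERIV_imp_deriv)
      (use smooth_real_deriv(1)[OF \<alpha>(1)] in \<open>auto intro!: derivative_eq_intros\<close>)
  show "dt (\<lambda>z. \<alpha> (fst z) * \<beta> (snd z)) x t = \<alpha> x * deriv \<beta> t"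
    unfolding dt_def by (rule DERIV_imp_deriv)
      (use smooth_real_deriv(1)[OF \<beta>(1)] in \<open>auto intro!: derivative_eq_intros\<close>)
qed

section \<open>Balance laws along a front\<close>

text \<open>In coordinates moving with the end point the domain becomes a fixed compact interval, so
  that differentiation under the integral sign applies.\<close>

lemma integral_lessThan_eq_shifted:
  fixes \<psi> :: "real \<Rightarrow> real"
  assumes \<psi>: "continuous_on UNIV \<psi>" and supp: "\<And>x. \<psi> x \<noteq> 0 \<Longrightarrow> \<bar>x\<bar> \<le> R"
    and S: "S \<ge> 0" "c - S \<le> - R"
  shows "(\<integral>x. indicator {..<c} x * \<psi> x \<partial>lborel) = integral {-S..0} (\<lambda>y. \<psi> (c + y))"
proof -
  have [measurable]: "\<psi> \<in> borel_measurable borel" by (rule borel_measurable_continuous_onI[OF \<psi>])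
  have \<psi>I: "continuous_on {c - S..c} \<psi>" using \<psi> continuous_on_subset by blast
  have int: "set_integrable lborel {c - S..c} \<psi>"
    by (rule borel_integrable_atLeastAtMost') (rule \<psi>I)
  have "(\<integral>x. indicator {..<c} x * \<psi> x \<partial>lborel) = (\<integral>x. indicator {c - S..c} x * \<psi> x \<partial>lborel)"
  proof (rule integral_cong_AE)
    show "AE x in lborel. indicator {..<c} x * \<psi> x = indicator {c - S..c} x * \<psi> x"
      using AE_lborel_singleton[of c] AE_lborel_singleton[of "c - S"]
    proof eventually_elim
      case (elim x)
      show ?case using supp[of x] S elim by (cases "\<psi> x = 0") (auto simp: indicator_def)
    qed
  qed simp_all
  also have "\<dots> = integral {c - S..c} \<psi>"
    using set_borel_integral_eq_integral(2)[OF int] by (simp add: set_lebesgue_integral_def)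
  also have "\<dots> = integral {-S..0} (\<lambda>y. \<psi> (c + y))"
    using integral_shift[of "-S" c 0 \<psi>] \<psi>I by (simp add: o_def add.commute)
  finally show ?thesis .
qed

lemma integral_lessThan_deriv:
  fixes \<psi> \<psi>' :: "real \<Rightarrow> real"
  assumes der: "\<And>x. (\<psi> has_real_derivative \<psi>' x) (at x)" and \<psi>': "continuous_on UNIV \<psi>'"
    and supp: "\<And>x. \<psi> x \<noteq> 0 \<Longrightarrow> \<bar>x\<bar> \<le> R" "\<And>x. \<psi>' x \<noteq> 0 \<Longrightarrow> \<bar>x\<bar> \<le> R"
  shows "(\<integral>x. indicator {..<c} x * \<psi>' x \<partial>lborel) = \<psi> c"
proof -
  define S where "S = \<bar>c\<bar> + \<bar>R\<bar> + 1"
  have "(\<integral>x. indicator {..<c} x * \<psi>' x \<partial>lborel) = integral {-S..0} (\<lambda>y. \<psi>' (c + y))"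
    by (rule integral_lessThan_eq_shifted[OF \<psi>' supp(2)]) (auto simp: S_def)
  also have "\<dots> = \<psi> (c + 0) - \<psi> (c + - S)"
  proof (rule integral_unique, rule fundamental_theorem_of_calculus)
    show "((\<lambda>y. \<psi> (c + y)) has_vector_derivative \<psi>' (c + y)) (at y within {-S..0})" for y
      using DERIV_shift[of \<psi> "\<psi>' (c + y)" y c] der[of "c + y"]
      by (simp add: add.commute has_real_derivative_iff_has_vector_derivative has_vector_derivative_at_within)
  qed (simp add: S_def)
  also have "\<psi> (c + - S) = 0"
  proof (rule ccontr)
    assume "\<psi> (c + - S) \<noteq> 0"
    from supp(1)[OF this] show False unfolding S_def by linarith
  qed
  finally show ?thesis by simp
qed

text \<open>The amount to the left of a moving front together with the point mass \<open>m\<close> on the front changes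
  at the rate that appears in the limit of the weak form. The Rankine-Hugoniot condition on
  \<open>m\<close> makes the flux through the front cancel.\<close>

lemma front_balance:
  assumes \<phi>: "test_function UNIV \<phi>" and ab: "a \<le> b"
    and c: "continuous_on {a..b} c" and c': "continuous_on {a<..<b} c'"
    and dc: "\<And>t. t \<in> {a<..<b} \<Longrightarrow> (c has_real_derivative c' t) (at t)"
    and m: "continuous_on {a..b} m"
    and dm: "\<And>t. t \<in> {a<..<b} \<Longrightarrow> (m has_real_derivative g - f * c' t) (at t)"
  shows "((\<lambda>t. f * (\<integral>x. indicator {..<c t} x * dt \<phi> x t \<partial>lborel) + g * \<phi> (c t, t)
        + m t * (dt \<phi> (c t) t + c' t * dx \<phi> (c t) t))
      has_integral (f * (\<integral>x. indicator {..<c b} x * \<phi> (x, b) \<partial>lborel) + m b * \<phi> (c b, b))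
        - (f * (\<integral>x. indicator {..<c a} x * \<phi> (x, a) \<partial>lborel) + m a * \<phi> (c a, a))) {a..b}"
proof -
  obtain R where R: "R > 0" and c0: "continuous_on UNIV \<phi>"
    and cx: "continuous_on UNIV (\<lambda>z. dx \<phi> (fst z) (snd z))"
    and ct: "continuous_on UNIV (\<lambda>z. dt \<phi> (fst z) (snd z))"
    and s0: "\<And>z. \<phi> z \<noteq> 0 \<Longrightarrow> \<bar>fst z\<bar> \<le> R \<and> \<bar>snd z\<bar> \<le> R"
    and sx: "\<And>z. dx \<phi> (fst z) (snd z) \<noteq> 0 \<Longrightarrow> \<bar>fst z\<bar> \<le> R \<and> \<bar>snd z\<bar> \<le> R"
    and st: "\<And>z. dt \<phi> (fst z) (snd z) \<noteq> 0 \<Longrightarrow> \<bar>fst z\<bar> \<le> R \<and> \<bar>snd z\<bar> \<le> R"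
    and der: "\<And>z. (\<phi> has_derivative (\<lambda>h. dx \<phi> (fst z) (snd z) * fst h + dt \<phi> (fst z) (snd z) * snd h)) (at z)"
    and derx: "\<And>x t. ((\<lambda>y. \<phi> (y, t)) has_real_derivative dx \<phi> x t) (at x)"
    by (rule test_function_props[OF \<phi>]) blast
  obtain Cb where Cb: "\<And>t. t \<in> {a..b} \<Longrightarrow> \<bar>c t\<bar> \<le> Cb"
  proof -
    have "compact (c ` {a..b})" by (rule compact_continuous_image[OF c]) simp
    then show ?thesis using that compact_imp_bounded[of "c ` {a..b}"] unfolding bounded_real by blast
  qed
  define S where "S = \<bar>Cb\<bar> + R"
  have S: "S \<ge> 0" "\<And>t. t \<in> {a..b} \<Longrightarrow> c t - S \<le> - R" using R Cb by (force simp: S_def)+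
  have line: "continuous_on UNIV (\<lambda>x. q (x, t))" if "continuous_on UNIV q" for q :: "real \<times> real \<Rightarrow> real" and t
    by (rule continuous_on_compose2[OF that]) (auto intro!: continuous_intros)
  have line_x: "continuous_on UNIV (\<lambda>x. dx \<phi> x t)" and line_t: "continuous_on UNIV (\<lambda>x. dt \<phi> x t)" for t
    using line[OF cx] line[OF ct] by simp_all
  define P where "P t = integral {-S..0} (\<lambda>y. \<phi> (c t + y, t))" for t
  have Peq: "(\<integral>x. indicator {..<c t} x * \<phi> (x, t) \<partial>lborel) = P t" if "t \<in> {a..b}" for t
    unfolding P_def by (rule integral_lessThan_eq_shifted[where R = R]) (use line[OF c0] s0[of "(_, t)"] S that in auto)
  have Pt: "(\<integral>x. indicator {..<c t} x * dt \<phi> x t \<partial>lborel) = integral {-S..0} (\<lambda>y. dt \<phi> (c t + y) t)"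
    if "t \<in> {a..b}" for t
    by (rule integral_lessThan_eq_shifted[where R = R]) (use line[OF ct] st[of "(_, t)"] S that in auto)
  have Px: "integral {-S..0} (\<lambda>y. dx \<phi> (c t + y) t) = \<phi> (c t, t)" if "t \<in> {a..b}" for t
  proof -
    have "(\<integral>x. indicator {..<c t} x * dx \<phi> x t \<partial>lborel) = integral {-S..0} (\<lambda>y. dx \<phi> (c t + y) t)"
      by (rule integral_lessThan_eq_shifted[where R = R]) (use line[OF cx] sx[of "(_, t)"] S that in auto)
    moreover have "(\<integral>x. indicator {..<c t} x * dx \<phi> x t \<partial>lborel) = \<phi> (c t, t)"
      by (rule integral_lessThan_deriv[OF derx, where R = R])
        (use line[OF cx] s0[of "(_, t)"] sx[of "(_, t)"] in auto)
    ultimately show ?thesis by simp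
  qed
  have shift2: "continuous_on (U \<times> cbox (-S) 0) (\<lambda>(t, y). q (c t + y, t))"
    if "continuous_on UNIV q" "U \<subseteq> {a..b}" for q :: "real \<times> real \<Rightarrow> real" and U
  proof -
    have "continuous_on (U \<times> cbox (-S) 0) (\<lambda>z. c (fst z))"
      by (rule continuous_on_compose2[OF c]) (use that in \<open>auto intro!: continuous_intros\<close>)
    then have "continuous_on (U \<times> cbox (-S) 0) (\<lambda>z. (c (fst z) + snd z, fst z))"
      by (intro continuous_intros)
    from continuous_on_compose2[OF that(1) this] show ?thesis by (simp add: split_beta')
  qed
  have Pc: "continuous_on {a..b} P"
    unfolding P_def using integral_continuous_on_param[OF shift2[OF c0 order_refl]] by simp
  have curve: "((\<lambda>t. \<phi> (c t + y, t)) has_real_derivative dx \<phi> (c t + y) t * c' t + dt \<phi> (c t + y) t) (at t)"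
    if "t \<in> {a<..<b}" for t y
  proof -
    have "((\<lambda>t. (c t + y, t)) has_derivative (\<lambda>h. (c' t * h, h))) (at t)"
      using dc[OF that] unfolding has_field_derivative_def
      by (auto intro!: derivative_eq_intros)
    from has_derivative_compose[OF this der[of "(c t + y, t)"]] show ?thesis
      unfolding has_field_derivative_def
      by (rule has_derivative_eq_rhs) (simp add: fun_eq_iff algebra_simps)
  qed
  have dP: "(P has_real_derivative (c' t * \<phi> (c t, t) + (\<integral>x. indicator {..<c t} x * dt \<phi> x t \<partial>lborel))) (at t)"
    if t: "t \<in> {a<..<b}" for t
  proof -
    have sub: "{a<..<b} \<subseteq> {a..b}" by auto
    have c'2: "continuous_on ({a<..<b} \<times> cbox (-S) 0) (\<lambda>z. c' (fst z))"
      by (rule continuous_on_compose2[OF c']) (auto intro!: continuous_intros)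
    have cont: "continuous_on ({a<..<b} \<times> cbox (-S) 0)
        (\<lambda>(t, y). dx \<phi> (c t + y) t * c' t + dt \<phi> (c t + y) t)"
      using shift2[OF cx sub] shift2[OF ct sub] c'2
      by (auto simp: split_beta' intro!: continuous_intros)
    have "((\<lambda>t. integral (cbox (-S) 0) (\<lambda>y. \<phi> (c t + y, t))) has_field_derivative
        integral (cbox (-S) 0) (\<lambda>y. dx \<phi> (c t + y) t * c' t + dt \<phi> (c t + y) t)) (at t within {a<..<b})"
    proof (rule leibniz_rule_field_derivative[OF _ _ cont])
      show "((\<lambda>t. \<phi> (c t + y, t)) has_real_derivative dx \<phi> (c s + y) s * c' s + dt \<phi> (c s + y) s)
          (at s within {a<..<b})" if "s \<in> {a<..<b}" for s y
        using curve[OF that] by (rule has_field_derivative_at_within)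
      show "(\<lambda>y. \<phi> (c s + y, s)) integrable_on cbox (-S) 0" for s
        by (intro integrable_continuous continuous_on_compose2[OF c0]) (auto intro!: continuous_intros)
    qed (use t in auto)
    moreover have "integral (cbox (-S) 0) (\<lambda>y. dx \<phi> (c t + y) t * c' t + dt \<phi> (c t + y) t)
        = c' t * \<phi> (c t, t) + (\<integral>x. indicator {..<c t} x * dt \<phi> x t \<partial>lborel)"
    proof -
      have i1: "(\<lambda>y. dx \<phi> (c t + y) t) integrable_on {-S..0}"
        by (rule integrable_continuous_real, rule continuous_on_compose2[OF line_x]) (auto intro!: continuous_intros)
      have i2: "(\<lambda>y. dt \<phi> (c t + y) t) integrable_on {-S..0}"
        by (rule integrable_continuous_real, rule continuous_on_compose2[OF line_t]) (auto intro!: continuous_intros)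
      show ?thesis
        using Px[of t] Pt[of t] t integral_add[OF integrable_on_mult_left[OF i1, of "c' t"] i2] by simp
    qed
    ultimately show ?thesis
      using at_within_open[OF t open_greaterThanLessThan] by (simp add: P_def[abs_def])
  qed
  define e where "e t = f * P t + m t * \<phi> (c t, t)" for t
  have "((\<lambda>t. f * (c' t * \<phi> (c t, t) + (\<integral>x. indicator {..<c t} x * dt \<phi> x t \<partial>lborel))
      + ((g - f * c' t) * \<phi> (c t, t) + (dx \<phi> (c t) t * c' t + dt \<phi> (c t) t) * m t))
      has_integral e b - e a) {a..b}"
  proof (rule fundamental_theorem_of_calculus_interior[OF ab])
    show "continuous_on {a..b} e" unfolding e_def
      by (intro continuous_intros Pc m continuous_on_compose2[OF c0] c) auto
    show "(e has_vector_derivative f * (c' t * \<phi> (c t, t) + (\<integral>x. indicator {..<c t} x * dt \<phi> x t \<partial>lborel))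
      + ((g - f * c' t) * \<phi> (c t, t) + (dx \<phi> (c t) t * c' t + dt \<phi> (c t) t) * m t)) (at t)"
      if "t \<in> {a<..<b}" for t
      unfolding has_real_derivative_iff_has_vector_derivative[symmetric] e_def
      using DERIV_add[OF DERIV_cmult[OF dP[OF that], of f] DERIV_mult[OF dm[OF that] curve[OF that, of 0]]]
      by simp
  qed
  moreover have "e b - e a = (f * (\<integral>x. indicator {..<c b} x * \<phi> (x, b) \<partial>lborel) + m b * \<phi> (c b, b))
        - (f * (\<integral>x. indicator {..<c a} x * \<phi> (x, a) \<partial>lborel) + m a * \<phi> (c a, a))"
    using Peq ab by (simp add: e_def)
  ultimately show ?thesis
    by (simp add: algebra_simps)
qed

section \<open>Moments of admissible wave patterns\<close>

definition moment :: "nat \<Rightarrow> state \<Rightarrow> real" where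
  "moment k U = fst U * snd U ^ k"

text \<open>The strength of a shadow wave, as a function of time. For a contact discontinuity the half
  width vanishes and so does the mass.\<close>

definition mass :: "wave \<Rightarrow> real \<Rightarrow> real" where
  "mass w t = Lim (at_right 0) (\<lambda>\<epsilon>. half_width w \<epsilon> t * (fst (lmid w \<epsilon> t) + fst (rmid w \<epsilon> t)))"

text \<open>The intermediate velocities tend to the speed of the front, so the strips carry the \<open>k\<close>-th
  moment of a point mass moving with the front.\<close>

definition front_moment :: "nat \<Rightarrow> wave \<Rightarrow> real \<Rightarrow> real" where
  "front_moment k w t = mass w t * deriv (front w) t ^ k"

lemma mass_eq_strength: "is_Shadow w \<Longrightarrow> strength w t m \<Longrightarrow> mass w t = m"
  unfolding mass_def strength_def half_width_def by (rule tendsto_Lim) simp_all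

lemma mass_Contact [simp]: "\<not> is_Shadow w \<Longrightarrow> mass w t = 0"
  unfolding mass_def half_width_def by (rule tendsto_Lim) simp_all

lemma tame_Contact:
  assumes "\<not> is_Shadow w" "(\<lambda>t. indicator I t * front w t) \<in> borel_measurable borel"
    and "\<And>t. t \<in> I \<Longrightarrow> m w t = 0"
  shows "tame_wave F I m w"
  using assms by (auto simp: tame_wave_def point_mass_def half_width_def strip_mass_def)

lemma regular_shadow_width:
  assumes w: "regular_shadow J w" "is_Shadow w"
  shows "((\<lambda>\<epsilon>. half_width w \<epsilon> t) \<longlongrightarrow> 0) (at_right 0)"
    and "\<forall>\<^sub>F \<epsilon> in at_right 0. \<forall>t\<in>interior J. half_width w \<epsilon> t > 0"
    and "\<forall>\<^sub>F \<epsilon> in at_right 0. \<forall>t. t \<le> R \<longrightarrow> half_width w \<epsilon> t \<le> \<bar>R\<bar> + 1"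
proof -
  have s: "(shift w \<longlongrightarrow> 0) (at_right 0)" using w by (simp add: regular_shadow_def)
  have "((\<lambda>\<epsilon>. \<epsilon> / 2 * t + shift w \<epsilon>) \<longlongrightarrow> 0 / 2 * t + 0) (at_right 0)"
    by (intro tendsto_intros s) simp
  then show "((\<lambda>\<epsilon>. half_width w \<epsilon> t) \<longlongrightarrow> 0) (at_right 0)"
    using w by (simp add: half_width_def width_def)
  have "\<forall>\<^sub>F \<epsilon> in at_right 0.
        continuous_on (interior J) (lmid w \<epsilon>) \<and> continuous_on (interior J) (rmid w \<epsilon>) \<and>
        (\<forall>t\<in>interior J. width w \<epsilon> t > 0 \<and> fst (lmid w \<epsilon> t) \<ge> 0 \<and> fst (rmid w \<epsilon> t) \<ge> 0)"
    using w by (simp add: regular_shadow_def)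
  then show "\<forall>\<^sub>F \<epsilon> in at_right 0. \<forall>t\<in>interior J. half_width w \<epsilon> t > 0"
    by eventually_elim (use w in \<open>simp add: half_width_def\<close>)
  have "\<forall>\<^sub>F \<epsilon> in at_right (0::real). \<epsilon> < 1" by (rule order_tendstoD(2)[OF tendsto_ident_at]) simp
  moreover have "\<forall>\<^sub>F \<epsilon> in at_right (0::real). 0 < \<epsilon>" by (rule eventually_at_right_less)
  moreover have "\<forall>\<^sub>F \<epsilon> in at_right 0. shift w \<epsilon> < 1" by (rule order_tendstoD(2)[OF s]) simp
  ultimately show "\<forall>\<^sub>F \<epsilon> in at_right 0. \<forall>t. t \<le> R \<longrightarrow> half_width w \<epsilon> t \<le> \<bar>R\<bar> + 1"
  proof eventually_elim
    case (elim \<epsilon>)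
    have "\<epsilon> / 2 * t \<le> \<bar>R\<bar>" if "t \<le> R" for t
    proof -
      have "\<epsilon> / 2 * t \<le> \<epsilon> / 2 * \<bar>R\<bar>" using elim that by (intro mult_left_mono) auto
      also have "\<dots> \<le> 1 * \<bar>R\<bar>" using elim by (intro mult_right_mono) auto
      finally show ?thesis by simp
    qed
    then show ?case using elim w by (fastforce simp: half_width_def width_def)
  qed
qed

lemma regular_shadow_measurable:
  fixes F :: "state \<Rightarrow> real"
  assumes w: "regular_shadow J w" and F: "continuous_on UNIV F"
  shows "(\<lambda>t. indicator (interior J) t * front w t) \<in> borel_measurable borel"
    and "\<forall>\<^sub>F \<epsilon> in at_right 0.
      (\<lambda>t. indicator (interior J) t * F (lmid w \<epsilon> t)) \<in> borel_measurable borel \<and>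
      (\<lambda>t. indicator (interior J) t * F (rmid w \<epsilon> t)) \<in> borel_measurable borel"
proof -
  have *: "(\<lambda>t. indicator (interior J) t * q t) \<in> borel_measurable borel"
    if "continuous_on (interior J) q" for q :: "real \<Rightarrow> real"
    using borel_measurable_continuous_on_indicator[OF _ that] by simp
  have "continuous_on (interior J) (front w)"
    using continuous_on_subset[of J "front w", OF _ interior_subset] w by (simp add: regular_shadow_def)
  then show "(\<lambda>t. indicator (interior J) t * front w t) \<in> borel_measurable borel" by (rule *)
  have "\<forall>\<^sub>F \<epsilon> in at_right 0.
        continuous_on (interior J) (lmid w \<epsilon>) \<and> continuous_on (interior J) (rmid w \<epsilon>) \<and>
        (\<forall>t\<in>interior J. width w \<epsilon> t > 0 \<and> fst (lmid w \<epsilon> t) \<ge> 0 \<and> fst (rmid w \<epsilon> t) \<ge> 0)"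
    using w by (simp add: regular_shadow_def)
  then show "\<forall>\<^sub>F \<epsilon> in at_right 0.
      (\<lambda>t. indicator (interior J) t * F (lmid w \<epsilon> t)) \<in> borel_measurable borel \<and>
      (\<lambda>t. indicator (interior J) t * F (rmid w \<epsilon> t)) \<in> borel_measurable borel"
  proof eventually_elim
    case (elim \<epsilon>)
    have "continuous_on (interior J) (\<lambda>t. F (lmid w \<epsilon> t))"
      by (rule continuous_on_compose2[OF F]) (use elim in auto)
    moreover have "continuous_on (interior J) (\<lambda>t. F (rmid w \<epsilon> t))"
      by (rule continuous_on_compose2[OF F]) (use elim in auto)
    ultimately show ?case using * by blast
  qed
qed

text \<open>On the strips \<open>\<rho> u\<^sup>k\<close> is compared with \<open>\<rho> s\<^sup>k\<close>, where \<open>s\<close> is the speed of the front: the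
  densities are nonnegative with bounded total mass and \<open>u\<^sup>k - s\<^sup>k\<close> tends to zero.\<close>

lemma tame_shadow_moment:
  assumes w: "regular_shadow J w" "is_Shadow w"
  shows "tame_wave (moment k) (interior J) (front_moment k) w"
proof -
  define I where "I = interior J"
  obtain K where K: "\<forall>\<^sub>F \<epsilon> in at_right 0. \<forall>t\<in>I. \<bar>snd (lmid w \<epsilon> t)\<bar> \<le> K \<and> \<bar>snd (rmid w \<epsilon> t)\<bar> \<le> K"
    using w unfolding regular_shadow_def I_def by blast
  have pos: "\<forall>\<^sub>F \<epsilon> in at_right 0. \<forall>t\<in>I. half_width w \<epsilon> t > 0 \<and> fst (lmid w \<epsilon> t) \<ge> 0 \<and> fst (rmid w \<epsilon> t) \<ge> 0"
  proof -
    have "\<forall>\<^sub>F \<epsilon> in at_right 0.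
        continuous_on (interior J) (lmid w \<epsilon>) \<and> continuous_on (interior J) (rmid w \<epsilon>) \<and>
        (\<forall>t\<in>interior J. width w \<epsilon> t > 0 \<and> fst (lmid w \<epsilon> t) \<ge> 0 \<and> fst (rmid w \<epsilon> t) \<ge> 0)"
      using w by (simp add: regular_shadow_def)
    then show ?thesis
      by eventually_elim (use w in \<open>simp add: half_width_def I_def\<close>)
  qed
  have bnd: "\<exists>K'. \<forall>\<^sub>F \<epsilon> in at_right 0. \<forall>t\<in>I. t \<le> R \<longrightarrow>
      half_width w \<epsilon> t * (fst (lmid w \<epsilon> t) + fst (rmid w \<epsilon> t)) \<le> K'" for R
    using w unfolding regular_shadow_def I_def half_width_def by auto
  have strip: "\<exists>K'. \<forall>\<^sub>F \<epsilon> in at_right 0. \<forall>t\<in>I. t \<le> R \<longrightarrow> strip_mass (moment k) \<epsilon> t w \<le> K'" for R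
  proof -
    obtain K' where K': "\<forall>\<^sub>F \<epsilon> in at_right 0. \<forall>t\<in>I. t \<le> R \<longrightarrow>
      half_width w \<epsilon> t * (fst (lmid w \<epsilon> t) + fst (rmid w \<epsilon> t)) \<le> K'" using bnd by blast
    have "\<forall>\<^sub>F \<epsilon> in at_right 0. \<forall>t\<in>I. t \<le> R \<longrightarrow> strip_mass (moment k) \<epsilon> t w \<le> \<bar>K'\<bar> * \<bar>K\<bar> ^ k"
      using K pos K'
    proof eventually_elim
      case (elim \<epsilon>)
      show ?case
      proof (intro ballI impI)
        fix t assume t: "t \<in> I" "t \<le> R"
        have p: "\<bar>u\<bar> ^ k \<le> \<bar>K\<bar> ^ k" if "\<bar>u\<bar> \<le> K" for u
          using that by (intro power_mono) auto
        have h: "half_width w \<epsilon> t > 0" "fst (lmid w \<epsilon> t) \<ge> 0" "fst (rmid w \<epsilon> t) \<ge> 0"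
          using elim t by auto
        have "strip_mass (moment k) \<epsilon> t w = half_width w \<epsilon> t *
            (fst (lmid w \<epsilon> t) * \<bar>snd (lmid w \<epsilon> t)\<bar> ^ k + fst (rmid w \<epsilon> t) * \<bar>snd (rmid w \<epsilon> t)\<bar> ^ k)"
          using h by (simp add: strip_mass_def moment_def abs_mult power_abs)
        also have "\<dots> \<le> half_width w \<epsilon> t *
            (fst (lmid w \<epsilon> t) * \<bar>K\<bar> ^ k + fst (rmid w \<epsilon> t) * \<bar>K\<bar> ^ k)"
          using h elim t p by (intro mult_left_mono add_mono) auto
        also have "\<dots> = half_width w \<epsilon> t * (fst (lmid w \<epsilon> t) + fst (rmid w \<epsilon> t)) * \<bar>K\<bar> ^ k"
          by (simp add: algebra_simps)
        also have "\<dots> \<le> \<bar>K'\<bar> * \<bar>K\<bar> ^ k"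
          using elim t by (intro mult_right_mono) (auto intro: order_trans[OF _ abs_ge_self])
        finally show "strip_mass (moment k) \<epsilon> t w \<le> \<bar>K'\<bar> * \<bar>K\<bar> ^ k" .
      qed
    qed
    then show ?thesis by blast
  qed
  have pm: "point_mass (moment k) t w (front_moment k w t)" if t: "t \<in> I" for t
  proof -
    define s where "s = deriv (front w) t"
    define h where "h \<epsilon> = half_width w \<epsilon> t" for \<epsilon>
    define A B where "A \<epsilon> = lmid w \<epsilon> t" and "B \<epsilon> = rmid w \<epsilon> t" for \<epsilon>
    obtain m where m: "strength w t m" and uA: "((\<lambda>\<epsilon>. snd (A \<epsilon>)) \<longlongrightarrow> s) (at_right 0)"
      and uB: "((\<lambda>\<epsilon>. snd (B \<epsilon>)) \<longlongrightarrow> s) (at_right 0)"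
      using w t unfolding regular_shadow_def I_def A_def B_def s_def by blast
    have mass: "mass w t = m" by (rule mass_eq_strength[OF w(2) m])
    have lim: "((\<lambda>\<epsilon>. h \<epsilon> * (fst (A \<epsilon>) + fst (B \<epsilon>))) \<longlongrightarrow> m) (at_right 0)"
      using m w(2) by (simp add: strength_def h_def half_width_def A_def B_def)
    obtain K' where K'0: "\<forall>\<^sub>F \<epsilon> in at_right 0. \<forall>t'\<in>I. t' \<le> t \<longrightarrow>
        half_width w \<epsilon> t' * (fst (lmid w \<epsilon> t') + fst (rmid w \<epsilon> t')) \<le> K'"
      using bnd[of t] by blast
    then have K': "\<forall>\<^sub>F \<epsilon> in at_right 0. h \<epsilon> * (fst (A \<epsilon>) + fst (B \<epsilon>)) \<le> K'"
      by eventually_elim (use t in \<open>simp add: h_def A_def B_def\<close>)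
    have p: "\<forall>\<^sub>F \<epsilon> in at_right 0. h \<epsilon> > 0 \<and> fst (A \<epsilon>) \<ge> 0 \<and> fst (B \<epsilon>) \<ge> 0"
      using pos by eventually_elim (use t in \<open>simp add: h_def A_def B_def\<close>)
    have "((\<lambda>\<epsilon>. h \<epsilon> * fst (C \<epsilon>) * (snd (C \<epsilon>) ^ k - s ^ k)) \<longlongrightarrow> 0) (at_right 0)"
      if C: "((\<lambda>\<epsilon>. snd (C \<epsilon>)) \<longlongrightarrow> s) (at_right 0)" "C = A \<or> C = B" for C :: "real \<Rightarrow> state"
    proof (rule Lim_null_comparison)
      have "((\<lambda>\<epsilon>. snd (C \<epsilon>) ^ k - s ^ k) \<longlongrightarrow> s ^ k - s ^ k) (at_right 0)"
        by (intro tendsto_intros C)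
      then show "((\<lambda>\<epsilon>. \<bar>K'\<bar> * \<bar>snd (C \<epsilon>) ^ k - s ^ k\<bar>) \<longlongrightarrow> 0) (at_right 0)"
        by (intro tendsto_mult_right_zero tendsto_rabs_zero) simp
      show "\<forall>\<^sub>F \<epsilon> in at_right 0. norm (h \<epsilon> * fst (C \<epsilon>) * (snd (C \<epsilon>) ^ k - s ^ k))
          \<le> \<bar>K'\<bar> * \<bar>snd (C \<epsilon>) ^ k - s ^ k\<bar>"
        using p K'
      proof eventually_elim
        case (elim \<epsilon>)
        have "fst (C \<epsilon>) \<ge> 0" "fst (C \<epsilon>) \<le> fst (A \<epsilon>) + fst (B \<epsilon>)"
          using C(2) elim by auto
        then have "h \<epsilon> * fst (C \<epsilon>) \<ge> 0" "h \<epsilon> * fst (C \<epsilon>) \<le> h \<epsilon> * (fst (A \<epsilon>) + fst (B \<epsilon>))"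
          using elim by (auto intro!: mult_left_mono)
        then have "\<bar>h \<epsilon> * fst (C \<epsilon>)\<bar> \<le> \<bar>K'\<bar>" using elim by linarith
        then have "\<bar>h \<epsilon> * fst (C \<epsilon>)\<bar> * \<bar>snd (C \<epsilon>) ^ k - s ^ k\<bar> \<le> \<bar>K'\<bar> * \<bar>snd (C \<epsilon>) ^ k - s ^ k\<bar>"
          by (intro mult_right_mono) auto
        then show ?case by (simp only: real_norm_def abs_mult)
      qed
    qed
    from tendsto_add[OF tendsto_add[OF this[OF uA] this[OF uB]] tendsto_mult_right[OF lim, of "s ^ k"]]
    have "((\<lambda>\<epsilon>. h \<epsilon> * (moment k (A \<epsilon>) + moment k (B \<epsilon>))) \<longlongrightarrow> m * s ^ k) (at_right 0)"
      by (simp add: moment_def algebra_simps)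
    moreover have "\<exists>K'. \<forall>\<^sub>F \<epsilon> in at_right 0. strip_mass (moment k) \<epsilon> t w \<le> K'"
    proof -
      obtain K' where "\<forall>\<^sub>F \<epsilon> in at_right 0. \<forall>t'\<in>I. t' \<le> t \<longrightarrow> strip_mass (moment k) \<epsilon> t' w \<le> K'"
        using strip[of t] by blast
      then have "\<forall>\<^sub>F \<epsilon> in at_right 0. strip_mass (moment k) \<epsilon> t w \<le> K'"
        by eventually_elim (use t in simp)
      then show ?thesis by blast
    qed
    moreover have "\<forall>\<^sub>F \<epsilon> in at_right 0. h \<epsilon> \<ge> 0" using p by eventually_elim simp
    ultimately show ?thesis
      using regular_shadow_width(1)[OF w, of t]
      by (simp add: point_mass_def front_moment_def mass s_def h_def A_def B_def strip_mass_def)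
  qed
  have cont: "continuous_on UNIV (moment k)" unfolding moment_def by (intro continuous_intros)
  show ?thesis
    unfolding tame_wave_def I_def[symmetric]
  proof (intro conjI impI ballI)
    show "(\<lambda>t. indicator I t * front w t) \<in> borel_measurable borel"
      unfolding I_def by (rule regular_shadow_measurable(1)[OF w(1) cont])
    show "\<forall>\<^sub>F \<epsilon> in at_right 0. (\<lambda>t. indicator I t * moment k (lmid w \<epsilon> t)) \<in> borel_measurable borel \<and>
        (\<lambda>t. indicator I t * moment k (rmid w \<epsilon> t)) \<in> borel_measurable borel"
      unfolding I_def by (rule regular_shadow_measurable(2)[OF w(1) cont])
    show "\<forall>\<^sub>F \<epsilon> in at_right 0. \<forall>t\<in>I. half_width w \<epsilon> t \<ge> 0"
      using pos by eventually_elim (auto intro: less_imp_le)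
  qed (use pm strip in blast)+
qed

text \<open>The velocities are bounded and the widths of the strips tend to zero.\<close>

lemma tame_shadow_velocity:
  assumes w: "regular_shadow J w" "is_Shadow w"
  shows "tame_wave snd (interior J) (\<lambda>_ _. 0) w"
proof -
  define I where "I = interior J"
  obtain K where K: "\<forall>\<^sub>F \<epsilon> in at_right 0. \<forall>t\<in>I. \<bar>snd (lmid w \<epsilon> t)\<bar> \<le> K \<and> \<bar>snd (rmid w \<epsilon> t)\<bar> \<le> K"
    using w unfolding regular_shadow_def I_def by blast
  note pos = regular_shadow_width(2)[OF w, folded I_def]
  have le: "half_width w \<epsilon> t * (\<bar>snd (lmid w \<epsilon> t)\<bar> + \<bar>snd (rmid w \<epsilon> t)\<bar>) \<le> half_width w \<epsilon> t * (2 * \<bar>K\<bar>)"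
    if "half_width w \<epsilon> t > 0" "\<bar>snd (lmid w \<epsilon> t)\<bar> \<le> K \<and> \<bar>snd (rmid w \<epsilon> t)\<bar> \<le> K" for \<epsilon> t
    using that by (intro mult_left_mono) auto
  have strip: "\<exists>K'. \<forall>\<^sub>F \<epsilon> in at_right 0. \<forall>t\<in>I. t \<le> R \<longrightarrow> strip_mass snd \<epsilon> t w \<le> K'" for R
  proof -
    have "\<forall>\<^sub>F \<epsilon> in at_right 0. \<forall>t\<in>I. t \<le> R \<longrightarrow> strip_mass snd \<epsilon> t w \<le> (\<bar>R\<bar> + 1) * (2 * \<bar>K\<bar>)"
      using K pos regular_shadow_width(3)[OF w, of R]
    proof eventually_elim
      case (elim \<epsilon>)
      show ?case
      proof (intro ballI impI)
        fix t assume t: "t \<in> I" "t \<le> R"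
        have "strip_mass snd \<epsilon> t w \<le> half_width w \<epsilon> t * (2 * \<bar>K\<bar>)"
          unfolding strip_mass_def by (rule le) (use elim t in auto)
        also have "\<dots> \<le> (\<bar>R\<bar> + 1) * (2 * \<bar>K\<bar>)"
          using elim t by (intro mult_right_mono) auto
        finally show "strip_mass snd \<epsilon> t w \<le> (\<bar>R\<bar> + 1) * (2 * \<bar>K\<bar>)" .
      qed
    qed
    then show ?thesis by blast
  qed
  have pm: "point_mass snd t w 0" if t: "t \<in> I" for t
  proof -
    have "((\<lambda>\<epsilon>. half_width w \<epsilon> t * (snd (lmid w \<epsilon> t) + snd (rmid w \<epsilon> t))) \<longlongrightarrow> 0) (at_right 0)"
    proof (rule Lim_null_comparison)
      show "((\<lambda>\<epsilon>. half_width w \<epsilon> t * (2 * \<bar>K\<bar>)) \<longlongrightarrow> 0) (at_right 0)"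
        by (intro tendsto_mult_left_zero regular_shadow_width(1)[OF w])
      show "\<forall>\<^sub>F \<epsilon> in at_right 0. norm (half_width w \<epsilon> t * (snd (lmid w \<epsilon> t) + snd (rmid w \<epsilon> t)))
          \<le> half_width w \<epsilon> t * (2 * \<bar>K\<bar>)"
        using K pos
      proof eventually_elim
        case (elim \<epsilon>)
        have "norm (half_width w \<epsilon> t * (snd (lmid w \<epsilon> t) + snd (rmid w \<epsilon> t)))
          \<le> half_width w \<epsilon> t * (\<bar>snd (lmid w \<epsilon> t)\<bar> + \<bar>snd (rmid w \<epsilon> t)\<bar>)"
          using elim t by (auto simp: abs_mult less_imp_le intro!: mult_left_mono)
        also have "\<dots> \<le> half_width w \<epsilon> t * (2 * \<bar>K\<bar>)" by (rule le) (use elim t in auto)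
        finally show ?case .
      qed
    qed
    moreover have "\<exists>K'. \<forall>\<^sub>F \<epsilon> in at_right 0. strip_mass snd \<epsilon> t w \<le> K'"
    proof -
      obtain K' where "\<forall>\<^sub>F \<epsilon> in at_right 0. \<forall>t'\<in>I. t' \<le> t \<longrightarrow> strip_mass snd \<epsilon> t' w \<le> K'"
        using strip[of t] by blast
      then have "\<forall>\<^sub>F \<epsilon> in at_right 0. strip_mass snd \<epsilon> t w \<le> K'"
        by eventually_elim (use t in simp)
      then show ?thesis by blast
    qed
    moreover have "\<forall>\<^sub>F \<epsilon> in at_right 0. half_width w \<epsilon> t \<ge> 0"
      using pos by eventually_elim (use t in \<open>auto intro: less_imp_le\<close>)
    ultimately show ?thesis
      using regular_shadow_width(1)[OF w, of t] by (simp add: point_mass_def strip_mass_def)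
  qed
  have cont: "continuous_on UNIV (snd :: state \<Rightarrow> real)" by (intro continuous_intros)
  show ?thesis
    unfolding tame_wave_def I_def[symmetric]
  proof (intro conjI impI ballI)
    show "(\<lambda>t. indicator I t * front w t) \<in> borel_measurable borel"
      unfolding I_def by (rule regular_shadow_measurable(1)[OF w(1) cont])
    show "\<forall>\<^sub>F \<epsilon> in at_right 0. (\<lambda>t. indicator I t * snd (lmid w \<epsilon> t)) \<in> borel_measurable borel \<and>
        (\<lambda>t. indicator I t * snd (rmid w \<epsilon> t)) \<in> borel_measurable borel"
      unfolding I_def by (rule regular_shadow_measurable(2)[OF w(1) cont])
    show "\<forall>\<^sub>F \<epsilon> in at_right 0. \<forall>t\<in>I. half_width w \<epsilon> t \<ge> 0"
      using pos by eventually_elim (auto intro: less_imp_le)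
  qed (use pm strip in blast)+
qed

text \<open>All moments of a simple field are constant. This covers constant states and the vacuum,
  whose velocity \<open>x / t\<close> is invisible to the moments.\<close>

definition level :: "nat \<Rightarrow> field \<Rightarrow> real" where
  "level k V = moment k (V 0 0)"

definition simple_field :: "field \<Rightarrow> bool" where
  "simple_field V \<longleftrightarrow> (\<forall>k x t. moment k (V x t) = level k V)"

lemma simple_field_const [simp]: "simple_field (\<lambda>x t. U)"
  by (simp add: simple_field_def level_def)

lemma simple_field_vacuum [simp]: "simple_field (\<lambda>x t. (0, q x t))"
  by (simp add: simple_field_def level_def moment_def)

lemma moment_simple: "simple_field V \<Longrightarrow> moment k (V x t) = level k V"
  by (simp add: simple_field_def)

lemma pairing_simple:
  assumes "simple_field V"
  shows "pairing (moment k) m \<psi> t V [] = level k V * (\<integral>x. \<psi> x \<partial>lborel)"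
    and "simple_field V' \<Longrightarrow> pairing (moment k) m \<psi> t V ((w, V') # ws) =
      (level k V - level k V') * (\<integral>x. indicator {..<front w t} x * \<psi> x \<partial>lborel)
        + m w * \<psi> (front w t) + pairing (moment k) m \<psi> t V' ws"
proof -
  show "pairing (moment k) m \<psi> t V [] = level k V * (\<integral>x. \<psi> x \<partial>lborel)"
    using assms by (simp add: moment_simple)
  have *: "indicator {..<front w t} x * ((level k V - level k V') * \<psi> x)
      = (level k V - level k V') * (indicator {..<front w t} x * \<psi> x)" for x
    by simp
  show "pairing (moment k) m \<psi> t V ((w, V') # ws) =
      (level k V - level k V') * (\<integral>x. indicator {..<front w t} x * \<psi> x \<partial>lborel)
        + m w * \<psi> (front w t) + pairing (moment k) m \<psi> t V' ws" if "simple_field V'"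
    using assms that by (simp add: moment_simple * del: mult.left_commute)
qed

subsection \<open>The weak form of a phase\<close>

text \<open>The time integrand in the limit of the weak form of \<open>\<partial>\<^sub>t (\<rho> u\<^sup>k) + \<partial>\<^sub>x (\<rho> u\<^sup>k\<^sup>+\<^sup>1) = 0\<close>.\<close>

definition weak_rate :: "nat \<Rightarrow> (real \<times> real \<Rightarrow> real) \<Rightarrow> field \<Rightarrow> (wave \<times> field) list \<Rightarrow> real \<Rightarrow> real" where
  "weak_rate k \<phi> V ws t =
     pairing (moment k) (\<lambda>w. front_moment k w t) (\<lambda>x. dt \<phi> x t) t V ws +
     pairing (moment (Suc k)) (\<lambda>w. front_moment (Suc k) w t) (\<lambda>x. dx \<phi> x t) t V ws"

lemma bounded_test:
  fixes \<psi> :: "real \<times> real \<Rightarrow> real"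
  assumes \<psi>: "continuous_on UNIV \<psi>" and R: "\<And>z. \<psi> z \<noteq> 0 \<Longrightarrow> \<bar>fst z\<bar> \<le> R \<and> \<bar>snd z\<bar> \<le> R"
  obtains B where "B \<ge> 0" "\<And>z. \<bar>\<psi> z\<bar> \<le> B"
proof -
  have "compact (\<psi> ` cbox (-R, -R) (R, R))"
    by (rule compact_continuous_image) (use \<psi> continuous_on_subset in auto)
  then obtain B where B: "\<And>z. z \<in> cbox (-R, -R) (R, R) \<Longrightarrow> \<bar>\<psi> z\<bar> \<le> B"
    using compact_imp_bounded[of "\<psi> ` cbox (-R, -R) (R, R)"] unfolding bounded_real by blast
  have "\<bar>\<psi> z\<bar> \<le> max B 0" for z
  proof (cases "\<psi> z = 0")
    case False
    then have "z \<in> cbox (-R, -R) (R, R)"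
      using R[OF False] by (cases z) (auto simp: abs_le_iff cbox_Pair_eq)
    then show ?thesis using B by fastforce
  qed simp
  then show ?thesis using that[of "max B 0"] by simp
qed

lemma phase_limit:
  assumes \<phi>: "test_function UNIV \<phi>" and I: "I \<in> sets borel"
    and ord: "\<And>t. t \<in> I \<Longrightarrow> ordered t ws"
    and simple: "\<And>V'. V' \<in> fields V ws \<Longrightarrow> simple_field V'"
    and tame: "\<And>w V' k. (w, V') \<in> set ws \<Longrightarrow> tame_wave (moment k) I (front_moment k) w"
  shows "((\<lambda>\<epsilon>. LBINT t:I. (LBINT x. moment k (profile V ws \<epsilon> x t) * dt \<phi> x t
        + moment (Suc k) (profile V ws \<epsilon> x t) * dx \<phi> x t))
      \<longlongrightarrow> (LBINT t:I. weak_rate k \<phi> V ws t)) (at_right 0)"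
    and "set_integrable lborel I (weak_rate k \<phi> V ws)"
    and "\<forall>\<^sub>F \<epsilon> in at_right 0. set_integrable lborel I (\<lambda>t. LBINT x. moment k (profile V ws \<epsilon> x t) * dt \<phi> x t
        + moment (Suc k) (profile V ws \<epsilon> x t) * dx \<phi> x t)"
proof -
  obtain R where cx: "continuous_on UNIV (\<lambda>z. dx \<phi> (fst z) (snd z))"
    and ct: "continuous_on UNIV (\<lambda>z. dt \<phi> (fst z) (snd z))"
    and sx: "\<And>z. dx \<phi> (fst z) (snd z) \<noteq> 0 \<Longrightarrow> \<bar>fst z\<bar> \<le> R \<and> \<bar>snd z\<bar> \<le> R"
    and st: "\<And>z. dt \<phi> (fst z) (snd z) \<noteq> 0 \<Longrightarrow> \<bar>fst z\<bar> \<le> R \<and> \<bar>snd z\<bar> \<le> R"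
    by (rule test_function_props[OF \<phi>]) blast
  have fm: "(\<lambda>z. moment j (V' (fst z) (snd z))) \<in> borel_measurable borel" if "V' \<in> fields V ws" for V' j
    using moment_simple[OF simple[OF that], of j] by simp
  have main: "((\<lambda>\<epsilon>. LBINT t:I. (LBINT x. moment j (profile V ws \<epsilon> x t) * q (x, t)))
        \<longlongrightarrow> (LBINT t:I. pairing (moment j) (\<lambda>w. front_moment j w t) (\<lambda>x. q (x, t)) t V ws)) (at_right 0)
      \<and> set_integrable lborel I (\<lambda>t. pairing (moment j) (\<lambda>w. front_moment j w t) (\<lambda>x. q (x, t)) t V ws)
      \<and> (\<forall>\<^sub>F \<epsilon> in at_right 0. set_integrable lborel I (\<lambda>t. LBINT x. moment j (profile V ws \<epsilon> x t) * q (x, t))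
        \<and> (\<forall>t\<in>I. integrable lborel (\<lambda>x. moment j (profile V ws \<epsilon> x t) * q (x, t))))"
    if q: "continuous_on UNIV q" "\<And>z. q z \<noteq> 0 \<Longrightarrow> \<bar>fst z\<bar> \<le> R \<and> \<bar>snd z\<bar> \<le> R" for q :: "real \<times> real \<Rightarrow> real" and j
  proof -
    obtain B where B: "B \<ge> 0" "\<And>z. \<bar>q z\<bar> \<le> B" using bounded_test[OF q] by blast
    define C where "C = (\<Sum>V'\<in>fields V ws. \<bar>level j V'\<bar>) * B"
    have fin: "finite (fields V ws)" by (simp add: fields_def)
    have C: "\<bar>moment j (V' x t) * q (x, t)\<bar> \<le> C" if "V' \<in> fields V ws" for V' x t
    proof -
      have "\<bar>level j V'\<bar> \<le> (\<Sum>V'\<in>fields V ws. \<bar>level j V'\<bar>)"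
        using member_le_sum[OF that, of "\<lambda>V'. \<bar>level j V'\<bar>"] fin by simp
      then have "\<bar>level j V'\<bar> * \<bar>q (x, t)\<bar> \<le> C"
        unfolding C_def using B by (intro mult_mono) (auto intro: order_trans[OF abs_ge_zero])
      then show ?thesis using moment_simple[OF simple[OF that], of j x t] by (simp add: abs_mult)
    qed
    show ?thesis
      by (intro conjI; rule pattern_limit[where F = "moment j" and m = "front_moment j" and V = V and I = I
            and \<psi> = q and ws = ws and C = C and R = R, OF I];
          (rule q(1) | erule ord | erule q(2) | erule fm | erule C | erule tame))
  qed
  note T = main[OF ct st, of k, simplified]
  note T1 = T[THEN conjunct1] and T2 = T[THEN conjunct2, THEN conjunct1] and T3 = T[THEN conjunct2, THEN conjunct2]
  note X = main[OF cx sx, of "Suc k", simplified]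
  note X1 = X[THEN conjunct1] and X2 = X[THEN conjunct2, THEN conjunct1] and X3 = X[THEN conjunct2, THEN conjunct2]
  show "set_integrable lborel I (weak_rate k \<phi> V ws)"
    unfolding weak_rate_def[abs_def] by (rule set_integral_add(1)[OF T2 X2])
  have ev: "\<forall>\<^sub>F \<epsilon> in at_right 0.
      set_integrable lborel I (\<lambda>t. LBINT x. moment k (profile V ws \<epsilon> x t) * dt \<phi> x t) \<and>
      set_integrable lborel I (\<lambda>t. LBINT x. moment (Suc k) (profile V ws \<epsilon> x t) * dx \<phi> x t) \<and>
      (\<forall>t\<in>I. (LBINT x. moment k (profile V ws \<epsilon> x t) * dt \<phi> x t + moment (Suc k) (profile V ws \<epsilon> x t) * dx \<phi> x t)
        = (LBINT x. moment k (profile V ws \<epsilon> x t) * dt \<phi> x t)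
          + (LBINT x. moment (Suc k) (profile V ws \<epsilon> x t) * dx \<phi> x t))"
    using T3 X3
  proof eventually_elim
    case (elim \<epsilon>)
    then show ?case by (auto intro: Bochner_Integration.integral_add)
  qed
  show "\<forall>\<^sub>F \<epsilon> in at_right 0. set_integrable lborel I (\<lambda>t. LBINT x. moment k (profile V ws \<epsilon> x t) * dt \<phi> x t
        + moment (Suc k) (profile V ws \<epsilon> x t) * dx \<phi> x t)"
    using ev
  proof eventually_elim
    case (elim \<epsilon>)
    have "set_integrable lborel I (\<lambda>t. (LBINT x. moment k (profile V ws \<epsilon> x t) * dt \<phi> x t)
          + (LBINT x. moment (Suc k) (profile V ws \<epsilon> x t) * dx \<phi> x t))"
      using elim by (intro set_integral_add(1)) auto
    also have "?this \<longleftrightarrow> set_integrable lborel I (\<lambda>t. LBINT x. moment k (profile V ws \<epsilon> x t) * dt \<phi> x t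
        + moment (Suc k) (profile V ws \<epsilon> x t) * dx \<phi> x t)"
      by (rule set_integrable_cong) (use elim in auto)
    finally show ?case .
  qed
  have "((\<lambda>\<epsilon>. (LBINT t:I. (LBINT x. moment k (profile V ws \<epsilon> x t) * dt \<phi> x t))
        + (LBINT t:I. (LBINT x. moment (Suc k) (profile V ws \<epsilon> x t) * dx \<phi> x t)))
      \<longlongrightarrow> (LBINT t:I. weak_rate k \<phi> V ws t)) (at_right 0)"
    unfolding weak_rate_def set_integral_add(2)[OF T2 X2] by (rule tendsto_add[OF T1 X1])
  then show "((\<lambda>\<epsilon>. LBINT t:I. (LBINT x. moment k (profile V ws \<epsilon> x t) * dt \<phi> x t
        + moment (Suc k) (profile V ws \<epsilon> x t) * dx \<phi> x t))
      \<longlongrightarrow> (LBINT t:I. weak_rate k \<phi> V ws t)) (at_right 0)"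
  proof (rule Lim_transform_eventually)
    show "\<forall>\<^sub>F \<epsilon> in at_right 0. (LBINT t:I. (LBINT x. moment k (profile V ws \<epsilon> x t) * dt \<phi> x t))
        + (LBINT t:I. (LBINT x. moment (Suc k) (profile V ws \<epsilon> x t) * dx \<phi> x t))
      = (LBINT t:I. (LBINT x. moment k (profile V ws \<epsilon> x t) * dt \<phi> x t
        + moment (Suc k) (profile V ws \<epsilon> x t) * dx \<phi> x t))"
      using ev
    proof eventually_elim
      case (elim \<epsilon>)
      note add = set_integral_add(2)[OF elim[THEN conjunct1] elim[THEN conjunct2, THEN conjunct1]]
      show ?case
        unfolding add[symmetric] by (rule set_lebesgue_integral_cong) (use I elim in auto)
    qed
  qed
qed

lemma C1_differentiable_deriv:
  fixes f :: "real \<Rightarrow> real"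
  assumes "f C1_differentiable_on S"
  shows "\<And>x. x \<in> S \<Longrightarrow> (f has_real_derivative deriv f x) (at x)" "continuous_on S (deriv f)"
proof -
  from assms obtain D where D: "\<And>x. x \<in> S \<Longrightarrow> (f has_real_derivative D x) (at x)" "continuous_on S D"
    unfolding C1_differentiable_on_def has_real_derivative_iff_has_vector_derivative by blast
  have eq: "deriv f x = D x" if "x \<in> S" for x by (rule DERIV_imp_deriv[OF D(1)[OF that]])
  show "(f has_real_derivative deriv f x) (at x)" if "x \<in> S" for x using D(1)[OF that] eq[OF that] by simp
  show "continuous_on S (deriv f)" using D(2) eq by (simp cong: continuous_on_cong)
qed

text \<open>\<open>balanced k a b M V ws\<close>: on \<open>{a<..<b}\<close> all fronts satisfy the Rankine-Hugoniot condition for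
  the \<open>k\<close>-th moment, and the moments on the fronts extend continuously, by \<open>M\<close>, to the end points.\<close>

fun balanced :: "nat \<Rightarrow> real \<Rightarrow> real \<Rightarrow> (wave \<Rightarrow> real \<Rightarrow> real) \<Rightarrow> field \<Rightarrow> (wave \<times> field) list \<Rightarrow> bool" where
  "balanced k a b M V [] \<longleftrightarrow> True"
| "balanced k a b M V ((w, V') # ws) \<longleftrightarrow>
     continuous_on {a..b} (front w) \<and> front w C1_differentiable_on {a<..<b} \<and> continuous_on {a..b} (M w) \<and>
     (\<forall>t\<in>{a<..<b}. front_moment k w t = M w t \<and>
        (M w has_real_derivative (level (Suc k) V - level (Suc k) V') - (level k V - level k V') * deriv (front w) t) (at t)) \<and>
     balanced k a b M V' ws"

lemma front_moment_Suc: "front_moment (Suc k) w t = front_moment k w t * deriv (front w) t"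
  by (simp add: front_moment_def)

text \<open>Thanks to the form of \<open>pairing\<close> the fronts can be treated one at a time, each by
  \<open>front_balance\<close>.\<close>

lemma weak_rate_has_integral:
  assumes \<phi>: "test_function UNIV \<phi>" and ab: "a \<le> b"
    and "\<And>V'. V' \<in> fields V ws \<Longrightarrow> simple_field V'" and "balanced k a b M V ws"
  shows "(weak_rate k \<phi> V ws has_integral
     pairing (moment k) (\<lambda>w. M w b) (\<lambda>x. \<phi> (x, b)) b V ws
     - pairing (moment k) (\<lambda>w. M w a) (\<lambda>x. \<phi> (x, a)) a V ws) {a..b}"
proof -
  obtain R where cx: "continuous_on UNIV (\<lambda>z. dx \<phi> (fst z) (snd z))"
    and s0: "\<And>z. \<phi> z \<noteq> 0 \<Longrightarrow> \<bar>fst z\<bar> \<le> R \<and> \<bar>snd z\<bar> \<le> R"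
    and sx: "\<And>z. dx \<phi> (fst z) (snd z) \<noteq> 0 \<Longrightarrow> \<bar>fst z\<bar> \<le> R \<and> \<bar>snd z\<bar> \<le> R"
    and st: "\<And>z. dt \<phi> (fst z) (snd z) \<noteq> 0 \<Longrightarrow> \<bar>fst z\<bar> \<le> R \<and> \<bar>snd z\<bar> \<le> R"
    and derx: "\<And>x t. ((\<lambda>y. \<phi> (y, t)) has_real_derivative dx \<phi> x t) (at x)"
    by (rule test_function_props[OF \<phi>]) blast
  have cx': "continuous_on UNIV (\<lambda>x. dx \<phi> x t)" for t
    using continuous_on_compose2[OF cx, of UNIV "\<lambda>x. (x, t)"] by (simp add: continuous_on_Pair)
  have dx_left: "(\<integral>x. indicator {..<c} x * dx \<phi> x t \<partial>lborel) = \<phi> (c, t)" for c t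
    by (rule integral_lessThan_deriv[OF derx cx', where R = R]) (use s0[of "(_, t)"] sx[of "(_, t)"] in auto)
  have all: "(\<integral>x. q x \<partial>lborel) = (\<integral>x. indicator {..<R + 1} x * q x \<partial>lborel)"
    if "\<And>x. q x \<noteq> 0 \<Longrightarrow> \<bar>x\<bar> \<le> R" for q :: "real \<Rightarrow> real"
    by (rule Bochner_Integration.integral_cong) (use that in \<open>force simp: indicator_def\<close>)+
  show ?thesis
    using assms(3-)
  proof (induction ws arbitrary: V)
    case Nil
    then have V: "simple_field V" by simp
    have "\<phi> (R + 1, t) = 0" for t using s0[of "(R + 1, t)"] by force
    then have "weak_rate k \<phi> V [] t = level k V * (\<integral>x. indicator {..<R + 1} x * dt \<phi> x t \<partial>lborel)" for t
      unfolding weak_rate_def pairing_simple(1)[OF V]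
      using all[of "\<lambda>x. dx \<phi> x t"] all[of "\<lambda>x. dt \<phi> x t"] sx[of "(_, t)"] st[of "(_, t)"] dx_left by simp
    moreover have "((\<lambda>t. level k V * (\<integral>x. indicator {..<R + 1} x * dt \<phi> x t \<partial>lborel) + 0 * \<phi> (R + 1, t)
        + 0 * (dt \<phi> (R + 1) t + 0 * dx \<phi> (R + 1) t))
      has_integral (level k V * (\<integral>x. indicator {..<R + 1} x * \<phi> (x, b) \<partial>lborel) + 0 * \<phi> (R + 1, b))
        - (level k V * (\<integral>x. indicator {..<R + 1} x * \<phi> (x, a) \<partial>lborel) + 0 * \<phi> (R + 1, a))) {a..b}"
      by (rule front_balance[OF \<phi> ab]) (auto intro!: continuous_intros derivative_eq_intros)
    moreover have "(\<integral>x. \<phi> (x, t) \<partial>lborel) = (\<integral>x. indicator {..<R + 1} x * \<phi> (x, t) \<partial>lborel)" for t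
      by (rule all) (use s0[of "(_, t)"] in auto)
    ultimately show ?case
      unfolding pairing_simple(1)[OF V] by simp
  next
    case (Cons p ws)
    obtain w V' where p: "p = (w, V')" by (cases p)
    have V: "simple_field V" "simple_field V'" and rest: "\<And>V''. V'' \<in> fields V' ws \<Longrightarrow> simple_field V''"
      using Cons.prems(1) by (auto simp: p fields_def)
    note ps = pairing_simple(2)[OF V(1) V(2)]
    have bal: "continuous_on {a..b} (front w)" "front w C1_differentiable_on {a<..<b}"
      "continuous_on {a..b} (M w)" "balanced k a b M V' ws"
      and fm: "\<And>t. t \<in> {a<..<b} \<Longrightarrow> front_moment k w t = M w t"
      and dM: "\<And>t. t \<in> {a<..<b} \<Longrightarrow> (M w has_real_derivative
          (level (Suc k) V - level (Suc k) V') - (level k V - level k V') * deriv (front w) t) (at t)"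
      using Cons.prems(2) by (auto simp: p)
    note IH = Cons.IH[OF rest bal(4)]
    note fb = front_balance[OF \<phi> ab bal(1) C1_differentiable_deriv(2)[OF bal(2)] C1_differentiable_deriv(1)[OF bal(2)]
        bal(3) dM]
    have "(weak_rate k \<phi> V (p # ws) has_integral
      ((level k V - level k V') * (\<integral>x. indicator {..<front w b} x * \<phi> (x, b) \<partial>lborel) + M w b * \<phi> (front w b, b))
        - ((level k V - level k V') * (\<integral>x. indicator {..<front w a} x * \<phi> (x, a) \<partial>lborel) + M w a * \<phi> (front w a, a))
      + (pairing (moment k) (\<lambda>w. M w b) (\<lambda>x. \<phi> (x, b)) b V' ws
         - pairing (moment k) (\<lambda>w. M w a) (\<lambda>x. \<phi> (x, a)) a V' ws)) (cbox a b)"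
      unfolding p
    proof (rule has_integral_spike_interior[rotated])
      show "weak_rate k \<phi> V ((w, V') # ws) t =
          ((level k V - level k V') * (\<integral>x. indicator {..<front w t} x * dt \<phi> x t \<partial>lborel)
          + (level (Suc k) V - level (Suc k) V') * \<phi> (front w t, t)
          + M w t * (dt \<phi> (front w t) t + deriv (front w) t * dx \<phi> (front w t) t)) + weak_rate k \<phi> V' ws t"
        if "t \<in> box a b" for t
        using fm[of t] that unfolding weak_rate_def ps dx_left by (simp add: front_moment_Suc algebra_simps)
    qed (use has_integral_add[OF fb IH] in simp)
    then show ?case by (simp add: p ps algebra_simps del: pairing.simps)
  qed
qed

lemma pairing_zero: "pairing F m (\<lambda>x. 0) t V ws = 0"
  by (induction F m "\<lambda>x::real. 0::real" t V ws rule: pairing.induct) simp_all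

lemma weak_rate_bounded:
  assumes "test_function UNIV \<phi>" "a \<le> b" "\<And>V'. V' \<in> fields V ws \<Longrightarrow> simple_field V'"
    and "balanced k a b M V ws" and "set_integrable lborel {a<..<b} (weak_rate k \<phi> V ws)"
  shows "(LBINT t:{a<..<b}. weak_rate k \<phi> V ws t) =
     pairing (moment k) (\<lambda>w. M w b) (\<lambda>x. \<phi> (x, b)) b V ws
     - pairing (moment k) (\<lambda>w. M w a) (\<lambda>x. \<phi> (x, a)) a V ws"
  using weak_rate_has_integral[OF assms(1-4)] set_borel_integral_eq_integral(2)[OF assms(5)]
  by (simp add: has_integral_Icc_iff_Ioo integral_unique)

text \<open>The test function vanishes at late times, so only the contribution of time \<open>a\<close> is left.\<close>

lemma weak_rate_unbounded:
  assumes \<phi>: "test_function UNIV \<phi>" and "\<And>V'. V' \<in> fields V ws \<Longrightarrow> simple_field V'"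
    and bal: "\<And>b. b > a \<Longrightarrow> balanced k a b M V ws"
    and int: "set_integrable lborel {a<..} (weak_rate k \<phi> V ws)"
  shows "(LBINT t:{a<..}. weak_rate k \<phi> V ws t) = - pairing (moment k) (\<lambda>w. M w a) (\<lambda>x. \<phi> (x, a)) a V ws"
proof -
  obtain R where s0: "\<And>z. \<phi> z \<noteq> 0 \<Longrightarrow> \<bar>fst z\<bar> \<le> R \<and> \<bar>snd z\<bar> \<le> R"
    and sx: "\<And>z. dx \<phi> (fst z) (snd z) \<noteq> 0 \<Longrightarrow> \<bar>fst z\<bar> \<le> R \<and> \<bar>snd z\<bar> \<le> R"
    and st: "\<And>z. dt \<phi> (fst z) (snd z) \<noteq> 0 \<Longrightarrow> \<bar>fst z\<bar> \<le> R \<and> \<bar>snd z\<bar> \<le> R"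
    by (rule test_function_props[OF \<phi>]) blast
  define b where "b = \<bar>a\<bar> + \<bar>R\<bar> + 1"
  have b: "a < b" "R < b" by (auto simp: b_def)
  have z: "(\<lambda>x. dt \<phi> x t) = (\<lambda>x. 0)" "(\<lambda>x. dx \<phi> x t) = (\<lambda>x. 0)" "(\<lambda>x. \<phi> (x, t)) = (\<lambda>x. 0)" if "b \<le> t" for t
    using st[of "(_, t)"] sx[of "(_, t)"] s0[of "(_, t)"] that b by force+
  have wz: "weak_rate k \<phi> V ws t = 0" if "b \<le> t" for t
    unfolding weak_rate_def z[OF that] pairing_zero by simp
  have "(LBINT t:{a<..}. weak_rate k \<phi> V ws t) = (LBINT t:{a<..<b}. weak_rate k \<phi> V ws t)"
    unfolding set_lebesgue_integral_def
    by (rule Bochner_Integration.integral_cong) (use wz in \<open>force simp: indicator_def\<close>)+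
  also have "\<dots> = pairing (moment k) (\<lambda>w. M w b) (\<lambda>x. \<phi> (x, b)) b V ws
     - pairing (moment k) (\<lambda>w. M w a) (\<lambda>x. \<phi> (x, a)) a V ws"
    by (rule weak_rate_bounded[OF \<phi> _ assms(2) bal set_integrable_subset[OF int]]) (use b in auto)
  also have "pairing (moment k) (\<lambda>w. M w b) (\<lambda>x. \<phi> (x, b)) b V ws = 0"
    unfolding z(3)[OF order_refl] by (rule pairing_zero)
  finally show ?thesis by simp
qed

section \<open>Riemann problems\<close>

fun last_field :: "field \<Rightarrow> (wave \<times> field) list \<Rightarrow> field" where
  "last_field V [] = V"
| "last_field V ((w, V') # ws) = last_field V' ws"

lemma pairing_append:
  "pairing F m \<psi> t V (ws @ ws') =
     pairing F m \<psi> t V ws - pairing F m \<psi> t (last_field V ws) [] + pairing F m \<psi> t (last_field V ws) ws'"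
  by (induction F m \<psi> t V ws rule: pairing.induct) simp_all

lemma riemann_cases:
  assumes "riemann a (\<rho>l, ul) (\<rho>r, ur) ws"
  obtains (contacts) "ul < ur" "ws = [(Contact (\<lambda>t. a + ul * t), \<lambda>x t. (0, (x - a) / t)),
              (Contact (\<lambda>t. a + ur * t), \<lambda>x t. (\<rho>r, ur))]"
  | (contact) "ul = ur" "ws = [(Contact (\<lambda>t. a + ur * t), \<lambda>x t. (\<rho>r, ur))]"
  | (shadow) w where "ul > ur" "ws = [(w, \<lambda>x t. (\<rho>r, ur))]" "is_Shadow w"
      "front w = (\<lambda>t. a + (sqrt \<rho>l * ul + sqrt \<rho>r * ur) / (sqrt \<rho>l + sqrt \<rho>r) * t)"
      "\<And>t. t > 0 \<Longrightarrow> mass w t = sqrt (\<rho>l * \<rho>r) * (ul - ur) * t"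
  using assms
  by (auto simp: riemann_def Let_def split: if_splits intro: mass_eq_strength)

lemma riemann_simple_fields:
  assumes "riemann a (\<rho>l, ul) (\<rho>r, ur) ws"
  shows "last_field V ws = (\<lambda>x t. (\<rho>r, ur))" "ws \<noteq> []"
    "\<And>w V'. (w, V') \<in> set ws \<Longrightarrow> simple_field V'"
  using assms by (cases rule: riemann_cases; auto)+

lemma deriv_affine: "deriv (\<lambda>t. a + s * t) t = (s :: real)"
  by (rule DERIV_imp_deriv) (auto intro!: derivative_eq_intros)

text \<open>Twice the rate of energy loss in a Riemann problem. It vanishes unless the streams approach
  each other; otherwise both are brought to the common speed of the front, and
  \<open>\<rho>\<^sub>l \<rho>\<^sub>r / (\<surd>\<rho>\<^sub>l + \<surd>\<rho>\<^sub>r)\<^sup>2\<close> plays the role of a reduced density.\<close>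

definition dissipation :: "real \<Rightarrow> real \<Rightarrow> real \<Rightarrow> real \<Rightarrow> real" where
  "dissipation \<rho>l \<rho>r ul ur = \<rho>l * \<rho>r / (sqrt \<rho>l + sqrt \<rho>r)\<^sup>2 * (max (ul - ur) 0) ^ 3"

text \<open>The last two equations are the Rankine-Hugoniot conditions for mass and momentum, which the
  speed \<open>s\<close> and the rate of growth of the strength satisfy. The first one is the corresponding
  expression for twice the energy, which fails to balance by the dissipation.\<close>

lemma shadow_energy_balance:
  fixes ul ur :: real
  assumes "\<rho>l > 0" "\<rho>r > 0" "ul > ur"
  defines "s \<equiv> (sqrt \<rho>l * ul + sqrt \<rho>r * ur) / (sqrt \<rho>l + sqrt \<rho>r)"
  shows "(\<rho>l * ul\<^sup>2 - \<rho>r * ur\<^sup>2) * s + sqrt (\<rho>l * \<rho>r) * (ul - ur) * s\<^sup>2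
    = \<rho>l * ul ^ 3 - \<rho>r * ur ^ 3 - dissipation \<rho>l \<rho>r ul ur"
    "sqrt (\<rho>l * \<rho>r) * (ul - ur) = (\<rho>l * ul - \<rho>r * ur) - (\<rho>l - \<rho>r) * s"
    "sqrt (\<rho>l * \<rho>r) * (ul - ur) * s = (\<rho>l * ul\<^sup>2 - \<rho>r * ur\<^sup>2) - (\<rho>l * ul - \<rho>r * ur) * s"
proof -
  define a where "a = sqrt \<rho>l"
  define b where "b = sqrt \<rho>r"
  have ab: "a > 0" "b > 0" "\<rho>l = a\<^sup>2" "\<rho>r = b\<^sup>2" "sqrt (\<rho>l * \<rho>r) = a * b"
    using assms by (auto simp: a_def b_def real_sqrt_mult)
  define d where "d = (ul - ur) / (a + b)"
  have u: "ul = s + b * d" "ur = s - a * d"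
  proof -
    have "s + b * d = (a * ul + b * ur + b * (ul - ur)) / (a + b)"
      "s - a * d = (a * ul + b * ur - a * (ul - ur)) / (a + b)"
      unfolding s_def a_def[symmetric] b_def[symmetric] d_def
      by (simp_all add: add_divide_distrib[symmetric] diff_divide_distrib[symmetric])
    moreover have "a * ul + b * ur + b * (ul - ur) = ul * (a + b)"
      "a * ul + b * ur - a * (ul - ur) = ur * (a + b)" by algebra+
    ultimately show "ul = s + b * d" "ur = s - a * d" using ab by simp_all
  qed
  have diff: "ul - ur = (a + b) * d" by (simp add: u algebra_simps)
  have m: "max (ul - ur) 0 = (a + b) * d" using assms(3) diff by simp
  have ds: "dissipation \<rho>l \<rho>r ul ur = a\<^sup>2 * b\<^sup>2 * (a + b) * d ^ 3"
    unfolding dissipation_def m a_def[symmetric] b_def[symmetric] ab(3,4)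
    using ab by (simp add: power2_eq_square power3_eq_cube)
  show "(\<rho>l * ul\<^sup>2 - \<rho>r * ur\<^sup>2) * s + sqrt (\<rho>l * \<rho>r) * (ul - ur) * s\<^sup>2
    = \<rho>l * ul ^ 3 - \<rho>r * ur ^ 3 - dissipation \<rho>l \<rho>r ul ur"
    unfolding ds diff ab(5) unfolding ab(3,4) u by algebra
  show "sqrt (\<rho>l * \<rho>r) * (ul - ur) = (\<rho>l * ul - \<rho>r * ur) - (\<rho>l - \<rho>r) * s"
    unfolding diff ab(5) unfolding ab(3,4) u by algebra
  show "sqrt (\<rho>l * \<rho>r) * (ul - ur) * s = (\<rho>l * ul\<^sup>2 - \<rho>r * ur\<^sup>2) - (\<rho>l * ul - \<rho>r * ur) * s"
    unfolding diff ab(5) unfolding ab(3,4) u by algebra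
qed

text \<open>As long as the fronts stay inside the window, the second moment changes by the difference of
  the fluxes through its boundary and by the dissipation. Without a shadow wave the dissipation is
  zero since contact discontinuities move with the adjacent streams.\<close>

lemma riemann_energy:
  assumes r: "riemann a (\<rho>l, ul) (\<rho>r, ur) ws" and pos: "\<rho>l > 0" "\<rho>r > 0" and t: "t > 0"
    and L: "\<And>w V'. (w, V') \<in> set ws \<Longrightarrow> \<bar>front w t\<bar> < L"
  shows "pairing (moment 2) (\<lambda>w. front_moment 2 w t) (indicator {-L..L}) t (\<lambda>x t. (\<rho>l, ul)) ws
     = \<rho>l * ul\<^sup>2 * (a + L) + \<rho>r * ur\<^sup>2 * (L - a)
       + t * (\<rho>l * ul ^ 3 - \<rho>r * ur ^ 3 - dissipation \<rho>l \<rho>r ul ur)"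
proof -
  have P: "(\<integral>x. indicator {..<c} x * (indicator {-L..L} x :: real) \<partial>lborel) = c + L" if "\<bar>c\<bar> < L" for c
  proof -
    have "(\<integral>x. indicator {..<c} x * (indicator {-L..L} x :: real) \<partial>lborel) = (\<integral>x. indicator {-L..<c} x \<partial>lborel)"
      by (rule Bochner_Integration.integral_cong) (use that in \<open>auto simp: indicator_def\<close>)
    then show ?thesis using that by (simp add: measure_def)
  qed
  have L0: "L > 0" using L riemann_simple_fields(2)[OF r] by (metis abs_ge_zero le_less_trans list.set_intros(1) neq_Nil_conv surj_pair)
  have all: "(\<integral>x. (indicator {-L..L} x :: real) \<partial>lborel) = 2 * L" using L0 by (simp add: measure_def)
  have lev: "level k (\<lambda>x t. (\<rho>, u)) = \<rho> * u ^ k" "level k (\<lambda>x t. (0, q x t)) = 0" for k \<rho> u q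
    by (auto simp: level_def moment_def)
  show ?thesis using r
  proof (cases rule: riemann_cases)
    case contacts
    have b: "\<bar>a + ul * t\<bar> < L" "\<bar>a + ur * t\<bar> < L" using L contacts(2) by force+
    have "pairing (moment 2) (\<lambda>w. front_moment 2 w t) (indicator {-L..L}) t (\<lambda>x t. (\<rho>l, ul)) ws
      = \<rho>l * ul\<^sup>2 * (a + ul * t + L) - \<rho>r * ur\<^sup>2 * (a + ur * t + L) + \<rho>r * ur\<^sup>2 * (2 * L)"
      using P[OF b(1)] P[OF b(2)] L0 unfolding contacts(2)
      by (simp add: pairing_simple lev all front_moment_def del: pairing.simps)
    then show ?thesis using contacts(1)
      by (simp add: dissipation_def algebra_simps power2_eq_square power3_eq_cube)
  next
    case contact
    have b: "\<bar>a + ur * t\<bar> < L" using L contact(2) by force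
    have "pairing (moment 2) (\<lambda>w. front_moment 2 w t) (indicator {-L..L}) t (\<lambda>x t. (\<rho>l, ul)) ws
      = (\<rho>l * ul\<^sup>2 - \<rho>r * ur\<^sup>2) * (a + ur * t + L) + \<rho>r * ur\<^sup>2 * (2 * L)"
      using P[OF b] L0 unfolding contact(2)
      by (simp add: pairing_simple lev all front_moment_def del: pairing.simps)
    then show ?thesis using contact(1)
      by (simp add: dissipation_def algebra_simps power2_eq_square power3_eq_cube)
  next
    case (shadow w)
    define s where "s = (sqrt \<rho>l * ul + sqrt \<rho>r * ur) / (sqrt \<rho>l + sqrt \<rho>r)"
    have fw: "front w = (\<lambda>t. a + s * t)" using shadow by (simp add: s_def)
    have fL: "\<bar>a + s * t\<bar> < L" using L[of w] shadow(2) by (simp add: fw)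
    have ind: "(indicator {-L..L} (a + s * t) :: real) = 1" using fL by (simp add: indicator_def abs_less_iff)
    have "front_moment 2 w t = sqrt (\<rho>l * \<rho>r) * (ul - ur) * s\<^sup>2 * t"
      unfolding front_moment_def fw deriv_affine using shadow(5)[OF t] by simp
    then have "pairing (moment 2) (\<lambda>w. front_moment 2 w t) (indicator {-L..L}) t (\<lambda>x t. (\<rho>l, ul)) ws
      = (\<rho>l * ul\<^sup>2 - \<rho>r * ur\<^sup>2) * (a + s * t + L) + sqrt (\<rho>l * \<rho>r) * (ul - ur) * s\<^sup>2 * t + \<rho>r * ur\<^sup>2 * (2 * L)"
      using P[OF fL] fL L0 unfolding shadow(2) by (simp add: pairing_simple lev all fw ind del: pairing.simps)
    also have "\<dots> = \<rho>l * ul\<^sup>2 * (a + L) + \<rho>r * ur\<^sup>2 * (L - a)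
       + t * ((\<rho>l * ul\<^sup>2 - \<rho>r * ur\<^sup>2) * s + sqrt (\<rho>l * \<rho>r) * (ul - ur) * s\<^sup>2)"
      by (simp add: algebra_simps)
    finally show ?thesis
      using shadow_energy_balance(1)[OF pos shadow(1), folded s_def] by simp
  qed
qed

section \<open>The initial energy rate and its extremal velocities\<close>

lemma riemann_front_affine:
  assumes "riemann a (\<rho>l, ul) (\<rho>r, ur) ws" "(w, V') \<in> set ws"
  shows "\<exists>s. front w = (\<lambda>t. a + s * t)"
  using assms(1)
proof (cases rule: riemann_cases)
  case contacts
  then show ?thesis using assms(2) by auto
next
  case contact
  then show ?thesis using assms(2) by auto
next
  case (shadow w')
  have "w = w'" using assms(2) shadow(2) by simp
  then show ?thesis using shadow(4) by blast
qed

lemma admissible_tame: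
  assumes adm: "admissible_on J V ws" and w: "(w, V') \<in> set ws"
    and aff: "\<not> is_Shadow w \<Longrightarrow> \<exists>a s. front w = (\<lambda>t. a + s * t)"
  shows "tame_wave (moment k) (interior J) (front_moment k) w"
    and "tame_wave snd (interior J) (\<lambda>_ _. 0) w"
proof -
  have reg: "regular_shadow J w" if "is_Shadow w"
    using adm w that by (auto simp: admissible_on_def)
  have m: "(\<lambda>t. indicator (interior J) t * front w t) \<in> borel_measurable borel" if ns: "\<not> is_Shadow w"
  proof -
    obtain a s where "front w = (\<lambda>t. a + s * t)" using aff[OF ns] by blast
    moreover have "interior J \<in> sets borel" by simp
    ultimately show ?thesis by simp
  qed
  show "tame_wave (moment k) (interior J) (front_moment k) w"
    using tame_shadow_moment[OF reg] tame_Contact[OF _ m] by (cases "is_Shadow w") (auto simp: front_moment_def)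
  show "tame_wave snd (interior J) (\<lambda>_ _. 0) w"
    using tame_shadow_velocity[OF reg] tame_Contact[OF _ m] by (cases "is_Shadow w") auto
qed

text \<open>The energy rate at time \<open>0+\<close> depends only on the pattern before the first interaction,
  whatever happens later.\<close>

lemma approx_solution_first_phase:
  assumes "approx_solution (\<rho>0, u0) (\<rho>1, u1) \<xi> \<mu> v N"
  obtains ws ws' J T where
    "riemann (- \<mu> / 2) (\<rho>0, u0) (\<xi> / \<mu>, v) ws" "riemann (\<mu> / 2) (\<xi> / \<mu>, v) (\<rho>1, u1) ws'"
    "T > 0" "{0<..<T} \<subseteq> interior J" "admissible_on J (\<lambda>x t. (\<rho>0, u0)) (ws @ ws')"
    "\<And>\<epsilon> x t. t \<in> {0<..<T} \<Longrightarrow> N \<epsilon> x t = profile (\<lambda>x t. (\<rho>0, u0)) (ws @ ws') \<epsilon> x t"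
proof -
  from assms obtain ws ws' where r: "riemann (- \<mu> / 2) (\<rho>0, u0) (\<xi> / \<mu>, v) ws"
      "riemann (\<mu> / 2) (\<xi> / \<mu>, v) (\<rho>1, u1) ws'"
    and e: "evolution 0 (\<lambda>x t. (\<rho>0, u0)) (ws @ ws') N"
    unfolding approx_solution_def by auto
  from e show ?thesis
  proof cases
    case settled
    show ?thesis by (rule that[OF r, of 1 "{0..}"]) (use settled in auto)
  next
    case (interaction T' ws'' N')
    show ?thesis by (rule that[OF r, of T' "{0..T'}"]) (use interaction in auto)
  qed
qed

definition total_dissipation :: "real \<Rightarrow> real \<Rightarrow> real \<Rightarrow> real \<Rightarrow> real \<Rightarrow> real \<Rightarrow> real" where
  "total_dissipation \<rho>0 u0 \<rho>1 u1 M v = dissipation \<rho>0 M u0 v + dissipation M \<rho>1 v u1"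

text \<open>Before the first interaction the two Riemann problems contribute separately, and the energy
  is an affine function of time.\<close>

lemma energy_rate_approx_solution:
  assumes N: "approx_solution (\<rho>0, u0) (\<rho>1, u1) \<xi> \<mu> v N"
    and pos: "\<rho>0 > 0" "\<rho>1 > 0" "\<xi> > 0" "\<mu> > 0" and L: "\<mu> / 2 < L"
  shows "energy_rate L N ((\<rho>0 * u0 ^ 3 - \<rho>1 * u1 ^ 3 - total_dissipation \<rho>0 u0 \<rho>1 u1 (\<xi> / \<mu>) v) / 2)"
proof -
  define M where "M = \<xi> / \<mu>"
  have M: "M > 0" using pos by (simp add: M_def)
  obtain ws ws' J T where r: "riemann (- \<mu> / 2) (\<rho>0, u0) (M, v) ws" "riemann (\<mu> / 2) (M, v) (\<rho>1, u1) ws'"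
    and T: "T > 0" "{0<..<T} \<subseteq> interior J" and adm: "admissible_on J (\<lambda>x t. (\<rho>0, u0)) (ws @ ws')"
    and N: "\<And>\<epsilon> x t. t \<in> {0<..<T} \<Longrightarrow> N \<epsilon> x t = profile (\<lambda>x t. (\<rho>0, u0)) (ws @ ws') \<epsilon> x t"
    by (rule approx_solution_first_phase[OF N, folded M_def]) (rule that)
  define d where "d = (\<rho>0 * u0 ^ 3 - \<rho>1 * u1 ^ 3 - total_dissipation \<rho>0 u0 \<rho>1 u1 M v) / 2"
  define H0 where "H0 = (\<rho>0 * u0\<^sup>2 * (- \<mu> / 2 + L) + M * v\<^sup>2 * \<mu> + \<rho>1 * u1\<^sup>2 * (L - \<mu> / 2)) / 2"
  define H where "H t = H0 + d * t" for t
  have aff: "\<exists>a s. \<bar>a\<bar> < L \<and> front w = (\<lambda>t. a + s * t)" if w: "(w, V') \<in> set (ws @ ws')" for w V'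
  proof -
    have b: "\<bar>- \<mu> / 2\<bar> < L" "\<bar>\<mu> / 2\<bar> < L" using L pos by auto
    from w consider "(w, V') \<in> set ws" | "(w, V') \<in> set ws'" by auto
    then show ?thesis
    proof cases
      case 1
      from riemann_front_affine[OF r(1) 1] b(1) show ?thesis by blast
    next
      case 2
      from riemann_front_affine[OF r(2) 2] b(2) show ?thesis by blast
    qed
  qed
  have near: "\<forall>\<^sub>F t in at_right 0. \<forall>p\<in>set (ws @ ws'). \<bar>front (fst p) t\<bar> < L"
  proof (rule eventually_ball_finite)
    show "\<forall>p\<in>set (ws @ ws'). \<forall>\<^sub>F t in at_right 0. \<bar>front (fst p) t\<bar> < L"
    proof
      fix p assume "p \<in> set (ws @ ws')"
      then obtain a s where a: "\<bar>a\<bar> < L" and f: "front (fst p) = (\<lambda>t. a + s * t)"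
        using aff[of "fst p" "snd p"] by auto
      have "((\<lambda>t. \<bar>a + s * t\<bar>) \<longlongrightarrow> \<bar>a + s * 0\<bar>) (at_right 0)" by (intro tendsto_intros)
      from order_tendstoD(2)[OF this] show "\<forall>\<^sub>F t in at_right 0. \<bar>front (fst p) t\<bar> < L"
        using a by (simp add: f)
    qed
  qed simp
  have "\<forall>\<^sub>F t in at_right 0. t \<in> {0<..<T}" using T(1) by (simp add: eventually_at_right_field) auto
  then have "\<forall>\<^sub>F t in at_right 0. energy L N t (H t) \<and> (H has_real_derivative d) (at t)"
    using near
  proof eventually_elim
    case (elim t)
    then have t: "t > 0" "t \<in> interior J" using T by auto
    let ?V = "\<lambda>x t. (\<rho>0, u0)" and ?\<psi> = "indicator {-L..L} :: real \<Rightarrow> real"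
    have L0: "L > 0" using L pos by auto
    have \<psi>: "integrable lborel ?\<psi>"
      using integrable_mult_indicator_bounded[of "{-L..L}" 1] by simp
    have simple: "simple_field V'" if "V' \<in> fields ?V (ws @ ws')" for V'
      using that riemann_simple_fields(3)[OF r(1)] riemann_simple_fields(3)[OF r(2)]
      by (auto simp: fields_def)
    have fr: "\<bar>front w t\<bar> < L" if "(w, V') \<in> set (ws @ ws')" for w V'
      using elim(2) that by force
    have wave: "isCont ?\<psi> (front w t) \<and> point_mass (moment 2) t w (front_moment 2 w t)"
      if w: "(w, V') \<in> set (ws @ ws')" for w V'
    proof
      have "\<forall>\<^sub>F x in nhds (front w t). x \<in> {-L<..<L}"
        by (rule eventually_nhds_in_open) (use fr[OF w] in auto)
      then have "\<forall>\<^sub>F x in nhds (front w t). ?\<psi> x = 1"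
        by eventually_elim (auto simp: indicator_def)
      then show "isCont ?\<psi> (front w t)" using isCont_cong[of ?\<psi> "\<lambda>x. 1"] by simp
      have "tame_wave (moment 2) (interior J) (front_moment 2) w"
        by (rule admissible_tame(1)[OF adm w]) (use aff[OF w] in blast)
      then show "point_mass (moment 2) t w (front_moment 2 w t)"
        using t(2) by (simp add: tame_wave_def)
    qed
    have "((\<lambda>\<epsilon>. \<integral>x. moment 2 (profile ?V (ws @ ws') \<epsilon> x t) * ?\<psi> x \<partial>lborel)
        \<longlongrightarrow> pairing (moment 2) (\<lambda>w. front_moment 2 w t) ?\<psi> t ?V (ws @ ws')) (at_right 0)"
    proof (rule profile_tendsto[THEN conjunct1])
      show "ordered t (ws @ ws')" using adm t(2) by (simp add: admissible_on_def)
      show "integrable lborel (\<lambda>x. moment 2 (V' x t) * ?\<psi> x)" if "V' \<in> fields ?V (ws @ ws')" for V'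
        using \<psi> by (simp add: moment_simple[OF simple[OF that]])
    qed (use \<psi> wave in auto)
    also have "pairing (moment 2) (\<lambda>w. front_moment 2 w t) ?\<psi> t ?V (ws @ ws') = 2 * H t"
    proof -
      have e1: "pairing (moment 2) (\<lambda>w. front_moment 2 w t) ?\<psi> t ?V ws
          = \<rho>0 * u0\<^sup>2 * (- \<mu> / 2 + L) + M * v\<^sup>2 * (L - - \<mu> / 2)
            + t * (\<rho>0 * u0 ^ 3 - M * v ^ 3 - dissipation \<rho>0 M u0 v)"
        by (rule riemann_energy[OF r(1) pos(1) M t(1)]) (use fr in auto)
      have e2: "pairing (moment 2) (\<lambda>w. front_moment 2 w t) ?\<psi> t (\<lambda>x t. (M, v)) ws'
          = M * v\<^sup>2 * (\<mu> / 2 + L) + \<rho>1 * u1\<^sup>2 * (L - \<mu> / 2)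
            + t * (M * v ^ 3 - \<rho>1 * u1 ^ 3 - dissipation M \<rho>1 v u1)"
        by (rule riemann_energy[OF r(2) M pos(2) t(1)]) (use fr in auto)
      have e3: "pairing (moment 2) (\<lambda>w. front_moment 2 w t) ?\<psi> t (\<lambda>x t. (M, v)) [] = M * v\<^sup>2 * (2 * L)"
        using L0 by (simp add: moment_def measure_def)
      show ?thesis
        unfolding pairing_append riemann_simple_fields(1)[OF r(1)] e1 e2 e3
        by (simp add: H_def H0_def d_def total_dissipation_def field_simps)
    qed
    finally have "((\<lambda>\<epsilon>. (\<integral>x. moment 2 (profile ?V (ws @ ws') \<epsilon> x t) * ?\<psi> x \<partial>lborel) / 2) \<longlongrightarrow> 2 * H t / 2) (at_right 0)"
      by (intro tendsto_divide) auto
    moreover have eq: "(LBINT x:{-L..L}. \<eta> (N \<epsilon> x t)) = (\<integral>x. moment 2 (profile ?V (ws @ ws') \<epsilon> x t) * ?\<psi> x \<partial>lborel) / 2" for \<epsilon>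
      unfolding set_lebesgue_integral_def integral_divide_zero[symmetric]
      by (simp add: N[OF elim(1)] \<eta>_def moment_def mult.commute)
    ultimately have "energy L N t (H t)" unfolding energy_def eq by simp
    moreover have "(H has_real_derivative d) (at t)"
      unfolding H_def by (auto intro!: derivative_eq_intros)
    ultimately show ?case by blast
  qed
  then have "energy_rate L N d"
    unfolding energy_rate_def by (intro exI[of _ H] exI[of _ "\<lambda>_. d"]) simp
  then show ?thesis by (simp add: d_def M_def)
qed

lemma energy_rate_unique:
  assumes "energy_rate L N d" "energy_rate L N d'"
  shows "d = d'"
proof -
  from assms(1) obtain H1 D1 where 1: "\<forall>\<^sub>F t in at_right 0. energy L N t (H1 t) \<and> (H1 has_real_derivative D1 t) (at t)"
      "(D1 \<longlongrightarrow> d) (at_right 0)" unfolding energy_rate_def by blast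
  from assms(2) obtain H2 D2 where 2: "\<forall>\<^sub>F t in at_right 0. energy L N t (H2 t) \<and> (H2 has_real_derivative D2 t) (at t)"
      "(D2 \<longlongrightarrow> d') (at_right 0)" unfolding energy_rate_def by blast
  from eventually_conj[OF 1(1) 2(1)] obtain b where b: "b > 0" and
    B: "\<And>t. 0 < t \<Longrightarrow> t < b \<Longrightarrow> (energy L N t (H1 t) \<and> (H1 has_real_derivative D1 t) (at t))
      \<and> energy L N t (H2 t) \<and> (H2 has_real_derivative D2 t) (at t)"
    unfolding eventually_at_right_field by blast
  have eq: "H1 t = H2 t" if "0 < t" "t < b" for t
    using B[OF that] unfolding energy_def by (auto intro: tendsto_unique[rotated])
  have "D1 t = D2 t" if t: "0 < t" "t < b" for t
  proof -
    have "(H2 has_real_derivative D1 t) (at t)"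
      by (rule has_field_derivative_transform_within_open[of H1 _ _ "{0<..<b}"]) (use B[OF t] t eq in auto)
    then show ?thesis using B[OF t] DERIV_unique by blast
  qed
  then have "\<forall>\<^sub>F t in at_right 0. D1 t = D2 t"
    unfolding eventually_at_right_field using b by blast
  from Lim_transform_eventually[OF 1(2) this] show ?thesis
    using 2(2) tendsto_unique[OF trivial_limit_at_right_real] by blast
qed

text \<open>The flux through the boundary of the window does not depend on \<open>u\<^sub>\<delta>\<close>, so comparing energy
  rates means comparing dissipations.\<close>

lemma least_dissipation_iff:
  assumes N: "approx_solution (\<rho>0, u0) (\<rho>1, u1) \<xi> \<mu> v N"
    and pos: "\<rho>0 > 0" "\<rho>1 > 0" "\<xi> > 0" "\<mu> > 0" and L: "\<mu> / 2 < L"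
  shows "least_dissipation (\<rho>0, u0) (\<rho>1, u1) \<xi> L \<mu> N \<longleftrightarrow>
    (\<forall>v' N'. approx_solution (\<rho>0, u0) (\<rho>1, u1) \<xi> \<mu> v' N' \<longrightarrow>
      total_dissipation \<rho>0 u0 \<rho>1 u1 (\<xi> / \<mu>) v \<le> total_dissipation \<rho>0 u0 \<rho>1 u1 (\<xi> / \<mu>) v')"
proof -
  note er = energy_rate_approx_solution[OF _ pos L]
  define d where "d v = (\<rho>0 * u0 ^ 3 - \<rho>1 * u1 ^ 3 - total_dissipation \<rho>0 u0 \<rho>1 u1 (\<xi> / \<mu>) v) / 2" for v
  have 1: "energy_rate L N' d' \<longleftrightarrow> d' = d v'" if "approx_solution (\<rho>0, u0) (\<rho>1, u1) \<xi> \<mu> v' N'" for v' N' d'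
    using er[OF that] energy_rate_unique unfolding d_def by blast
  have "least_dissipation (\<rho>0, u0) (\<rho>1, u1) \<xi> L \<mu> N \<longleftrightarrow>
    (\<forall>v' N'. approx_solution (\<rho>0, u0) (\<rho>1, u1) \<xi> \<mu> v' N' \<longrightarrow> d v' \<le> d v)"
    unfolding least_dissipation_def using 1 N by auto
  then show ?thesis by (simp add: d_def)
qed

lemma initial_energy_eq:
  assumes "\<mu> > 0" "\<mu> / 2 < L" "\<xi> > 0"
  shows "initial_energy (\<rho>0, u0) (\<rho>1, u1) \<xi> L \<mu> v =
    (\<rho>0 * u0\<^sup>2 + \<rho>1 * u1\<^sup>2) / 2 * (L - \<mu> / 2) + \<xi> * v\<^sup>2 / 2"
proof -
  have "initial_energy (\<rho>0, u0) (\<rho>1, u1) \<xi> L \<mu> v =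
    (\<integral>x. \<rho>0 * u0\<^sup>2 / 2 * indicator {-L..<-\<mu>/2} x + \<xi> / \<mu> * v\<^sup>2 / 2 * indicator {-\<mu>/2..<\<mu>/2} x
        + \<rho>1 * u1\<^sup>2 / 2 * indicator {\<mu>/2..L} x \<partial>lborel)"
    unfolding initial_energy_def set_lebesgue_integral_def
    by (rule Bochner_Integration.integral_cong)
      (use assms in \<open>auto simp: initial_data_def \<eta>_def indicator_def\<close>)
  also have "\<dots> = (\<integral>x. \<rho>0 * u0\<^sup>2 / 2 * indicator {-L..<-\<mu>/2} x \<partial>lborel)
      + (\<integral>x. \<xi> / \<mu> * v\<^sup>2 / 2 * indicator {-\<mu>/2..<\<mu>/2} x \<partial>lborel)
      + (\<integral>x. \<rho>1 * u1\<^sup>2 / 2 * indicator {\<mu>/2..L} x \<partial>lborel)"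
  proof -
    have i: "integrable lborel (\<lambda>x. \<rho>0 * u0\<^sup>2 / 2 * indicator {-L..<-\<mu>/2} x)"
        "integrable lborel (\<lambda>x. \<xi> / \<mu> * v\<^sup>2 / 2 * indicator {-\<mu>/2..<\<mu>/2} x)"
        "integrable lborel (\<lambda>x. \<rho>1 * u1\<^sup>2 / 2 * indicator {\<mu>/2..L} x)"
      by (rule integrable_mult_indicator_bounded; simp)+
    show ?thesis
      unfolding Bochner_Integration.integral_add[OF Bochner_Integration.integrable_add[OF i(1,2)] i(3)]
        Bochner_Integration.integral_add[OF i(1,2)] ..
  qed
  also have "\<dots> = \<rho>0 * u0\<^sup>2 / 2 * (L - \<mu> / 2) + \<xi> * v\<^sup>2 / 2 + \<rho>1 * u1\<^sup>2 / 2 * (L - \<mu> / 2)"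
    using assms by (simp add: measure_def)
  finally show ?thesis by (simp add: algebra_simps add_divide_distrib)
qed

text \<open>Convexity of the truncated cube, strict at a point where it is positive; this is what
  singles out the value of \<open>u\<^sub>\<delta>\<close>.\<close>

lemma cube_above_tangent:
  fixes p x :: real
  assumes "p > 0"
  shows "p ^ 3 + 3 * p\<^sup>2 * (x - p) \<le> max x 0 ^ 3"
    and "x \<noteq> p \<Longrightarrow> p ^ 3 + 3 * p\<^sup>2 * (x - p) < max x 0 ^ 3"
proof -
  have lt: "p ^ 3 + 3 * p\<^sup>2 * (x - p) < max x 0 ^ 3" if "x \<noteq> p"
  proof (cases "x \<ge> 0")
    case True
    have "x ^ 3 - (p ^ 3 + 3 * p\<^sup>2 * (x - p)) = (x - p)\<^sup>2 * (x + 2 * p)" by algebra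
    also have "\<dots> > 0" using that True assms by (intro mult_pos_pos) auto
    finally show ?thesis using True by simp
  next
    case False
    have "p ^ 3 + 3 * p\<^sup>2 * (x - p) = 3 * p\<^sup>2 * x - 2 * p ^ 3" by algebra
    also have "\<dots> < 0"
    proof -
      have "3 * p\<^sup>2 * x < 0" using False assms by (intro mult_pos_neg) auto
      moreover have "p ^ 3 > 0" using assms by simp
      ultimately show ?thesis by linarith
    qed
    finally show ?thesis using False by simp
  qed
  then show "x \<noteq> p \<Longrightarrow> p ^ 3 + 3 * p\<^sup>2 * (x - p) < max x 0 ^ 3" .
  show "p ^ 3 + 3 * p\<^sup>2 * (x - p) \<le> max x 0 ^ 3" using lt assms by (cases "x = p") auto
qed

text \<open>Both cubes are bounded below by their tangents at \<open>y\<^sup>\<mu>\<close>. The defining formula of \<open>y\<^sup>\<mu>\<close> says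
  that \<open>r\<^sub>0 p\<^sup>2 = r\<^sub>1 q\<^sup>2\<close> for \<open>p = u\<^sub>0 - y\<^sup>\<mu>\<close> and \<open>q = y\<^sup>\<mu> - u\<^sub>1\<close>, so the linear terms cancel.\<close>

lemma total_dissipation_minimal:
  assumes pos: "\<rho>0 > 0" "\<rho>1 > 0" "\<xi> > 0" "\<mu> > 0" and u: "u0 > u1"
    and v: "v \<noteq> y_mu (\<rho>0, u0) (\<rho>1, u1) \<xi> \<mu>"
  shows "total_dissipation \<rho>0 u0 \<rho>1 u1 (\<xi> / \<mu>) (y_mu (\<rho>0, u0) (\<rho>1, u1) \<xi> \<mu>)
    < total_dissipation \<rho>0 u0 \<rho>1 u1 (\<xi> / \<mu>) v"
proof -
  define M where "M = \<xi> / \<mu>"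
  have M: "M > 0" using pos by (simp add: M_def)
  define r0 where "r0 = \<rho>0 * M / (sqrt M + sqrt \<rho>0)\<^sup>2"
  define r1 where "r1 = \<rho>1 * M / (sqrt M + sqrt \<rho>1)\<^sup>2"
  define a where "a = sqrt r0"
  define b where "b = sqrt r1"
  have "sqrt M + sqrt \<rho>0 > 0" "sqrt M + sqrt \<rho>1 > 0" using M pos by (auto intro!: add_pos_pos)
  then have r: "r0 > 0" "r1 > 0" unfolding r0_def r1_def using M pos
    by (auto intro!: divide_pos_pos mult_pos_pos zero_less_power)
  then have ab: "a > 0" "b > 0" "r0 = a\<^sup>2" "r1 = b\<^sup>2" by (auto simp: a_def b_def)
  define y where "y = y_mu (\<rho>0, u0) (\<rho>1, u1) \<xi> \<mu>"
  have y: "y = (u0 * a + u1 * b) / (a + b)"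
    by (simp add: y_def y_mu_def Let_def a_def b_def r0_def r1_def M_def)
  define p where "p = u0 - y"
  define q where "q = y - u1"
  have "p = b * (u0 - u1) / (a + b)" "q = a * (u0 - u1) / (a + b)"
    using ab unfolding p_def q_def y by (simp_all add: field_simps)
  then have pq: "p > 0" "q > 0" "a * p = b * q" using ab u by auto
  have rpq: "r0 * p\<^sup>2 = r1 * q\<^sup>2" using pq(3) unfolding ab(3,4) by (metis power_mult_distrib)
  have td: "total_dissipation \<rho>0 u0 \<rho>1 u1 M x = r0 * max (u0 - x) 0 ^ 3 + r1 * max (x - u1) 0 ^ 3" for x
    by (simp add: total_dissipation_def dissipation_def r0_def r1_def add.commute mult.commute)
  have at_y: "total_dissipation \<rho>0 u0 \<rho>1 u1 M y = r0 * p ^ 3 + r1 * q ^ 3"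
    unfolding td p_def[symmetric] q_def[symmetric] using pq by simp
  \<comment> \<open>Replacing both cubes by their tangents does not change the sum.\<close>
  have "r0 * p ^ 3 + r1 * q ^ 3 = r0 * (p ^ 3 + 3 * p\<^sup>2 * ((u0 - v) - p)) + r1 * (q ^ 3 + 3 * q\<^sup>2 * ((v - u1) - q))"
  proof -
    have "r0 * (3 * p\<^sup>2 * ((u0 - v) - p)) + r1 * (3 * q\<^sup>2 * ((v - u1) - q))
        = 3 * (r0 * p\<^sup>2) * (y - v) + 3 * (r1 * q\<^sup>2) * (v - y)"
      by (simp add: p_def q_def algebra_simps)
    also have "\<dots> = 0" unfolding rpq by (simp add: algebra_simps)
    finally show ?thesis by (simp add: algebra_simps)
  qed
  also have "\<dots> < r0 * max (u0 - v) 0 ^ 3 + r1 * max (v - u1) 0 ^ 3"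
    using cube_above_tangent(2)[OF pq(1), of "u0 - v"] cube_above_tangent(1)[OF pq(2), of "v - u1"] r v
    by (intro add_less_le_mono mult_strict_left_mono mult_left_mono) (auto simp: p_def y_def)
  finally show ?thesis using at_y td[of v] by (simp add: y_def M_def)
qed

lemma total_dissipation_eq_0_iff:
  assumes pos: "\<rho>0 > 0" "\<rho>1 > 0" "M > 0"
  shows "total_dissipation \<rho>0 u0 \<rho>1 u1 M v \<ge> 0"
    "total_dissipation \<rho>0 u0 \<rho>1 u1 M v = 0 \<longleftrightarrow> u0 \<le> v \<and> v \<le> u1"
proof -
  have *: "dissipation \<rho>l \<rho>r ul ur \<ge> 0 \<and> (dissipation \<rho>l \<rho>r ul ur = 0 \<longleftrightarrow> ul \<le> ur)"
    if "\<rho>l > 0" "\<rho>r > 0" for \<rho>l \<rho>r ul ur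
  proof -
    have "sqrt \<rho>l + sqrt \<rho>r > 0" using that by (simp add: add_pos_pos)
    then have "\<rho>l * \<rho>r / (sqrt \<rho>l + sqrt \<rho>r)\<^sup>2 > 0" using that by simp
    then obtain r where r: "r = \<rho>l * \<rho>r / (sqrt \<rho>l + sqrt \<rho>r)\<^sup>2" "r > 0" by blast
    show ?thesis unfolding dissipation_def r(1)[symmetric] using r(2)
      by (cases "ul \<le> ur") simp_all
  qed
  show "total_dissipation \<rho>0 u0 \<rho>1 u1 M v \<ge> 0"
    "total_dissipation \<rho>0 u0 \<rho>1 u1 M v = 0 \<longleftrightarrow> u0 \<le> v \<and> v \<le> u1"
    using *[OF pos(1,3), of u0 v] *[OF pos(3,2), of v u1] unfolding total_dissipation_def by auto
qed

section \<open>Patterns of two Riemann problems\<close>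

lemma balanced_append:
  "balanced k a b M V (ws @ ws') \<longleftrightarrow> balanced k a b M V ws \<and> balanced k a b M (last_field V ws) ws'"
  by (induction k a b M V ws rule: balanced.induct) auto

lemma level_state: "level k (\<lambda>x t. (\<rho>, u)) = \<rho> * u ^ k" "level k (\<lambda>x t. (0, q x t)) = 0"
  by (auto simp: level_def moment_def)

lemma pairing_riemann_start:
  assumes "riemann a (\<rho>l, ul) (\<rho>r, ur) ws"
  shows "pairing (moment k) (\<lambda>w. 0) \<psi> 0 (\<lambda>x t. (\<rho>l, ul)) ws =
    (\<rho>l * ul ^ k - \<rho>r * ur ^ k) * (\<integral>x. indicator {..<a} x * \<psi> x \<partial>lborel) + \<rho>r * ur ^ k * (\<integral>x. \<psi> x \<partial>lborel)"
  using assms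
proof (cases rule: riemann_cases)
  case contacts
  then show ?thesis by (simp add: pairing_simple level_state algebra_simps del: pairing.simps)
next
  case contact
  then show ?thesis by (simp add: pairing_simple level_state del: pairing.simps)
next
  case (shadow w)
  then show ?thesis by (simp add: pairing_simple level_state del: pairing.simps)
qed

text \<open>The fronts of the two Riemann problems start where the initial data jump, without any mass
  on them.\<close>

lemma pairing_initial:
  assumes r: "riemann (- \<mu> / 2) (\<rho>0, u0) (\<xi> / \<mu>, v) ws" "riemann (\<mu> / 2) (\<xi> / \<mu>, v) (\<rho>1, u1) ws'"
    and \<mu>: "\<mu> > 0" and \<psi>: "integrable lborel \<psi>"
  shows "pairing (moment k) (\<lambda>w. 0) \<psi> 0 (\<lambda>x t. (\<rho>0, u0)) (ws @ ws') =
    (\<integral>x. moment k (initial_data (\<rho>0, u0) (\<rho>1, u1) \<xi> \<mu> v x) * \<psi> x \<partial>lborel)"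
proof -
  let ?P = "\<lambda>c. (\<integral>x. indicator {..<c} x * \<psi> x \<partial>lborel)"
  define f0 f1 f2 where "f0 = \<rho>0 * u0 ^ k" and "f1 = \<xi> / \<mu> * v ^ k" and "f2 = \<rho>1 * u1 ^ k"
  have i: "integrable lborel (\<lambda>x. d * (indicator {..<c} x * \<psi> x))" for c d
    by (intro integrable_mult_right integrable_indicator_mult[OF \<psi>]) simp
  have i': "integrable lborel (\<lambda>x. d * \<psi> x)" for d by (intro integrable_mult_right \<psi>)
  have "pairing (moment k) (\<lambda>w. 0) \<psi> 0 (\<lambda>x t. (\<rho>0, u0)) (ws @ ws')
      = (f0 - f1) * ?P (- \<mu> / 2) + (f1 - f2) * ?P (\<mu> / 2) + f2 * (\<integral>x. \<psi> x \<partial>lborel)"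
    unfolding pairing_append riemann_simple_fields(1)[OF r(1)] pairing_riemann_start[OF r(1)]
      pairing_riemann_start[OF r(2)] f0_def f1_def f2_def
    by (simp add: pairing_simple(1) level_state del: pairing.simps)
  also have "\<dots> = (\<integral>x. (f0 - f1) * (indicator {..<-\<mu> / 2} x * \<psi> x) + (f1 - f2) * (indicator {..<\<mu> / 2} x * \<psi> x)
      + f2 * \<psi> x \<partial>lborel)"
    unfolding Bochner_Integration.integral_add[OF Bochner_Integration.integrable_add[OF i i] i']
      Bochner_Integration.integral_add[OF i i] by simp
  also have "\<dots> = (\<integral>x. moment k (initial_data (\<rho>0, u0) (\<rho>1, u1) \<xi> \<mu> v x) * \<psi> x \<partial>lborel)"
    by (rule Bochner_Integration.integral_cong)
      (use \<mu> in \<open>auto simp: initial_data_def moment_def indicator_def f0_def f1_def f2_def algebra_simps\<close>)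
  finally show ?thesis .
qed

lemma weak_form_moment:
  "weak_form fst (\<lambda>U. fst U * snd U) U \<phi> =
     (LBINT t:{0<..}. (LBINT x. moment 0 (U x t) * dt \<phi> x t + moment (Suc 0) (U x t) * dx \<phi> x t))"
  "weak_form (\<lambda>U. fst U * snd U) (\<lambda>U. fst U * (snd U)\<^sup>2) U \<phi> =
     (LBINT t:{0<..}. (LBINT x. moment 1 (U x t) * dt \<phi> x t + moment (Suc 1) (U x t) * dx \<phi> x t))"
  "weak_form \<eta> Q U \<phi> =
     (LBINT t:{0<..}. (LBINT x. moment 2 (U x t) * dt \<phi> x t + moment (Suc 2) (U x t) * dx \<phi> x t)) / 2"
proof -
  show "weak_form fst (\<lambda>U. fst U * snd U) U \<phi> =
     (LBINT t:{0<..}. (LBINT x. moment 0 (U x t) * dt \<phi> x t + moment (Suc 0) (U x t) * dx \<phi> x t))"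
   "weak_form (\<lambda>U. fst U * snd U) (\<lambda>U. fst U * (snd U)\<^sup>2) U \<phi> =
     (LBINT t:{0<..}. (LBINT x. moment 1 (U x t) * dt \<phi> x t + moment (Suc 1) (U x t) * dx \<phi> x t))"
    by (simp_all add: weak_form_def moment_def power2_eq_square)
  have *: "\<eta> (U x t) * dt \<phi> x t + Q (U x t) * dx \<phi> x t =
      (moment 2 (U x t) * dt \<phi> x t + moment (Suc 2) (U x t) * dx \<phi> x t) / 2" for x t
    by (simp add: moment_def \<eta>_def Q_def power2_eq_square power3_eq_cube field_simps)
  show "weak_form \<eta> Q U \<phi> =
     (LBINT t:{0<..}. (LBINT x. moment 2 (U x t) * dt \<phi> x t + moment (Suc 2) (U x t) * dx \<phi> x t)) / 2"
    unfolding weak_form_def * by simp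
qed

lemma solves_in_limit_moments:
  "solves_in_limit N V \<longleftrightarrow> (\<forall>\<phi>. test_function UNIV \<phi> \<longrightarrow> (\<forall>k\<in>{0, 1}.
     ((\<lambda>\<epsilon>. (LBINT t:{0<..}. (LBINT x. moment k (N \<epsilon> x t) * dt \<phi> x t + moment (Suc k) (N \<epsilon> x t) * dx \<phi> x t))
        + (\<integral>x. moment k (V x) * \<phi> (x, 0) \<partial>lborel)) \<longlongrightarrow> 0) (at_right 0)))"
  unfolding solves_in_limit_def weak_form_moment by (simp add: moment_def)

section \<open>Contact discontinuities\<close>

lemma riemann_contacts_exist:
  assumes "ul \<le> ur"
  obtains ws where "riemann a (\<rho>l, ul) (\<rho>r, ur) ws"
  using assms by (cases "ul = ur") (auto simp: riemann_def)

context
  fixes a \<rho>l ul \<rho>r ur :: real and ws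
  assumes r: "riemann a (\<rho>l, ul) (\<rho>r, ur) ws" and le: "ul \<le> ur"
begin

lemma contacts_not_shadow: "(w, V') \<in> set ws \<Longrightarrow> \<not> is_Shadow w"
  using r le by (cases rule: riemann_cases) auto

lemma contacts_balanced: "balanced k s b (\<lambda>_ _. 0) (\<lambda>x t. (\<rho>l, ul)) ws"
  using r
proof (cases rule: riemann_cases)
  case contacts
  then show ?thesis
    by (auto simp: front_moment_def level_state deriv_affine C1_differentiable_on_def
        intro!: continuous_intros derivative_eq_intros)
next
  case contact
  have eq: "\<rho>l * (ur * ur ^ k) - \<rho>r * (ur * ur ^ k) = (\<rho>l * ur ^ k - \<rho>r * ur ^ k) * ur"
    by (simp add: algebra_simps)
  show ?thesis using contact
    by (auto simp: front_moment_def level_state deriv_affine C1_differentiable_on_def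
        eq intro!: continuous_intros derivative_eq_intros)
next
  case (shadow w)
  then show ?thesis using le by simp
qed

lemma contacts_fronts:
  assumes "t > 0" "(w, V') \<in> set ws"
  shows "a + ul * t \<le> front w t" "front w t \<le> a + ur * t"
  using r le assms by (cases rule: riemann_cases; force)+

lemma contacts_ordered: "t > 0 \<Longrightarrow> ordered t ws"
  using r le by (cases rule: riemann_cases) (auto simp: ordered_def)

end

lemma two_contacts_ordered:
  assumes r: "riemann (- \<mu> / 2) (\<rho>0, u0) (M, v) ws" "riemann (\<mu> / 2) (M, v) (\<rho>1, u1) ws'"
    and le: "u0 \<le> v" "v \<le> u1" and \<mu>: "\<mu> > 0" and t: "t > 0"
  shows "ordered t (ws @ ws')"
proof -
  have "front w t < front w' t" if "(w, V) \<in> set ws" "(w', V') \<in> set ws'" for w V w' V'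
    using contacts_fronts(2)[OF r(1) le(1) t that(1)] contacts_fronts(1)[OF r(2) le(2) t that(2)] \<mu> by simp
  then show ?thesis
    using contacts_ordered[OF r(1) le(1) t] contacts_ordered[OF r(2) le(2) t]
    by (fastforce simp: ordered_def sorted_wrt_append)
qed

text \<open>A merger needs two fronts in the same point.\<close>

lemma collide_ordered:
  assumes "collide T ws ws'" "ordered T ws"
  shows "ws' = ws"
  using assms
proof induction
  case (keep ws ws' p)
  then show ?case by (simp add: ordered_def)
next
  case (merge ws ws' g w)
  from \<open>length g \<ge> 2\<close> obtain p q g' where g: "g = p # q # g'"
    by (metis One_nat_def Suc_le_length_iff numeral_2_eq_2)
  then have "front (fst p) T < front (fst q) T"
    using merge.prems by (auto simp: ordered_def split: prod.splits)
  moreover have "front (fst p) T = front w T" "front (fst q) T = front w T"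
    using merge.hyps(3) g by auto
  ultimately show ?case by simp
qed simp

lemma evolution_ordered:
  assumes e: "evolution 0 V ws N" and ord: "\<And>t. t > 0 \<Longrightarrow> ordered t ws"
  shows "N = profile V ws"
  using e
proof cases
  case (interaction T' ws' N')
  then have "ws' = ws" using collide_ordered[OF _ ord[of T']] by blast
  then show ?thesis using interaction by simp
qed

lemma overcompressive_contacts:
  "(\<And>w V'. (w, V') \<in> set ws \<Longrightarrow> \<not> is_Shadow w) \<Longrightarrow> overcompressive t V ws"
proof (induction ws arbitrary: V)
  case (Cons p ws)
  obtain w V' where p: "p = (w, V')" by (cases p)
  have "\<not> is_Shadow w" using Cons.prems[of w V'] by (simp add: p)
  moreover have "overcompressive t V' ws"
    by (rule Cons.IH) (use Cons.prems in \<open>auto simp: p\<close>)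
  ultimately show ?case by (simp add: p)
qed simp

text \<open>Contact discontinuities carry no mass and move with the velocity of the adjacent streams, so
  both sides of the Rankine-Hugoniot condition vanish for every moment. The second part therefore
  holds for all \<open>k\<close>: \<open>k = 0, 1\<close> yields the system, \<open>k = 2\<close> the conservation of energy.\<close>

lemma two_contacts_approx_iff:
  assumes r: "riemann (- \<mu> / 2) (\<rho>0, u0) (\<xi> / \<mu>, v) ws" "riemann (\<mu> / 2) (\<xi> / \<mu>, v) (\<rho>1, u1) ws'"
    and le: "u0 \<le> v" "v \<le> u1" and \<mu>: "\<mu> > 0"
  shows "approx_solution (\<rho>0, u0) (\<rho>1, u1) \<xi> \<mu> v N \<longleftrightarrow> N = profile (\<lambda>x t. (\<rho>0, u0)) (ws @ ws')"
    and "test_function UNIV \<phi> \<Longrightarrow>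
      ((\<lambda>\<epsilon>. (LBINT t:{0<..}. (LBINT x. moment k (profile (\<lambda>x t. (\<rho>0, u0)) (ws @ ws') \<epsilon> x t) * dt \<phi> x t
          + moment (Suc k) (profile (\<lambda>x t. (\<rho>0, u0)) (ws @ ws') \<epsilon> x t) * dx \<phi> x t))
        + (\<integral>x. moment k (initial_data (\<rho>0, u0) (\<rho>1, u1) \<xi> \<mu> v x) * \<phi> (x, 0) \<partial>lborel)) \<longlongrightarrow> 0) (at_right 0)"
proof -
  let ?V = "\<lambda>x t. (\<rho>0, u0)"
  have ord: "ordered t (ws @ ws')" if "t > 0" for t by (rule two_contacts_ordered[OF r le \<mu> that])
  have ns: "\<not> is_Shadow w" if "(w, V') \<in> set (ws @ ws')" for w V'
    using that contacts_not_shadow[OF r(1) le(1)] contacts_not_shadow[OF r(2) le(2)] by auto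
  have oc: "overcompressive t V (ws @ ws')" for t V
    by (rule overcompressive_contacts) (rule ns)
  have adm: "admissible_on {0..} ?V (ws @ ws')"
    unfolding admissible_on_def using ns ord oc by auto
  have fields: "simple_field V'" if "V' \<in> fields ?V (ws @ ws')" for V'
    using that riemann_simple_fields(3)[OF r(1)] riemann_simple_fields(3)[OF r(2)]
    by (auto simp: fields_def)
  have aff: "\<exists>a s. front w = (\<lambda>t. a + s * t)" if w: "(w, V') \<in> set (ws @ ws')" for w V'
  proof -
    from w consider "(w, V') \<in> set ws" | "(w, V') \<in> set ws'" by auto
    then show ?thesis by cases (use riemann_front_affine[OF r(1)] riemann_front_affine[OF r(2)] in blast)+
  qed
  have tame: "tame_wave (moment k) {0<..} (front_moment k) w" if "(w, V') \<in> set (ws @ ws')" for w V' k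
    using admissible_tame(1)[OF adm that aff[OF that]] by simp
  have bal: "balanced k 0 b (\<lambda>_ _. 0) ?V (ws @ ws')" for k b
    unfolding balanced_append riemann_simple_fields(1)[OF r(1)]
    using contacts_balanced[OF r(1) le(1)] contacts_balanced[OF r(2) le(2)] by blast
  show weak: "((\<lambda>\<epsilon>. (LBINT t:{0<..}. (LBINT x. moment k (profile ?V (ws @ ws') \<epsilon> x t) * dt \<phi> x t
          + moment (Suc k) (profile ?V (ws @ ws') \<epsilon> x t) * dx \<phi> x t))
        + (\<integral>x. moment k (initial_data (\<rho>0, u0) (\<rho>1, u1) \<xi> \<mu> v x) * \<phi> (x, 0) \<partial>lborel)) \<longlongrightarrow> 0) (at_right 0)"
    if \<phi>: "test_function UNIV \<phi>" for k \<phi>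
  proof -
    obtain R where c0: "continuous_on UNIV \<phi>" and s0: "\<And>z. \<phi> z \<noteq> 0 \<Longrightarrow> \<bar>fst z\<bar> \<le> R \<and> \<bar>snd z\<bar> \<le> R"
      by (rule test_function_props[OF \<phi>]) blast
    obtain B where B: "\<And>z. \<bar>\<phi> z\<bar> \<le> B" using bounded_test[OF c0 s0] by blast
    have int: "integrable lborel (\<lambda>x. \<phi> (x, 0))"
      by (rule integrable_bounded_support[where R = R])
        (use B s0[of "(_, 0)"] continuous_on_compose2[OF c0, of UNIV "\<lambda>x. (x, 0)"] in
          \<open>auto simp: continuous_on_Pair intro!: borel_measurable_continuous_onI\<close>)
    let ?W = "\<lambda>\<epsilon>. LBINT t:{0<..}. (LBINT x. moment k (profile ?V (ws @ ws') \<epsilon> x t) * dt \<phi> x t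
          + moment (Suc k) (profile ?V (ws @ ws') \<epsilon> x t) * dx \<phi> x t)"
    have lim: "(?W \<longlongrightarrow> (LBINT t:{0<..}. weak_rate k \<phi> ?V (ws @ ws') t)) (at_right 0)"
      by (rule phase_limit(1)[OF \<phi>]; (erule fields | erule tame | simp add: ord))
    have int_rate: "set_integrable lborel {0<..} (weak_rate k \<phi> ?V (ws @ ws'))"
      by (rule phase_limit(2)[OF \<phi>]; (erule fields | erule tame | simp add: ord))
    have "(LBINT t:{0<..}. weak_rate k \<phi> ?V (ws @ ws') t)
        = - (\<integral>x. moment k (initial_data (\<rho>0, u0) (\<rho>1, u1) \<xi> \<mu> v x) * \<phi> (x, 0) \<partial>lborel)"
      using weak_rate_unbounded[OF \<phi> fields bal int_rate] pairing_initial[OF r \<mu> int, of k] by simp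
    then show ?thesis using tendsto_add[OF lim tendsto_const[of
        "\<integral>x. moment k (initial_data (\<rho>0, u0) (\<rho>1, u1) \<xi> \<mu> v x) * \<phi> (x, 0) \<partial>lborel"]] by simp
  qed
  show "approx_solution (\<rho>0, u0) (\<rho>1, u1) \<xi> \<mu> v N \<longleftrightarrow> N = profile ?V (ws @ ws')"
  proof
    assume "approx_solution (\<rho>0, u0) (\<rho>1, u1) \<xi> \<mu> v N"
    then obtain qs qs' where q: "riemann (- \<mu> / 2) (\<rho>0, u0) (\<xi> / \<mu>, v) qs" "riemann (\<mu> / 2) (\<xi> / \<mu>, v) (\<rho>1, u1) qs'"
      and e: "evolution 0 ?V (qs @ qs') N" by (auto simp: approx_solution_def)
    have "qs = ws" "qs' = ws'" using q r le by (auto simp: riemann_def Let_def split: if_splits)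
    with evolution_ordered[OF e] ord show "N = profile ?V (ws @ ws')" by blast
  next
    assume N: "N = profile ?V (ws @ ws')"
    have "evolution 0 ?V (ws @ ws') N" unfolding N by (rule settled[OF adm])
    moreover have "solves_in_limit N (initial_data (\<rho>0, u0) (\<rho>1, u1) \<xi> \<mu> v)"
      unfolding solves_in_limit_moments N using weak by blast
    ultimately show "approx_solution (\<rho>0, u0) (\<rho>1, u1) \<xi> \<mu> v N"
      unfolding approx_solution_def using r by blast
  qed
qed

lemma two_contacts_profile:
  assumes r: "riemann (- \<mu> / 2) (\<rho>0, u0) (M, v) ws" "riemann (\<mu> / 2) (M, v) (\<rho>1, u1) ws'"
    and le: "u0 \<le> v" "v \<le> u1" and t: "t > 0"
  shows "profile (\<lambda>x t. (\<rho>0, u0)) (ws @ ws') \<epsilon> x t =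
    (if x < - \<mu> / 2 + u0 * t then (\<rho>0, u0)
     else if x < - \<mu> / 2 + v * t then (0, (x + \<mu> / 2) / t)
     else if x < \<mu> / 2 + v * t then (M, v)
     else if x < \<mu> / 2 + u1 * t then (0, (x - \<mu> / 2) / t)
     else (\<rho>1, u1))"
proof -
  have 1: "profile V (ws @ qs) \<epsilon> x t = (if x < - \<mu> / 2 + u0 * t then V x t
     else if x < - \<mu> / 2 + v * t then (0, (x + \<mu> / 2) / t) else profile (\<lambda>x t. (M, v)) qs \<epsilon> x t)" for V qs
    using r(1) le by (cases rule: riemann_cases) auto
  have 2: "profile V ws' \<epsilon> x t = (if x < \<mu> / 2 + v * t then V x t
     else if x < \<mu> / 2 + u1 * t then (0, (x - \<mu> / 2) / t) else (\<rho>1, u1))" for V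
    using r(2) le by (cases rule: riemann_cases) auto
  show ?thesis unfolding 1 2 ..
qed

section \<open>Limits of fields tested in space and time\<close>

lemma test_line:
  fixes \<phi> :: "real \<times> real \<Rightarrow> real"
  assumes "continuous_on UNIV \<phi>" and "\<And>z. \<phi> z \<noteq> 0 \<Longrightarrow> \<bar>fst z\<bar> \<le> R \<and> \<bar>snd z\<bar> \<le> R"
  shows "continuous_on UNIV (\<lambda>x. \<phi> (x, t))" "integrable lborel (\<lambda>x. \<phi> (x, t))"
    "isCont (\<lambda>x. \<phi> (x, t)) c"
proof -
  show c: "continuous_on UNIV (\<lambda>x. \<phi> (x, t))"
    using continuous_on_compose2[OF assms(1), of UNIV "\<lambda>x. (x, t)"] by (simp add: continuous_on_Pair)
  then show "isCont (\<lambda>x. \<phi> (x, t)) c" by (simp add: continuous_on_eq_continuous_at)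
  obtain B where B: "\<And>z. \<bar>\<phi> z\<bar> \<le> B" using bounded_test[OF assms] by blast
  show "integrable lborel (\<lambda>x. \<phi> (x, t))"
    by (rule integrable_bounded_support[where R = R])
      (use B assms(2)[of "(_, t)"] c in \<open>auto intro!: borel_measurable_continuous_onI\<close>)
qed

lemma measurable_field_integral:
  fixes h :: "real \<Rightarrow> real \<Rightarrow> real"
  assumes \<phi>: "continuous_on UNIV \<phi>"
    and [measurable]: "(\<lambda>z. h (fst z) (snd z)) \<in> borel_measurable (borel \<Otimes>\<^sub>M borel)"
  shows "(\<lambda>t. LBINT x. h x t * \<phi> (x, t)) \<in> borel_measurable borel"
proof -
  have [measurable]: "\<phi> \<in> borel_measurable (borel \<Otimes>\<^sub>M borel)"
    using borel_measurable_continuous_onI[OF \<phi>] by (simp add: borel_prod)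
  have "(\<lambda>z. (\<lambda>z. h (fst z) (snd z)) (snd z, fst z) * \<phi> (snd z, fst z)) \<in> borel_measurable (borel \<Otimes>\<^sub>M lborel)"
    by measurable
  then show ?thesis
    by (intro lborel.borel_measurable_lebesgue_integral) (simp add: split_beta')
qed

text \<open>Bounded convergence in space at each time, followed by bounded convergence in time; the
  compact support of \<open>\<phi>\<close> makes constants integrable.\<close>

lemma tendsto_field_integral:
  fixes f :: "real \<Rightarrow> real \<Rightarrow> real \<Rightarrow> real"
  assumes \<phi>: "continuous_on UNIV \<phi>" and R: "\<And>z. \<phi> z \<noteq> 0 \<Longrightarrow> \<bar>fst z\<bar> \<le> R \<and> \<bar>snd z\<bar> \<le> R"
    and fm: "\<forall>\<^sub>F \<mu> in at_right 0. (\<lambda>z. f \<mu> (fst z) (snd z)) \<in> borel_measurable (borel \<Otimes>\<^sub>M borel)"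
    and gm: "(\<lambda>z. g (fst z) (snd z)) \<in> borel_measurable (borel \<Otimes>\<^sub>M borel)"
    and K: "\<forall>\<^sub>F \<mu> in at_right 0. \<forall>x. \<forall>t>0. \<bar>f \<mu> x t\<bar> \<le> K"
    and lim: "\<And>t. t > 0 \<Longrightarrow> AE x in lborel. ((\<lambda>\<mu>. f \<mu> x t) \<longlongrightarrow> g x t) (at_right 0)"
  shows "((\<lambda>\<mu>. LBINT t:{0<..}. (LBINT x. f \<mu> x t * \<phi> (x, t)))
    \<longlongrightarrow> (LBINT t:{0<..}. (LBINT x. g x t * \<phi> (x, t)))) (at_right 0)"
    and "\<forall>\<^sub>F \<mu> in at_right 0. set_integrable lborel {0<..} (\<lambda>t. LBINT x. f \<mu> x t * \<phi> (x, t))"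
    and "set_integrable lborel {0<..} (\<lambda>t. LBINT x. g x t * \<phi> (x, t))"
proof -
  obtain B where B0: "B \<ge> 0" and B: "\<And>z. \<bar>\<phi> z\<bar> \<le> B" using bounded_test[OF \<phi> R] by blast
  have meas: "(\<lambda>t. indicator {0<..} t * (LBINT x. h x t * \<phi> (x, t))) \<in> borel_measurable lborel"
    if "(\<lambda>z. h (fst z) (snd z)) \<in> borel_measurable (borel \<Otimes>\<^sub>M borel)" for h :: "real \<Rightarrow> real \<Rightarrow> real"
    using measurable_field_integral[OF \<phi> that] by simp
  have sect: "(\<lambda>x. h x t) \<in> borel_measurable borel"
    if h: "(\<lambda>z. h (fst z) (snd z)) \<in> borel_measurable (borel \<Otimes>\<^sub>M borel)" for h :: "real \<Rightarrow> real \<Rightarrow> real" and t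
    using measurable_compose[OF _ h, of "\<lambda>x. (x, t)" borel] by simp
  define D where "D = \<bar>K\<bar> * B * (2 * \<bar>R\<bar>)"
  have supp0: "\<phi> (x, t) = 0" if "\<not> (\<bar>x\<bar> \<le> \<bar>R\<bar> \<and> \<bar>t\<bar> \<le> \<bar>R\<bar>)" for x t
    using R[of "(x, t)"] that by force
  have pw: "\<bar>h x t * \<phi> (x, t)\<bar> \<le> \<bar>K\<bar> * B * indicator {-\<bar>R\<bar>..\<bar>R\<bar>} x * indicator {-\<bar>R\<bar>..\<bar>R\<bar>} t"
    if "\<bar>h x t\<bar> \<le> K" for h :: "real \<Rightarrow> real \<Rightarrow> real" and x t
  proof (cases "\<bar>x\<bar> \<le> \<bar>R\<bar> \<and> \<bar>t\<bar> \<le> \<bar>R\<bar>")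
    case True
    have "\<bar>h x t\<bar> * \<bar>\<phi> (x, t)\<bar> \<le> \<bar>K\<bar> * B" using that B by (intro mult_mono) auto
    then show ?thesis using True by (simp add: abs_mult indicator_def abs_le_iff)
  next
    case False
    then show ?thesis using supp0[OF False] B0 by (simp add: mult_nonneg_nonneg)
  qed
  have wint: "integrable lborel (\<lambda>x. \<bar>K\<bar> * B * indicator {-\<bar>R\<bar>..\<bar>R\<bar>} x * indicator {-\<bar>R\<bar>..\<bar>R\<bar>} t)" for t :: real
    using integrable_mult_left[OF integrable_mult_indicator_bounded[of "{-\<bar>R\<bar>..\<bar>R\<bar>}" "\<bar>K\<bar> * B"]] by simp
  have bnd: "\<bar>indicator {0<..} t * (LBINT x. f \<mu> x t * \<phi> (x, t))\<bar> \<le> D * indicator {-\<bar>R\<bar>..\<bar>R\<bar>} t"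
    if fm: "(\<lambda>z. f \<mu> (fst z) (snd z)) \<in> borel_measurable (borel \<Otimes>\<^sub>M borel)" and K: "\<forall>x. \<forall>t>0. \<bar>f \<mu> x t\<bar> \<le> K" for \<mu> t
  proof (cases "t > 0")
    case True
    have m: "(\<lambda>x. f \<mu> x t * \<phi> (x, t)) \<in> borel_measurable borel"
      by (intro borel_measurable_times sect[OF fm] borel_measurable_continuous_onI[OF test_line(1)[OF \<phi> R]])
    have "\<bar>LBINT x. f \<mu> x t * \<phi> (x, t)\<bar> \<le> (LBINT x. \<bar>f \<mu> x t * \<phi> (x, t)\<bar>)" by (rule integral_abs_bound)
    also have "\<dots> \<le> (LBINT x. \<bar>K\<bar> * B * indicator {-\<bar>R\<bar>..\<bar>R\<bar>} x * indicator {-\<bar>R\<bar>..\<bar>R\<bar>} t)"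
    proof (rule integral_mono[OF _ wint])
      show "integrable lborel (\<lambda>x. \<bar>f \<mu> x t * \<phi> (x, t)\<bar>)"
        by (rule Bochner_Integration.integrable_bound[OF wint[of t]])
          (use m pw[of "f \<mu>" _ t] K True in \<open>auto intro!: AE_I2 intro: order_trans[OF _ abs_ge_self]\<close>)
      show "\<bar>f \<mu> x t * \<phi> (x, t)\<bar> \<le> \<bar>K\<bar> * B * indicator {-\<bar>R\<bar>..\<bar>R\<bar>} x * indicator {-\<bar>R\<bar>..\<bar>R\<bar>} t" for x
        by (rule pw) (use K True in auto)
    qed
    also have "\<dots> = D * indicator {-\<bar>R\<bar>..\<bar>R\<bar>} t" by (simp add: D_def measure_def)
    finally show ?thesis using True by simp
  next
    case False
    then show ?thesis using B0 by (simp add: D_def)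
  qed
  have evb: "\<forall>\<^sub>F \<mu> in at_right 0. (\<lambda>t. indicator {0<..} t * (LBINT x. f \<mu> x t * \<phi> (x, t))) \<in> borel_measurable lborel \<and>
      (\<forall>t. \<bar>indicator {0<..} t * (LBINT x. f \<mu> x t * \<phi> (x, t))\<bar> \<le> D * indicator {-\<bar>R\<bar>..\<bar>R\<bar>} t)"
    using fm K
  proof eventually_elim
    case (elim \<mu>)
    show ?case using meas[OF elim(1)] bnd[OF elim] by blast
  qed
  have Dint: "integrable lborel (\<lambda>t. D * indicator {-\<bar>R\<bar>..\<bar>R\<bar>} t)"
    by (rule integrable_mult_indicator_bounded) auto
  have inner: "((\<lambda>\<mu>. LBINT x. f \<mu> x t * \<phi> (x, t)) \<longlongrightarrow> (LBINT x. g x t * \<phi> (x, t))) (at_right 0)" if t: "t > 0" for t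
  proof (rule dominated_convergence_at_right(1)[OF _ _ _ _ wint[of t]])
    have mt: "(\<lambda>x. \<phi> (x, t)) \<in> borel_measurable borel"
      by (rule borel_measurable_continuous_onI[OF test_line(1)[OF \<phi> R]])
    show "\<forall>\<^sub>F \<mu> in at_right 0. (\<lambda>x. f \<mu> x t * \<phi> (x, t)) \<in> borel_measurable lborel"
      using fm
    proof eventually_elim
      case (elim \<mu>)
      show ?case using sect[OF elim, of t] mt by simp
    qed
    show "(\<lambda>x. g x t * \<phi> (x, t)) \<in> borel_measurable lborel" using sect[OF gm, of t] mt by simp
    show "AE x in lborel. ((\<lambda>\<mu>. f \<mu> x t * \<phi> (x, t)) \<longlongrightarrow> g x t * \<phi> (x, t)) (at_right 0)"
      using lim[OF t] by eventually_elim (intro tendsto_mult_right)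
    show "\<forall>\<^sub>F \<mu> in at_right 0. AE x in lborel. \<bar>f \<mu> x t * \<phi> (x, t)\<bar>
        \<le> \<bar>K\<bar> * B * indicator {-\<bar>R\<bar>..\<bar>R\<bar>} x * indicator {-\<bar>R\<bar>..\<bar>R\<bar>} t"
      using K
    proof eventually_elim
      case (elim \<mu>)
      show ?case by (intro AE_I2 pw) (use elim t in auto)
    qed
  qed
  have l: "((\<lambda>\<mu>. indicator {0<..} t * (LBINT x. f \<mu> x t * \<phi> (x, t)))
      \<longlongrightarrow> indicator {0<..} t * (LBINT x. g x t * \<phi> (x, t))) (at_right 0)" for t :: real
    using inner[of t] by (cases "t > 0") auto
  have dc: "((\<lambda>\<mu>. \<integral>t. indicator {0<..} t * (LBINT x. f \<mu> x t * \<phi> (x, t)) \<partial>lborel)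
      \<longlongrightarrow> (\<integral>t. indicator {0<..} t * (LBINT x. g x t * \<phi> (x, t)) \<partial>lborel)) (at_right 0)
    \<and> integrable lborel (\<lambda>t. indicator {0<..} t * (LBINT x. g x t * \<phi> (x, t)))"
    by (intro conjI dominated_convergence_at_right[OF _ meas[OF gm] _ _ Dint])
      (use evb l in \<open>auto elim: eventually_mono\<close>)
  then show "((\<lambda>\<mu>. LBINT t:{0<..}. (LBINT x. f \<mu> x t * \<phi> (x, t)))
    \<longlongrightarrow> (LBINT t:{0<..}. (LBINT x. g x t * \<phi> (x, t)))) (at_right 0)"
    "set_integrable lborel {0<..} (\<lambda>t. LBINT x. g x t * \<phi> (x, t))"
    by (simp_all add: set_lebesgue_integral_def set_integrable_def)
  show "\<forall>\<^sub>F \<mu> in at_right 0. set_integrable lborel {0<..} (\<lambda>t. LBINT x. f \<mu> x t * \<phi> (x, t))"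
    using evb
  proof eventually_elim
    case (elim \<mu>)
    have "integrable lborel (\<lambda>t. indicator {0<..} t * (LBINT x. f \<mu> x t * \<phi> (x, t)))"
      by (rule Bochner_Integration.integrable_bound[OF Dint])
        (use elim in \<open>auto intro!: AE_I2 intro: order_trans[OF _ abs_ge_self]\<close>)
    then show ?case by (simp add: set_integrable_def)
  qed
qed

text \<open>The analogue for the point masses on the fronts.\<close>

lemma tendsto_front_integral:
  fixes h :: "real \<Rightarrow> real \<Rightarrow> real"
  assumes hm: "\<forall>\<^sub>F \<mu> in at_right 0. (\<lambda>t. indicator {0<..} t * h \<mu> t) \<in> borel_measurable borel"
    and K: "\<forall>\<^sub>F \<mu> in at_right 0. \<forall>t>0. \<bar>h \<mu> t\<bar> \<le> K * indicator {-R..R} t"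
    and lim: "\<And>t. t > 0 \<Longrightarrow> ((\<lambda>\<mu>. h \<mu> t) \<longlongrightarrow> g t) (at_right 0)"
  shows "((\<lambda>\<mu>. LBINT t:{0<..}. h \<mu> t) \<longlongrightarrow> (LBINT t:{0<..}. g t)) (at_right 0)"
    and "\<forall>\<^sub>F \<mu> in at_right 0. set_integrable lborel {0<..} (h \<mu>)"
    and "set_integrable lborel {0<..} g"
proof -
  have Kint: "integrable lborel (\<lambda>t. \<bar>K\<bar> * indicator {-R..R} t)"
    by (rule integrable_mult_indicator_bounded) auto
  have b: "\<forall>\<^sub>F \<mu> in at_right 0. \<forall>t. \<bar>indicator {0<..} t * h \<mu> t\<bar> \<le> \<bar>K\<bar> * indicator {-R..R} t"
    using K
  proof eventually_elim
    case (elim \<mu>)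
    show ?case
    proof
      fix t :: real
      show "\<bar>indicator {0<..} t * h \<mu> t\<bar> \<le> \<bar>K\<bar> * indicator {-R..R} t"
        using elim by (cases "t > 0") (fastforce simp: indicator_def split: if_splits)+
    qed
  qed
  have l: "((\<lambda>\<mu>. indicator {0<..} t * h \<mu> t) \<longlongrightarrow> indicator {0<..} t * g t) (at_right 0)" for t
    using lim[of t] by (cases "t > 0") auto
  have gm: "(\<lambda>t. indicator {0<..} t * g t) \<in> borel_measurable lborel"
    by (rule borel_measurable_lim_at_right[where f = "\<lambda>\<mu> t. indicator {0<..} t * h \<mu> t"]) (use hm l in auto)
  have "((\<lambda>\<mu>. \<integral>t. indicator {0<..} t * h \<mu> t \<partial>lborel) \<longlongrightarrow> (\<integral>t. indicator {0<..} t * g t \<partial>lborel)) (at_right 0)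
    \<and> integrable lborel (\<lambda>t. indicator {0<..} t * g t)"
    by (intro conjI dominated_convergence_at_right[OF _ gm _ _ Kint])
      (use hm b l in \<open>auto elim: eventually_mono\<close>)
  then show "((\<lambda>\<mu>. LBINT t:{0<..}. h \<mu> t) \<longlongrightarrow> (LBINT t:{0<..}. g t)) (at_right 0)"
    "set_integrable lborel {0<..} g"
    by (simp_all add: set_lebesgue_integral_def set_integrable_def)
  show "\<forall>\<^sub>F \<mu> in at_right 0. set_integrable lborel {0<..} (h \<mu>)"
    using hm b
  proof eventually_elim
    case (elim \<mu>)
    have "integrable lborel (\<lambda>t. indicator {0<..} t * h \<mu> t)"
      by (rule Bochner_Integration.integrable_bound[OF Kint])
        (use elim in \<open>auto intro!: AE_I2 intro: order_trans[OF _ abs_ge_self]\<close>)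
    then show ?case by (simp add: set_integrable_def)
  qed
qed

section \<open>The case of separating states\<close>

text \<open>The point of \<open>[u0, u1]\<close> closest to zero.\<close>

definition slowest :: "real \<Rightarrow> real \<Rightarrow> real" where
  "slowest u0 u1 = (if u0 > 0 then u0 else if u1 < 0 then u1 else 0)"

lemma slowest:
  assumes "u0 \<le> u1"
  shows "slowest u0 u1 \<in> {u0..u1}"
    and "v \<in> {u0..u1} \<Longrightarrow> (slowest u0 u1)\<^sup>2 \<le> v\<^sup>2"
    and "v \<in> {u0..u1} \<Longrightarrow> v\<^sup>2 \<le> (slowest u0 u1)\<^sup>2 \<Longrightarrow> v = slowest u0 u1"
proof -
  show "slowest u0 u1 \<in> {u0..u1}" using assms by (auto simp: slowest_def)
  show "(slowest u0 u1)\<^sup>2 \<le> v\<^sup>2" if "v \<in> {u0..u1}"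
    using that by (auto simp: slowest_def abs_le_square_iff[symmetric])
  show "v = slowest u0 u1" if "v \<in> {u0..u1}" "v\<^sup>2 \<le> (slowest u0 u1)\<^sup>2"
    using that by (auto simp: slowest_def abs_le_square_iff[symmetric] split: if_splits)
qed

lemma eventually_small_mu: "L > 0 \<Longrightarrow> \<forall>\<^sub>F \<mu> in at_right 0. 0 < \<mu> \<and> \<mu> / 2 < (L :: real)"
  unfolding eventually_at_right_field by (rule exI[of _ "2 * L"]) auto

lemma approx_solution_exists:
  assumes "u0 \<le> v" "v \<le> u1" "\<mu> > 0"
  shows "\<exists>N. approx_solution (\<rho>0, u0) (\<rho>1, u1) \<xi> \<mu> v N"
proof -
  obtain ws where 1: "riemann (- \<mu> / 2) (\<rho>0, u0) (\<xi> / \<mu>, v) ws" by (rule riemann_contacts_exist[OF assms(1)])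
  obtain ws' where 2: "riemann (\<mu> / 2) (\<xi> / \<mu>, v) (\<rho>1, u1) ws'" by (rule riemann_contacts_exist[OF assms(2)])
  show ?thesis using two_contacts_approx_iff(1)[OF 1 2 assms] by blast
qed

text \<open>The dissipation vanishes exactly for values between the two velocities, and all of these are
  attained by a solution. What remains of the initial energy is \<open>\<xi> v\<^sup>2 / 2\<close>.\<close>

lemma separating_selection:
  assumes pos: "\<rho>0 > 0" "\<rho>1 > 0" "\<xi> > 0" "\<mu> > 0" and L: "\<mu> / 2 < L" and u: "u0 \<le> u1"
  shows "approx_solution (\<rho>0, u0) (\<rho>1, u1) \<xi> \<mu> v N \<and> least_dissipation (\<rho>0, u0) (\<rho>1, u1) \<xi> L \<mu> N \<and>
     (\<forall>v' N'. approx_solution (\<rho>0, u0) (\<rho>1, u1) \<xi> \<mu> v' N' \<and> least_dissipation (\<rho>0, u0) (\<rho>1, u1) \<xi> L \<mu> N' \<longrightarrow>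
        initial_energy (\<rho>0, u0) (\<rho>1, u1) \<xi> L \<mu> v \<le> initial_energy (\<rho>0, u0) (\<rho>1, u1) \<xi> L \<mu> v')
    \<longleftrightarrow> v = slowest u0 u1 \<and> approx_solution (\<rho>0, u0) (\<rho>1, u1) \<xi> \<mu> v N"
proof -
  define s where "s = slowest u0 u1"
  let ?D = "total_dissipation \<rho>0 u0 \<rho>1 u1 (\<xi> / \<mu>)"
  let ?A = "approx_solution (\<rho>0, u0) (\<rho>1, u1) \<xi> \<mu>"
  let ?L = "least_dissipation (\<rho>0, u0) (\<rho>1, u1) \<xi> L \<mu>"
  let ?E = "initial_energy (\<rho>0, u0) (\<rho>1, u1) \<xi> L \<mu>"
  have M: "\<xi> / \<mu> > 0" using pos by simp
  note D0 = total_dissipation_eq_0_iff[OF pos(1,2) M, of u0 u1]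
  have s: "u0 \<le> s" "s \<le> u1" using slowest(1)[OF u] by (auto simp: s_def)
  obtain Ns where Ns: "?A s Ns" using approx_solution_exists[OF s pos(4)] by blast
  have Ds: "?D s = 0" using D0(2) s by simp
  have least: "?L N' \<longleftrightarrow> v' \<in> {u0..u1}" if "?A v' N'" for v' N'
  proof -
    have "?L N' \<longleftrightarrow> (\<forall>v'' N''. ?A v'' N'' \<longrightarrow> ?D v' \<le> ?D v'')"
      by (rule least_dissipation_iff[OF that pos L])
    also have "\<dots> \<longleftrightarrow> ?D v' = 0"
    proof
      assume "\<forall>v'' N''. ?A v'' N'' \<longrightarrow> ?D v' \<le> ?D v''"
      then have "?D v' \<le> 0" using Ns Ds by metis
      then show "?D v' = 0" using D0(1)[of v'] by simp
    qed (use D0(1) in simp)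
    finally show ?thesis using D0(2) by simp
  qed
  have E: "?E v' \<le> ?E v'' \<longleftrightarrow> v'\<^sup>2 \<le> v''\<^sup>2" for v' v''
    unfolding initial_energy_eq[OF pos(4) L pos(3)] using pos by (simp add: divide_right_mono)
  show ?thesis
  proof
    assume *: "?A v N \<and> ?L N \<and> (\<forall>v' N'. ?A v' N' \<and> ?L N' \<longrightarrow> ?E v \<le> ?E v')"
    then have "v \<in> {u0..u1}" using least by blast
    moreover have "v\<^sup>2 \<le> s\<^sup>2" using * Ns least[OF Ns] s E by (metis atLeastAtMost_iff)
    ultimately show "v = slowest u0 u1 \<and> ?A v N" using slowest(3)[OF u] * by (auto simp: s_def)
  next
    assume *: "v = slowest u0 u1 \<and> ?A v N"
    then show "?A v N \<and> ?L N \<and> (\<forall>v' N'. ?A v' N' \<and> ?L N' \<longrightarrow> ?E v \<le> ?E v')"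
      using least slowest(1,2)[OF u] E by metis
  qed
qed

lemma front_switch:
  fixes x c :: real
  assumes "x \<noteq> c"
  shows "\<forall>\<^sub>F \<mu> in at_right 0. (x < - \<mu> / 2 + c \<longleftrightarrow> x < c) \<and> (x < \<mu> / 2 + c \<longleftrightarrow> x < c)"
  unfolding eventually_at_right_field
  by (rule exI[of _ "2 * \<bar>x - c\<bar>"]) (use assms in \<open>auto simp: abs_if split: if_splits\<close>)

text \<open>The weak form of the energy equation is the balance law of the second moment; since \<open>\<phi>\<close>
  vanishes near the initial line, the initial data do not enter.\<close>

lemma separating_conserves_energy:
  assumes le: "u0 \<le> s" "s \<le> u1"
    and N: "\<forall>\<^sub>F \<mu> in at_right 0. \<mu> > 0 \<and> approx_solution (\<rho>0, u0) (\<rho>1, u1) \<xi> \<mu> s (N \<mu>)"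
  shows "locally_conserves_energy N"
  unfolding locally_conserves_energy_def
proof (intro allI impI)
  fix \<phi> assume \<phi>: "test_function {z. snd z > 0} \<phi>"
  obtain \<delta> where \<delta>: "\<delta> > 0" "\<And>x t. t \<le> \<delta> \<Longrightarrow> \<phi> (x, t) = 0"
    by (rule test_function_positive_time[OF \<phi>]) blast
  have "\<forall>\<^sub>F \<mu> in at_right 0. ((\<lambda>\<epsilon>. weak_form \<eta> Q (N \<mu> \<epsilon>) \<phi>) \<longlongrightarrow> 0) (at_right 0)"
    using N
  proof eventually_elim
    case (elim \<mu>)
    obtain ws where 1: "riemann (- \<mu> / 2) (\<rho>0, u0) (\<xi> / \<mu>, s) ws" by (rule riemann_contacts_exist[OF le(1)])
    obtain ws' where 2: "riemann (\<mu> / 2) (\<xi> / \<mu>, s) (\<rho>1, u1) ws'" by (rule riemann_contacts_exist[OF le(2)])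
    have \<mu>: "\<mu> > 0" using elim by simp
    have N: "N \<mu> = profile (\<lambda>x t. (\<rho>0, u0)) (ws @ ws')"
      using two_contacts_approx_iff(1)[OF 1 2 le \<mu>] elim by blast
    from two_contacts_approx_iff(2)[OF 1 2 le \<mu> test_function_mono[OF \<phi>], of 2]
    have "((\<lambda>\<epsilon>. (LBINT t:{0<..}. (LBINT x. moment 2 (N \<mu> \<epsilon> x t) * dt \<phi> x t
          + moment (Suc 2) (N \<mu> \<epsilon> x t) * dx \<phi> x t)) / 2) \<longlongrightarrow> 0 / 2) (at_right 0)"
      using \<delta> by (intro tendsto_divide) (simp_all add: N)
    then show ?case unfolding weak_form_moment by simp
  qed
  then show "iterated_limit (\<lambda>\<mu> \<epsilon>. weak_form \<eta> Q (N \<mu> \<epsilon>) \<phi>) 0"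
    unfolding iterated_limit_def by (intro exI[of _ "\<lambda>\<mu>. 0"]) simp
qed

text \<open>The four fronts converge to three rays, the middle two to the same one. Outside the middle
  state density and velocity are bounded and converge almost everywhere.\<close>

lemma separating_limit:
  assumes \<xi>: "\<xi> > 0" and le: "u0 \<le> s" "s \<le> u1"
    and N: "\<forall>\<^sub>F \<mu> in at_right 0. \<mu> > 0 \<and> approx_solution (\<rho>0, u0) (\<rho>1, u1) \<xi> \<mu> s (N \<mu>)"
  shows "converges_to_delta N
    (\<lambda>x t. if x < u0 * t then (\<rho>0, u0) else if x < s * t then (0, x / t)
       else if x < u1 * t then (0, x / t) else (\<rho>1, u1)) (\<lambda>t. \<xi>) (\<lambda>t. s * t)"
  unfolding converges_to_delta_def
proof (intro allI impI conjI)
  fix \<phi> assume \<phi>0: "test_function {z. snd z > 0} \<phi>"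
  let ?V = "\<lambda>x t. if x < u0 * t then (\<rho>0, u0) else if x < s * t then (0, x / t)
       else if x < u1 * t then (0, x / t) else (\<rho>1, u1)"
  obtain R where \<phi>: "continuous_on UNIV \<phi>" and R: "\<And>z. \<phi> z \<noteq> 0 \<Longrightarrow> \<bar>fst z\<bar> \<le> R \<and> \<bar>snd z\<bar> \<le> R"
    by (rule test_function_props[OF test_function_mono[OF \<phi>0]]) blast
  obtain B where B0: "B \<ge> 0" and B: "\<And>z. \<bar>\<phi> z\<bar> \<le> B" using bounded_test[OF \<phi> R] by blast
  have line: "continuous_on UNIV (\<lambda>x. \<phi> (x, t))" "integrable lborel (\<lambda>x. \<phi> (x, t))"
    "isCont (\<lambda>x. \<phi> (x, t)) c" for t c
    by (rule test_line[OF \<phi> R]; assumption)+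
  have form: "N \<mu> \<epsilon> x t =
    (if x < - \<mu> / 2 + u0 * t then (\<rho>0, u0)
     else if x < - \<mu> / 2 + s * t then (0, (x + \<mu> / 2) / t)
     else if x < \<mu> / 2 + s * t then (\<xi> / \<mu>, s)
     else if x < \<mu> / 2 + u1 * t then (0, (x - \<mu> / 2) / t)
     else (\<rho>1, u1))"
    if "\<mu> > 0 \<and> approx_solution (\<rho>0, u0) (\<rho>1, u1) \<xi> \<mu> s (N \<mu>)" "t > 0" for \<mu> \<epsilon> x t
  proof -
    obtain ws where 1: "riemann (- \<mu> / 2) (\<rho>0, u0) (\<xi> / \<mu>, s) ws" by (rule riemann_contacts_exist[OF le(1)])
    obtain ws' where 2: "riemann (\<mu> / 2) (\<xi> / \<mu>, s) (\<rho>1, u1) ws'" by (rule riemann_contacts_exist[OF le(2)])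
    have "N \<mu> = profile (\<lambda>x t. (\<rho>0, u0)) (ws @ ws')"
      using two_contacts_approx_iff(1)[OF 1 2 le] that(1) by blast
    then show ?thesis using two_contacts_profile[OF 1 2 le that(2)] by simp
  qed
  have lt: "u0 * t \<le> s * t" "s * t \<le> u1 * t" if "t > 0" for t
    using le that by (auto intro: mult_right_mono)
  have ae: "AE x in lborel. x \<noteq> u0 * t \<and> x \<noteq> s * t \<and> x \<noteq> u1 * t" for t
    using AE_lborel_singleton[of "u0 * t"] AE_lborel_singleton[of "s * t"] AE_lborel_singleton[of "u1 * t"]
    by eventually_elim simp
  \<comment> \<open>The density is split into a bounded background \<open>f\<close> and the contribution \<open>h\<close> of the middle
    state, whose height is \<open>\<xi> / \<mu>\<close> on a strip of width \<open>\<mu>\<close>.\<close>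
  define f where "f \<mu> x t = (if x < - \<mu> / 2 + u0 * t then \<rho>0 else if x < \<mu> / 2 + u1 * t then 0 else \<rho>1)" for \<mu> x t
  define h where "h \<mu> t = \<xi> / \<mu> * (LBINT x. indicator {s * t - \<mu> / 2..<s * t + \<mu> / 2} x * \<phi> (x, t))" for \<mu> t
  have fm: "(\<lambda>z. f \<mu> (fst z) (snd z)) \<in> borel_measurable (borel \<Otimes>\<^sub>M borel)" for \<mu>
    unfolding f_def by measurable
  have Vm: "(\<lambda>z. fst (?V (fst z) (snd z))) \<in> borel_measurable (borel \<Otimes>\<^sub>M borel)"
    "(\<lambda>z. snd (?V (fst z) (snd z))) \<in> borel_measurable (borel \<Otimes>\<^sub>M borel)"
    by (simp_all add: if_distrib[of fst] if_distrib[of snd] cong: if_cong)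
  have fK: "\<bar>f \<mu> x t\<bar> \<le> \<bar>\<rho>0\<bar> + \<bar>\<rho>1\<bar>" for \<mu> x t by (auto simp: f_def)
  have flim: "AE x in lborel. ((\<lambda>\<mu>. f \<mu> x t) \<longlongrightarrow> fst (?V x t)) (at_right 0)" if t: "t > 0" for t
    using ae[of t]
  proof eventually_elim
    case (elim x)
    have n: "x \<noteq> u0 * t" "x \<noteq> u1 * t" using elim by auto
    have "\<forall>\<^sub>F \<mu> in at_right 0. f \<mu> x t = fst (?V x t)"
      using front_switch[OF n(1)] front_switch[OF n(2)]
      by eventually_elim (use lt[OF t] in \<open>auto simp: f_def\<close>)
    then show ?case by (rule tendsto_eventually)
  qed
  have F: "((\<lambda>\<mu>. LBINT t:{0<..}. (LBINT x. f \<mu> x t * \<phi> (x, t))) \<longlongrightarrow>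
       (LBINT t:{0<..}. (LBINT x. fst (?V x t) * \<phi> (x, t)))) (at_right 0)"
    "\<forall>\<^sub>F \<mu> in at_right 0. set_integrable lborel {0<..} (\<lambda>t. LBINT x. f \<mu> x t * \<phi> (x, t))"
    by (rule tendsto_field_integral[OF \<phi> R always_eventually[OF allI[OF fm]] Vm(1)
      always_eventually[OF allI[OF allI[OF allI[OF impI[OF fK]]]]] flim]; assumption)+
  have strip: "integrable lborel (\<lambda>x. indicator {p..<q} x * \<phi> (x, t))" for p q t
    by (rule integrable_indicator_mult[OF line(2)]) simp
  have hb: "\<bar>h \<mu> t\<bar> \<le> (\<xi> * B) * indicator {-R..R} t" if "\<mu> > 0" for \<mu> t
  proof (cases "\<bar>t\<bar> \<le> R")
    case True
    have "\<bar>LBINT x. indicator {s * t - \<mu> / 2..<s * t + \<mu> / 2} x * \<phi> (x, t)\<bar>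
        \<le> (LBINT x. \<bar>indicator {s * t - \<mu> / 2..<s * t + \<mu> / 2} x * \<phi> (x, t)\<bar>)" by (rule integral_abs_bound)
    also have "\<dots> \<le> (LBINT x. B * indicator {s * t - \<mu> / 2..<s * t + \<mu> / 2} x)"
      by (rule integral_mono[OF integrable_abs[OF strip] integrable_mult_indicator_bounded])
        (use B in \<open>auto simp: indicator_def\<close>)
    also have "\<dots> = B * \<mu>" using that by (simp add: measure_def)
    finally have "\<bar>h \<mu> t\<bar> \<le> \<xi> / \<mu> * (B * \<mu>)"
      unfolding h_def abs_mult using \<xi> that by (intro mult_mono) auto
    then show ?thesis using that True by (simp add: abs_le_iff)
  next
    case False
    then have "\<phi> (x, t) = 0" for x using R[of "(x, t)"] by force
    then show ?thesis using \<xi> B0 by (simp add: h_def)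
  qed
  have hm: "(\<lambda>t. indicator {0<..} t * h \<mu> t) \<in> borel_measurable borel" for \<mu>
  proof -
    have "(\<lambda>z. indicator {s * snd z - \<mu> / 2..<s * snd z + \<mu> / 2} (fst z) :: real)
      = (\<lambda>z. if s * snd z - \<mu> / 2 \<le> fst z \<and> fst z < s * snd z + \<mu> / 2 then 1 else 0)"
      by (auto simp: indicator_def fun_eq_iff)
    then have "(\<lambda>z. indicator {s * snd z - \<mu> / 2..<s * snd z + \<mu> / 2} (fst z) :: real)
        \<in> borel_measurable (borel \<Otimes>\<^sub>M borel)" by simp
    from measurable_field_integral[OF \<phi> this[folded split_beta]] show ?thesis unfolding h_def by simp
  qed
  have hlim: "((\<lambda>\<mu>. h \<mu> t) \<longlongrightarrow> \<xi> * \<phi> (s * t, t)) (at_right 0)" for t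
  proof -
    have "((\<lambda>\<mu>. \<xi> / \<mu> * (LBINT x. indicator {s * t - \<mu> / 2..<s * t} x * \<phi> (x, t))
        + \<xi> / \<mu> * (LBINT x. indicator {s * t..<s * t + \<mu> / 2} x * \<phi> (x, t))) \<longlongrightarrow> \<xi> * \<phi> (s * t, t)) (at_right 0)"
    proof (rule tendsto_integral_strips[OF line(2) line(3), where K = \<xi>])
      show "\<forall>\<^sub>F \<mu> in at_right 0. 0 \<le> \<mu> / (2::real)"
        using eventually_at_right_less[of 0] by eventually_elim simp
      show "((\<lambda>\<mu>. \<mu> / 2) \<longlongrightarrow> 0) (at_right (0::real))"
        by (auto intro!: tendsto_eq_intros)
      have "\<forall>\<^sub>F \<mu> in at_right 0. \<mu> / 2 * (\<xi> / \<mu> + \<xi> / \<mu>) = \<xi>"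
        using eventually_at_right_less[of 0] by eventually_elim simp
      then show "((\<lambda>\<mu>. \<mu> / 2 * (\<xi> / \<mu> + \<xi> / \<mu>)) \<longlongrightarrow> \<xi>) (at_right 0)" by (rule tendsto_eventually)
      show "\<forall>\<^sub>F \<mu> in at_right 0. \<mu> / 2 * (\<bar>\<xi> / \<mu>\<bar> + \<bar>\<xi> / \<mu>\<bar>) \<le> \<xi>"
        using eventually_at_right_less[of 0] by eventually_elim (use \<xi> in simp)
    qed
    moreover have "\<forall>\<^sub>F \<mu> in at_right 0. \<xi> / \<mu> * (LBINT x. indicator {s * t - \<mu> / 2..<s * t} x * \<phi> (x, t))
        + \<xi> / \<mu> * (LBINT x. indicator {s * t..<s * t + \<mu> / 2} x * \<phi> (x, t)) = h \<mu> t"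
      using eventually_at_right_less[of 0]
    proof eventually_elim
      case (elim \<mu>)
      have "indicator {s * t - \<mu> / 2..<s * t} x * \<phi> (x, t) + indicator {s * t..<s * t + \<mu> / 2} x * \<phi> (x, t)
          = indicator {s * t - \<mu> / 2..<s * t + \<mu> / 2} x * \<phi> (x, t)" for x
        using elim by (auto simp: indicator_def)
      then show ?case unfolding h_def distrib_left[symmetric] by (simp add: Bochner_Integration.integral_add[OF strip strip, symmetric])
    qed
    ultimately show ?thesis by (rule Lim_transform_eventually)
  qed
  have hK: "\<forall>\<^sub>F \<mu> in at_right 0. \<forall>t>0. \<bar>h \<mu> t\<bar> \<le> \<xi> * B * indicator {-R..R} t"
    using eventually_at_right_less[of 0] by eventually_elim (use hb in blast)
  note H = tendsto_front_integral[OF always_eventually[OF allI[OF hm]] hK hlim]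
  have split: "(LBINT t:{0<..}. (LBINT x. fst (N \<mu> \<epsilon> x t) * \<phi> (x, t)))
      = (LBINT t:{0<..}. (LBINT x. f \<mu> x t * \<phi> (x, t))) + (LBINT t:{0<..}. h \<mu> t)"
    if N: "\<mu> > 0 \<and> approx_solution (\<rho>0, u0) (\<rho>1, u1) \<xi> \<mu> s (N \<mu>)"
      and i: "set_integrable lborel {0<..} (\<lambda>t. LBINT x. f \<mu> x t * \<phi> (x, t))" "set_integrable lborel {0<..} (h \<mu>)" for \<mu> \<epsilon>
  proof -
    have "(LBINT x. fst (N \<mu> \<epsilon> x t) * \<phi> (x, t)) = (LBINT x. f \<mu> x t * \<phi> (x, t)) + h \<mu> t" if t: "t > 0" for t
    proof -
      have "fst (N \<mu> \<epsilon> x t) * \<phi> (x, t) = f \<mu> x t * \<phi> (x, t)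
          + \<xi> / \<mu> * (indicator {s * t - \<mu> / 2..<s * t + \<mu> / 2} x * \<phi> (x, t))" for x
        unfolding form[OF N t] using lt[OF t] N by (auto simp: f_def indicator_def)
      moreover have fi: "integrable lborel (\<lambda>x. f \<mu> x t * \<phi> (x, t))"
      proof (rule Bochner_Integration.integrable_bound)
        show "integrable lborel (\<lambda>x. (\<bar>\<rho>0\<bar> + \<bar>\<rho>1\<bar>) * \<phi> (x, t))"
          by (rule integrable_mult_right[OF line(2)])
        have "(\<lambda>x. f \<mu> x t) \<in> borel_measurable borel" unfolding f_def by measurable
        then show "(\<lambda>x. f \<mu> x t * \<phi> (x, t)) \<in> borel_measurable lborel"
          using borel_measurable_continuous_onI[OF line(1)] by simp
        show "AE x in lborel. norm (f \<mu> x t * \<phi> (x, t)) \<le> norm ((\<bar>\<rho>0\<bar> + \<bar>\<rho>1\<bar>) * \<phi> (x, t))"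
          using fK[of \<mu> _ t] by (auto simp: abs_mult intro!: AE_I2 mult_right_mono)
      qed
      ultimately show ?thesis
        unfolding h_def
        by (simp only: Bochner_Integration.integral_add[OF fi integrable_mult_right[OF strip]] integral_mult_right_zero)
    qed
    then have "(LBINT t:{0<..}. (LBINT x. fst (N \<mu> \<epsilon> x t) * \<phi> (x, t)))
        = (LBINT t:{0<..}. (LBINT x. f \<mu> x t * \<phi> (x, t)) + h \<mu> t)"
      by (intro set_lebesgue_integral_cong) auto
    then show ?thesis using set_integral_add(2)[OF i] by simp
  qed
  show "iterated_limit (\<lambda>\<mu> \<epsilon>. LBINT t:{0<..}. (LBINT x. fst (N \<mu> \<epsilon> x t) * \<phi> (x, t)))
       ((LBINT t:{0<..}. (LBINT x. fst (?V x t) * \<phi> (x, t))) + (LBINT t:{0<..}. \<xi> * \<phi> (s * t, t)))"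
    unfolding iterated_limit_def
  proof (intro exI conjI)
    show "((\<lambda>\<mu>. (LBINT t:{0<..}. (LBINT x. f \<mu> x t * \<phi> (x, t))) + (LBINT t:{0<..}. h \<mu> t)) \<longlongrightarrow>
       (LBINT t:{0<..}. (LBINT x. fst (?V x t) * \<phi> (x, t))) + (LBINT t:{0<..}. \<xi> * \<phi> (s * t, t))) (at_right 0)"
      by (rule tendsto_add[OF F(1) H(1)])
    show "\<forall>\<^sub>F \<mu> in at_right 0. ((\<lambda>\<epsilon>. LBINT t:{0<..}. (LBINT x. fst (N \<mu> \<epsilon> x t) * \<phi> (x, t)))
        \<longlongrightarrow> (LBINT t:{0<..}. (LBINT x. f \<mu> x t * \<phi> (x, t))) + (LBINT t:{0<..}. h \<mu> t)) (at_right 0)"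
      using N F(2) H(2) by eventually_elim (simp add: split)
  qed
  \<comment> \<open>All velocities in the wave fan lie between the outer ones.\<close>
  define g where "g \<mu> x t = (if x < - \<mu> / 2 + u0 * t then u0
     else if x < - \<mu> / 2 + s * t then (x + \<mu> / 2) / t
     else if x < \<mu> / 2 + s * t then s
     else if x < \<mu> / 2 + u1 * t then (x - \<mu> / 2) / t else u1)" for \<mu> x t
  have gm: "(\<lambda>z. g \<mu> (fst z) (snd z)) \<in> borel_measurable (borel \<Otimes>\<^sub>M borel)" for \<mu>
    unfolding g_def by measurable
  have gK: "\<bar>g \<mu> x t\<bar> \<le> \<bar>u0\<bar> + \<bar>u1\<bar>" if t: "t > 0" for \<mu> x t
  proof -
    have 1: "(x + \<mu> / 2) / t \<ge> u0" if "\<not> x < - \<mu> / 2 + u0 * t"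
      using that t by (simp add: pos_le_divide_eq)
    have 2: "(x + \<mu> / 2) / t < s" if "x < - \<mu> / 2 + s * t"
      using that t by (simp add: pos_divide_less_eq)
    have 3: "(x - \<mu> / 2) / t \<ge> s" if "\<not> x < \<mu> / 2 + s * t"
      using that t by (simp add: pos_le_divide_eq)
    have 4: "(x - \<mu> / 2) / t < u1" if "x < \<mu> / 2 + u1 * t"
      using that t by (simp add: pos_divide_less_eq)
    consider "x < - \<mu> / 2 + u0 * t" | "\<not> x < - \<mu> / 2 + u0 * t" "x < - \<mu> / 2 + s * t"
      | "\<not> x < - \<mu> / 2 + u0 * t" "\<not> x < - \<mu> / 2 + s * t" "x < \<mu> / 2 + s * t"
      | "\<not> x < - \<mu> / 2 + u0 * t" "\<not> x < - \<mu> / 2 + s * t" "\<not> x < \<mu> / 2 + s * t" "x < \<mu> / 2 + u1 * t"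
      | "\<not> x < - \<mu> / 2 + u0 * t" "\<not> x < - \<mu> / 2 + s * t" "\<not> x < \<mu> / 2 + s * t" "\<not> x < \<mu> / 2 + u1 * t"
      by blast
    then have "u0 \<le> g \<mu> x t \<and> g \<mu> x t \<le> u1"
      by cases (use 1 2 3 4 le in \<open>simp_all add: g_def\<close>)
    then show ?thesis by linarith
  qed
  have glim: "AE x in lborel. ((\<lambda>\<mu>. g \<mu> x t) \<longlongrightarrow> snd (?V x t)) (at_right 0)" if t: "t > 0" for t
    using ae[of t]
  proof eventually_elim
    case (elim x)
    have n: "x \<noteq> u0 * t" "x \<noteq> s * t" "x \<noteq> u1 * t" using elim by auto
    define q where "q \<mu> = (if x < u0 * t then u0 else if x < s * t then (x + \<mu> / 2) / t
       else if x < u1 * t then (x - \<mu> / 2) / t else u1)" for \<mu>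
    have "((\<lambda>\<mu>. (x + \<mu> / 2) / t) \<longlongrightarrow> (x + 0 / 2) / t) (at_right 0)"
      "((\<lambda>\<mu>. (x - \<mu> / 2) / t) \<longlongrightarrow> (x - 0 / 2) / t) (at_right 0)"
      by (intro tendsto_intros; use t in simp)+
    then have "(q \<longlongrightarrow> snd (?V x t)) (at_right 0)" unfolding q_def
      by (cases "x < u0 * t"; cases "x < s * t"; cases "x < u1 * t") simp_all
    moreover have "\<forall>\<^sub>F \<mu> in at_right 0. q \<mu> = g \<mu> x t"
      using front_switch[OF n(1)] front_switch[OF n(2)] front_switch[OF n(3)]
      by eventually_elim (use lt[OF t] in \<open>auto simp: g_def q_def\<close>)
    ultimately show ?case by (rule Lim_transform_eventually)
  qed
  have G: "((\<lambda>\<mu>. LBINT t:{0<..}. (LBINT x. g \<mu> x t * \<phi> (x, t))) \<longlongrightarrow>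
       (LBINT t:{0<..}. (LBINT x. snd (?V x t) * \<phi> (x, t)))) (at_right 0)"
    "\<forall>\<^sub>F \<mu> in at_right 0. set_integrable lborel {0<..} (\<lambda>t. LBINT x. g \<mu> x t * \<phi> (x, t))"
    by (rule tendsto_field_integral[OF \<phi> R always_eventually[OF allI[OF gm]] Vm(2)
      always_eventually[OF allI[OF allI[OF allI[OF impI[OF gK]]]]] glim]; assumption)+
  show "iterated_limit (\<lambda>\<mu> \<epsilon>. LBINT t:{0<..}. (LBINT x. snd (N \<mu> \<epsilon> x t) * \<phi> (x, t)))
       (LBINT t:{0<..}. (LBINT x. snd (?V x t) * \<phi> (x, t)))"
    unfolding iterated_limit_def
  proof (intro exI conjI)
    show "((\<lambda>\<mu>. LBINT t:{0<..}. (LBINT x. g \<mu> x t * \<phi> (x, t))) \<longlongrightarrow>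
       (LBINT t:{0<..}. (LBINT x. snd (?V x t) * \<phi> (x, t)))) (at_right 0)" by (rule G(1))
    show "\<forall>\<^sub>F \<mu> in at_right 0. ((\<lambda>\<epsilon>. LBINT t:{0<..}. (LBINT x. snd (N \<mu> \<epsilon> x t) * \<phi> (x, t)))
        \<longlongrightarrow> (LBINT t:{0<..}. (LBINT x. g \<mu> x t * \<phi> (x, t)))) (at_right 0)"
      using N
    proof eventually_elim
      case (elim \<mu>)
      have "snd (N \<mu> \<epsilon> x t) = g \<mu> x t" if "t > 0" for \<epsilon> x t
        unfolding form[OF elim that] g_def by simp
      then have "(LBINT t:{0<..}. (LBINT x. snd (N \<mu> \<epsilon> x t) * \<phi> (x, t))) = (LBINT t:{0<..}. (LBINT x. g \<mu> x t * \<phi> (x, t)))" for \<epsilon>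
        by (intro set_lebesgue_integral_cong) auto
      then show ?case by simp
    qed
  qed
qed

section \<open>The trajectory of the merged shadow wave\<close>

text \<open>Two colliding streams with the middle velocity of least dissipation. In the frame moving with
  the middle state, \<open>\<alpha> t\<close> and \<open>\<beta> t\<close> are the distances by which the two streams, if they moved freely,
  would have passed the centre. The position \<open>z t\<close> of the merged wave is determined by the
  conservation of the centre of mass, \<open>(\<rho>1 - \<rho>0) z\<^sup>2 / 2 + P z = S\<close>; it is written in the form that
  remains valid for \<open>\<rho>0 = \<rho>1\<close>. The mass on the front is the square root \<open>m t\<close> of the
  discriminant.\<close>

locale colliding =
  fixes \<rho>0 \<rho>1 \<xi> \<mu> u0 u1 :: real
  assumes pos: "\<rho>0 > 0" "\<rho>1 > 0" "\<xi> > 0" "\<mu> > 0" and u: "u0 > u1"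
begin

definition "M = \<xi> / \<mu>"
definition "v = y_mu (\<rho>0, u0) (\<rho>1, u1) \<xi> \<mu>"
definition "s0 = (sqrt \<rho>0 * u0 + sqrt M * v) / (sqrt \<rho>0 + sqrt M)"
definition "s1 = (sqrt M * v + sqrt \<rho>1 * u1) / (sqrt M + sqrt \<rho>1)"
definition "rel = s0 - v"
definition "T = \<mu> / (2 * rel)"
definition "\<alpha> t = (u0 - v) * t - \<mu> / 2"
definition "\<beta> t = (v - u1) * t - \<mu> / 2"
definition "P t = \<xi> + \<rho>0 * \<alpha> t + \<rho>1 * \<beta> t"
definition "S t = (\<rho>0 * (\<alpha> t)\<^sup>2 - \<rho>1 * (\<beta> t)\<^sup>2) / 2"
definition "m t = sqrt ((P t)\<^sup>2 + 2 * (\<rho>1 - \<rho>0) * S t)"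
definition "z t = 2 * S t / (P t + m t)"
definition "c t = v * t + z t"
definition "dP = \<rho>0 * (u0 - v) + \<rho>1 * (v - u1)"
definition "dS t = \<rho>0 * \<alpha> t * (u0 - v) - \<rho>1 * \<beta> t * (v - u1)"
definition "dz t = (dS t - dP * z t) / m t"

abbreviation "ra \<equiv> sqrt \<rho>0"
abbreviation "rk \<equiv> sqrt M"
abbreviation "re \<equiv> sqrt \<rho>1"

lemma roots: "ra > 0" "rk > 0" "re > 0" "\<rho>0 = ra\<^sup>2" "\<rho>1 = re\<^sup>2" "\<xi> = rk\<^sup>2 * \<mu>" "M > 0" "M = rk\<^sup>2"
  using pos by (auto simp: M_def)

text \<open>Relative to the middle state the two shadow waves move with opposite velocities; this is the
  condition of least dissipation, and it makes the waves meet at the centre.\<close>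

lemma relative_velocities:
  shows "u0 - v = rel * (ra + rk) / ra" "v - u1 = rel * (re + rk) / re" "rel > 0"
    "s0 = v + rel" "s1 = v - rel"
proof -
  define p where "p = ra * rk / (rk + ra)"
  define q where "q = re * rk / (rk + re)"
  note r = roots
  have pq: "p > 0" "q > 0" using r(1-3)
    by (auto simp: p_def q_def intro!: divide_pos_pos mult_pos_pos add_pos_pos)
  have "sqrt (\<rho>0 * M / (rk + ra)\<^sup>2) = p" "sqrt (\<rho>1 * M / (rk + re)\<^sup>2) = q"
    using r(1-3) by (simp_all add: p_def q_def real_sqrt_mult real_sqrt_divide)
  then have v: "v = (u0 * p + u1 * q) / (p + q)"
    unfolding v_def y_mu_def Let_def M_def[symmetric] by simp
  have up: "u0 - v = q * ((u0 - u1) / (p + q))" "v - u1 = p * ((u0 - u1) / (p + q))"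
    unfolding v using pq by (simp_all add: field_simps)
  define d where "d = (u0 - u1) / (p + q)"
  have d: "d > 0" using pq u by (simp add: d_def)
  have rel: "rel = ra * (u0 - v) / (ra + rk)" and rel': "v - s1 = re * (v - u1) / (re + rk)"
  proof -
    have "(a * x + k * y) / (a + k) - y = a * (x - y) / (a + k)" "y - (k * y + a * x) / (k + a) = a * (y - x) / (a + k)"
      if "a > 0" "k > 0" for a k x y :: real
    proof -
      have "a + k \<noteq> 0" "k + a \<noteq> 0" using that by auto
      then show "(a * x + k * y) / (a + k) - y = a * (x - y) / (a + k)"
        "y - (k * y + a * x) / (k + a) = a * (y - x) / (a + k)" by (simp_all add: field_simps)
    qed
    then show "rel = ra * (u0 - v) / (ra + rk)" "v - s1 = re * (v - u1) / (re + rk)"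
      using r(1-3) unfolding rel_def s0_def s1_def by blast+
  qed
  have pk: "ra / (ra + rk) = p / rk" and qk: "re / (re + rk) = q / rk"
    using r(2) by (simp_all add: p_def q_def add.commute)
  have reld: "rel = p * q * d / rk"
  proof -
    have "rel = ra / (ra + rk) * (q * d)" unfolding rel up(1) d_def by simp
    then show ?thesis unfolding pk by simp
  qed
  have "v - s1 = p * q * d / rk"
  proof -
    have "v - s1 = re / (re + rk) * (p * d)" unfolding rel' up(2) d_def by simp
    then show ?thesis unfolding qk by simp
  qed
  then show "s0 = v + rel" "s1 = v - rel" using reld by (auto simp: rel_def)
  show "rel > 0" using reld pq d r by simp
  have c: "w = x * w / y * y / x" if "x > 0" "y > 0" for w x y :: real using that by simp
  have sums: "ra + rk > 0" "re + rk > 0" using r(1-3) by (auto intro: add_pos_pos)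
  show "u0 - v = rel * (ra + rk) / ra" unfolding rel by (rule c[OF r(1) sums(1)])
  have "rel = re * (v - u1) / (re + rk)" using rel' \<open>s1 = v - rel\<close> by simp
  then show "v - u1 = rel * (re + rk) / re" using c[OF r(3) sums(2), of "v - u1"] by simp
qed

lemma T_pos: "T > 0" using relative_velocities(3) pos by (simp add: T_def)

lemma rel_T: "rel * T = \<mu> / 2" using relative_velocities(3) by (simp add: T_def)

lemma meeting_point: "- \<mu> / 2 + s0 * T = v * T" "\<mu> / 2 + s1 * T = v * T"
  using rel_T unfolding relative_velocities(4,5) by (simp_all add: algebra_simps)

lemma meeting_distances: "\<alpha> T = rk * \<mu> / (2 * ra)" "\<beta> T = rk * \<mu> / (2 * re)"
proof -
  have "(u0 - v) * T = (rel * T) * (ra + rk) / ra" "(v - u1) * T = (rel * T) * (re + rk) / re"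
    using relative_velocities(1,2) by simp_all
  moreover have "\<mu> / 2 * (a + rk) / a - \<mu> / 2 = rk * \<mu> / (2 * a)" if "a > 0" for a
    using that by (simp add: field_simps)
  ultimately show "\<alpha> T = rk * \<mu> / (2 * ra)" "\<beta> T = rk * \<mu> / (2 * re)"
    unfolding \<alpha>_def \<beta>_def rel_T using roots(1,3) by simp_all
qed

lemma v_between: "u1 < v" "v < u0"
proof -
  have "rel * (ra + rk) / ra > 0" "rel * (re + rk) / re > 0"
    using relative_velocities(3) roots by (simp_all add: add_pos_pos)
  then show "u1 < v" "v < u0" using relative_velocities(1,2) by linarith+
qed

lemma distances_pos:
  assumes "t \<ge> T"
  shows "\<alpha> t > 0" "\<beta> t > 0"
proof -
  have "\<alpha> t \<ge> \<alpha> T" "\<beta> t \<ge> \<beta> T"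
    using assms v_between by (auto simp: \<alpha>_def \<beta>_def intro!: mult_left_mono)
  moreover have "\<alpha> T > 0" "\<beta> T > 0" using meeting_distances roots pos by simp_all
  ultimately show "\<alpha> t > 0" "\<beta> t > 0" by linarith+
qed

lemma S_at_T: "S T = 0" "z T = 0"
proof -
  show "S T = 0" unfolding S_def meeting_distances using roots
    by (simp add: power_divide power_mult_distrib)
  then show "z T = 0" by (simp add: z_def)
qed

text \<open>After the collision all terms on the right are nonnegative and \<open>\<xi>\<^sup>2 > 0\<close>, so the front
  always carries mass.\<close>

lemma discriminant:
  "(P t)\<^sup>2 + 2 * (\<rho>1 - \<rho>0) * S t = \<xi>\<^sup>2 + 2 * \<xi> * (\<rho>0 * \<alpha> t + \<rho>1 * \<beta> t) + \<rho>0 * \<rho>1 * (\<alpha> t + \<beta> t)\<^sup>2"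
  unfolding P_def S_def by (simp add: power2_eq_square field_simps)

lemma mass_pos:
  assumes "t \<ge> T"
  shows "(P t)\<^sup>2 + 2 * (\<rho>1 - \<rho>0) * S t > 0" "m t > 0" "P t > 0" "(m t)\<^sup>2 = (P t)\<^sup>2 + 2 * (\<rho>1 - \<rho>0) * S t"
proof -
  have ab: "\<rho>0 * \<alpha> t > 0" "\<rho>1 * \<beta> t > 0" using distances_pos[OF assms] pos by simp_all
  show "P t > 0" using ab pos by (simp add: P_def)
  have "2 * \<xi> * (\<rho>0 * \<alpha> t + \<rho>1 * \<beta> t) > 0" "\<rho>0 * \<rho>1 * (\<alpha> t + \<beta> t)\<^sup>2 \<ge> 0" "\<xi>\<^sup>2 > 0"
    using ab pos by (simp_all add: add_pos_pos)
  then show *: "(P t)\<^sup>2 + 2 * (\<rho>1 - \<rho>0) * S t > 0" unfolding discriminant by linarith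
  then show "m t > 0" "(m t)\<^sup>2 = (P t)\<^sup>2 + 2 * (\<rho>1 - \<rho>0) * S t" by (simp_all add: m_def)
qed

text \<open>The first equation says that the front carries the initial mass and what it has swept up
  from both sides; the second is the conservation of the centre of mass.\<close>

lemma centre_of_mass:
  assumes "t \<ge> T"
  shows "P t + (\<rho>1 - \<rho>0) * z t = m t" "(\<rho>1 - \<rho>0) * (z t)\<^sup>2 / 2 + P t * z t = S t"
proof -
  note mp = mass_pos[OF assms]
  have z: "z t * (P t + m t) = 2 * S t" using mp by (simp add: z_def)
  have "(\<rho>1 - \<rho>0) * z t * (P t + m t) = (m t - P t) * (P t + m t)"
  proof -
    have "(\<rho>1 - \<rho>0) * z t * (P t + m t) = (\<rho>1 - \<rho>0) * (2 * S t)" using z by (simp only: mult.assoc)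
    also have "\<dots> = (m t)\<^sup>2 - (P t)\<^sup>2" using mp(4) by simp
    finally show ?thesis by (simp add: power2_eq_square algebra_simps)
  qed
  then have d: "(\<rho>1 - \<rho>0) * z t = m t - P t" using mp by simp
  then show "P t + (\<rho>1 - \<rho>0) * z t = m t" by simp
  have "(\<rho>1 - \<rho>0) * (z t)\<^sup>2 / 2 + P t * z t = z t * ((\<rho>1 - \<rho>0) * z t / 2 + P t)"
    by (simp add: power2_eq_square algebra_simps)
  also have "\<dots> = z t * (P t + m t) / 2" unfolding d by (simp add: field_simps)
  finally show "(\<rho>1 - \<rho>0) * (z t)\<^sup>2 / 2 + P t * z t = S t" using z by simp
qed

lemma P_deriv: "(P has_real_derivative dP) (at t)"
  unfolding P_def \<alpha>_def \<beta>_def dP_def by (auto intro!: derivative_eq_intros)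

lemma S_deriv: "(S has_real_derivative dS t) (at t)"
  unfolding S_def \<alpha>_def \<beta>_def dS_def by (auto intro!: derivative_eq_intros simp: field_simps power2_eq_square)

lemma P_cont: "continuous_on A P" and S_cont: "continuous_on A S"
  using P_deriv S_deriv by (auto intro!: continuous_at_imp_continuous_on DERIV_isCont)

lemma m_cont: "continuous_on {T..} m"
  unfolding m_def by (intro continuous_intros P_cont S_cont)

lemma z_cont: "continuous_on {T..} z"
  unfolding z_def using mass_pos by (intro continuous_intros P_cont S_cont m_cont) (force simp: add_pos_pos)

text \<open>Differentiability follows from the explicit formula, but the value of the derivative is read
  off from the centre of mass relation.\<close>

lemma z_deriv:
  assumes "t > T"
  shows "(z has_real_derivative dz t) (at t)"
proof -
  have mp: "(P t)\<^sup>2 + 2 * (\<rho>1 - \<rho>0) * S t > 0" "m t > 0" "P t > 0" using mass_pos assms by auto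
  have "((\<lambda>t. (P t)\<^sup>2 + 2 * (\<rho>1 - \<rho>0) * S t) has_real_derivative
      2 * P t * dP + 2 * (\<rho>1 - \<rho>0) * dS t) (at t)"
    by (auto intro!: derivative_eq_intros P_deriv S_deriv)
  from DERIV_chain2[OF DERIV_real_sqrt[OF mp(1)] this] obtain m' where m': "(m has_real_derivative m') (at t)" unfolding m_def[abs_def] by blast
  have "((\<lambda>t. 2 * S t / (P t + m t)) has_real_derivative
      ((2 * dS t) * (P t + m t) - (2 * S t) * (dP + m')) / ((P t + m t) * (P t + m t))) (at t)"
    using mp by (intro DERIV_divide DERIV_cmult S_deriv DERIV_add P_deriv m') simp
  then obtain z' where z': "(z has_real_derivative z') (at t)" unfolding z_def[abs_def] by blast
  have "((\<lambda>t. (\<rho>1 - \<rho>0) * (z t)\<^sup>2 / 2 + P t * z t) has_real_derivative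
      ((\<rho>1 - \<rho>0) * z t * z' + (dP * z t + z' * P t))) (at t)"
    by (auto intro!: derivative_eq_intros z' P_deriv)
  moreover have "((\<lambda>t. (\<rho>1 - \<rho>0) * (z t)\<^sup>2 / 2 + P t * z t) has_real_derivative dS t) (at t)"
    by (rule has_field_derivative_transform_within_open[OF S_deriv, of "{T<..}"])
      (use assms centre_of_mass(2) in auto)
  ultimately have "(\<rho>1 - \<rho>0) * z t * z' + (dP * z t + z' * P t) = dS t" by (rule DERIV_unique)
  then have "(P t + (\<rho>1 - \<rho>0) * z t) * z' = dS t - dP * z t" by (simp add: algebra_simps)
  then have "m t * z' = dS t - dP * z t" using centre_of_mass(1) assms by simp
  then have "z' = dz t" using mp by (simp add: dz_def field_simps)
  then show ?thesis using z' by simp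
qed

lemma c_deriv: "t > T \<Longrightarrow> (c has_real_derivative v + dz t) (at t)" "t > T \<Longrightarrow> deriv c t = v + dz t"
proof -
  show "(c has_real_derivative v + dz t) (at t)" if "t > T"
    unfolding c_def[abs_def] by (auto intro!: derivative_eq_intros z_deriv[OF that])
  then show "deriv c t = v + dz t" if "t > T" using that by (auto intro: DERIV_imp_deriv)
qed

lemma c_cont: "continuous_on {T..} c"
  unfolding c_def by (intro continuous_intros z_cont)

lemma dz_cont: "continuous_on {T..} dz"
  unfolding dz_def dS_def \<alpha>_def \<beta>_def using mass_pos(2)
  by (intro continuous_intros z_cont m_cont) force

lemma mass_balance:
  assumes "t > T"
  shows "(m has_real_derivative (\<rho>0 * u0 - \<rho>1 * u1) - (\<rho>0 - \<rho>1) * (v + dz t)) (at t)"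
proof -
  have "((\<lambda>t. P t + (\<rho>1 - \<rho>0) * z t) has_real_derivative dP + (\<rho>1 - \<rho>0) * dz t) (at t)"
    by (intro DERIV_add P_deriv DERIV_cmult z_deriv assms)
  moreover have "dP + (\<rho>1 - \<rho>0) * dz t = (\<rho>0 * u0 - \<rho>1 * u1) - (\<rho>0 - \<rho>1) * (v + dz t)"
    by (simp add: dP_def algebra_simps)
  ultimately show ?thesis
    using has_field_derivative_transform_within_open[of "\<lambda>t. P t + (\<rho>1 - \<rho>0) * z t" _ t "{T<..}" m]
      centre_of_mass(1) assms by simp
qed

text \<open>The momentum on the front, in a form that is continuous up to time \<open>T\<close>; \<open>momentum_eq\<close>
  identifies it as mass times speed.\<close>

definition "momentum t = m t * v + dS t - dP * z t"

lemma momentum_eq: "t \<ge> T \<Longrightarrow> momentum t = m t * (v + dz t)"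
  using mass_pos(2)[of t] by (simp add: momentum_def dz_def field_simps)

lemma momentum_balance:
  assumes "t > T"
  shows "(momentum has_real_derivative (\<rho>0 * u0\<^sup>2 - \<rho>1 * u1\<^sup>2) - (\<rho>0 * u0 - \<rho>1 * u1) * (v + dz t)) (at t)"
proof -
  have dS: "(dS has_real_derivative \<rho>0 * (u0 - v)\<^sup>2 - \<rho>1 * (v - u1)\<^sup>2) (at t)"
    unfolding dS_def \<alpha>_def \<beta>_def by (auto intro!: derivative_eq_intros simp: power2_eq_square)
  have "(momentum has_real_derivative ((\<rho>0 * u0 - \<rho>1 * u1) - (\<rho>0 - \<rho>1) * (v + dz t)) * v
      + (\<rho>0 * (u0 - v)\<^sup>2 - \<rho>1 * (v - u1)\<^sup>2) - dP * dz t) (at t)"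
    unfolding momentum_def[abs_def]
    by (intro DERIV_diff DERIV_add DERIV_cmult_right DERIV_cmult mass_balance dS z_deriv assms)
  moreover have "((\<rho>0 * u0 - \<rho>1 * u1) - (\<rho>0 - \<rho>1) * (v + dz t)) * v
      + (\<rho>0 * (u0 - v)\<^sup>2 - \<rho>1 * (v - u1)\<^sup>2) - dP * dz t
    = (\<rho>0 * u0\<^sup>2 - \<rho>1 * u1\<^sup>2) - (\<rho>0 * u0 - \<rho>1 * u1) * (v + dz t)"
    unfolding dP_def by algebra
  ultimately show ?thesis by simp
qed

lemma momentum_cont: "continuous_on {T..} momentum"
  unfolding momentum_def dS_def \<alpha>_def \<beta>_def by (intro continuous_intros z_cont m_cont)

text \<open>The front has not been overtaken by the free streams, so it has swept up nonnegative masses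
  from both sides. The differences are extracted from the quadratic equation by multiplying with
  suitable positive factors.\<close>

lemma front_between:
  assumes "t \<ge> T"
  shows "z t \<le> \<alpha> t" "- \<beta> t \<le> z t"
proof -
  note mp = mass_pos[OF assms] and ab = distances_pos[OF assms] and cm = centre_of_mass[OF assms]
  have e: "(\<rho>1 - \<rho>0) * (z t)\<^sup>2 + 2 * (\<xi> + \<rho>0 * \<alpha> t + \<rho>1 * \<beta> t) * z t = \<rho>0 * (\<alpha> t)\<^sup>2 - \<rho>1 * (\<beta> t)\<^sup>2"
    using cm(2) by (simp add: P_def S_def field_simps)
  have "(\<alpha> t - z t) * (m t + (\<xi> + \<rho>1 * (\<alpha> t + \<beta> t))) = 2 * \<xi> * \<alpha> t + \<rho>1 * (\<alpha> t + \<beta> t)\<^sup>2"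
    unfolding cm(1)[symmetric] P_def using e by algebra
  moreover have "2 * \<xi> * \<alpha> t + \<rho>1 * (\<alpha> t + \<beta> t)\<^sup>2 \<ge> 0" "m t + (\<xi> + \<rho>1 * (\<alpha> t + \<beta> t)) > 0"
    using mp ab pos by (simp_all add: add_pos_pos)
  ultimately have "\<alpha> t - z t \<ge> 0" by (metis zero_le_mult_iff not_less)
  then show "z t \<le> \<alpha> t" by simp
  have "(z t + \<beta> t) * (m t + (\<xi> + \<rho>0 * (\<alpha> t + \<beta> t))) = 2 * \<xi> * \<beta> t + \<rho>0 * (\<alpha> t + \<beta> t)\<^sup>2"
    unfolding cm(1)[symmetric] P_def using e by algebra
  moreover have "2 * \<xi> * \<beta> t + \<rho>0 * (\<alpha> t + \<beta> t)\<^sup>2 \<ge> 0" "m t + (\<xi> + \<rho>0 * (\<alpha> t + \<beta> t)) > 0"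
    using mp ab pos by (simp_all add: add_pos_pos)
  ultimately have "z t + \<beta> t \<ge> 0" by (metis zero_le_mult_iff not_less)
  then show "- \<beta> t \<le> z t" by simp
qed

text \<open>The merged wave is overcompressive: its velocity is an average of those of the matter it has
  collected.\<close>

lemma speed_between:
  assumes "t \<ge> T"
  shows "u1 \<le> v + dz t" "v + dz t \<le> u0"
proof -
  note mp = mass_pos[OF assms] and fb = front_between[OF assms] and cm = centre_of_mass(1)[OF assms]
  have dz: "m t * dz t = dS t - dP * z t" using mp by (simp add: dz_def)
  have "m t * (u0 - (v + dz t)) = m t * (u0 - v) - (dS t - dP * z t)"
    unfolding dz[symmetric] by (simp add: algebra_simps)
  also have "\<dots> = \<xi> * (u0 - v) + \<rho>1 * (\<beta> t + z t) * (u0 - u1)"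
    unfolding cm[symmetric] P_def dS_def dP_def by algebra
  also have "\<dots> \<ge> 0" using fb v_between u pos by simp
  finally have "u0 - (v + dz t) \<ge> 0" using mp(2) by (simp add: zero_le_mult_iff)
  then show "v + dz t \<le> u0" by simp
  have "m t * ((v + dz t) - u1) = m t * (v - u1) + (dS t - dP * z t)"
    unfolding dz[symmetric] by (simp add: algebra_simps)
  also have "\<dots> = \<xi> * (v - u1) + \<rho>0 * (\<alpha> t - z t) * (u0 - u1)"
    unfolding cm[symmetric] P_def dS_def dP_def by algebra
  also have "\<dots> \<ge> 0" using fb v_between u pos by simp
  finally have "(v + dz t) - u1 \<ge> 0" using mp(2) by (simp add: zero_le_mult_iff)
  then show "u1 \<le> v + dz t" by simp
qed

text \<open>The strengths of the two shadow waves at the meeting time add up to the mass on the merged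
  wave, and likewise for the momenta. Together with the balance laws afterwards this makes the two
  phases fit together.\<close>

lemma merged_moments:
  "T * (sqrt (\<rho>0 * M) * (u0 - v) + sqrt (M * \<rho>1) * (v - u1)) = m T"
  "T * (sqrt (\<rho>0 * M) * (u0 - v) * s0 + sqrt (M * \<rho>1) * (v - u1) * s1) = momentum T"
proof -
  note r = roots
  have 0: "T * (sqrt (\<rho>0 * M) * (u0 - v)) = rk * \<mu> * (ra + rk) / 2"
  proof -
    have "T * (sqrt (\<rho>0 * M) * (u0 - v)) = ra * rk * (rel * T) * (ra + rk) / ra"
      unfolding relative_velocities(1) real_sqrt_mult by simp
    then show ?thesis unfolding rel_T using r(1) by simp
  qed
  have 1: "T * (sqrt (M * \<rho>1) * (v - u1)) = rk * \<mu> * (re + rk) / 2"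
  proof -
    have "T * (sqrt (M * \<rho>1) * (v - u1)) = rk * re * (rel * T) * (re + rk) / re"
      unfolding relative_velocities(2) real_sqrt_mult by simp
    then show ?thesis unfolding rel_T using r(3) by simp
  qed
  have mT: "m T = rk * \<mu> * (ra + rk) / 2 + rk * \<mu> * (re + rk) / 2"
  proof -
    have "m T = P T" using mass_pos(3)[of T] by (simp add: m_def S_at_T)
    also have "\<dots> = rk\<^sup>2 * \<mu> + ra\<^sup>2 * (rk * \<mu> / (2 * ra)) + re\<^sup>2 * (rk * \<mu> / (2 * re))"
      unfolding P_def meeting_distances by (simp only: r(4,5,6)[symmetric])
    also have "\<dots> = rk * \<mu> * (ra + rk) / 2 + rk * \<mu> * (re + rk) / 2"
    proof -
      have "k\<^sup>2 * d + a\<^sup>2 * (k * d / (2 * a)) + e\<^sup>2 * (k * d / (2 * e)) = k * d * (a + k) / 2 + k * d * (e + k) / 2"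
        if "a > 0" "e > 0" for a e k d :: real
        using that by (simp add: power2_eq_square field_simps)
      then show ?thesis using r(1,3) by blast
    qed
    finally show ?thesis .
  qed
  show "T * (sqrt (\<rho>0 * M) * (u0 - v) + sqrt (M * \<rho>1) * (v - u1)) = m T"
    unfolding mT distrib_left 0 1 ..
  have "dS T = ra\<^sup>2 * (rk * \<mu> / (2 * ra)) * (rel * (ra + rk) / ra) - re\<^sup>2 * (rk * \<mu> / (2 * re)) * (rel * (re + rk) / re)"
    unfolding dS_def meeting_distances relative_velocities(1,2) by (simp only: r(4,5)[symmetric])
  also have "\<dots> = rel * (rk * \<mu> * (ra + rk) / 2 - rk * \<mu> * (re + rk) / 2)"
  proof -
    have "a\<^sup>2 * (k * d / (2 * a)) * (w * (a + k) / a) - e\<^sup>2 * (k * d / (2 * e)) * (w * (e + k) / e)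
        = w * (k * d * (a + k) / 2 - k * d * (e + k) / 2)"
      if "a > 0" "e > 0" for a e k d w :: real
      using that by (simp add: power2_eq_square field_simps)
    then show ?thesis using r(1,3) by blast
  qed
  finally have dST: "dS T = rel * (rk * \<mu> * (ra + rk) / 2 - rk * \<mu> * (re + rk) / 2)" .
  have "T * (sqrt (\<rho>0 * M) * (u0 - v) * s0 + sqrt (M * \<rho>1) * (v - u1) * s1)
      = T * (sqrt (\<rho>0 * M) * (u0 - v)) * s0 + T * (sqrt (M * \<rho>1) * (v - u1)) * s1"
    by (simp add: algebra_simps)
  also have "\<dots> = m T * v + dS T"
  proof -
    have "X * (v + rel) + Y * (v - rel) = (X + Y) * v + rel * (X - Y)" for X Y
      by (simp add: algebra_simps)
    then show ?thesis unfolding 0 1 mT dST relative_velocities(4,5) .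
  qed
  finally show "T * (sqrt (\<rho>0 * M) * (u0 - v) * s0 + sqrt (M * \<rho>1) * (v - u1) * s1) = momentum T"
    by (simp add: momentum_def S_at_T)
qed

end

section \<open>Collision of two shadow waves\<close>

lemma set_integral_split_at:
  fixes f :: "real \<Rightarrow> real"
  assumes T: "T > 0" and i: "set_integrable lborel {0<..<T} f" "set_integrable lborel {T<..} f"
  shows "(LBINT t:{0<..}. f t) = (LBINT t:{0<..<T}. f t) + (LBINT t:{T<..}. f t)"
proof -
  have i': "integrable lborel (\<lambda>t. indicator {0<..<T} t * f t)" "integrable lborel (\<lambda>t. indicator {T<..} t * f t)"
    using i by (simp_all add: set_integrable_def)
  have "(LBINT t:{0<..}. f t) = (\<integral>t. indicator {0<..<T} t * f t + indicator {T<..} t * f t \<partial>lborel)"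
    unfolding set_lebesgue_integral_def real_scaleR_def
  proof (rule integral_cong_AE)
    have [measurable]: "(\<lambda>t. indicator {0<..<T} t * f t) \<in> borel_measurable lborel"
      "(\<lambda>t. indicator {T<..} t * f t) \<in> borel_measurable lborel" using i' by auto
    show "(\<lambda>t. indicator {0<..<T} t * f t + indicator {T<..} t * f t) \<in> borel_measurable lborel" by measurable
    have "(\<lambda>t. indicator {0<..} t * f t)
        = (\<lambda>t. indicator {0<..<T} t * f t + indicator {T<..} t * f t + indicator {T} t * f T)"
    proof
      fix t :: real
      consider "t \<le> 0" | "0 < t" "t < T" | "t = T" | "T < t" by linarith
      then show "indicator {0<..} t * f t
        = indicator {0<..<T} t * f t + indicator {T<..} t * f t + indicator {T} t * f T"
        by cases (use T in simp_all)
    qed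
    also have "\<dots> \<in> borel_measurable lborel" by measurable
    finally show "(\<lambda>t. indicator {0<..} t * f t) \<in> borel_measurable lborel" .
    show "AE t in lborel. indicator {0<..} t * f t = indicator {0<..<T} t * f t + indicator {T<..} t * f t"
      using AE_lborel_singleton[of T]
    proof eventually_elim
      case (elim t)
      consider "t \<le> 0" | "0 < t" "t < T" | "T < t" using elim by linarith
      then show ?case by cases (use T in simp_all)
    qed
  qed
  also have "\<dots> = (LBINT t:{0<..<T}. f t) + (LBINT t:{T<..}. f t)"
    unfolding set_lebesgue_integral_def real_scaleR_def by (rule Bochner_Integration.integral_add[OF i'])
  finally show ?thesis .
qed

lemma riemann_shadow:
  assumes "riemann a (\<rho>l, ul) (\<rho>r, ur) [(w, V)]" "ul > ur"
  shows "V = (\<lambda>x t. (\<rho>r, ur))" "is_Shadow w"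
    "front w = (\<lambda>t. a + (sqrt \<rho>l * ul + sqrt \<rho>r * ur) / (sqrt \<rho>l + sqrt \<rho>r) * t)"
    "\<And>t. t > 0 \<Longrightarrow> front_moment k w t =
        t * (sqrt (\<rho>l * \<rho>r) * (ul - ur) * ((sqrt \<rho>l * ul + sqrt \<rho>r * ur) / (sqrt \<rho>l + sqrt \<rho>r)) ^ k)"
proof -
  define s where "s = (sqrt \<rho>l * ul + sqrt \<rho>r * ur) / (sqrt \<rho>l + sqrt \<rho>r)"
  from assms(1) have *: "V = (\<lambda>x t. (\<rho>r, ur)) \<and> is_Shadow w \<and> front w = (\<lambda>t. a + s * t) \<and>
      (\<forall>t>0. mass w t = sqrt (\<rho>l * \<rho>r) * (ul - ur) * t)"
  proof (cases rule: riemann_cases)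
    case contacts
    then show ?thesis by simp
  next
    case contact
    then show ?thesis using assms(2) by simp
  next
    case (shadow w')
    then have "w' = w" "V = (\<lambda>x t. (\<rho>r, ur))" by simp_all
    then show ?thesis using shadow(3-5) unfolding s_def by blast
  qed
  then show "V = (\<lambda>x t. (\<rho>r, ur))" "is_Shadow w" by blast+
  from * have f: "front w = (\<lambda>t. a + s * t)" by blast
  then show "front w = (\<lambda>t. a + (sqrt \<rho>l * ul + sqrt \<rho>r * ur) / (sqrt \<rho>l + sqrt \<rho>r) * t)"
    by (simp only: s_def)
  show "front_moment k w t = t * (sqrt (\<rho>l * \<rho>r) * (ul - ur) *
      ((sqrt \<rho>l * ul + sqrt \<rho>r * ur) / (sqrt \<rho>l + sqrt \<rho>r)) ^ k)" if "t > 0" for t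
    using * that unfolding front_moment_def f deriv_affine s_def[symmetric] by simp
qed

text \<open>The moments on the front are written as \<open>t * front_moment k w 1\<close>, since the strength grows
  linearly and is specified for positive times only; this is its continuous extension.\<close>

lemma riemann_shadow_balanced:
  assumes r: "riemann a (\<rho>l, ul) (\<rho>r, ur) [(w, V)]" and u: "ul > ur" and pos: "\<rho>l > 0" "\<rho>r > 0"
    and k: "k \<in> {0, 1}" and s0: "0 \<le> s"
  shows "balanced k s b (\<lambda>w t. t * front_moment k w 1) (\<lambda>x t. (\<rho>l, ul)) [(w, V)]"
proof -
  define s' where "s' = (sqrt \<rho>l * ul + sqrt \<rho>r * ur) / (sqrt \<rho>l + sqrt \<rho>r)"
  note w = riemann_shadow[OF r u, folded s'_def]
  have 1: "front_moment k w 1 = sqrt (\<rho>l * \<rho>r) * (ul - ur) * s' ^ k" using w(4)[of 1 k] by simp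
  have 2: "sqrt (\<rho>l * \<rho>r) * (ul - ur) * s' ^ k
      = (\<rho>l * ul ^ Suc k - \<rho>r * ur ^ Suc k) - (\<rho>l * ul ^ k - \<rho>r * ur ^ k) * s'"
    using k shadow_energy_balance(2,3)[OF pos u, folded s'_def] by (auto simp: power2_eq_square)
  have "front_moment k w t = t * front_moment k w 1" if "t > s" for t
    using w(4)[of t k] that s0 1 by simp
  moreover have "deriv (front w) t = s'" for t unfolding w(3) by (rule deriv_affine)
  moreover have "((\<lambda>t. t * front_moment k w 1) has_real_derivative
      (level (Suc k) (\<lambda>x t. (\<rho>l, ul)) - level (Suc k) V) - (level k (\<lambda>x t. (\<rho>l, ul)) - level k V) * deriv (front w) t) (at t)" for t
    unfolding 1 2 w(1,3) deriv_affine level_state by (auto intro!: derivative_eq_intros)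
  ultimately show ?thesis
    unfolding balanced.simps
    by (auto simp: w(3) C1_differentiable_on_def intro!: continuous_intros derivative_eq_intros)
qed

context colliding
begin

definition "front_mass k = (if k = (0::nat) then m else momentum)"

text \<open>The first phase obeys the conservation laws, so only its state at time \<open>T\<close> enters, where the
  two shadow waves have reached the same point. Of the second phase nothing but admissibility is
  assumed; this serves both the existence and the uniqueness of the merged wave.\<close>

lemma weak_two_phase:
  assumes r: "riemann (- \<mu> / 2) (\<rho>0, u0) (M, v) [(w0, V0)]" "riemann (\<mu> / 2) (M, v) (\<rho>1, u1) [(w1, V1)]"
    and adm: "admissible_on {0..T} (\<lambda>x t. (\<rho>0, u0)) [(w0, V0), (w1, V1)]"
    and adm': "admissible_on {T..} (\<lambda>x t. (\<rho>0, u0)) [(w, V1)]" and w: "is_Shadow w"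
    and N: "\<And>\<epsilon> x t. N \<epsilon> x t = (if t < T then profile (\<lambda>x t. (\<rho>0, u0)) [(w0, V0), (w1, V1)] \<epsilon> x t
        else profile (\<lambda>x t. (\<rho>0, u0)) [(w, V1)] \<epsilon> x t)"
    and \<phi>: "test_function UNIV \<phi>" and k: "k \<in> {0, 1}"
  shows "((\<lambda>\<epsilon>. (LBINT t:{0<..}. (LBINT x. moment k (N \<epsilon> x t) * dt \<phi> x t + moment (Suc k) (N \<epsilon> x t) * dx \<phi> x t))
        + (\<integral>x. moment k (initial_data (\<rho>0, u0) (\<rho>1, u1) \<xi> \<mu> v x) * \<phi> (x, 0) \<partial>lborel))
      \<longlongrightarrow> (\<rho>0 * u0 ^ k - \<rho>1 * u1 ^ k) * (\<integral>x. indicator {..<v * T} x * \<phi> (x, T) \<partial>lborel)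
        + front_mass k T * \<phi> (v * T, T) + \<rho>1 * u1 ^ k * (\<integral>x. \<phi> (x, T) \<partial>lborel)
        + (LBINT t:{T<..}. weak_rate k \<phi> (\<lambda>x t. (\<rho>0, u0)) [(w, V1)] t)) (at_right 0)"
    and "set_integrable lborel {T<..} (weak_rate k \<phi> (\<lambda>x t. (\<rho>0, u0)) [(w, V1)])"
proof -
  let ?U = "\<lambda>x t. (\<rho>0, u0)" and ?ws = "[(w0, V0), (w1, V1)]"
  note vb = v_between and Mpos = roots(7)
  note w0 = riemann_shadow[OF r(1) vb(2), folded s0_def] and w1 = riemann_shadow[OF r(2) vb(1), folded s1_def]
  have rap: "riemann (- \<mu> / 2) (\<rho>0, u0) (\<xi> / \<mu>, v) [(w0, V0)]" "riemann (\<mu> / 2) (\<xi> / \<mu>, v) (\<rho>1, u1) [(w1, V1)]"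
    using r by (simp_all add: M_def)
  have fields: "V' \<in> fields ?U ?ws \<Longrightarrow> simple_field V'" and fields': "V' \<in> fields ?U [(w, V1)] \<Longrightarrow> simple_field V'" for V'
    by (auto simp: w0(1) w1(1))
  have tame: "tame_wave (moment j) {0<..<T} (front_moment j) w'" if "(w', V') \<in> set ?ws" for w' V' j
    using admissible_tame(1)[OF adm that, of j] that w0(2) w1(2) by auto
  have tame': "tame_wave (moment j) {T<..} (front_moment j) w'" if "(w', V') \<in> set [(w, V1)]" for w' V' j
    using admissible_tame(1)[OF adm' that, of j] that w by auto
  have ord: "t \<in> {0<..<T} \<Longrightarrow> ordered t ?ws" and ord': "t \<in> {T<..} \<Longrightarrow> ordered t [(w, V1)]" for t
    using adm by (auto simp: admissible_on_def ordered_def)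
  let ?W = "\<lambda>I ws \<epsilon>. LBINT t:I. (LBINT x. moment k (profile ?U ws \<epsilon> x t) * dt \<phi> x t
        + moment (Suc k) (profile ?U ws \<epsilon> x t) * dx \<phi> x t)"
  have 1: "(?W {0<..<T} ?ws \<longlongrightarrow> (LBINT t:{0<..<T}. weak_rate k \<phi> ?U ?ws t)) (at_right 0)"
    "set_integrable lborel {0<..<T} (weak_rate k \<phi> ?U ?ws)"
    "\<forall>\<^sub>F \<epsilon> in at_right 0. set_integrable lborel {0<..<T} (\<lambda>t. LBINT x. moment k (profile ?U ?ws \<epsilon> x t) * dt \<phi> x t
        + moment (Suc k) (profile ?U ?ws \<epsilon> x t) * dx \<phi> x t)"
    by (rule phase_limit[OF \<phi>]; (erule ord | erule fields | erule tame | simp))+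
  have 2: "(?W {T<..} [(w, V1)] \<longlongrightarrow> (LBINT t:{T<..}. weak_rate k \<phi> ?U [(w, V1)] t)) (at_right 0)"
    "\<forall>\<^sub>F \<epsilon> in at_right 0. set_integrable lborel {T<..} (\<lambda>t. LBINT x. moment k (profile ?U [(w, V1)] \<epsilon> x t) * dt \<phi> x t
        + moment (Suc k) (profile ?U [(w, V1)] \<epsilon> x t) * dx \<phi> x t)"
    and int2: "set_integrable lborel {T<..} (weak_rate k \<phi> ?U [(w, V1)])"
    by (rule phase_limit[OF \<phi>]; (erule ord' | erule fields' | erule tame' | simp))+
  then show "set_integrable lborel {T<..} (weak_rate k \<phi> ?U [(w, V1)])" by blast
  have bal: "balanced k 0 T (\<lambda>w t. t * front_moment k w 1) ?U ?ws"
    using riemann_shadow_balanced[OF r(1) vb(2) pos(1) Mpos k, of 0 T]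
      riemann_shadow_balanced[OF r(2) vb(1) Mpos pos(2) k, of 0 T] by (simp add: w0(1))
  obtain R where c0: "continuous_on UNIV \<phi>" and sp: "\<And>z. \<phi> z \<noteq> 0 \<Longrightarrow> \<bar>fst z\<bar> \<le> R \<and> \<bar>snd z\<bar> \<le> R"
    by (rule test_function_props[OF \<phi>]) blast
  have int0: "integrable lborel (\<lambda>x. \<phi> (x, 0))" by (rule test_line(2)[OF c0 sp])
  have p0: "pairing (moment k) (\<lambda>w. 0 * front_moment k w 1) (\<lambda>x. \<phi> (x, 0)) 0 ?U ?ws
      = (\<integral>x. moment k (initial_data (\<rho>0, u0) (\<rho>1, u1) \<xi> \<mu> v x) * \<phi> (x, 0) \<partial>lborel)"
    using pairing_initial[OF rap pos(4) int0, of k] by simp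
  have fT: "front w0 T = v * T" "front w1 T = v * T"
    using meeting_point by (simp_all add: w0(3) w1(3))
  have moments: "T * front_moment k w0 1 + T * front_moment k w1 1 = front_mass k T"
  proof -
    have "front_moment k w0 1 = sqrt (\<rho>0 * M) * (u0 - v) * s0 ^ k" "front_moment k w1 1 = sqrt (M * \<rho>1) * (v - u1) * s1 ^ k"
      using w0(4)[of 1 k] w1(4)[of 1 k] by simp_all
    then have "T * front_moment k w0 1 + T * front_moment k w1 1
        = T * (sqrt (\<rho>0 * M) * (u0 - v) * s0 ^ k + sqrt (M * \<rho>1) * (v - u1) * s1 ^ k)"
      by (simp only: distrib_left)
    also have "\<dots> = front_mass k T"
      using k merged_moments by (elim insertE emptyE) (simp_all only: front_mass_def power_0 power_one_right mult_1_right if_True one_neq_zero if_False refl)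
    finally show ?thesis .
  qed
  have pT: "pairing (moment k) (\<lambda>w. T * front_moment k w 1) (\<lambda>x. \<phi> (x, T)) T ?U ?ws
      = (\<rho>0 * u0 ^ k - \<rho>1 * u1 ^ k) * (\<integral>x. indicator {..<v * T} x * \<phi> (x, T) \<partial>lborel)
        + front_mass k T * \<phi> (v * T, T) + \<rho>1 * u1 ^ k * (\<integral>x. \<phi> (x, T) \<partial>lborel)"
  proof -
    have "pairing (moment k) (\<lambda>w. T * front_moment k w 1) (\<lambda>x. \<phi> (x, T)) T ?U ?ws =
        (\<rho>0 * u0 ^ k - M * v ^ k) * (\<integral>x. indicator {..<v * T} x * \<phi> (x, T) \<partial>lborel) + T * front_moment k w0 1 * \<phi> (v * T, T)
        + ((M * v ^ k - \<rho>1 * u1 ^ k) * (\<integral>x. indicator {..<v * T} x * \<phi> (x, T) \<partial>lborel) + T * front_moment k w1 1 * \<phi> (v * T, T)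
        + \<rho>1 * u1 ^ k * (\<integral>x. \<phi> (x, T) \<partial>lborel))"
      by (simp add: pairing_simple w0(1) w1(1) level_state fT del: pairing.simps)
    also have "\<dots> = (\<rho>0 * u0 ^ k - \<rho>1 * u1 ^ k) * (\<integral>x. indicator {..<v * T} x * \<phi> (x, T) \<partial>lborel)
        + (T * front_moment k w0 1 + T * front_moment k w1 1) * \<phi> (v * T, T) + \<rho>1 * u1 ^ k * (\<integral>x. \<phi> (x, T) \<partial>lborel)"
      by (simp add: algebra_simps)
    finally show ?thesis unfolding moments .
  qed
  have "(LBINT t:{0<..<T}. weak_rate k \<phi> ?U ?ws t)
      = pairing (moment k) (\<lambda>w. T * front_moment k w 1) (\<lambda>x. \<phi> (x, T)) T ?U ?ws
      - pairing (moment k) (\<lambda>w. 0 * front_moment k w 1) (\<lambda>x. \<phi> (x, 0)) 0 ?U ?ws"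
    by (rule weak_rate_bounded[OF \<phi> less_imp_le[OF T_pos] _ bal 1(2)]) (erule fields)
  note ph1 = this[unfolded p0 pT]
  have "((\<lambda>\<epsilon>. (?W {0<..<T} ?ws \<epsilon> + ?W {T<..} [(w, V1)] \<epsilon>)
      + (\<integral>x. moment k (initial_data (\<rho>0, u0) (\<rho>1, u1) \<xi> \<mu> v x) * \<phi> (x, 0) \<partial>lborel))
    \<longlongrightarrow> ((LBINT t:{0<..<T}. weak_rate k \<phi> ?U ?ws t) + (LBINT t:{T<..}. weak_rate k \<phi> ?U [(w, V1)] t))
      + (\<integral>x. moment k (initial_data (\<rho>0, u0) (\<rho>1, u1) \<xi> \<mu> v x) * \<phi> (x, 0) \<partial>lborel)) (at_right 0)"
    by (intro tendsto_add 1(1) 2(1) tendsto_const)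
  moreover have "\<forall>\<^sub>F \<epsilon> in at_right 0. (?W {0<..<T} ?ws \<epsilon> + ?W {T<..} [(w, V1)] \<epsilon>)
        + (\<integral>x. moment k (initial_data (\<rho>0, u0) (\<rho>1, u1) \<xi> \<mu> v x) * \<phi> (x, 0) \<partial>lborel)
      = (LBINT t:{0<..}. (LBINT x. moment k (N \<epsilon> x t) * dt \<phi> x t + moment (Suc k) (N \<epsilon> x t) * dx \<phi> x t))
        + (\<integral>x. moment k (initial_data (\<rho>0, u0) (\<rho>1, u1) \<xi> \<mu> v x) * \<phi> (x, 0) \<partial>lborel)"
    using 1(3) 2(2)
  proof eventually_elim
    case (elim \<epsilon>)
    let ?f = "\<lambda>t. LBINT x. moment k (N \<epsilon> x t) * dt \<phi> x t + moment (Suc k) (N \<epsilon> x t) * dx \<phi> x t"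
    have "?W {0<..<T} ?ws \<epsilon> = (LBINT t:{0<..<T}. ?f t)"
      by (rule set_lebesgue_integral_cong) (auto simp: N)
    moreover have "?W {T<..} [(w, V1)] \<epsilon> = (LBINT t:{T<..}. ?f t)"
      by (rule set_lebesgue_integral_cong) (auto simp: N)
    moreover have "set_integrable lborel {0<..<T} ?f"
      by (rule set_integrable_cong[THEN iffD1, OF refl refl _ elim(1)]) (simp add: N)
    moreover have "set_integrable lborel {T<..} ?f"
      by (rule set_integrable_cong[THEN iffD1, OF refl refl _ elim(2)]) (simp add: N)
    ultimately show ?case using set_integral_split_at[OF T_pos, of ?f] by simp
  qed
  ultimately have lim: "((\<lambda>\<epsilon>. (LBINT t:{0<..}. (LBINT x. moment k (N \<epsilon> x t) * dt \<phi> x t + moment (Suc k) (N \<epsilon> x t) * dx \<phi> x t))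
        + (\<integral>x. moment k (initial_data (\<rho>0, u0) (\<rho>1, u1) \<xi> \<mu> v x) * \<phi> (x, 0) \<partial>lborel))
      \<longlongrightarrow> ((LBINT t:{0<..<T}. weak_rate k \<phi> ?U ?ws t) + (LBINT t:{T<..}. weak_rate k \<phi> ?U [(w, V1)] t))
      + (\<integral>x. moment k (initial_data (\<rho>0, u0) (\<rho>1, u1) \<xi> \<mu> v x) * \<phi> (x, 0) \<partial>lborel)) (at_right 0)"
    by (rule Lim_transform_eventually)
  have "((LBINT t:{0<..<T}. weak_rate k \<phi> ?U ?ws t) + (LBINT t:{T<..}. weak_rate k \<phi> ?U [(w, V1)] t))
      + (\<integral>x. moment k (initial_data (\<rho>0, u0) (\<rho>1, u1) \<xi> \<mu> v x) * \<phi> (x, 0) \<partial>lborel)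
    = (\<rho>0 * u0 ^ k - \<rho>1 * u1 ^ k) * (\<integral>x. indicator {..<v * T} x * \<phi> (x, T) \<partial>lborel)
        + front_mass k T * \<phi> (v * T, T) + \<rho>1 * u1 ^ k * (\<integral>x. \<phi> (x, T) \<partial>lborel)
        + (LBINT t:{T<..}. weak_rate k \<phi> ?U [(w, V1)] t)"
    unfolding ph1 by linarith
  from lim[unfolded this] show "((\<lambda>\<epsilon>. (LBINT t:{0<..}. (LBINT x. moment k (N \<epsilon> x t) * dt \<phi> x t + moment (Suc k) (N \<epsilon> x t) * dx \<phi> x t))
        + (\<integral>x. moment k (initial_data (\<rho>0, u0) (\<rho>1, u1) \<xi> \<mu> v x) * \<phi> (x, 0) \<partial>lborel))
      \<longlongrightarrow> (\<rho>0 * u0 ^ k - \<rho>1 * u1 ^ k) * (\<integral>x. indicator {..<v * T} x * \<phi> (x, T) \<partial>lborel)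
        + front_mass k T * \<phi> (v * T, T) + \<rho>1 * u1 ^ k * (\<integral>x. \<phi> (x, T) \<partial>lborel)
        + (LBINT t:{T<..}. weak_rate k \<phi> (\<lambda>x t. (\<rho>0, u0)) [(w, V1)] t)) (at_right 0)" .
qed

subsection \<open>Existence\<close>

text \<open>Density \<open>\<sigma> / \<epsilon>\<close> on strips of width \<open>\<epsilon> t / 2\<close> on either side of the front, hence strength
  \<open>\<sigma> t\<close>.\<close>

definition "incoming a s \<sigma> = Shadow (\<lambda>t. a + s * t) (\<lambda>\<epsilon>. 0) (\<lambda>\<epsilon> t. (\<sigma> / \<epsilon>, s)) (\<lambda>\<epsilon> t. (\<sigma> / \<epsilon>, s))"

lemma incoming_strength: "strength (incoming a s \<sigma>) t (\<sigma> * t)"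
proof -
  have "\<forall>\<^sub>F \<epsilon> in at_right 0. \<epsilon> / 2 * t * (\<sigma> / \<epsilon> + \<sigma> / \<epsilon>) = \<sigma> * t"
    using eventually_at_right_less[of 0] by eventually_elim simp
  then show ?thesis unfolding strength_def width_def incoming_def by (simp add: tendsto_eventually)
qed

lemma incoming_regular:
  assumes \<sigma>: "\<sigma> \<ge> 0"
  shows "regular_shadow {0..T} (incoming a s \<sigma>)"
proof -
  let ?w = "incoming a s \<sigma>"
  have pos: "\<forall>\<^sub>F \<epsilon> in at_right (0::real). \<epsilon> > 0" by (rule eventually_at_right_less)
  have f: "front ?w = (\<lambda>t. a + s * t)" "shift ?w = (\<lambda>\<epsilon>. 0)"
    "lmid ?w \<epsilon> t = (\<sigma> / \<epsilon>, s)" "rmid ?w \<epsilon> t = (\<sigma> / \<epsilon>, s)" "width ?w \<epsilon> t = \<epsilon> / 2 * t" for \<epsilon> t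
    by (simp_all add: incoming_def width_def)
  have m: "lmid ?w \<epsilon> = (\<lambda>t. (\<sigma> / \<epsilon>, s))" "rmid ?w \<epsilon> = (\<lambda>t. (\<sigma> / \<epsilon>, s))" for \<epsilon>
    by (simp_all add: incoming_def)
  have bound: "\<forall>\<^sub>F \<epsilon> in at_right 0. \<forall>t\<in>{0<..<T}. t \<le> R \<longrightarrow>
      width ?w \<epsilon> t * (fst (lmid ?w \<epsilon> t) + fst (rmid ?w \<epsilon> t)) \<le> \<sigma> * T" for R
    using pos
  proof eventually_elim
    case (elim \<epsilon>)
    have "width ?w \<epsilon> t * (fst (lmid ?w \<epsilon> t) + fst (rmid ?w \<epsilon> t)) = \<sigma> * t" for t using elim by (simp add: f)
    then show ?case using \<sigma> by (auto intro: mult_left_mono)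
  qed
  show ?thesis
    unfolding regular_shadow_def interior_atLeastAtMost_real
  proof (intro conjI allI)
    show "continuous_on {0..T} (front ?w)" unfolding f by (intro continuous_intros)
    show "front ?w C1_differentiable_on {0<..<T}" unfolding f
      by (auto simp: C1_differentiable_on_def intro!: derivative_eq_intros exI[of _ "\<lambda>t. s"] continuous_intros)
    show "(shift ?w \<longlongrightarrow> 0) (at_right 0)" unfolding f by simp
    show "\<forall>\<^sub>F \<epsilon> in at_right 0. continuous_on {0<..<T} (lmid ?w \<epsilon>) \<and> continuous_on {0<..<T} (rmid ?w \<epsilon>) \<and>
        (\<forall>t\<in>{0<..<T}. width ?w \<epsilon> t > 0 \<and> fst (lmid ?w \<epsilon> t) \<ge> 0 \<and> fst (rmid ?w \<epsilon> t) \<ge> 0)"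
      using pos
    proof eventually_elim
      case (elim \<epsilon>)
      show ?case using \<sigma> elim by (simp add: m f)
    qed
    show "\<exists>K. \<forall>\<^sub>F \<epsilon> in at_right 0. \<forall>t\<in>{0<..<T}. \<bar>snd (lmid ?w \<epsilon> t)\<bar> \<le> K \<and> \<bar>snd (rmid ?w \<epsilon> t)\<bar> \<le> K"
      by (rule exI[of _ "\<bar>s\<bar>"]) (simp add: f)
    show "\<exists>K. \<forall>\<^sub>F \<epsilon> in at_right 0. \<forall>t\<in>{0<..<T}. t \<le> R \<longrightarrow>
      width ?w \<epsilon> t * (fst (lmid ?w \<epsilon> t) + fst (rmid ?w \<epsilon> t)) \<le> K" for R
      using bound by blast
    show "\<forall>t\<in>{0<..<T}. (\<exists>m. strength ?w t m) \<and>
        ((\<lambda>\<epsilon>. snd (lmid ?w \<epsilon> t)) \<longlongrightarrow> deriv (front ?w) t) (at_right 0) \<and>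
        ((\<lambda>\<epsilon>. snd (rmid ?w \<epsilon> t)) \<longlongrightarrow> deriv (front ?w) t) (at_right 0)"
    proof
      fix t
      show "(\<exists>m. strength ?w t m) \<and>
        ((\<lambda>\<epsilon>. snd (lmid ?w \<epsilon> t)) \<longlongrightarrow> deriv (front ?w) t) (at_right 0) \<and>
        ((\<lambda>\<epsilon>. snd (rmid ?w \<epsilon> t)) \<longlongrightarrow> deriv (front ?w) t) (at_right 0)"
        using incoming_strength[of a s \<sigma> t] unfolding f deriv_affine by auto
    qed
  qed
qed

lemma incoming_riemann:
  assumes "ul > ur"
  shows "riemann a (\<rho>l, ul) (\<rho>r, ur)
    [(incoming a ((sqrt \<rho>l * ul + sqrt \<rho>r * ur) / (sqrt \<rho>l + sqrt \<rho>r)) (sqrt (\<rho>l * \<rho>r) * (ul - ur)), \<lambda>x t. (\<rho>r, ur))]"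
  using assms incoming_strength[of a "(sqrt \<rho>l * ul + sqrt \<rho>r * ur) / (sqrt \<rho>l + sqrt \<rho>r)" "sqrt (\<rho>l * \<rho>r) * (ul - ur)"]
  by (auto simp: riemann_def Let_def incoming_def)

text \<open>Density \<open>m t / (\<epsilon> t)\<close> on strips of width \<open>\<epsilon> t / 2\<close> on either side of the front, hence
  strength \<open>m t\<close>.\<close>

definition "merged = Shadow c (\<lambda>\<epsilon>. 0) (\<lambda>\<epsilon> t. (m t / (\<epsilon> * t), v + dz t)) (\<lambda>\<epsilon> t. (m t / (\<epsilon> * t), v + dz t))"

lemma merged_strength:
  assumes "t > T"
  shows "strength merged t (m t)"
proof -
  have "t > 0" using assms T_pos by simp
  have "\<forall>\<^sub>F \<epsilon> in at_right 0. \<epsilon> / 2 * t * (m t / (\<epsilon> * t) + m t / (\<epsilon> * t)) = m t"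
    using eventually_at_right_less[of 0] by eventually_elim (use \<open>t > 0\<close> in simp)
  then show ?thesis unfolding strength_def width_def merged_def by (simp add: tendsto_eventually)
qed

lemma merged_regular: "regular_shadow {T..} merged"
proof -
  have pos: "\<forall>\<^sub>F \<epsilon> in at_right (0::real). \<epsilon> > 0" by (rule eventually_at_right_less)
  have bound: "\<exists>K. \<forall>\<^sub>F \<epsilon> in at_right 0. \<forall>t\<in>{T<..}. t \<le> R \<longrightarrow> width merged \<epsilon> t * (fst (lmid merged \<epsilon> t) + fst (rmid merged \<epsilon> t)) \<le> K" for R
  proof -
    have "compact (m ` {T..R})"
      by (rule compact_continuous_image) (rule continuous_on_subset[OF m_cont], auto)
    then obtain K where K: "\<And>t. t \<in> {T..R} \<Longrightarrow> \<bar>m t\<bar> \<le> K"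
      using compact_imp_bounded[of "m ` {T..R}"] unfolding bounded_real by blast
    have "\<forall>\<^sub>F \<epsilon> in at_right 0. \<forall>t\<in>{T<..}. t \<le> R \<longrightarrow> width merged \<epsilon> t * (fst (lmid merged \<epsilon> t) + fst (rmid merged \<epsilon> t)) \<le> K"
      using pos
    proof eventually_elim
      case (elim \<epsilon>)
      show ?case
      proof (intro ballI impI)
        fix t assume t: "t \<in> {T<..}" "t \<le> R"
        have "width merged \<epsilon> t * (fst (lmid merged \<epsilon> t) + fst (rmid merged \<epsilon> t)) = m t"
          using elim t T_pos by (simp add: merged_def width_def)
        then show "width merged \<epsilon> t * (fst (lmid merged \<epsilon> t) + fst (rmid merged \<epsilon> t)) \<le> K"
          using K[of t] t by simp
      qed
    qed
    then show ?thesis by blast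
  qed
  have speed: "\<bar>v + dz t\<bar> \<le> \<bar>u0\<bar> + \<bar>u1\<bar>" if "t > T" for t using speed_between[of t] that by simp
  have cont: "continuous_on {T<..} m" "continuous_on {T<..} dz"
    by (rule continuous_on_subset[OF m_cont] continuous_on_subset[OF dz_cont]; auto)+
  have mid: "\<forall>\<^sub>F \<epsilon> in at_right 0.
        continuous_on {T<..} (lmid merged \<epsilon>) \<and> continuous_on {T<..} (rmid merged \<epsilon>) \<and>
        (\<forall>t\<in>{T<..}. width merged \<epsilon> t > 0 \<and> fst (lmid merged \<epsilon> t) \<ge> 0 \<and> fst (rmid merged \<epsilon> t) \<ge> 0)"
    using pos
  proof eventually_elim
    case (elim \<epsilon>)
    have "continuous_on {T<..} (\<lambda>t. (m t / (\<epsilon> * t), v + dz t))"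
      by (intro continuous_intros cont) (use elim T_pos in auto)
    then show ?case using elim T_pos mass_pos(2) by (fastforce simp: merged_def width_def less_imp_le)
  qed
  have C1: "c C1_differentiable_on {T<..}"
    unfolding C1_differentiable_on_def
    by (rule exI[of _ "\<lambda>t. v + dz t"])
      (use c_deriv(1) cont in \<open>auto simp: has_real_derivative_iff_has_vector_derivative[symmetric] intro!: continuous_intros\<close>)
  show ?thesis
    unfolding regular_shadow_def interior_real_atLeast
  proof (intro conjI allI)
    show "\<exists>K. \<forall>\<^sub>F \<epsilon> in at_right 0. \<forall>t\<in>{T<..}. \<bar>snd (lmid merged \<epsilon> t)\<bar> \<le> K \<and> \<bar>snd (rmid merged \<epsilon> t)\<bar> \<le> K"
      by (rule exI[of _ "\<bar>u0\<bar> + \<bar>u1\<bar>"]) (use speed in \<open>simp add: merged_def\<close>)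
    show "\<forall>t\<in>{T<..}. (\<exists>m. strength merged t m) \<and>
        ((\<lambda>\<epsilon>. snd (lmid merged \<epsilon> t)) \<longlongrightarrow> deriv (front merged) t) (at_right 0) \<and>
        ((\<lambda>\<epsilon>. snd (rmid merged \<epsilon> t)) \<longlongrightarrow> deriv (front merged) t) (at_right 0)"
      using merged_strength c_deriv(2) by (auto simp: merged_def)
    show "\<exists>K. \<forall>\<^sub>F \<epsilon> in at_right 0. \<forall>t\<in>{T<..}. t \<le> R \<longrightarrow> width merged \<epsilon> t * (fst (lmid merged \<epsilon> t) + fst (rmid merged \<epsilon> t)) \<le> K" for R
      by (rule bound)
    show "\<forall>\<^sub>F \<epsilon> in at_right 0.
        continuous_on {T<..} (lmid merged \<epsilon>) \<and> continuous_on {T<..} (rmid merged \<epsilon>) \<and>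
        (\<forall>t\<in>{T<..}. width merged \<epsilon> t > 0 \<and> fst (lmid merged \<epsilon> t) \<ge> 0 \<and> fst (rmid merged \<epsilon> t) \<ge> 0)"
      by (rule mid)
  qed (use c_cont C1 in \<open>simp_all add: merged_def\<close>)
qed

text \<open>The two incoming waves meet at time \<open>T\<close> and are replaced by the merged wave along the
  explicit trajectory. It satisfies the Rankine-Hugoniot conditions by \<open>mass_balance\<close> and
  \<open>momentum_balance\<close>.\<close>

lemma approx_solution_collision: "\<exists>N. approx_solution (\<rho>0, u0) (\<rho>1, u1) \<xi> \<mu> v N"
proof -
  let ?U = "\<lambda>x t. (\<rho>0, u0)"
  define V0 :: field where "V0 = (\<lambda>x t. (M, v))"
  define V1 :: field where "V1 = (\<lambda>x t. (\<rho>1, u1))"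
  define w0 where "w0 = incoming (- \<mu> / 2) s0 (sqrt (\<rho>0 * M) * (u0 - v))"
  define w1 where "w1 = incoming (\<mu> / 2) s1 (sqrt (M * \<rho>1) * (v - u1))"
  define N :: net where "N \<epsilon> x t = (if t < T then profile ?U [(w0, V0), (w1, V1)] \<epsilon> x t else profile ?U [(merged, V1)] \<epsilon> x t)" for \<epsilon> x t
  note vb = v_between and Mpos = roots(7)
  have r: "riemann (- \<mu> / 2) (\<rho>0, u0) (M, v) [(w0, V0)]" "riemann (\<mu> / 2) (M, v) (\<rho>1, u1) [(w1, V1)]"
    unfolding w0_def w1_def V0_def V1_def s0_def s1_def by (rule incoming_riemann; rule vb)+
  have f: "front w0 = (\<lambda>t. - \<mu> / 2 + s0 * t)" "front w1 = (\<lambda>t. \<mu> / 2 + s1 * t)" "is_Shadow w0" "is_Shadow w1"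
    by (simp_all add: w0_def w1_def incoming_def)
  have reg: "regular_shadow {0..T} w0" "regular_shadow {0..T} w1"
    unfolding w0_def w1_def using vb Mpos pos by (auto intro!: incoming_regular)
  have spd: "u1 \<le> s1" "s1 \<le> v" "v \<le> s0" "s0 \<le> u0"
  proof -
    have "rel \<le> u0 - v" "rel \<le> v - u1"
      unfolding relative_velocities(1,2) using relative_velocities(3) roots(1-3) by (simp_all add: field_simps)
    then show "u1 \<le> s1" "s1 \<le> v" "v \<le> s0" "s0 \<le> u0"
      unfolding relative_velocities(4,5) using relative_velocities(3) by auto
  qed
  have "ordered t [(w0, V0), (w1, V1)]" if "t < T" for t
  proof -
    have "rel * t < rel * T" using that relative_velocities(3) by simp
    then have "- \<mu> / 2 + s0 * t < \<mu> / 2 + s1 * t"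
      unfolding rel_T relative_velocities(4,5) by (simp add: algebra_simps)
    then show ?thesis by (simp add: ordered_def f)
  qed
  then have adm: "admissible_on {0..T} ?U [(w0, V0), (w1, V1)]"
    using reg spd by (auto simp: admissible_on_def f deriv_affine V0_def V1_def interior_atLeastAtMost_real)
  have adm': "admissible_on {T..} ?U [(merged, V1)]"
    using merged_regular speed_between c_deriv(2)
    by (auto simp: admissible_on_def ordered_def interior_real_atLeast V1_def merged_def)
  have "collide T ([(w0, V0), (w1, V1)] @ []) [(merged, snd (last [(w0, V0), (w1, V1)]))]"
    by (rule collide.merge[OF collide.none]) (use meeting_point S_at_T in \<open>auto simp: f merged_def c_def\<close>)
  then have coll: "collide T [(w0, V0), (w1, V1)] [(merged, V1)]" by simp
  have "evolution 0 ?U ([(w0, V0)] @ [(w1, V1)]) (\<lambda>\<epsilon> x t. if t < T then profile ?U [(w0, V0), (w1, V1)] \<epsilon> x t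
      else profile ?U [(merged, V1)] \<epsilon> x t)"
    using evolution.interaction[OF T_pos adm coll _ _ evolution.settled[OF adm']] by (simp add: ordered_def)
  moreover have "N = (\<lambda>\<epsilon> x t. if t < T then profile ?U [(w0, V0), (w1, V1)] \<epsilon> x t
      else profile ?U [(merged, V1)] \<epsilon> x t)" by (simp add: N_def fun_eq_iff)
  ultimately have evol: "evolution 0 ?U ([(w0, V0)] @ [(w1, V1)]) N" by simp
  have shadow: "is_Shadow merged" by (simp add: merged_def)
  have "solves_in_limit N (initial_data (\<rho>0, u0) (\<rho>1, u1) \<xi> \<mu> v)"
    unfolding solves_in_limit_moments
  proof (intro allI impI ballI)
    fix \<phi> and k :: nat assume \<phi>: "test_function UNIV \<phi>" and k: "k \<in> {0, 1}"
    note two = weak_two_phase[OF r adm adm' shadow N_def \<phi> k]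
    have fm: "front_moment k merged t = front_mass k t" if "t > T" for t
      using k mass_eq_strength[OF shadow merged_strength[OF that]] c_deriv(2)[OF that] momentum_eq[of t] that
      by (auto simp: front_moment_def front_mass_def merged_def)
    have bal: "balanced k T b (\<lambda>_. front_mass k) ?U [(merged, V1)]" if "b > T" for b
    proof -
      have "continuous_on {T..b} (front merged)" "continuous_on {T..b} (front_mass k)"
        using c_cont m_cont momentum_cont k continuous_on_subset[of "{T..}" _ "{T..b}"]
        by (auto simp: merged_def front_mass_def)
      moreover have "front merged C1_differentiable_on {T<..<b}"
      proof (rule C1_differentiable_on_subset)
        show "front merged C1_differentiable_on {T<..}"
          using merged_regular unfolding regular_shadow_def interior_real_atLeast by blast
      qed auto
      moreover have "(front_mass k has_real_derivative
          (level (Suc k) ?U - level (Suc k) V1) - (level k ?U - level k V1) * deriv (front merged) t) (at t)"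
        if "t > T" for t
        using mass_balance[OF that] momentum_balance[OF that] k c_deriv(2)[OF that]
        by (auto simp: front_mass_def level_state V1_def merged_def power2_eq_square)
      ultimately show ?thesis using fm by simp
    qed
    have fields: "simple_field V'" if "V' \<in> fields ?U [(merged, V1)]" for V'
      using that by (auto simp: V1_def)
    have "(LBINT t:{T<..}. weak_rate k \<phi> ?U [(merged, V1)] t)
        = - pairing (moment k) (\<lambda>w. front_mass k T) (\<lambda>x. \<phi> (x, T)) T ?U [(merged, V1)]"
      by (rule weak_rate_unbounded[OF \<phi> fields bal two(2)])
    also have "pairing (moment k) (\<lambda>w. front_mass k T) (\<lambda>x. \<phi> (x, T)) T ?U [(merged, V1)]
        = (\<rho>0 * u0 ^ k - \<rho>1 * u1 ^ k) * (\<integral>x. indicator {..<v * T} x * \<phi> (x, T) \<partial>lborel)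
          + front_mass k T * \<phi> (v * T, T) + \<rho>1 * u1 ^ k * (\<integral>x. \<phi> (x, T) \<partial>lborel)"
      by (simp add: pairing_simple V1_def level_state merged_def c_def S_at_T del: pairing.simps)
    finally show "((\<lambda>\<epsilon>. (LBINT t:{0<..}. (LBINT x. moment k (N \<epsilon> x t) * dt \<phi> x t + moment (Suc k) (N \<epsilon> x t) * dx \<phi> x t))
        + (\<integral>x. moment k (initial_data (\<rho>0, u0) (\<rho>1, u1) \<xi> \<mu> v x) * \<phi> (x, 0) \<partial>lborel)) \<longlongrightarrow> 0) (at_right 0)"
      using two(1) by simp
  qed
  then have "approx_solution (\<rho>0, u0) (\<rho>1, u1) \<xi> \<mu> v N"
    unfolding approx_solution_def using r[unfolded M_def] evol by blast
  then show ?thesis by blast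
qed

subsection \<open>Every approximate solution is of this form\<close>

lemma collide_length_1:
  assumes "collide s ws ws'" "length ws = 1"
  shows "length ws' = 1"
  using assms
proof cases
  case (keep qs qs' p)
  with assms(2) have "qs = []" by simp
  from keep(3) have "qs' = []" unfolding \<open>qs = []\<close>
    by cases auto
  then show ?thesis using keep by simp
next
  case (merge qs qs' g w)
  then show ?thesis using assms(2) by simp
qed (use assms in simp)

lemma collide_pair:
  assumes "collide s [p, q] ws'" "length ws' < 2"
  obtains w where "ws' = [(w, snd q)]" "is_Shadow w" "front (fst p) s = front w s" "front (fst q) s = front w s"
  using assms(1)
proof cases
  case (keep qs')
  then show ?thesis using collide_length_1[of s "[q]" qs'] assms(2) by auto
next
  case (merge qs qs' g w)
  have "length g + length qs = 2" using merge(1) by (metis length_append length_Cons list.size(3) numeral_2_eq_2)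
  then have "length qs = 0" using merge(4) by linarith
  then have "qs = []" by simp
  moreover from this have "g = [p, q]" using merge(1) by simp
  ultimately have "qs = []" "g = [p, q]" by blast+
  from merge(3) have "qs' = []" unfolding \<open>qs = []\<close> by cases auto
  show ?thesis
    by (rule that[of w]) (use merge \<open>qs' = []\<close> \<open>g = [p, q]\<close> in auto)
qed

text \<open>The fronts approach each other at the constant relative speed \<open>2 rel\<close>, so they have to
  interact exactly at time \<open>T\<close>. The only wave that is left afterwards has no partner for another
  interaction.\<close>

lemma approx_solution_structure:
  assumes N: "approx_solution (\<rho>0, u0) (\<rho>1, u1) \<xi> \<mu> v N"
  obtains w0 V0 w1 V1 w where
    "riemann (- \<mu> / 2) (\<rho>0, u0) (M, v) [(w0, V0)]" "riemann (\<mu> / 2) (M, v) (\<rho>1, u1) [(w1, V1)]"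
    "admissible_on {0..T} (\<lambda>x t. (\<rho>0, u0)) [(w0, V0), (w1, V1)]"
    "admissible_on {T..} (\<lambda>x t. (\<rho>0, u0)) [(w, V1)]" "is_Shadow w" "front w T = v * T"
    "\<And>\<epsilon> x t. N \<epsilon> x t = (if t < T then profile (\<lambda>x t. (\<rho>0, u0)) [(w0, V0), (w1, V1)] \<epsilon> x t
        else profile (\<lambda>x t. (\<rho>0, u0)) [(w, V1)] \<epsilon> x t)"
proof -
  let ?U = "\<lambda>x t. (\<rho>0, u0)"
  from N obtain ws ws' where r: "riemann (- \<mu> / 2) (\<rho>0, u0) (M, v) ws" "riemann (\<mu> / 2) (M, v) (\<rho>1, u1) ws'"
    and e: "evolution 0 ?U (ws @ ws') N" unfolding approx_solution_def M_def by auto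
  obtain w0 V0 where ws: "ws = [(w0, V0)]" using r(1) v_between by (cases rule: riemann_cases) auto
  obtain w1 V1 where ws': "ws' = [(w1, V1)]" using r(2) v_between by (cases rule: riemann_cases) auto
  note w0 = riemann_shadow[OF r(1)[unfolded ws] v_between(2), folded s0_def]
    and w1 = riemann_shadow[OF r(2)[unfolded ws'] v_between(1), folded s1_def]
  have meet: "front w0 t < front w1 t \<longleftrightarrow> t < T" "front w0 t = front w1 t \<longleftrightarrow> t = T" for t
  proof -
    have d: "front w1 t - front w0 t = 2 * rel * (T - t)"
      unfolding w0(3) w1(3) relative_velocities(4,5) using rel_T by (simp add: algebra_simps)
    have a: "0 < 2 * rel * (T - t) \<longleftrightarrow> t < T" "2 * rel * (T - t) = 0 \<longleftrightarrow> t = T"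
      using relative_velocities(3) by (auto simp: zero_less_mult_iff)
    show "front w0 t < front w1 t \<longleftrightarrow> t < T" "front w0 t = front w1 t \<longleftrightarrow> t = T"
      unfolding a[symmetric] d[symmetric] by auto
  qed
  from e show ?thesis
    unfolding ws ws' append_Cons append_Nil
  proof cases
    case settled
    then have "ordered T [(w0, V0), (w1, V1)]" using T_pos by (simp add: admissible_on_def)
    then show ?thesis using meet(1)[of T] by (simp add: ordered_def)
  next
    case (interaction T' qs N')
    from interaction(5) have "length qs < 2" by simp
    from collide_pair[OF interaction(4) this] obtain w where qs: "qs = [(w, V1)]" and w: "is_Shadow w"
      and f: "front w0 T' = front w T'" "front w1 T' = front w T'" by auto
    have T': "T' = T" using meet(2)[of T'] f by simp
    from interaction(7) have "admissible_on {T..} ?U [(w, V1)] \<and> N' = profile ?U [(w, V1)]"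
      unfolding qs T'
    proof cases
      case (interaction T'' qs' N'')
      then show ?thesis using collide_length_1[of T'' "[(w, V1)]" qs'] by simp
    qed simp
    moreover have "front w T = v * T" using f(1) meeting_point(1) unfolding T' w0(3) by simp
    ultimately show ?thesis
      by (intro that[OF r(1)[unfolded ws] r(2)[unfolded ws'] _ _ w]) (use interaction T' in auto)
  qed
qed

end

section \<open>Uniqueness of the merged wave\<close>

text \<open>If all integrals of a bounded function over intervals vanish, then the measure with density
  \<open>1 + f / (2 K)\<close> is Lebesgue measure, and densities are unique.\<close>

lemma AE_zero_if_interval_integrals_zero:
  fixes f :: "real \<Rightarrow> real"
  assumes fm[measurable]: "f \<in> borel_measurable borel" and K: "K > 0" "\<And>t. \<bar>f t\<bar> \<le> K"
    and int: "integrable lborel f" and zero: "\<And>a b. a \<le> b \<Longrightarrow> (\<integral>t. indicator {a<..<b} t * f t \<partial>lborel) = 0"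
  shows "AE t in lborel. f t = 0"
proof -
  define d where "d t = 1 + f t / (2 * K)" for t
  have dpos: "d t \<ge> 0" for t
  proof -
    have "f t / (2 * K) \<ge> - K / (2 * K)" using K(2)[of t] K(1) by (intro divide_right_mono) auto
    then show ?thesis using K(1) by (simp add: d_def)
  qed
  have [measurable]: "d \<in> borel_measurable borel" unfolding d_def by measurable
  have "lborel = density lborel (\<lambda>t. ennreal (d t))"
  proof (rule lborel_eqI)
    show "emeasure (density lborel (\<lambda>t. ennreal (d t))) (box l u) = (\<Prod>b\<in>Basis. (u - l) \<bullet> b)"
      if "\<And>b. b \<in> Basis \<Longrightarrow> l \<bullet> b \<le> u \<bullet> b" for l u :: real
    proof -
      have lu: "l \<le> u" using that[of 1] by simp
      have fi: "integrable lborel (\<lambda>t. indicator {l<..<u} t * f t)"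
        by (rule integrable_indicator_mult[OF int]) simp
      have ii: "integrable lborel (\<lambda>t. 1 * indicator {l<..<u} t :: real)"
        by (rule integrable_mult_indicator_bounded) auto
      have eq: "d t * indicator {l<..<u} t = 1 * indicator {l<..<u} t + indicator {l<..<u} t * f t / (2 * K)" for t
        by (simp add: d_def indicator_def)
      have di: "integrable lborel (\<lambda>t. d t * indicator {l<..<u} t)"
        unfolding eq using ii fi by (intro Bochner_Integration.integrable_add integrable_divide)
      have "emeasure (density lborel (\<lambda>t. ennreal (d t))) (box l u)
          = (\<integral>\<^sup>+ t. ennreal (d t) * indicator (box l u) t \<partial>lborel)"
        by (rule emeasure_density) auto
      also have "\<dots> = (\<integral>\<^sup>+ t. ennreal (d t * indicator {l<..<u} t) \<partial>lborel)"
        by (rule nn_integral_cong) (auto simp: indicator_def box_real)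
      also have "\<dots> = ennreal (\<integral>t. d t * indicator {l<..<u} t \<partial>lborel)"
        by (rule nn_integral_eq_integral[OF di]) (use dpos in simp)
      also have "(\<integral>t. d t * indicator {l<..<u} t \<partial>lborel) = u - l"
        unfolding eq Bochner_Integration.integral_add[OF ii integrable_divide[OF fi]] using lu
        by (simp add: zero[OF lu] measure_def)
      finally show ?thesis by simp
    qed
  qed simp
  then have "density lborel (\<lambda>t. ennreal (d t)) = density lborel (\<lambda>t. 1)" by (simp add: density_1)
  then have "AE t in lborel. ennreal (d t) = 1"
    by (rule sigma_finite_measure.density_unique[OF lborel.sigma_finite_measure_axioms, rotated 2]) auto
  then show ?thesis
  proof eventually_elim
    case (elim t)
    then have "d t = 1" using dpos[of t] by (metis ennreal_1 ennreal_inj zero_le_one)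
    then show ?case using K by (simp add: d_def)
  qed
qed

text \<open>Used to construct test functions with prescribed time derivative.\<close>

lemma smooth_antiderivative:
  assumes \<psi>: "smooth_real \<psi>" and supp: "\<And>t. t \<ge> b \<Longrightarrow> \<psi> t = 0"
  obtains \<Psi> where "smooth_real \<Psi>" "\<And>t. (\<Psi> has_real_derivative \<psi> t) (at t)" "\<And>t. t \<ge> b \<Longrightarrow> \<Psi> t = 0"
proof -
  have "\<exists>F. \<forall>x. - \<infinity> < ereal x \<longrightarrow> ereal x < \<infinity> \<longrightarrow> (F has_vector_derivative \<psi> x) (at x)"
    by (rule einterval_antiderivative) (use smooth_real_deriv(1)[OF \<psi>] in \<open>auto intro: DERIV_isCont\<close>)
  then obtain F where F: "\<And>x. (F has_real_derivative \<psi> x) (at x)"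
    by (auto simp: has_real_derivative_iff_has_vector_derivative)
  define \<Psi> where "\<Psi> t = F t - F b" for t
  have d: "(\<Psi> has_real_derivative \<psi> t) (at t)" for t
    unfolding \<Psi>_def by (auto intro!: derivative_eq_intros F)
  show ?thesis
  proof (rule that[of \<Psi>])
    show "smooth_real \<Psi>" by (rule smooth_realI[OF d \<psi>])
    show "(\<Psi> has_real_derivative \<psi> t) (at t)" for t by (rule d)
    show "\<Psi> t = 0" if "t \<ge> b" for t
    proof (cases "t = b")
      case False
      then have "b < t" using that by simp
      then have "\<Psi> t = \<Psi> b"
      proof (rule DERIV_isconst_end)
        show "continuous_on {b..t} \<Psi>" using d by (auto intro!: continuous_at_imp_continuous_on DERIV_isCont)
        show "(\<Psi> has_real_derivative 0) (at x)" if "b < x" "x < t" for x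
          using d[of x] supp[of x] that by simp
      qed
      then show ?thesis by (simp add: \<Psi>_def)
    qed (simp add: \<Psi>_def)
  qed
qed

lemma shadow_moment_bounded:
  assumes w: "regular_shadow J w" "is_Shadow w"
  shows "(\<lambda>t. indicator (interior J) t * front_moment k w t) \<in> borel_measurable borel"
    and "\<exists>K. \<forall>t\<in>interior J. t \<le> R \<longrightarrow> \<bar>front_moment k w t\<bar> \<le> K"
    and "t \<in> interior J \<Longrightarrow> mass w t \<ge> 0"
proof -
  note tw = tame_shadow_moment[OF w, of k, unfolded tame_wave_def]
  define h where "h \<epsilon> t = half_width w \<epsilon> t * (moment k (lmid w \<epsilon> t) + moment k (rmid w \<epsilon> t))" for \<epsilon> t
  have lim: "((\<lambda>\<epsilon>. h \<epsilon> t) \<longlongrightarrow> front_moment k w t) (at_right 0)" if "t \<in> interior J" for t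
    using tw that by (simp add: point_mass_def h_def)
  have hw: "(\<lambda>t. half_width w \<epsilon> t) \<in> borel_measurable borel" for \<epsilon>
    unfolding half_width_def width_def using w(2) by simp
  have hm: "\<forall>\<^sub>F \<epsilon> in at_right 0. (\<lambda>t. indicator (interior J) t * h \<epsilon> t) \<in> borel_measurable borel"
  proof -
    have "\<forall>\<^sub>F \<epsilon> in at_right 0.
        (\<lambda>t. indicator (interior J) t * moment k (lmid w \<epsilon> t)) \<in> borel_measurable borel \<and>
        (\<lambda>t. indicator (interior J) t * moment k (rmid w \<epsilon> t)) \<in> borel_measurable borel" using tw w(2) by simp
    then show ?thesis
    proof eventually_elim
      case (elim \<epsilon>)
      have "(\<lambda>t. half_width w \<epsilon> t * (indicator (interior J) t * moment k (lmid w \<epsilon> t) + indicator (interior J) t * moment k (rmid w \<epsilon> t)))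
          \<in> borel_measurable borel" using borel_measurable_times[OF hw borel_measurable_add[OF elim[THEN conjunct1] elim[THEN conjunct2]]] .
      moreover have "(\<lambda>t. half_width w \<epsilon> t * (indicator (interior J) t * moment k (lmid w \<epsilon> t) + indicator (interior J) t * moment k (rmid w \<epsilon> t)))
          = (\<lambda>t. indicator (interior J) t * h \<epsilon> t)" by (simp add: h_def fun_eq_iff algebra_simps)
      ultimately show ?case by simp
    qed
  qed
  show "(\<lambda>t. indicator (interior J) t * front_moment k w t) \<in> borel_measurable borel"
  proof (rule borel_measurable_lim_at_right[OF hm])
    show "((\<lambda>\<epsilon>. indicator (interior J) t * h \<epsilon> t) \<longlongrightarrow> indicator (interior J) t * front_moment k w t) (at_right 0)" for t
      using lim[of t] by (cases "t \<in> interior J") auto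
  qed
  obtain K where K: "\<forall>\<^sub>F \<epsilon> in at_right 0. \<forall>t\<in>interior J. t \<le> R \<longrightarrow> strip_mass (moment k) \<epsilon> t w \<le> K"
    using tw by blast
  have pos: "\<forall>\<^sub>F \<epsilon> in at_right 0. \<forall>t\<in>interior J. half_width w \<epsilon> t \<ge> 0" using tw by blast
  have "\<bar>front_moment k w t\<bar> \<le> K" if t: "t \<in> interior J" "t \<le> R" for t
  proof (rule tendsto_upperbound[OF tendsto_rabs[OF lim[OF t(1)]]])
    show "\<forall>\<^sub>F \<epsilon> in at_right 0. \<bar>h \<epsilon> t\<bar> \<le> K"
      using K pos
    proof eventually_elim
      case (elim \<epsilon>)
      have "\<bar>h \<epsilon> t\<bar> \<le> strip_mass (moment k) \<epsilon> t w"
        unfolding h_def strip_mass_def abs_mult using elim t by (simp add: mult_left_mono)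
      then show ?case using elim t by fastforce
    qed
  qed simp
  then show "\<exists>K. \<forall>t\<in>interior J. t \<le> R \<longrightarrow> \<bar>front_moment k w t\<bar> \<le> K" by blast
  show "mass w t \<ge> 0" if t: "t \<in> interior J"
  proof -
    obtain m where m: "strength w t m" using w t by (auto simp: regular_shadow_def)
    have "\<forall>\<^sub>F \<epsilon> in at_right 0.
        continuous_on (interior J) (lmid w \<epsilon>) \<and> continuous_on (interior J) (rmid w \<epsilon>) \<and>
        (\<forall>t\<in>interior J. width w \<epsilon> t > 0 \<and> fst (lmid w \<epsilon> t) \<ge> 0 \<and> fst (rmid w \<epsilon> t) \<ge> 0)"
      using w by (simp add: regular_shadow_def)
    then have "\<forall>\<^sub>F \<epsilon> in at_right 0. 0 \<le> width w \<epsilon> t * (fst (lmid w \<epsilon> t) + fst (rmid w \<epsilon> t))"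
      by eventually_elim (use t in \<open>simp add: less_imp_le\<close>)
    then have "m \<ge> 0" using m unfolding strength_def by (intro tendsto_lowerbound) auto
    then show ?thesis using mass_eq_strength[OF w(2) m] by simp
  qed
qed

lemma AE_zero_imp_zero:
  fixes g :: "real \<Rightarrow> real"
  assumes "continuous_on {a<..} g" "AE t in lborel. t > a \<longrightarrow> g t = 0" "t > a"
  shows "g t = 0"
proof (rule ccontr)
  assume "g t \<noteq> 0"
  have op: "open {s \<in> {a<..}. g s \<noteq> 0}"
  proof -
    have "{s \<in> {a<..}. g s \<noteq> 0} = {a<..} \<inter> g -` (- {0})" by auto
    moreover have "open ({a<..} \<inter> g -` (- {0}))"
      by (rule continuous_open_preimage[OF assms(1) open_greaterThan]) (simp add: open_Compl)
    ultimately show ?thesis by simp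
  qed
  have "{s \<in> {a<..}. g s \<noteq> 0} \<in> null_sets lborel"
  proof (rule AE_iff_null_sets[THEN iffD2])
    show "{s \<in> {a<..}. g s \<noteq> 0} \<in> sets lborel" using op by simp
    show "AE x in lborel. x \<notin> {s \<in> {a<..}. g s \<noteq> 0}" using assms(2) by eventually_elim auto
  qed
  then have "negligible {s \<in> {a<..}. g s \<noteq> 0}"
    by (simp add: negligible_iff_null_sets null_sets_completionI)
  moreover have "t \<in> {s \<in> {a<..}. g s \<noteq> 0}" using assms(3) \<open>g t \<noteq> 0\<close> by simp
  ultimately show False using open_not_negligible[OF op] by blast
qed

lemma cutoff_exists:
  assumes "R > 0"
  obtains \<alpha> where "smooth_real \<alpha>" "\<And>x. \<bar>x\<bar> \<le> R \<Longrightarrow> \<alpha> x = 1" "\<And>x. \<bar>x\<bar> > R + 1 \<Longrightarrow> \<alpha> x = 0"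
proof -
  have "smooth_real (\<lambda>x. step (1 * x + (R + 1)) * step ((-1) * x + (R + 1)))"
    by (rule smooth_real_mult[OF smooth_real_affine[OF smooth_step] smooth_real_affine[OF smooth_step]])
  moreover have "step (1 * x + (R + 1)) * step ((-1) * x + (R + 1)) = 1" if "\<bar>x\<bar> \<le> R" for x
    using that step_ge_1[of "1 * x + (R + 1)"] step_ge_1[of "(-1) * x + (R + 1)"] by auto
  moreover have "step (1 * x + (R + 1)) * step ((-1) * x + (R + 1)) = 0" if "\<bar>x\<bar> > R + 1" for x
  proof (cases "x \<ge> 0")
    case True
    then show ?thesis using that step_le_0[of "(-1) * x + (R + 1)"] by simp
  next
    case False
    then show ?thesis using that step_le_0[of "1 * x + (R + 1)"] by simp
  qed
  ultimately show ?thesis using that by blast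
qed

context colliding
begin

context
  fixes w :: wave
  assumes w: "is_Shadow w" and reg: "regular_shadow {T..} w" and start: "front w T = v * T"
    and weak_int: "\<And>\<phi> k. test_function UNIV \<phi> \<Longrightarrow> k \<in> {0, 1} \<Longrightarrow>
      set_integrable lborel {T<..} (weak_rate k \<phi> (\<lambda>x t. (\<rho>0, u0)) [(w, \<lambda>x t. (\<rho>1, u1))])"
    and weak: "\<And>\<phi> k. test_function UNIV \<phi> \<Longrightarrow> k \<in> {0, 1} \<Longrightarrow>
      (\<rho>0 * u0 ^ k - \<rho>1 * u1 ^ k) * (\<integral>x. indicator {..<v * T} x * \<phi> (x, T) \<partial>lborel)
        + front_mass k T * \<phi> (v * T, T) + \<rho>1 * u1 ^ k * (\<integral>x. \<phi> (x, T) \<partial>lborel)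
        + (LBINT t:{T<..}. weak_rate k \<phi> (\<lambda>x t. (\<rho>0, u0)) [(w, \<lambda>x t. (\<rho>1, u1))] t) = 0"
begin

text \<open>The moments that the front must carry if the conservation laws hold.\<close>

definition collected :: "nat \<Rightarrow> real \<Rightarrow> real" where
  "collected k t = front_mass k T + (\<rho>0 * u0 ^ Suc k - \<rho>1 * u1 ^ Suc k) * (t - T)
     - (\<rho>0 * u0 ^ k - \<rho>1 * u1 ^ k) * (front w t - v * T)"

abbreviation "defect k t \<equiv> front_moment k w t - collected k t"

lemma front_regular:
  "continuous_on {T..} (front w)" "\<And>t. t > T \<Longrightarrow> (front w has_real_derivative deriv (front w) t) (at t)"
  "continuous_on {T<..} (deriv (front w))"
proof -
  have "front w C1_differentiable_on {T<..}"
    using reg unfolding regular_shadow_def interior_real_atLeast by blast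
  from C1_differentiable_deriv[OF this]
  show "\<And>t. t > T \<Longrightarrow> (front w has_real_derivative deriv (front w) t) (at t)"
    "continuous_on {T<..} (deriv (front w))" by auto
  show "continuous_on {T..} (front w)" using reg by (simp add: regular_shadow_def)
qed

lemma collected_cont: "continuous_on {T..} (collected k)"
  unfolding collected_def by (intro continuous_intros front_regular(1))

text \<open>The same computation that turns a balanced front into boundary terms shows that the defect is
  annihilated by the derivative of every test function along the front.\<close>

lemma defect_along_front:
  assumes \<phi>: "test_function UNIV \<phi>" and k: "k \<in> {0, 1}" and B: "T < B"
    and zero: "\<And>x t. t \<ge> B \<Longrightarrow> \<phi> (x, t) = 0 \<and> dx \<phi> x t = 0 \<and> dt \<phi> x t = 0"
  shows "((\<lambda>t. defect k t * (dt \<phi> (front w t) t + deriv (front w) t * dx \<phi> (front w t) t)) has_integral 0) {T..B}"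
proof -
  let ?U = "\<lambda>x t. (\<rho>0, u0)" and ?V = "\<lambda>x t. (\<rho>1, u1)"
  define f where "f = \<rho>0 * u0 ^ k - \<rho>1 * u1 ^ k"
  define g where "g = \<rho>0 * u0 ^ Suc k - \<rho>1 * u1 ^ Suc k"
  obtain R where cx: "continuous_on UNIV (\<lambda>z. dx \<phi> (fst z) (snd z))"
    and s0: "\<And>z. \<phi> z \<noteq> 0 \<Longrightarrow> \<bar>fst z\<bar> \<le> R \<and> \<bar>snd z\<bar> \<le> R"
    and sx: "\<And>z. dx \<phi> (fst z) (snd z) \<noteq> 0 \<Longrightarrow> \<bar>fst z\<bar> \<le> R \<and> \<bar>snd z\<bar> \<le> R"
    and derx: "\<And>x t. ((\<lambda>y. \<phi> (y, t)) has_real_derivative dx \<phi> x t) (at x)"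
    by (rule test_function_props[OF \<phi>]) blast
  have cx': "continuous_on UNIV (\<lambda>x. dx \<phi> x t)" for t
    using continuous_on_compose2[OF cx, of UNIV "\<lambda>x. (x, t)"] by (simp add: continuous_on_Pair)
  have dx_left: "(\<integral>x. indicator {..<c} x * dx \<phi> x t \<partial>lborel) = \<phi> (c, t)" for c t
    by (rule integral_lessThan_deriv[OF derx cx', where R = R]) (use s0[of "(_, t)"] sx[of "(_, t)"] in auto)
  have z0: "(\<lambda>x. \<phi> (x, t)) = (\<lambda>x. 0)" if "t \<ge> B" for t using zero that by auto
  have z1: "(\<lambda>x. dx \<phi> x t) = (\<lambda>x. 0)" "(\<lambda>x. dt \<phi> x t) = (\<lambda>x. 0)" if "t \<ge> B" for t using zero that by auto
  have col: "(collected k has_real_derivative g - f * deriv (front w) t) (at t)" if "t > T" for t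
    unfolding collected_def[abs_def] f_def[symmetric] g_def[symmetric]
    by (auto intro!: derivative_eq_intros front_regular(2)[OF that])
  have c3: "continuous_on {T<..<B} (deriv (front w))"
    by (rule continuous_on_subset[OF front_regular(3)]) auto
  have "((\<lambda>t. f * (\<integral>x. indicator {..<front w t} x * dt \<phi> x t \<partial>lborel) + g * \<phi> (front w t, t)
        + collected k t * (dt \<phi> (front w t) t + deriv (front w) t * dx \<phi> (front w t) t))
      has_integral (f * (\<integral>x. indicator {..<front w B} x * \<phi> (x, B) \<partial>lborel) + collected k B * \<phi> (front w B, B))
        - (f * (\<integral>x. indicator {..<front w T} x * \<phi> (x, T) \<partial>lborel) + collected k T * \<phi> (front w T, T))) {T..B}"
    by (rule front_balance[OF \<phi>])
      (use B col front_regular continuous_on_subset[OF front_regular(1), of "{T..B}"]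
        c3
        continuous_on_subset[OF collected_cont, of "{T..B}"] in auto)
  then have bal: "((\<lambda>t. f * (\<integral>x. indicator {..<front w t} x * dt \<phi> x t \<partial>lborel) + g * \<phi> (front w t, t)
        + collected k t * (dt \<phi> (front w t) t + deriv (front w) t * dx \<phi> (front w t) t))
      has_integral - (f * (\<integral>x. indicator {..<v * T} x * \<phi> (x, T) \<partial>lborel) + front_mass k T * \<phi> (v * T, T))) {T..B}"
    using zero[of B] by (simp add: start collected_def)
  have right: "(weak_rate k \<phi> ?V [] has_integral - (\<rho>1 * u1 ^ k * (\<integral>x. \<phi> (x, T) \<partial>lborel))) {T..B}"
    using weak_rate_has_integral[OF \<phi> less_imp_le[OF B], of ?V "[]" k "\<lambda>_ _. 0"] z0[of B]
    by (simp add: pairing_simple level_state del: pairing.simps)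
  have i: "set_integrable lborel {T<..<B} (weak_rate k \<phi> ?U [(w, ?V)])"
    by (rule set_integrable_subset[OF weak_int[OF \<phi> k]]) auto
  have wz: "weak_rate k \<phi> ?U [(w, ?V)] t = 0" if "t \<ge> B" for t
    unfolding weak_rate_def z1[OF that] pairing_zero by simp
  have "(LBINT t:{T<..}. weak_rate k \<phi> ?U [(w, ?V)] t) = (LBINT t:{T<..<B}. weak_rate k \<phi> ?U [(w, ?V)] t)"
    unfolding set_lebesgue_integral_def
    by (rule Bochner_Integration.integral_cong) (use wz in \<open>force simp: indicator_def\<close>)+
  also have "\<dots> = integral {T<..<B} (weak_rate k \<phi> ?U [(w, ?V)])"
    by (rule set_borel_integral_eq_integral(2)[OF i])
  finally have "(weak_rate k \<phi> ?U [(w, ?V)] has_integral (LBINT t:{T<..}. weak_rate k \<phi> ?U [(w, ?V)] t)) {T..B}"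
    using set_borel_integral_eq_integral(1)[OF i] by (simp add: has_integral_Icc_iff_Ioo integrable_integral)
  from has_integral_diff[OF has_integral_diff[OF this right] bal]
  have "((\<lambda>t. weak_rate k \<phi> ?U [(w, ?V)] t - weak_rate k \<phi> ?V [] t
      - (f * (\<integral>x. indicator {..<front w t} x * dt \<phi> x t \<partial>lborel) + g * \<phi> (front w t, t)
        + collected k t * (dt \<phi> (front w t) t + deriv (front w) t * dx \<phi> (front w t) t))) has_integral 0) {T..B}"
    using weak[OF \<phi> k] by (simp add: f_def algebra_simps)
  moreover have "weak_rate k \<phi> ?U [(w, ?V)] t - weak_rate k \<phi> ?V [] t
      - (f * (\<integral>x. indicator {..<front w t} x * dt \<phi> x t \<partial>lborel) + g * \<phi> (front w t, t)
        + collected k t * (dt \<phi> (front w t) t + deriv (front w) t * dx \<phi> (front w t) t))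
    = defect k t * (dt \<phi> (front w t) t + deriv (front w) t * dx \<phi> (front w t) t)" for t
  proof -
    have "weak_rate k \<phi> ?U [(w, ?V)] t = f * (\<integral>x. indicator {..<front w t} x * dt \<phi> x t \<partial>lborel)
        + front_moment k w t * dt \<phi> (front w t) t + g * \<phi> (front w t, t)
        + front_moment k w t * deriv (front w) t * dx \<phi> (front w t) t + weak_rate k \<phi> ?V [] t"
      unfolding weak_rate_def
      by (simp add: pairing_simple(2) level_state dx_left front_moment_Suc f_def g_def del: pairing.simps)
    then show ?thesis by (simp add: algebra_simps)
  qed
  ultimately show ?thesis by simp
qed

lemma defect_bounded:
  shows "(\<lambda>t. indicator {T<..<B} t * defect k t) \<in> borel_measurable borel"
    and "\<exists>K. K > 0 \<and> (\<forall>t. \<bar>indicator {T<..<B} t * defect k t\<bar> \<le> K)"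
proof -
  have c: "continuous_on {T<..} (collected k)" by (rule continuous_on_subset[OF collected_cont]) auto
  have 1: "(\<lambda>t. indicator {T<..} t * collected k t) \<in> borel_measurable borel"
    using borel_measurable_continuous_on_indicator[OF _ c] by simp
  have 2: "(\<lambda>t. indicator {T<..} t * front_moment k w t) \<in> borel_measurable borel"
    using shadow_moment_bounded(1)[OF reg w] by (simp add: interior_real_atLeast)
  have "(\<lambda>t. indicator {T<..<B} t * (indicator {T<..} t * front_moment k w t - indicator {T<..} t * collected k t))
      \<in> borel_measurable borel" using 1 2 by measurable
  moreover have "(\<lambda>t. indicator {T<..<B} t * (indicator {T<..} t * front_moment k w t - indicator {T<..} t * collected k t))
      = (\<lambda>t. indicator {T<..<B} t * defect k t)" by (auto simp: indicator_def fun_eq_iff)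
  ultimately show "(\<lambda>t. indicator {T<..<B} t * defect k t) \<in> borel_measurable borel" by simp
  obtain K1 where K1: "\<And>t. t > T \<Longrightarrow> t \<le> B \<Longrightarrow> \<bar>front_moment k w t\<bar> \<le> K1"
    using shadow_moment_bounded(2)[OF reg w, of B k] by (auto simp: interior_real_atLeast)
  have "compact (collected k ` {T..B})"
    by (rule compact_continuous_image) (rule continuous_on_subset[OF collected_cont], auto)
  then obtain K2 where K2: "\<And>t. t \<in> {T..B} \<Longrightarrow> \<bar>collected k t\<bar> \<le> K2"
    using compact_imp_bounded[of "collected k ` {T..B}"] unfolding bounded_real by blast
  have "\<bar>indicator {T<..<B} t * defect k t\<bar> \<le> \<bar>K1\<bar> + \<bar>K2\<bar> + 1" for t
  proof (cases "T < t \<and> t < B")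
    case True
    then show ?thesis using K1[of t] K2[of t] by simp
  next
    case False
    then show ?thesis by auto
  qed
  then show "\<exists>K. K > 0 \<and> (\<forall>t. \<bar>indicator {T<..<B} t * defect k t\<bar> \<le> K)"
    by (intro exI[of _ "\<bar>K1\<bar> + \<bar>K2\<bar> + 1"]) auto
qed

text \<open>The test functions are constant in \<open>x\<close> near the front, so that along the front only their
  time derivative is seen. It can be prescribed, and approximates the indicator function of the
  interval.\<close>

lemma defect_interval:
  assumes k: "k \<in> {0, 1}" and ab: "T < a" "a < b"
  shows "(\<integral>t. indicator {a<..<b} t * defect k t \<partial>lborel) = 0"
proof -
  define B where "B = b + 1"
  have B: "T < B" using ab by (simp add: B_def)
  define h where "h t = indicator {T<..<B} t * defect k t" for t
  note hm[measurable] = defect_bounded(1)[of B k, folded h_def]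
  obtain K where K: "K > 0" "\<And>t. \<bar>h t\<bar> \<le> K" using defect_bounded(2)[of B k] unfolding h_def by blast
  have hi: "integrable lborel h"
    by (rule integrable_bounded_support[OF hm K(2), where R = "\<bar>T\<bar> + \<bar>B\<bar>"])
      (auto simp: h_def indicator_def split: if_splits)
  \<comment> \<open>The difference of two steps, rising within \<open>1 / Suc n\<close> after \<open>a\<close> and after \<open>b\<close>.\<close>
  define \<psi> where "\<psi> n t = step (real (Suc n) * t + (- real (Suc n) * a)) - step (real (Suc n) * t + (- real (Suc n) * b))" for n t
  have \<psi>eq: "\<psi> n t = step (real (Suc n) * (t - a)) - step (real (Suc n) * (t - b))" for n t
    by (simp add: \<psi>_def algebra_simps)
  have \<psi>s: "smooth_real (\<psi> n)" for n
    unfolding \<psi>_def[abs_def] by (rule smooth_real_diff[OF smooth_real_affine[OF smooth_step] smooth_real_affine[OF smooth_step]])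
  have \<psi>0: "\<psi> n t = 0" if "t \<ge> B" for n t
  proof -
    have "1 * 1 \<le> real (Suc n) * (t - a)" "1 * 1 \<le> real (Suc n) * (t - b)"
      by (rule mult_mono; use that ab in \<open>simp add: B_def\<close>)+
    then show ?thesis by (simp add: \<psi>eq step_ge_1)
  qed
  have \<psi>b: "\<bar>\<psi> n t\<bar> \<le> 1" for n t
    using step_bounds[of "real (Suc n) * (t - a)"] step_bounds[of "real (Suc n) * (t - b)"] by (simp add: \<psi>eq)
  have \<psi>m[measurable]: "\<psi> n \<in> borel_measurable borel" for n
    by (rule borel_measurable_continuous_onI) (use smooth_real_deriv(1)[OF \<psi>s] in
      \<open>auto intro!: continuous_at_imp_continuous_on DERIV_isCont\<close>)
  have zero: "(\<integral>t. h t * \<psi> n t \<partial>lborel) = 0" for n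
  proof -
    obtain \<Psi> where \<Psi>: "smooth_real \<Psi>" "\<And>t. (\<Psi> has_real_derivative \<psi> n t) (at t)" "\<And>t. t \<ge> B \<Longrightarrow> \<Psi> t = 0"
      by (rule smooth_antiderivative[where b = B, OF \<psi>s[where n = n]]) (erule \<psi>0, rule that)
    \<comment> \<open>The cut-off at negative times makes the support compact and is invisible after \<open>T\<close>.\<close>
    define \<beta> where "\<beta> t = \<Psi> t * step (1 * t + 1)" for t
    have \<beta>s: "smooth_real \<beta>" unfolding \<beta>_def[abs_def]
      by (rule smooth_real_mult[OF \<Psi>(1) smooth_real_affine[OF smooth_step]])
    have \<beta>0: "\<beta> t = 0" if "t \<ge> B \<or> t \<le> - 1" for t
      using that \<Psi>(3)[of t] step_le_0[of "1 * t + 1"] by (auto simp: \<beta>_def)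
    have d\<beta>: "deriv \<beta> t = \<psi> n t" if "t > 0" for t
    proof (rule DERIV_imp_deriv)
      show "(\<beta> has_real_derivative \<psi> n t) (at t)"
        by (rule has_field_derivative_transform_within_open[OF \<Psi>(2), of "{0<..}"])
          (use that in \<open>auto simp: \<beta>_def step_ge_1\<close>)
    qed
    have "compact (front w ` {T..B})"
      by (rule compact_continuous_image) (rule continuous_on_subset[OF front_regular(1)], auto)
    then obtain R0 where R0: "\<And>t. t \<in> {T..B} \<Longrightarrow> \<bar>front w t\<bar> \<le> R0"
      using compact_imp_bounded[of "front w ` {T..B}"] unfolding bounded_real by blast
    define R where "R = \<bar>R0\<bar> + 1"
    have R: "R > 0" "\<And>t. t \<in> {T..B} \<Longrightarrow> \<bar>front w t\<bar> < R" using R0 by (force simp: R_def)+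
    obtain \<alpha> where \<alpha>: "smooth_real \<alpha>" "\<And>x. \<bar>x\<bar> \<le> R \<Longrightarrow> \<alpha> x = 1" "\<And>x. \<bar>x\<bar> > R + 1 \<Longrightarrow> \<alpha> x = 0"
      using cutoff_exists[OF R(1)] by blast
    have d\<alpha>: "deriv \<alpha> x = 0" if "\<bar>x\<bar> < R" for x
    proof (rule DERIV_imp_deriv)
      show "(\<alpha> has_real_derivative 0) (at x)"
        by (rule has_field_derivative_transform_within_open[of "\<lambda>x. 1" _ _ "{-R<..<R}"])
          (use that \<alpha>(2) in \<open>auto simp: abs_less_iff\<close>)
    qed
    define r where "r = R + 1 + \<bar>B\<bar> + 1"
    have \<alpha>r: "\<alpha> x = 0" if "\<bar>x\<bar> > r" for x using \<alpha>(3) that by (auto simp: r_def)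
    have \<beta>r: "\<beta> t = 0" if "\<bar>t\<bar> > r" for t
    proof -
      have "t \<ge> B \<or> t \<le> - 1" using that R(1) unfolding r_def by linarith
      then show ?thesis by (rule \<beta>0)
    qed
    define \<phi> where "\<phi> z = \<alpha> (fst z) * \<beta> (snd z)" for z
    have "\<phi> = (\<lambda>z. \<alpha> (fst z) * \<beta> (snd z))" by (simp add: \<phi>_def fun_eq_iff)
    then have prod: "test_function UNIV \<phi>" "dx \<phi> x t = deriv \<alpha> x * \<beta> t" "dt \<phi> x t = \<alpha> x * deriv \<beta> t" for x t
      using test_function_product[OF \<alpha>(1) \<alpha>r \<beta>s \<beta>r] by auto
    have T0: "T > 0" by (rule T_pos)
    have int0: "((\<lambda>t. defect k t * (dt \<phi> (front w t) t + deriv (front w) t * dx \<phi> (front w t) t)) has_integral 0) {T..B}"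
    proof (rule defect_along_front[OF prod(1) k B])
      fix x t assume t: "t \<ge> B"
      then have "deriv \<beta> t = 0" using d\<beta>[of t] \<psi>0[of t n] B T0 by simp
      then show "\<phi> (x, t) = 0 \<and> dx \<phi> x t = 0 \<and> dt \<phi> x t = 0"
        unfolding prod(2,3) using \<beta>0[of t] t by (simp add: \<phi>_def)
    qed
    have "((\<lambda>t. defect k t * \<psi> n t) has_integral 0) {T..B}"
    proof (rule has_integral_eq[OF _ int0])
      fix t assume t: "t \<in> {T..B}"
      have "\<bar>front w t\<bar> < R" by (rule R(2)[OF t])
      then show "defect k t * (dt \<phi> (front w t) t + deriv (front w) t * dx \<phi> (front w t) t) = defect k t * \<psi> n t"
        unfolding prod(2,3) using d\<alpha>[of "front w t"] \<alpha>(2)[of "front w t"] d\<beta>[of t] t T0 by simp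
    qed
    then have hk: "((\<lambda>t. defect k t * \<psi> n t) has_integral 0) {T<..<B}" by (simp add: has_integral_Icc_iff_Ioo)
    have "integrable lborel (\<lambda>t. h t * \<psi> n t)"
      by (rule Bochner_Integration.integrable_bound[OF hi])
        (use \<psi>b[of n] in \<open>auto simp: abs_mult intro!: AE_I2 mult_left_le\<close>)
    then have "set_integrable lborel {T<..<B} (\<lambda>t. defect k t * \<psi> n t)"
      by (simp add: set_integrable_def h_def mult.assoc)
    from set_borel_integral_eq_integral(2)[OF this] hk
    have "(LBINT t:{T<..<B}. defect k t * \<psi> n t) = 0" by (simp add: integral_unique)
    then show ?thesis by (simp add: set_lebesgue_integral_def h_def mult.assoc)
  qed
  have "(\<lambda>n. \<integral>t. h t * \<psi> n t \<partial>lborel) \<longlonglongrightarrow> (\<integral>t. h t * indicator {a<..<b} t \<partial>lborel)"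
  proof (rule integral_dominated_convergence)
    show "integrable lborel (\<lambda>t. \<bar>h t\<bar>)" using hi by simp
    show "AE t in lborel. norm (h t * \<psi> n t) \<le> \<bar>h t\<bar>" for n
      using \<psi>b[of n] by (auto simp: abs_mult intro!: AE_I2 mult_left_le)
    show "AE t in lborel. (\<lambda>n. h t * \<psi> n t) \<longlonglongrightarrow> h t * indicator {a<..<b} t"
      using AE_lborel_singleton[of b]
    proof eventually_elim
      case (elim t)
      have st: "(\<lambda>n. step (real (Suc n) * (t - c))) \<longlonglongrightarrow> (if t > c then 1 else 0)" for c
      proof (cases "t > c")
        case True
        then obtain n0 where n0: "1 < real n0 * (t - c)" using reals_Archimedean3[of "t - c"] by auto
        have "\<forall>\<^sub>F n in sequentially. step (real (Suc n) * (t - c)) = 1"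
          unfolding eventually_sequentially
        proof (rule exI[of _ n0], intro allI impI)
          fix n assume "n0 \<le> n"
          then have "real n0 * (t - c) \<le> real (Suc n) * (t - c)" using True by (intro mult_right_mono) auto
          then show "step (real (Suc n) * (t - c)) = 1" using n0 by (intro step_ge_1) simp
        qed
        then show ?thesis using True by (simp add: tendsto_eventually)
      next
        case False
        then have "real (Suc n) * (t - c) \<le> 0" for n by (intro mult_nonneg_nonpos) auto
        then show ?thesis using False by (simp add: step_le_0)
      qed
      have "(\<lambda>n. \<psi> n t) \<longlonglongrightarrow> (if t > a then 1 else 0) - (if t > b then 1 else 0)"
        unfolding \<psi>eq by (intro tendsto_diff st)
      also have "(if t > a then 1 else 0) - (if t > b then 1 else 0) = (indicator {a<..<b} t :: real)"
        using elim ab by (auto simp: indicator_def)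
      finally show ?case by (intro tendsto_mult_left)
    qed
  qed simp_all
  then have "(\<integral>t. h t * indicator {a<..<b} t \<partial>lborel) = 0"
    unfolding zero using LIMSEQ_unique tendsto_const by metis
  moreover have "h t * indicator {a<..<b} t = indicator {a<..<b} t * defect k t" for t
    using ab by (auto simp: h_def indicator_def B_def)
  ultimately show ?thesis by simp
qed

text \<open>The half line is exhausted by bounded intervals away from \<open>T\<close>, to which \<open>defect_interval\<close>
  applies.\<close>

lemma AE_defect_zero:
  assumes k: "k \<in> {0, 1}"
  shows "AE t in lborel. t > T \<longrightarrow> front_moment k w t = collected k t"
proof -
  have "AE t in lborel. indicator {p<..<q} t * defect k t = 0" if pq: "T < p" for p q
  proof -
    have ind: "indicator {p<..<q} t * (indicator {T<..<q} t * defect k t) = indicator {p<..<q} t * defect k t" for t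
      using pq by (auto simp: indicator_def)
    have m: "(\<lambda>t. indicator {p<..<q} t * defect k t) \<in> borel_measurable borel"
      using borel_measurable_times[OF borel_measurable_indicator defect_bounded(1)[of q k], of "{p<..<q}"] by (simp add: ind)
    obtain K where K: "K > 0" "\<And>t. \<bar>indicator {T<..<q} t * defect k t\<bar> \<le> K" using defect_bounded(2)[of q k] by blast
    have b: "\<bar>indicator {p<..<q} t * defect k t\<bar> \<le> K" for t
      using K(2)[of t] K(1) pq by (auto simp: indicator_def split: if_splits)
    have i: "integrable lborel (\<lambda>t. indicator {p<..<q} t * defect k t)"
      by (rule integrable_bounded_support[OF m b, where R = "\<bar>p\<bar> + \<bar>q\<bar>"])
        (auto simp: indicator_def split: if_splits)
    show ?thesis
    proof (rule AE_zero_if_interval_integrals_zero[OF m K(1) b i])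
      fix a b :: real
      have eq: "indicator {a<..<b} t * (indicator {p<..<q} t * defect k t)
          = indicator {max a p<..<min b q} t * defect k t" for t
        by (auto simp: indicator_def)
      show "(\<integral>t. indicator {a<..<b} t * (indicator {p<..<q} t * defect k t) \<partial>lborel) = 0"
      proof (cases "max a p < min b q")
        case True
        then show ?thesis unfolding eq using pq by (intro defect_interval[OF k]) auto
      next
        case False
        then have "min b q \<le> max a p" by (simp only: not_less)
        then have "{max a p<..<min b q} = {}" by (rule greaterThanLessThan_empty)
        then show ?thesis unfolding eq by simp
      qed
    qed
  qed
  then have "AE t in lborel. indicator {T + 1 / real (Suc n)<..<T + real (Suc n)} t * defect k t = 0" for n
    by simp
  then have "AE t in lborel. \<forall>n. indicator {T + 1 / real (Suc n)<..<T + real (Suc n)} t * defect k t = 0"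
    unfolding AE_all_countable by blast
  then show ?thesis
  proof eventually_elim
    case (elim t)
    show ?case
    proof
      assume t: "t > T"
      obtain n1 where n1: "1 < real n1 * (t - T)" using reals_Archimedean3[of "t - T"] t by auto
      obtain n2 where n2: "t - T < real n2" using reals_Archimedean2 by blast
      define n where "n = max n1 n2"
      have "1 < real (Suc n) * (t - T)"
      proof -
        have "real n1 * (t - T) \<le> real (Suc n) * (t - T)" using t by (intro mult_right_mono) (auto simp: n_def)
        then show ?thesis using n1 by simp
      qed
      then have "1 / real (Suc n) < t - T" by (simp add: pos_divide_less_eq mult.commute)
      moreover have "t - T < real (Suc n)" using n2 by (simp add: n_def)
      ultimately have "indicator {T + 1 / real (Suc n)<..<T + real (Suc n)} t = (1 :: real)"
        by (simp add: indicator_def)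
      then show "front_moment k w t = collected k t" using elim[rule_format, of n] by simp
    qed
  qed
qed

text \<open>Almost everywhere the moments on the front are the collected ones, which are continuous; so
  momentum equals mass times speed for all times. This differential equation for the front has the
  centre of mass relation as a first integral. It is quadratic in the position, and the sign of
  the mass decides between its two roots.\<close>

theorem merged_unique:
  shows "t \<ge> T \<Longrightarrow> front w t = c t"
    and "AE t in lborel. t > T \<longrightarrow> mass w t = m t"
proof -
  define zw where "zw t = front w t - v * t" for t
  note A = collected_cont
  have A': "continuous_on {T<..} (collected k)" for k by (rule continuous_on_subset[OF A]) auto
  have mT: "front_mass 0 T = P T" "front_mass 1 T = P T * v + dS T"
    using mass_pos(3)[of T] by (simp_all add: front_mass_def m_def S_at_T momentum_def)
  have A0: "collected 0 t = P t + (\<rho>1 - \<rho>0) * zw t" for t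
    unfolding collected_def mT zw_def P_def \<alpha>_def \<beta>_def by (simp add: algebra_simps)
  have A1: "collected 1 t - v * collected 0 t = dS t - dP * zw t" for t
    unfolding collected_def mT zw_def P_def dS_def dP_def \<alpha>_def \<beta>_def
    by (simp add: algebra_simps power2_eq_square)
  have ae: "AE t in lborel. t > T \<longrightarrow> mass w t = collected 0 t"
    using AE_defect_zero[of 0] by (simp add: front_moment_def)
  have ode: "collected 0 t * deriv (front w) t - collected 1 t = 0" if "t > T" for t
  proof (rule AE_zero_imp_zero[OF _ _ that])
    show "continuous_on {T<..} (\<lambda>t. collected 0 t * deriv (front w) t - collected 1 t)"
      by (intro continuous_intros A' front_regular(3))
    show "AE t in lborel. T < t \<longrightarrow> collected 0 t * deriv (front w) t - collected 1 t = 0"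
    proof -
      have "AE t in lborel. T < t \<longrightarrow> front_moment 1 w t = collected 1 t" by (rule AE_defect_zero) simp
      with ae show ?thesis by eventually_elim (auto simp: front_moment_def)
    qed
  qed
  have nonneg: "collected 0 t \<ge> 0" if "t > T" for t
  proof -
    have "min (collected 0 t) 0 = 0"
    proof (rule AE_zero_imp_zero[OF _ _ that])
      show "continuous_on {T<..} (\<lambda>t. min (collected 0 t) 0)" by (intro continuous_intros A')
      show "AE t in lborel. T < t \<longrightarrow> min (collected 0 t) 0 = 0"
        using ae
      proof eventually_elim
        case (elim t)
        then show ?case using shadow_moment_bounded(3)[OF reg w, of t] by (auto simp: interior_real_atLeast)
      qed
    qed
    then show ?thesis by (simp add: min_def split: if_splits)
  qed
  have zc: "continuous_on {T..} zw" unfolding zw_def by (intro continuous_intros front_regular(1))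
  \<comment> \<open>The first integral of the differential equation \<open>ode\<close>, zero at time \<open>T\<close>.\<close>
  define E where "E t = (\<rho>1 - \<rho>0) * (zw t)\<^sup>2 / 2 + P t * zw t - S t" for t
  have E0: "E t = 0" if "t > T" for t
  proof -
    have "E t = E T"
    proof (rule DERIV_isconst_end[OF that])
      show "continuous_on {T..t} E" unfolding E_def
        by (intro continuous_intros P_cont S_cont continuous_on_subset[OF zc]) auto
      show "(E has_real_derivative 0) (at s)" if s: "T < s" "s < t" for s
      proof -
        have dzw: "(zw has_real_derivative deriv (front w) s - v) (at s)"
          unfolding zw_def by (auto intro!: derivative_eq_intros front_regular(2)[OF s(1)])
        have "(E has_real_derivative (\<rho>1 - \<rho>0) * zw s * (deriv (front w) s - v)
            + (dP * zw s + (deriv (front w) s - v) * P s) - dS s) (at s)"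
          unfolding E_def by (auto intro!: derivative_eq_intros dzw P_deriv S_deriv)
        moreover have "(\<rho>1 - \<rho>0) * zw s * (deriv (front w) s - v)
            + (dP * zw s + (deriv (front w) s - v) * P s) - dS s
          = collected 0 s * (deriv (front w) s - v) - (collected 1 s - v * collected 0 s)"
          unfolding A1 unfolding A0 by (simp add: algebra_simps)
        moreover have "\<dots> = 0" using ode[OF s(1)] by (simp add: algebra_simps)
        ultimately show ?thesis by simp
      qed
    qed
    then show ?thesis by (simp add: E_def zw_def start S_at_T)
  qed
  have sol: "zw t = z t \<and> collected 0 t = m t" if t: "t > T" for t
  proof -
    have mp: "m t > 0" "P t > 0" "(m t)\<^sup>2 = (P t)\<^sup>2 + 2 * (\<rho>1 - \<rho>0) * S t" using mass_pos[of t] t by auto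
    have e: "2 * S t = zw t * (P t + (P t + (\<rho>1 - \<rho>0) * zw t))"
      using E0[OF t] by (simp add: E_def power2_eq_square field_simps)
    have "(collected 0 t)\<^sup>2 = (P t)\<^sup>2 + (\<rho>1 - \<rho>0) * (zw t * (P t + (P t + (\<rho>1 - \<rho>0) * zw t)))"
      unfolding A0 by (simp add: power2_eq_square algebra_simps)
    also have "\<dots> = (m t)\<^sup>2" unfolding e[symmetric] mp(3) by simp
    finally have cm: "collected 0 t = m t" using nonneg[OF t] mp(1) by (simp add: power2_eq_iff_nonneg)
    then have "zw t * (P t + m t) = 2 * S t" unfolding e A0[symmetric] by simp
    then have "zw t = z t" using mp by (simp add: z_def field_simps)
    then show ?thesis using cm by simp
  qed
  show "front w t = c t" if "t \<ge> T"
    using sol[of t] that start S_at_T by (cases "t = T") (auto simp: zw_def c_def)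
  show "AE t in lborel. t > T \<longrightarrow> mass w t = m t"
    using ae by eventually_elim (use sol in simp)
qed

end

end

section \<open>The limit of the colliding solutions\<close>

text \<open>The quantities \<open>P\<close>, \<open>S\<close>, \<open>m\<close>, \<open>c\<close> of the merged wave as functions of all parameters, the
  velocity \<open>v\<close> of the middle state being an independent one: for the limit \<open>\<mu> \<rightarrow> 0\<close> only \<open>\<mu> \<rightarrow> 0\<close>
  and \<open>v \<rightarrow> y\<close> matter, not how \<open>v\<close> depends on \<open>\<mu>\<close>.\<close>

definition trajectory_P :: "real \<Rightarrow> real \<Rightarrow> real \<Rightarrow> real \<Rightarrow> real \<Rightarrow> real \<Rightarrow> real \<Rightarrow> real \<Rightarrow> real" where
  "trajectory_P \<rho>0 \<rho>1 \<xi> u0 u1 \<mu> v t = \<xi> + \<rho>0 * ((u0 - v) * t - \<mu> / 2) + \<rho>1 * ((v - u1) * t - \<mu> / 2)"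

definition trajectory_S :: "real \<Rightarrow> real \<Rightarrow> real \<Rightarrow> real \<Rightarrow> real \<Rightarrow> real \<Rightarrow> real \<Rightarrow> real" where
  "trajectory_S \<rho>0 \<rho>1 u0 u1 \<mu> v t = (\<rho>0 * ((u0 - v) * t - \<mu> / 2)\<^sup>2 - \<rho>1 * ((v - u1) * t - \<mu> / 2)\<^sup>2) / 2"

definition trajectory_mass :: "real \<Rightarrow> real \<Rightarrow> real \<Rightarrow> real \<Rightarrow> real \<Rightarrow> real \<Rightarrow> real \<Rightarrow> real \<Rightarrow> real" where
  "trajectory_mass \<rho>0 \<rho>1 \<xi> u0 u1 \<mu> v t =
     sqrt ((trajectory_P \<rho>0 \<rho>1 \<xi> u0 u1 \<mu> v t)\<^sup>2 + 2 * (\<rho>1 - \<rho>0) * trajectory_S \<rho>0 \<rho>1 u0 u1 \<mu> v t)"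

definition trajectory :: "real \<Rightarrow> real \<Rightarrow> real \<Rightarrow> real \<Rightarrow> real \<Rightarrow> real \<Rightarrow> real \<Rightarrow> real \<Rightarrow> real" where
  "trajectory \<rho>0 \<rho>1 \<xi> u0 u1 \<mu> v t = v * t + 2 * trajectory_S \<rho>0 \<rho>1 u0 u1 \<mu> v t
     / (trajectory_P \<rho>0 \<rho>1 \<xi> u0 u1 \<mu> v t + trajectory_mass \<rho>0 \<rho>1 \<xi> u0 u1 \<mu> v t)"

lemma integral_two_states:
  fixes \<psi> :: "real \<Rightarrow> real"
  assumes "integrable lborel \<psi>"
  shows "(LBINT x. (if x < c then p else q) * \<psi> x)
    = (p - q) * (\<integral>x. indicator {..<c} x * \<psi> x \<partial>lborel) + q * (\<integral>x. \<psi> x \<partial>lborel)"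
proof -
  have i: "integrable lborel (\<lambda>x. (p - q) * (indicator {..<c} x * \<psi> x))" "integrable lborel (\<lambda>x. q * \<psi> x)"
    using assms by (auto intro!: integrable_mult_right integrable_indicator_mult)
  have "(LBINT x. (if x < c then p else q) * \<psi> x) = (\<integral>x. (p - q) * (indicator {..<c} x * \<psi> x) + q * \<psi> x \<partial>lborel)"
    by (rule Bochner_Integration.integral_cong) (auto simp: indicator_def algebra_simps)
  then show ?thesis unfolding Bochner_Integration.integral_add[OF i] by simp
qed

lemma set_integral_from_later:
  fixes g :: "real \<Rightarrow> real"
  assumes "T > 0" "\<And>t. 0 < t \<Longrightarrow> t \<le> T \<Longrightarrow> g t = 0"
  shows "(LBINT t:{T<..}. g t) = (LBINT t:{0<..}. g t)"
  unfolding set_lebesgue_integral_def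
  by (rule Bochner_Integration.integral_cong) (use assms in \<open>auto simp: indicator_def\<close>)

context colliding
begin

lemma trajectory_eq: "m t = trajectory_mass \<rho>0 \<rho>1 \<xi> u0 u1 \<mu> v t" "c t = trajectory \<rho>0 \<rho>1 \<xi> u0 u1 \<mu> v t"
  by (simp_all add: trajectory_mass_def trajectory_def trajectory_P_def trajectory_S_def m_def c_def z_def
      P_def S_def \<alpha>_def \<beta>_def)

text \<open>If \<open>\<phi>\<close> vanishes up to the collision, only the second phase is seen, and there uniqueness
  turns an arbitrary merged wave into the explicit one.\<close>

lemma collision_limit:
  assumes N: "approx_solution (\<rho>0, u0) (\<rho>1, u1) \<xi> \<mu> v N"
    and \<phi>: "continuous_on UNIV \<phi>" and R: "\<And>z. \<phi> z \<noteq> 0 \<Longrightarrow> \<bar>fst z\<bar> \<le> R \<and> \<bar>snd z\<bar> \<le> R"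
    and late: "\<And>x t. t \<le> T \<Longrightarrow> \<phi> (x, t) = 0"
  shows "((\<lambda>\<epsilon>. LBINT t:{0<..}. (LBINT x. fst (N \<epsilon> x t) * \<phi> (x, t))) \<longlongrightarrow>
      (LBINT t:{0<..}. (LBINT x. (if x < c t then \<rho>0 else \<rho>1) * \<phi> (x, t))) + (LBINT t:{0<..}. m t * \<phi> (c t, t))) (at_right 0)"
    and "((\<lambda>\<epsilon>. LBINT t:{0<..}. (LBINT x. snd (N \<epsilon> x t) * \<phi> (x, t))) \<longlongrightarrow>
      (LBINT t:{0<..}. (LBINT x. (if x < c t then u0 else u1) * \<phi> (x, t)))) (at_right 0)"
proof -
  let ?U = "\<lambda>x t. (\<rho>0, u0)" and ?V = "\<lambda>x t. (\<rho>1, u1)"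
  obtain w0 V0 w1 V1 w where r: "riemann (- \<mu> / 2) (\<rho>0, u0) (M, v) [(w0, V0)]"
      and r': "riemann (\<mu> / 2) (M, v) (\<rho>1, u1) [(w1, V1)]"
    and adm: "admissible_on {0..T} ?U [(w0, V0), (w1, V1)]"
    and adm': "admissible_on {T..} ?U [(w, V1)]" and w: "is_Shadow w" and start: "front w T = v * T"
    and form: "\<And>\<epsilon> x t. N \<epsilon> x t = (if t < T then profile ?U [(w0, V0), (w1, V1)] \<epsilon> x t
        else profile ?U [(w, V1)] \<epsilon> x t)"
    by (rule approx_solution_structure[OF N]) (rule that)
  have V1: "V1 = ?V" by (rule riemann_shadow(1)[OF r' v_between(1)])
  have reg: "regular_shadow {T..} w" using adm' w by (simp add: admissible_on_def)
  have solves: "solves_in_limit N (initial_data (\<rho>0, u0) (\<rho>1, u1) \<xi> \<mu> v)"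
    using N by (simp add: approx_solution_def)
  note two = weak_two_phase[OF r r' adm adm' w form]
  have weak: "(\<rho>0 * u0 ^ k - \<rho>1 * u1 ^ k) * (\<integral>x. indicator {..<v * T} x * \<phi> (x, T) \<partial>lborel)
        + front_mass k T * \<phi> (v * T, T) + \<rho>1 * u1 ^ k * (\<integral>x. \<phi> (x, T) \<partial>lborel)
        + (LBINT t:{T<..}. weak_rate k \<phi> ?U [(w, ?V)] t) = 0"
    if "test_function UNIV \<phi>" "k \<in> {0, 1}" for \<phi> k
  proof (rule tendsto_unique[OF trivial_limit_at_right_real two(1)[OF that, unfolded V1]])
    show "((\<lambda>\<epsilon>. (LBINT t:{0<..}. (LBINT x. moment k (N \<epsilon> x t) * dt \<phi> x t + moment (Suc k) (N \<epsilon> x t) * dx \<phi> x t))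
        + (\<integral>x. moment k (initial_data (\<rho>0, u0) (\<rho>1, u1) \<xi> \<mu> v x) * \<phi> (x, 0) \<partial>lborel)) \<longlongrightarrow> 0) (at_right 0)"
      using solves that unfolding solves_in_limit_moments by blast
  qed
  note uniq = merged_unique[OF w reg start two(2)[unfolded V1] weak]
  have front: "front w t = c t" if "t \<ge> T" for t by (rule uniq(1)) (use that in auto)
  have mass: "AE t in lborel. t > T \<longrightarrow> mass w t = m t" by (rule uniq(2)) auto
  obtain B where B0: "B \<ge> 0" and B: "\<And>z. \<bar>\<phi> z\<bar> \<le> B" using bounded_test[OF \<phi> R] by blast
  have line: "integrable lborel (\<lambda>x. \<phi> (x, t))" for t
    by (rule test_line(2)[OF \<phi> R])
  have ord: "ordered t [(w, V1)]" for t by (simp add: ordered_def)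
  have tame: "tame_wave (moment k) {T<..} (front_moment k) w" "tame_wave snd {T<..} (\<lambda>_ _. 0) w" for k
    using admissible_tame[OF adm', of w V1] w by (auto simp: interior_real_atLeast)
  have cm: "(\<lambda>t. c t) \<in> borel_measurable borel" "(\<lambda>t. m t) \<in> borel_measurable borel"
    unfolding c_def z_def m_def P_def S_def \<alpha>_def \<beta>_def by measurable
  have bg: "set_integrable lborel {0<..} (\<lambda>t. LBINT x. (if x < c t then p else q) * \<phi> (x, t))" for p q
  proof (rule tendsto_field_integral(3)[OF \<phi> R, where f = "\<lambda>_ x t. if x < c t then p else q" and K = "\<bar>p\<bar> + \<bar>q\<bar>"])
    show m: "(\<lambda>z. if fst z < c (snd z) then p else q) \<in> borel_measurable (borel \<Otimes>\<^sub>M borel)"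
      using cm(1) by measurable
    then show "\<forall>\<^sub>F \<mu> in at_right (0::real). (\<lambda>z. if fst z < c (snd z) then p else q) \<in> borel_measurable (borel \<Otimes>\<^sub>M borel)"
      by simp
  qed auto
  have phase: "(LBINT t:{0<..}. (LBINT x. F (N \<epsilon> x t) * \<phi> (x, t))) = (LBINT t:{T<..}. (LBINT x. F (profile ?U [(w, V1)] \<epsilon> x t) * \<phi> (x, t)))"
    for F :: "state \<Rightarrow> real" and \<epsilon>
  proof -
    have "(LBINT t:{T<..}. (LBINT x. F (profile ?U [(w, V1)] \<epsilon> x t) * \<phi> (x, t))) = (LBINT t:{T<..}. (LBINT x. F (N \<epsilon> x t) * \<phi> (x, t)))"
      by (rule set_lebesgue_integral_cong) (auto simp: form)
    also have "\<dots> = (LBINT t:{0<..}. (LBINT x. F (N \<epsilon> x t) * \<phi> (x, t)))"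
      by (rule set_integral_from_later[OF T_pos]) (simp add: late)
    finally show ?thesis ..
  qed
  have fm: "(\<lambda>z. F (V' (fst z) (snd z))) \<in> borel_measurable borel" if "V' \<in> fields ?U [(w, V1)]" for V' and F :: "state \<Rightarrow> real"
    using that by (auto simp: V1)
  have C: "\<bar>F (V' x t) * \<phi> (x, t)\<bar> \<le> (\<bar>F (\<rho>0, u0)\<bar> + \<bar>F (\<rho>1, u1)\<bar>) * B" if "V' \<in> fields ?U [(w, V1)]" for V' x t and F :: "state \<Rightarrow> real"
    unfolding abs_mult using that B by (intro mult_mono) (auto simp: V1)
  have wt: "tame_wave F {T<..} mm w'" if "(w', V') \<in> set [(w, V1)]" "tame_wave F {T<..} mm w" for F mm w' V'
    using that by simp
  \<comment> \<open>The velocity is bounded, so the vanishing strips leave no point mass.\<close>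
  have "((\<lambda>\<epsilon>. LBINT t:{T<..}. (LBINT x. snd (profile ?U [(w, V1)] \<epsilon> x t) * \<phi> (x, t)))
      \<longlongrightarrow> (LBINT t:{T<..}. pairing snd (\<lambda>w. 0) (\<lambda>x. \<phi> (x, t)) t ?U [(w, V1)])) (at_right 0)"
    by (rule pattern_limit(1)[where m = "\<lambda>_ _. 0", OF _ ord \<phi> R fm C]) (use tame(2) in auto)
  moreover have "(LBINT t:{T<..}. pairing snd (\<lambda>w. 0) (\<lambda>x. \<phi> (x, t)) t ?U [(w, V1)])
      = (LBINT t:{T<..}. (LBINT x. (if x < c t then u0 else u1) * \<phi> (x, t)))"
  proof (rule set_lebesgue_integral_cong)
    show "\<forall>t. t \<in> {T<..} \<longrightarrow> pairing snd (\<lambda>w. 0) (\<lambda>x. \<phi> (x, t)) t ?U [(w, V1)] = (LBINT x. (if x < c t then u0 else u1) * \<phi> (x, t))"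
    proof (intro allI impI)
      fix t assume "t \<in> {T<..}"
      then have "front w t = c t" by (simp add: front)
      moreover have "(LBINT x. indicator {..<c t} x * ((u0 - u1) * \<phi> (x, t))) = (u0 - u1) * (LBINT x. indicator {..<c t} x * \<phi> (x, t))"
        unfolding integral_mult_right_zero[symmetric] by (rule Bochner_Integration.integral_cong) simp_all
      ultimately show "pairing snd (\<lambda>w. 0) (\<lambda>x. \<phi> (x, t)) t ?U [(w, V1)] = (LBINT x. (if x < c t then u0 else u1) * \<phi> (x, t))"
        unfolding integral_two_states[OF line] by (simp add: V1)
    qed
  qed simp
  moreover have "\<dots> = (LBINT t:{0<..}. (LBINT x. (if x < c t then u0 else u1) * \<phi> (x, t)))"
    by (rule set_integral_from_later[OF T_pos]) (simp add: late)
  ultimately show "((\<lambda>\<epsilon>. LBINT t:{0<..}. (LBINT x. snd (N \<epsilon> x t) * \<phi> (x, t))) \<longlongrightarrow>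
      (LBINT t:{0<..}. (LBINT x. (if x < c t then u0 else u1) * \<phi> (x, t)))) (at_right 0)"
    unfolding phase by simp
  \<comment> \<open>The mass on the front is known for almost every time only, which suffices under the integral.\<close>
  define A where "A t = (LBINT x. (if x < c t then \<rho>0 else \<rho>1) * \<phi> (x, t))" for t
  define L where "L t = pairing (moment 0) (\<lambda>w. front_moment 0 w t) (\<lambda>x. \<phi> (x, t)) t ?U [(w, V1)]" for t
  have lim: "((\<lambda>\<epsilon>. LBINT t:{T<..}. (LBINT x. moment 0 (profile ?U [(w, V1)] \<epsilon> x t) * \<phi> (x, t)))
      \<longlongrightarrow> (LBINT t:{T<..}. L t)) (at_right 0)" and Lint: "set_integrable lborel {T<..} L"
    unfolding L_def
    by (rule pattern_limit[where m = "front_moment 0", OF _ ord \<phi> R fm C]; use tame(1) in simp)+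
  have Aint: "set_integrable lborel {T<..} A"
    unfolding A_def by (rule set_integrable_subset[OF bg]) (use T_pos in auto)
  have L: "L t = A t + mass w t * \<phi> (c t, t)" if "t > T" for t
    unfolding L_def A_def integral_two_states[OF line] using that
    by (simp add: pairing_simple V1 level_state front front_moment_def del: pairing.simps)
  have mint: "set_integrable lborel {T<..} (\<lambda>t. L t - A t)" by (rule set_integral_diff(1)[OF Lint Aint])
  have "(LBINT t:{T<..}. L t - A t) = (LBINT t:{T<..}. m t * \<phi> (c t, t))"
    unfolding set_lebesgue_integral_def
  proof (rule integral_cong_AE)
    show "(\<lambda>t. indicator {T<..} t *\<^sub>R (L t - A t)) \<in> borel_measurable lborel"
      using mint unfolding set_integrable_def by (rule borel_measurable_integrable)
    have [measurable]: "\<phi> \<in> borel_measurable (borel \<Otimes>\<^sub>M borel)"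
      using borel_measurable_continuous_onI[OF \<phi>] by (simp add: borel_prod)
    note [measurable] = cm
    show "(\<lambda>t. indicator {T<..} t *\<^sub>R (m t * \<phi> (c t, t))) \<in> borel_measurable lborel" by measurable
    show "AE t in lborel. indicator {T<..} t *\<^sub>R (L t - A t) = indicator {T<..} t *\<^sub>R (m t * \<phi> (c t, t))"
      using mass
    proof eventually_elim
      case (elim t)
      then show ?case using L[of t] by (cases "t > T") auto
    qed
  qed
  then have "(LBINT t:{T<..}. L t) = (LBINT t:{T<..}. A t) + (LBINT t:{T<..}. m t * \<phi> (c t, t))"
    using set_integral_diff(2)[OF Lint Aint] by simp
  also have "(LBINT t:{T<..}. A t) = (LBINT t:{0<..}. A t)"
    by (rule set_integral_from_later[OF T_pos]) (simp add: late A_def)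
  also have "(LBINT t:{T<..}. m t * \<phi> (c t, t)) = (LBINT t:{0<..}. m t * \<phi> (c t, t))"
    by (rule set_integral_from_later[OF T_pos]) (simp add: late)
  finally show "((\<lambda>\<epsilon>. LBINT t:{0<..}. (LBINT x. fst (N \<epsilon> x t) * \<phi> (x, t))) \<longlongrightarrow>
      (LBINT t:{0<..}. (LBINT x. (if x < c t then \<rho>0 else \<rho>1) * \<phi> (x, t))) + (LBINT t:{0<..}. m t * \<phi> (c t, t))) (at_right 0)"
    using lim unfolding phase by (simp add: moment_def A_def)
qed

text \<open>In terms of the data, to show that the collision happens early for small \<open>\<mu>\<close>.\<close>

lemma T_formula: "T = (\<mu> * sqrt \<rho>0 + sqrt (\<xi> * \<mu>)) / (2 * sqrt \<rho>0 * (u0 - v))"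
proof -
  have "\<mu> * rk = sqrt (\<xi> * \<mu>)"
  proof -
    have "(\<mu> * k)\<^sup>2 = k\<^sup>2 * \<mu> * \<mu>" for k by (simp add: power2_eq_square)
    then have "(\<mu> * rk)\<^sup>2 = \<xi> * \<mu>" by (simp only: roots(6)[symmetric])
    then show ?thesis using pos roots(2) by (metis abs_of_nonneg less_imp_le mult_nonneg_nonneg real_sqrt_abs)
  qed
  then have s: "sqrt (\<xi> * \<mu>) = \<mu> * rk" by simp
  have "ra * (u0 - v) = rel * (ra + rk)" unfolding relative_velocities(1) using roots(1) by simp
  then have "(\<mu> * ra + sqrt (\<xi> * \<mu>)) / (2 * ra * (u0 - v)) = \<mu> * (ra + rk) / (2 * (rel * (ra + rk)))"
    unfolding s by (simp add: algebra_simps)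
  also have "\<dots> = \<mu> / (2 * rel)"
  proof -
    have "ra + rk > 0" using roots(1,2) by (rule add_pos_pos)
    then show ?thesis by simp
  qed
  finally show ?thesis by (simp add: T_def)
qed

end

text \<open>The density \<open>\<xi> / \<mu>\<close> of the middle state tends to infinity, so the reduced densities tend to
  those of the outer states.\<close>

lemma y_mu_limit:
  assumes pos: "\<rho>0 > 0" "\<rho>1 > 0" "\<xi> > 0"
  shows "((\<lambda>\<mu>. y_mu (\<rho>0, u0) (\<rho>1, u1) \<xi> \<mu>) \<longlongrightarrow>
    (u0 * sqrt \<rho>0 + u1 * sqrt \<rho>1) / (sqrt \<rho>0 + sqrt \<rho>1)) (at_right 0)"
proof -
  define r where "r \<rho> \<mu> = \<rho> * (\<xi> / \<mu>) / (sqrt (\<xi> / \<mu>) + sqrt \<rho>)\<^sup>2" for \<rho> \<mu> :: real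
  have r: "((\<lambda>\<mu>. r \<rho> \<mu>) \<longlongrightarrow> \<rho>) (at_right 0)" for \<rho>
  proof (rule Lim_transform_eventually)
    have "((\<lambda>\<mu>. \<rho> * \<xi> / (sqrt \<xi> + sqrt \<rho> * sqrt \<mu>)\<^sup>2) \<longlongrightarrow> \<rho> * \<xi> / (sqrt \<xi> + sqrt \<rho> * sqrt 0)\<^sup>2) (at_right 0)"
      by (intro tendsto_intros) (use pos in auto)
    then show "((\<lambda>\<mu>. \<rho> * \<xi> / (sqrt \<xi> + sqrt \<rho> * sqrt \<mu>)\<^sup>2) \<longlongrightarrow> \<rho>) (at_right 0)"
      using pos by simp
    show "\<forall>\<^sub>F \<mu> in at_right 0. \<rho> * \<xi> / (sqrt \<xi> + sqrt \<rho> * sqrt \<mu>)\<^sup>2 = r \<rho> \<mu>"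
      using eventually_at_right_less[of 0]
    proof eventually_elim
      case (elim \<mu>)
      have "sqrt (\<xi> / \<mu>) + sqrt \<rho> = (sqrt \<xi> + sqrt \<rho> * sqrt \<mu>) / sqrt \<mu>"
        using elim by (simp add: real_sqrt_divide field_simps)
      then have "(sqrt (\<xi> / \<mu>) + sqrt \<rho>)\<^sup>2 = (sqrt \<xi> + sqrt \<rho> * sqrt \<mu>)\<^sup>2 / \<mu>"
        using elim by (simp add: power_divide)
      then show ?case using elim by (simp add: r_def)
    qed
  qed
  have eq: "y_mu (\<rho>0, u0) (\<rho>1, u1) \<xi> \<mu> =
      (u0 * sqrt (r \<rho>0 \<mu>) + u1 * sqrt (r \<rho>1 \<mu>)) / (sqrt (r \<rho>0 \<mu>) + sqrt (r \<rho>1 \<mu>))" for \<mu>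
    by (simp add: y_mu_def Let_def r_def)
  have "sqrt \<rho>0 + sqrt \<rho>1 > 0" using pos by (simp add: add_pos_pos)
  then show ?thesis unfolding eq
    by (intro tendsto_divide tendsto_add tendsto_mult tendsto_const tendsto_real_sqrt r) simp
qed

text \<open>Seen from a front of speed \<open>y\<close> the momentum fluxes of the two streams balance, which is why
  \<open>trajectory_S\<close> tends to zero. The second expression is the mass flux into such a front.\<close>

lemma balanced_velocity:
  fixes \<rho>0 \<rho>1 u0 u1 :: real
  assumes pos: "\<rho>0 > 0" "\<rho>1 > 0"
  defines "y \<equiv> (u0 * sqrt \<rho>0 + u1 * sqrt \<rho>1) / (sqrt \<rho>0 + sqrt \<rho>1)"
  shows "\<rho>0 * (u0 - y)\<^sup>2 = \<rho>1 * (y - u1)\<^sup>2"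
    and "\<rho>0 * (u0 - y) + \<rho>1 * (y - u1) = sqrt (\<rho>0 * \<rho>1) * (u0 - u1)"
proof -
  define a b d where "a = sqrt \<rho>0" and "b = sqrt \<rho>1" and "d = (u0 - u1) / (a + b)"
  have ab: "a > 0" "b > 0" "\<rho>0 = a\<^sup>2" "\<rho>1 = b\<^sup>2" using pos by (simp_all add: a_def b_def)
  have n: "a + b \<noteq> 0" using ab by simp
  have u: "u0 - y = b * d" "y - u1 = a * d" "u0 - u1 = (a + b) * d"
    using n unfolding y_def d_def a_def[symmetric] b_def[symmetric] by (simp_all add: field_simps)
  show "\<rho>0 * (u0 - y)\<^sup>2 = \<rho>1 * (y - u1)\<^sup>2"
    unfolding u ab by (simp add: power_mult_distrib)
  have "sqrt (\<rho>0 * \<rho>1) = a * b" by (simp add: real_sqrt_mult a_def b_def)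
  then show "\<rho>0 * (u0 - y) + \<rho>1 * (y - u1) = sqrt (\<rho>0 * \<rho>1) * (u0 - u1)"
    unfolding u ab by (simp add: power2_eq_square algebra_simps)
qed

text \<open>Since \<open>trajectory_S\<close> tends to zero, the square root becomes \<open>trajectory_P\<close> and the
  displacement from the line \<open>x = v t\<close> disappears.\<close>

lemma trajectory_limits:
  fixes \<rho>0 \<rho>1 \<xi> u0 u1 :: real
  assumes pos: "\<rho>0 > 0" "\<rho>1 > 0" "\<xi> > 0" and u: "u0 > u1" and t: "t > 0"
  defines "y \<equiv> (u0 * sqrt \<rho>0 + u1 * sqrt \<rho>1) / (sqrt \<rho>0 + sqrt \<rho>1)"
  assumes v: "(v \<longlongrightarrow> y) (at_right 0)"
  shows "((\<lambda>\<mu>. trajectory_mass \<rho>0 \<rho>1 \<xi> u0 u1 \<mu> (v \<mu>) t) \<longlongrightarrow> \<xi> + sqrt (\<rho>0 * \<rho>1) * (u0 - u1) * t) (at_right 0)"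
    and "((\<lambda>\<mu>. trajectory \<rho>0 \<rho>1 \<xi> u0 u1 \<mu> (v \<mu>) t) \<longlongrightarrow> y * t) (at_right 0)"
proof -
  let ?X = "\<xi> + sqrt (\<rho>0 * \<rho>1) * (u0 - u1) * t"
  have X: "?X > 0" using pos u t by (intro add_pos_pos) auto
  have bal: "\<rho>0 * (u0 - y)\<^sup>2 = \<rho>1 * (y - u1)\<^sup>2"
    "\<rho>0 * (u0 - y) + \<rho>1 * (y - u1) = sqrt (\<rho>0 * \<rho>1) * (u0 - u1)"
    unfolding y_def by (rule balanced_velocity[OF pos(1,2)])+
  have "((\<lambda>\<mu>. trajectory_P \<rho>0 \<rho>1 \<xi> u0 u1 \<mu> (v \<mu>) t) \<longlongrightarrow>
      \<xi> + \<rho>0 * ((u0 - y) * t - 0 / 2) + \<rho>1 * ((y - u1) * t - 0 / 2)) (at_right 0)"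
    unfolding trajectory_P_def by (intro tendsto_intros v) simp_all
  also have "\<xi> + \<rho>0 * ((u0 - y) * t - 0 / 2) + \<rho>1 * ((y - u1) * t - 0 / 2) = ?X"
    unfolding bal(2)[symmetric] by (simp add: algebra_simps)
  finally have P: "((\<lambda>\<mu>. trajectory_P \<rho>0 \<rho>1 \<xi> u0 u1 \<mu> (v \<mu>) t) \<longlongrightarrow> ?X) (at_right 0)" .
  have "((\<lambda>\<mu>. trajectory_S \<rho>0 \<rho>1 u0 u1 \<mu> (v \<mu>) t) \<longlongrightarrow>
      (\<rho>0 * ((u0 - y) * t - 0 / 2)\<^sup>2 - \<rho>1 * ((y - u1) * t - 0 / 2)\<^sup>2) / 2) (at_right 0)"
    unfolding trajectory_S_def by (intro tendsto_intros v) simp_all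
  also have "(\<rho>0 * ((u0 - y) * t - 0 / 2)\<^sup>2 - \<rho>1 * ((y - u1) * t - 0 / 2)\<^sup>2) / 2
      = (\<rho>0 * (u0 - y)\<^sup>2 - \<rho>1 * (y - u1)\<^sup>2) * t\<^sup>2 / 2"
  proof -
    have sq: "(w * t - 0 / 2)\<^sup>2 = w\<^sup>2 * t\<^sup>2" for w by (simp add: power_mult_distrib)
    show ?thesis unfolding sq by (simp add: algebra_simps)
  qed
  also have "\<dots> = 0" unfolding bal(1) by simp
  finally have S: "((\<lambda>\<mu>. trajectory_S \<rho>0 \<rho>1 u0 u1 \<mu> (v \<mu>) t) \<longlongrightarrow> 0) (at_right 0)" .
  have "((\<lambda>\<mu>. trajectory_mass \<rho>0 \<rho>1 \<xi> u0 u1 \<mu> (v \<mu>) t) \<longlongrightarrow> sqrt (?X\<^sup>2 + 2 * (\<rho>1 - \<rho>0) * 0)) (at_right 0)"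
    unfolding trajectory_mass_def by (intro tendsto_intros P S)
  then show m: "((\<lambda>\<mu>. trajectory_mass \<rho>0 \<rho>1 \<xi> u0 u1 \<mu> (v \<mu>) t) \<longlongrightarrow> ?X) (at_right 0)"
    using X by (simp only: mult_zero_right add_0_right real_sqrt_abs abs_of_pos)
  have "((\<lambda>\<mu>. trajectory \<rho>0 \<rho>1 \<xi> u0 u1 \<mu> (v \<mu>) t) \<longlongrightarrow> y * t + 2 * 0 / (?X + ?X)) (at_right 0)"
    unfolding trajectory_def by (intro tendsto_intros P S m v) (use X in linarith)
  then show "((\<lambda>\<mu>. trajectory \<rho>0 \<rho>1 \<xi> u0 u1 \<mu> (v \<mu>) t) \<longlongrightarrow> y * t) (at_right 0)" by simp
qed

lemma trajectory_mass_bounded: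
  fixes \<rho>0 \<rho>1 \<xi> u0 u1 R :: real
  assumes pos: "\<rho>0 > 0" "\<rho>1 > 0" "\<xi> > 0"
  obtains K where "\<And>\<mu> v t. 0 < \<mu> \<Longrightarrow> \<mu> \<le> 1 \<Longrightarrow> u1 \<le> v \<Longrightarrow> v \<le> u0 \<Longrightarrow> 0 < t \<Longrightarrow> t \<le> R \<Longrightarrow>
    \<bar>trajectory_mass \<rho>0 \<rho>1 \<xi> u0 u1 \<mu> v t\<bar> \<le> K"
proof
  fix \<mu> v t :: real
  assume \<mu>: "0 < \<mu>" "\<mu> \<le> 1" and v: "u1 \<le> v" "v \<le> u0" and t: "0 < t" "t \<le> R"
  define D where "D = (u0 - u1) * R + 1"
  let ?P = "trajectory_P \<rho>0 \<rho>1 \<xi> u0 u1 \<mu> v t" and ?S = "trajectory_S \<rho>0 \<rho>1 u0 u1 \<mu> v t"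
  have w: "\<bar>w * t - \<mu> / 2\<bar> \<le> D" if "0 \<le> w" "w \<le> u0 - u1" for w
  proof -
    have "0 \<le> w * t" "w * t \<le> (u0 - u1) * R" using that t by (auto intro: mult_mono)
    then show ?thesis using \<mu> unfolding D_def by linarith
  qed
  have a: "\<bar>(u0 - v) * t - \<mu> / 2\<bar> \<le> D" and b: "\<bar>(v - u1) * t - \<mu> / 2\<bar> \<le> D"
    by (rule w; use v in linarith)+
  have wa: "\<bar>r * x\<bar> \<le> r * D" if "\<bar>x\<bar> \<le> D" "r > 0" for x r
    using that by (simp add: abs_mult)
  have "\<bar>?P\<bar> \<le> \<xi> + \<rho>0 * D + \<rho>1 * D"
    unfolding trajectory_P_def using wa[OF a pos(1)] wa[OF b pos(2)] pos(3) by linarith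
  then have P: "?P\<^sup>2 \<le> (\<xi> + \<rho>0 * D + \<rho>1 * D)\<^sup>2" by (rule abs_le_square_iff[THEN iffD1, OF order_trans]) simp
  have sq: "x\<^sup>2 \<le> D\<^sup>2" if "\<bar>x\<bar> \<le> D" for x
    using that by (simp add: abs_le_square_iff[symmetric])
  have sb: "0 \<le> r * x\<^sup>2 \<and> r * x\<^sup>2 \<le> r * D\<^sup>2" if "\<bar>x\<bar> \<le> D" "r > 0" for x r
    using sq[OF that(1)] that(2) by simp
  have S: "\<bar>?S\<bar> \<le> \<rho>0 * D\<^sup>2 + \<rho>1 * D\<^sup>2"
  proof -
    have "\<bar>(p - q) / 2\<bar> \<le> p' + q'" if "0 \<le> p \<and> p \<le> p'" "0 \<le> q \<and> q \<le> q'" for p q p' q' :: real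
    proof (rule abs_leI)
      have "0 \<le> p" "p \<le> p'" "0 \<le> q" "q \<le> q'" using that by auto
      then show "(p - q) / 2 \<le> p' + q'" "- ((p - q) / 2) \<le> p' + q'" by (simp_all add: field_simps)
    qed
    from this[OF sb[OF a pos(1)] sb[OF b pos(2)]] show ?thesis unfolding trajectory_S_def .
  qed
  have "\<bar>2 * (\<rho>1 - \<rho>0) * ?S\<bar> \<le> 2 * \<bar>\<rho>1 - \<rho>0\<bar> * (\<rho>0 * D\<^sup>2 + \<rho>1 * D\<^sup>2)"
    unfolding abs_mult using S by (intro mult_mono) auto
  then have "\<bar>?P\<^sup>2 + 2 * (\<rho>1 - \<rho>0) * ?S\<bar> \<le> (\<xi> + \<rho>0 * D + \<rho>1 * D)\<^sup>2 + 2 * \<bar>\<rho>1 - \<rho>0\<bar> * (\<rho>0 * D\<^sup>2 + \<rho>1 * D\<^sup>2)"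
    using P zero_le_power2[of ?P] by linarith
  then show "\<bar>trajectory_mass \<rho>0 \<rho>1 \<xi> u0 u1 \<mu> v t\<bar> \<le> sqrt ((\<xi> + \<rho>0 * ((u0 - u1) * R + 1) + \<rho>1 * ((u0 - u1) * R + 1))\<^sup>2
      + 2 * \<bar>\<rho>1 - \<rho>0\<bar> * (\<rho>0 * ((u0 - u1) * R + 1)\<^sup>2 + \<rho>1 * ((u0 - u1) * R + 1)\<^sup>2))"
    unfolding trajectory_mass_def real_sqrt_abs2[symmetric] D_def real_sqrt_abs' by simp
qed

lemma trajectory_measurable:
  "(\<lambda>t. trajectory_mass \<rho>0 \<rho>1 \<xi> u0 u1 \<mu> v t) \<in> borel_measurable borel"
  "(\<lambda>t. trajectory \<rho>0 \<rho>1 \<xi> u0 u1 \<mu> v t) \<in> borel_measurable borel"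
  unfolding trajectory_def trajectory_mass_def trajectory_P_def trajectory_S_def by measurable

lemma early_collision:
  fixes \<rho>0 \<rho>1 \<xi> u0 u1 :: real
  assumes pos: "\<rho>0 > 0" "\<rho>1 > 0" "\<xi> > 0" and u: "u0 > u1" and \<delta>: "\<delta> > 0"
  shows "\<forall>\<^sub>F \<mu> in at_right 0. colliding.T \<rho>0 \<rho>1 \<xi> \<mu> u0 u1 \<le> \<delta>"
proof -
  define y where "y = (u0 * sqrt \<rho>0 + u1 * sqrt \<rho>1) / (sqrt \<rho>0 + sqrt \<rho>1)"
  let ?T = "\<lambda>\<mu>. (\<mu> * sqrt \<rho>0 + sqrt (\<xi> * \<mu>)) / (2 * sqrt \<rho>0 * (u0 - y_mu (\<rho>0, u0) (\<rho>1, u1) \<xi> \<mu>))"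
  have "u0 - y = sqrt \<rho>1 * (u0 - u1) / (sqrt \<rho>0 + sqrt \<rho>1)"
  proof -
    have "sqrt \<rho>0 + sqrt \<rho>1 > 0" using pos by (simp add: add_pos_pos)
    then show ?thesis unfolding y_def by (simp add: field_simps)
  qed
  then have y: "u0 - y > 0" using pos u by (simp add: add_pos_pos)
  have "(?T \<longlongrightarrow> (0 * sqrt \<rho>0 + sqrt (\<xi> * 0)) / (2 * sqrt \<rho>0 * (u0 - y))) (at_right 0)"
    by (intro tendsto_intros y_mu_limit[OF pos, of u0 u1, folded y_def]) (use y pos in auto)
  then have "(?T \<longlongrightarrow> 0) (at_right 0)" by simp
  then have "\<forall>\<^sub>F \<mu> in at_right 0. ?T \<mu> < \<delta>" by (rule order_tendstoD(2)) (rule \<delta>)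
  then show ?thesis using eventually_at_right_less[of 0]
  proof eventually_elim
    case (elim \<mu>)
    interpret colliding \<rho>0 \<rho>1 \<xi> \<mu> u0 u1 by unfold_locales (use pos u elim in auto)
    show ?case using elim(1) unfolding T_formula v_def by simp
  qed
qed

text \<open>For small \<open>\<mu>\<close> the collision precedes the support of the test function, and the \<open>\<epsilon>\<close>-limits
  are those of the merged wave. The explicit trajectory and mass converge pointwise and
  boundedly.\<close>

lemma colliding_limit:
  fixes \<rho>0 \<rho>1 \<xi> u0 u1 :: real and N :: "real \<Rightarrow> net"
  assumes pos: "\<rho>0 > 0" "\<rho>1 > 0" "\<xi> > 0" and u: "u0 > u1"
    and N: "\<forall>\<^sub>F \<mu> in at_right 0. \<mu> > 0 \<and>
      approx_solution (\<rho>0, u0) (\<rho>1, u1) \<xi> \<mu> (y_mu (\<rho>0, u0) (\<rho>1, u1) \<xi> \<mu>) (N \<mu>)"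
  defines "y \<equiv> (u0 * sqrt \<rho>0 + u1 * sqrt \<rho>1) / (sqrt \<rho>0 + sqrt \<rho>1)"
  shows "converges_to_delta N (\<lambda>x t. if x < y * t then (\<rho>0, u0) else (\<rho>1, u1))
    (\<lambda>t. \<xi> + sqrt (\<rho>0 * \<rho>1) * (u0 - u1) * t) (\<lambda>t. y * t)"
  unfolding converges_to_delta_def
proof (intro allI impI conjI)
  fix \<phi> assume \<phi>0: "test_function {z. snd z > 0} \<phi>"
  define v where "v \<mu> = y_mu (\<rho>0, u0) (\<rho>1, u1) \<xi> \<mu>" for \<mu>
  define c where "c \<mu> t = trajectory \<rho>0 \<rho>1 \<xi> u0 u1 \<mu> (v \<mu>) t" for \<mu> t
  define m where "m \<mu> t = trajectory_mass \<rho>0 \<rho>1 \<xi> u0 u1 \<mu> (v \<mu>) t" for \<mu> t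
  obtain R where \<phi>: "continuous_on UNIV \<phi>" and R: "\<And>z. \<phi> z \<noteq> 0 \<Longrightarrow> \<bar>fst z\<bar> \<le> R \<and> \<bar>snd z\<bar> \<le> R"
    by (rule test_function_props[OF test_function_mono[OF \<phi>0]]) blast
  obtain B where B0: "B \<ge> 0" and B: "\<And>z. \<bar>\<phi> z\<bar> \<le> B" using bounded_test[OF \<phi> R] by blast
  obtain \<delta> where \<delta>: "\<delta> > 0" "\<And>x t. t \<le> \<delta> \<Longrightarrow> \<phi> (x, t) = 0"
    by (rule test_function_positive_time[OF \<phi>0]) blast
  have v: "(v \<longlongrightarrow> y) (at_right 0)" unfolding v_def y_def by (rule y_mu_limit[OF pos])
  have mlim: "((\<lambda>\<mu>. m \<mu> t) \<longlongrightarrow> \<xi> + sqrt (\<rho>0 * \<rho>1) * (u0 - u1) * t) (at_right 0)"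
    and clim: "((\<lambda>\<mu>. c \<mu> t) \<longlongrightarrow> y * t) (at_right 0)" if "t > 0" for t
    using trajectory_limits[OF pos u that v[unfolded y_def]] unfolding c_def m_def y_def by simp_all
  have [measurable]: "m \<mu> \<in> borel_measurable borel" "c \<mu> \<in> borel_measurable borel" for \<mu>
    unfolding c_def m_def by (rule trajectory_measurable)+
  have [measurable]: "\<phi> \<in> borel_measurable (borel \<Otimes>\<^sub>M borel)"
    using borel_measurable_continuous_onI[OF \<phi>] by (simp add: borel_prod)
  \<comment> \<open>The limits for fixed \<open>\<mu>\<close>, as soon as the collision precedes the support of \<open>\<phi>\<close>.\<close>
  have inner: "\<forall>\<^sub>F \<mu> in at_right 0.
     ((\<lambda>\<epsilon>. LBINT t:{0<..}. (LBINT x. fst (N \<mu> \<epsilon> x t) * \<phi> (x, t))) \<longlongrightarrow>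
      (LBINT t:{0<..}. (LBINT x. (if x < c \<mu> t then \<rho>0 else \<rho>1) * \<phi> (x, t))) + (LBINT t:{0<..}. m \<mu> t * \<phi> (c \<mu> t, t))) (at_right 0)
    \<and> ((\<lambda>\<epsilon>. LBINT t:{0<..}. (LBINT x. snd (N \<mu> \<epsilon> x t) * \<phi> (x, t))) \<longlongrightarrow>
      (LBINT t:{0<..}. (LBINT x. (if x < c \<mu> t then u0 else u1) * \<phi> (x, t)))) (at_right 0)"
    using N early_collision[OF pos u \<delta>(1)]
  proof eventually_elim
    case (elim \<mu>)
    interpret C: colliding \<rho>0 \<rho>1 \<xi> \<mu> u0 u1 by unfold_locales (use pos u elim in auto)
    have appr: "approx_solution (\<rho>0, u0) (\<rho>1, u1) \<xi> \<mu> C.v (N \<mu>)" using elim by (simp add: C.v_def)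
    have late: "\<phi> (x, t) = 0" if "t \<le> C.T" for x t by (rule \<delta>(2)) (use that elim in linarith)
    have "((\<lambda>\<epsilon>. LBINT t:{0<..}. (LBINT x. fst (N \<mu> \<epsilon> x t) * \<phi> (x, t))) \<longlongrightarrow>
        (LBINT t:{0<..}. (LBINT x. (if x < C.c t then \<rho>0 else \<rho>1) * \<phi> (x, t))) + (LBINT t:{0<..}. C.m t * \<phi> (C.c t, t))) (at_right 0)"
      "((\<lambda>\<epsilon>. LBINT t:{0<..}. (LBINT x. snd (N \<mu> \<epsilon> x t) * \<phi> (x, t))) \<longlongrightarrow>
        (LBINT t:{0<..}. (LBINT x. (if x < C.c t then u0 else u1) * \<phi> (x, t)))) (at_right 0)"
      by (rule C.collision_limit[OF appr \<phi> R late]; assumption)+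
    moreover have "C.c = c \<mu>" "C.m = m \<mu>" unfolding c_def m_def v_def C.v_def[symmetric]
      by (intro ext C.trajectory_eq)+
    ultimately show ?case by simp
  qed
  \<comment> \<open>A point off the line \<open>x = y t\<close> is eventually on the same side of the trajectories.\<close>
  have two: "((\<lambda>\<mu>. LBINT t:{0<..}. (LBINT x. (if x < c \<mu> t then p else q) * \<phi> (x, t))) \<longlongrightarrow>
      (LBINT t:{0<..}. (LBINT x. (if x < y * t then p else q) * \<phi> (x, t)))) (at_right 0)" for p q :: real
  proof (rule tendsto_field_integral(1)[OF \<phi> R, where K = "\<bar>p\<bar> + \<bar>q\<bar>"])
    show "\<forall>\<^sub>F \<mu> in at_right 0. (\<lambda>z. if fst z < c \<mu> (snd z) then p else q) \<in> borel_measurable (borel \<Otimes>\<^sub>M borel)"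
      by (rule always_eventually, rule allI, measurable)
    show "(\<lambda>z. if fst z < y * snd z then p else q) \<in> borel_measurable (borel \<Otimes>\<^sub>M borel)" by measurable
    show "\<forall>\<^sub>F \<mu> in at_right 0. \<forall>x. \<forall>t>0. \<bar>if x < c \<mu> t then p else q\<bar> \<le> \<bar>p\<bar> + \<bar>q\<bar>" by simp
    show "AE x in lborel. ((\<lambda>\<mu>. if x < c \<mu> t then p else q) \<longlongrightarrow> (if x < y * t then p else q)) (at_right 0)"
      if t: "t > 0" for t
      using AE_lborel_singleton[of "y * t"]
    proof eventually_elim
      case (elim x)
      have "\<forall>\<^sub>F \<mu> in at_right 0. (if x < c \<mu> t then p else q) = (if x < y * t then p else q)"
      proof (cases "x < y * t")
        case True
        show ?thesis by (rule eventually_mono[OF order_tendstoD(1)[OF clim[OF t] True]]) (use True in simp)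
      next
        case False
        then have "y * t < x" using elim by simp
        show ?thesis
          by (rule eventually_mono[OF order_tendstoD(2)[OF clim[OF t] \<open>y * t < x\<close>]]) (use False in simp)
      qed
      then show ?case by (rule tendsto_eventually)
    qed
  qed
  \<comment> \<open>The masses are bounded uniformly in \<open>\<mu>\<close>, because the middle velocity stays between the outer
    ones.\<close>
  obtain K where K: "\<And>\<mu> v t. 0 < \<mu> \<Longrightarrow> \<mu> \<le> 1 \<Longrightarrow> u1 \<le> v \<Longrightarrow> v \<le> u0 \<Longrightarrow> 0 < t \<Longrightarrow> t \<le> R \<Longrightarrow>
      \<bar>trajectory_mass \<rho>0 \<rho>1 \<xi> u0 u1 \<mu> v t\<bar> \<le> K"
    by (rule trajectory_mass_bounded[OF pos]) (rule that)
  have atoms: "((\<lambda>\<mu>. LBINT t:{0<..}. m \<mu> t * \<phi> (c \<mu> t, t)) \<longlongrightarrow>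
      (LBINT t:{0<..}. (\<xi> + sqrt (\<rho>0 * \<rho>1) * (u0 - u1) * t) * \<phi> (y * t, t))) (at_right 0)"
  proof (rule tendsto_front_integral(1)[where K = "\<bar>K\<bar> * B" and R = R])
    show "\<forall>\<^sub>F \<mu> in at_right 0. (\<lambda>t. indicator {0<..} t * (m \<mu> t * \<phi> (c \<mu> t, t))) \<in> borel_measurable borel"
      by (rule always_eventually, rule allI, measurable)
    have "\<forall>\<^sub>F \<mu> in at_right 0. 0 < \<mu> \<and> \<mu> \<le> (1 :: real)"
      using eventually_at_right_real[of 0 1] by (auto elim: eventually_mono)
    then show "\<forall>\<^sub>F \<mu> in at_right 0. \<forall>t>0. \<bar>m \<mu> t * \<phi> (c \<mu> t, t)\<bar> \<le> \<bar>K\<bar> * B * indicator {-R..R} t"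
    proof eventually_elim
      case (elim \<mu>)
      interpret C: colliding \<rho>0 \<rho>1 \<xi> \<mu> u0 u1 by unfold_locales (use pos u elim in auto)
      have vb: "u1 \<le> v \<mu>" "v \<mu> \<le> u0" using C.v_between unfolding C.v_def v_def by simp_all
      show ?case
      proof (intro allI impI)
        fix t :: real assume t: "t > 0"
        show "\<bar>m \<mu> t * \<phi> (c \<mu> t, t)\<bar> \<le> \<bar>K\<bar> * B * indicator {-R..R} t"
        proof (cases "t \<le> R")
          case True
          have "\<bar>m \<mu> t\<bar> \<le> \<bar>K\<bar>" using K[of \<mu> "v \<mu>" t] elim vb t True unfolding m_def by linarith
          then have "\<bar>m \<mu> t * \<phi> (c \<mu> t, t)\<bar> \<le> \<bar>K\<bar> * B"
            unfolding abs_mult using B B0 by (intro mult_mono) auto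
          then show ?thesis using t True by simp
        next
          case False
          then have "\<phi> (c \<mu> t, t) = 0" using R[of "(c \<mu> t, t)"] t by fastforce
          then show ?thesis using B0 by simp
        qed
      qed
    qed
    show "((\<lambda>\<mu>. m \<mu> t * \<phi> (c \<mu> t, t)) \<longlongrightarrow> (\<xi> + sqrt (\<rho>0 * \<rho>1) * (u0 - u1) * t) * \<phi> (y * t, t)) (at_right 0)"
      if t: "t > 0" for t
    proof (rule tendsto_mult[OF mlim[OF t]])
      show "((\<lambda>\<mu>. \<phi> (c \<mu> t, t)) \<longlongrightarrow> \<phi> (y * t, t)) (at_right 0)"
        by (rule isCont_tendsto_compose[OF test_line(3)[OF \<phi> R] clim[OF t]])
    qed
  qed
  show "iterated_limit (\<lambda>\<mu> \<epsilon>. LBINT t:{0<..}. (LBINT x. fst (N \<mu> \<epsilon> x t) * \<phi> (x, t)))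
       ((LBINT t:{0<..}. (LBINT x. fst (if x < y * t then (\<rho>0, u0) else (\<rho>1, u1)) * \<phi> (x, t)))
        + (LBINT t:{0<..}. (\<xi> + sqrt (\<rho>0 * \<rho>1) * (u0 - u1) * t) * \<phi> (y * t, t)))"
    unfolding iterated_limit_def if_distrib[of fst] fst_conv
    by (rule exI, rule conjI[rotated], rule tendsto_add[OF two atoms]) (rule eventually_mono[OF inner conjunct1])
  show "iterated_limit (\<lambda>\<mu> \<epsilon>. LBINT t:{0<..}. (LBINT x. snd (N \<mu> \<epsilon> x t) * \<phi> (x, t)))
       (LBINT t:{0<..}. (LBINT x. snd (if x < y * t then (\<rho>0, u0) else (\<rho>1, u1)) * \<phi> (x, t)))"
    unfolding iterated_limit_def if_distrib[of snd] snd_conv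
    by (rule exI, rule conjI[rotated], rule two) (rule eventually_mono[OF inner conjunct2])
qed

text \<open>There is only one value of least dissipation, and it is attained by a solution; nothing is
  left for the initial energy to decide.\<close>

lemma colliding_selection:
  assumes pos: "\<rho>0 > 0" "\<rho>1 > 0" "\<xi> > 0" "\<mu> > 0" and L: "\<mu> / 2 < L" and u: "u0 > u1"
  shows "approx_solution (\<rho>0, u0) (\<rho>1, u1) \<xi> \<mu> v N \<and> least_dissipation (\<rho>0, u0) (\<rho>1, u1) \<xi> L \<mu> N \<and>
     (\<forall>v' N'. approx_solution (\<rho>0, u0) (\<rho>1, u1) \<xi> \<mu> v' N' \<and> least_dissipation (\<rho>0, u0) (\<rho>1, u1) \<xi> L \<mu> N' \<longrightarrow>
        initial_energy (\<rho>0, u0) (\<rho>1, u1) \<xi> L \<mu> v \<le> initial_energy (\<rho>0, u0) (\<rho>1, u1) \<xi> L \<mu> v')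
    \<longleftrightarrow> v = y_mu (\<rho>0, u0) (\<rho>1, u1) \<xi> \<mu> \<and> approx_solution (\<rho>0, u0) (\<rho>1, u1) \<xi> \<mu> v N"
proof -
  interpret colliding \<rho>0 \<rho>1 \<xi> \<mu> u0 u1 by unfold_locales (use pos u in auto)
  define s where "s = y_mu (\<rho>0, u0) (\<rho>1, u1) \<xi> \<mu>"
  let ?D = "total_dissipation \<rho>0 u0 \<rho>1 u1 (\<xi> / \<mu>)"
  let ?A = "approx_solution (\<rho>0, u0) (\<rho>1, u1) \<xi> \<mu>"
  let ?L = "least_dissipation (\<rho>0, u0) (\<rho>1, u1) \<xi> L \<mu>"
  let ?E = "initial_energy (\<rho>0, u0) (\<rho>1, u1) \<xi> L \<mu>"
  obtain Ns where Ns: "?A s Ns" using approx_solution_collision unfolding v_def s_def by blast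
  have strict: "?D s < ?D v'" if "v' \<noteq> s" for v'
    using total_dissipation_minimal[OF pos u] that unfolding s_def by blast
  have least: "?L N' \<longleftrightarrow> v' = s" if "?A v' N'" for v' N'
  proof -
    have "?L N' \<longleftrightarrow> (\<forall>v'' N''. ?A v'' N'' \<longrightarrow> ?D v' \<le> ?D v'')"
      by (rule least_dissipation_iff[OF that pos L])
    also have "\<dots> \<longleftrightarrow> v' = s"
    proof
      assume "\<forall>v'' N''. ?A v'' N'' \<longrightarrow> ?D v' \<le> ?D v''"
      then have "?D v' \<le> ?D s" using Ns by blast
      then show "v' = s" using strict[of v'] by force
    next
      assume "v' = s"
      then have "?D v' \<le> ?D v''" for v'' using strict[of v''] by (cases "v'' = s") auto
      then show "\<forall>v'' N''. ?A v'' N'' \<longrightarrow> ?D v' \<le> ?D v''" by simp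
    qed
    finally show ?thesis .
  qed
  show ?thesis unfolding s_def[symmetric]
  proof
    assume "?A v N \<and> ?L N \<and> (\<forall>v' N'. ?A v' N' \<and> ?L N' \<longrightarrow> ?E v \<le> ?E v')"
    then show "v = s \<and> ?A v N" using least by blast
  next
    assume *: "v = s \<and> ?A v N"
    then have "?E v \<le> ?E v'" if "?A v' N'" "?L N'" for v' N' using least that by auto
    then show "?A v N \<and> ?L N \<and> (\<forall>v' N'. ?A v' N' \<and> ?L N' \<longrightarrow> ?E v \<le> ?E v')" using * least by auto
  qed
qed

section \<open>The solutions selected by the backward energy condition\<close>

text \<open>Once the selection is known to be a single value \<open>s \<mu>\<close>, for every window \<open>L\<close>, the condition
  says no more than that \<open>u\<^sub>\<delta>\<close> has this value.\<close>

lemma backward_energy_iff_selected: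
  assumes sel: "\<And>L \<mu> w N. 0 < \<mu> \<Longrightarrow> \<mu> / 2 < L \<Longrightarrow>
      approx_solution U0 U1 \<xi> \<mu> w N \<and> least_dissipation U0 U1 \<xi> L \<mu> N \<and>
     (\<forall>v' N'. approx_solution U0 U1 \<xi> \<mu> v' N' \<and> least_dissipation U0 U1 \<xi> L \<mu> N' \<longrightarrow>
        initial_energy U0 U1 \<xi> L \<mu> w \<le> initial_energy U0 U1 \<xi> L \<mu> v')
      \<longleftrightarrow> w = s \<mu> \<and> approx_solution U0 U1 \<xi> \<mu> w N"
  shows "backward_energy U0 U1 \<xi> v N \<longleftrightarrow>
    (\<forall>\<^sub>F \<mu> in at_right 0. \<mu> > 0 \<and> v \<mu> = s \<mu> \<and> approx_solution U0 U1 \<xi> \<mu> (s \<mu>) (N \<mu>))"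
    (is "_ \<longleftrightarrow> eventually ?S _")
proof
  assume "backward_energy U0 U1 \<xi> v N"
  from eventually_happens'[OF trivial_limit_at_top_linorder
      eventually_conj[OF this[unfolded backward_energy_def] eventually_gt_at_top[of 0]]]
  obtain L where "L > 0" and ev: "\<forall>\<^sub>F \<mu> in at_right 0.
     approx_solution U0 U1 \<xi> \<mu> (v \<mu>) (N \<mu>) \<and> least_dissipation U0 U1 \<xi> L \<mu> (N \<mu>) \<and>
     (\<forall>v' N'. approx_solution U0 U1 \<xi> \<mu> v' N' \<and> least_dissipation U0 U1 \<xi> L \<mu> N' \<longrightarrow>
        initial_energy U0 U1 \<xi> L \<mu> (v \<mu>) \<le> initial_energy U0 U1 \<xi> L \<mu> v')"
    by blast
  show "eventually ?S (at_right 0)" using ev eventually_small_mu[OF \<open>L > 0\<close>]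
  proof eventually_elim
    case (elim \<mu>)
    have "v \<mu> = s \<mu> \<and> approx_solution U0 U1 \<xi> \<mu> (v \<mu>) (N \<mu>)"
      by (rule iffD1[OF sel[of \<mu> L] elim(1)]) (use elim(2) in simp_all)
    then show ?case using elim(2) by auto
  qed
next
  assume ev: "eventually ?S (at_right 0)"
  show "backward_energy U0 U1 \<xi> v N" unfolding backward_energy_def
    using eventually_gt_at_top[of 0]
  proof eventually_elim
    case (elim L)
    show ?case using ev eventually_small_mu[OF elim]
    proof eventually_elim
      case (elim \<mu>)
      then show ?case using sel[of \<mu> L "v \<mu>" "N \<mu>"] by simp
    qed
  qed
qed

lemma backward_energy_exists:
  assumes iff: "\<And>N. backward_energy U0 U1 \<xi> s N \<longleftrightarrow>
      (\<forall>\<^sub>F \<mu> in at_right 0. \<mu> > 0 \<and> s \<mu> = s \<mu> \<and> approx_solution U0 U1 \<xi> \<mu> (s \<mu>) (N \<mu>))"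
    and ex: "\<And>\<mu>. \<mu> > 0 \<Longrightarrow> \<exists>N. approx_solution U0 U1 \<xi> \<mu> (s \<mu>) N"
  shows "\<exists>N. backward_energy U0 U1 \<xi> s N"
proof
  show "backward_energy U0 U1 \<xi> s (\<lambda>\<mu>. SOME N. approx_solution U0 U1 \<xi> \<mu> (s \<mu>) N)"
    unfolding iff using eventually_at_right_less[of 0]
  proof eventually_elim
    case (elim \<mu>)
    then show ?case using someI_ex[OF ex[OF elim]] by simp
  qed
qed

theorem theorem3p1:
  fixes \<rho>0 \<rho>1 \<xi>\<delta> u0 u1 :: real
  assumes "\<rho>0 > 0" and "\<rho>1 > 0" and "\<xi>\<delta> > 0"
  shows
    "(u0 > u1 \<longrightarrow>
       (let \<xi> = sqrt (\<rho>0 * \<rho>1) * (u0 - u1);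
            y = (u0 * sqrt \<rho>0 + u1 * sqrt \<rho>1) / (sqrt \<rho>0 + sqrt \<rho>1)
        in (\<exists>N. backward_energy (\<rho>0, u0) (\<rho>1, u1) \<xi>\<delta> (y_mu (\<rho>0, u0) (\<rho>1, u1) \<xi>\<delta>) N) \<and>
           (\<forall>v N. backward_energy (\<rho>0, u0) (\<rho>1, u1) \<xi>\<delta> v N \<longrightarrow>
              converges_to_delta N
                (\<lambda>x t. if x < y * t then (\<rho>0, u0) else (\<rho>1, u1))
                (\<lambda>t. \<xi>\<delta> + \<xi> * t) (\<lambda>t. y * t)))) \<and>
     (u0 \<le> u1 \<longrightarrow>
       (\<exists>u\<delta>\<in>{u0..u1}.
          (\<forall>\<^sub>F L in at_top. \<forall>\<^sub>F \<mu> in at_right 0.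
             is_arg_min (initial_energy (\<rho>0, u0) (\<rho>1, u1) \<xi>\<delta> L \<mu>) (\<lambda>v. v \<in> {u0..u1}) u\<delta>) \<and>
          (sgn (u0 * u1) < 0 \<longrightarrow> u\<delta> = 0) \<and>
          (sgn u0 \<ge> 0 \<and> sgn u1 \<ge> 0 \<longrightarrow> u\<delta> = min u0 u1) \<and>
          (sgn u0 \<le> 0 \<and> sgn u1 \<le> 0 \<longrightarrow> u\<delta> = max u0 u1) \<and>
          (\<exists>N. backward_energy (\<rho>0, u0) (\<rho>1, u1) \<xi>\<delta> (\<lambda>\<mu>. u\<delta>) N) \<and>
          (\<forall>v N. backward_energy (\<rho>0, u0) (\<rho>1, u1) \<xi>\<delta> v N \<longrightarrow>
             locally_conserves_energy N \<and>
             converges_to_delta N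
               (\<lambda>x t. if x < u0 * t then (\<rho>0, u0)
                      else if x < u\<delta> * t then (0, x / t)
                      else if x < u1 * t then (0, x / t)
                      else (\<rho>1, u1))
               (\<lambda>t. \<xi>\<delta>) (\<lambda>t. u\<delta> * t))))"
proof (intro conjI impI)
  assume u: "u0 > u1"
  let ?s = "y_mu (\<rho>0, u0) (\<rho>1, u1) \<xi>\<delta>"
  have iff: "backward_energy (\<rho>0, u0) (\<rho>1, u1) \<xi>\<delta> v N \<longleftrightarrow>
      (\<forall>\<^sub>F \<mu> in at_right 0. \<mu> > 0 \<and> v \<mu> = ?s \<mu> \<and> approx_solution (\<rho>0, u0) (\<rho>1, u1) \<xi>\<delta> \<mu> (?s \<mu>) (N \<mu>))" for v N
    by (rule backward_energy_iff_selected) (rule colliding_selection[OF assms _ _ u])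
  have "\<exists>N. approx_solution (\<rho>0, u0) (\<rho>1, u1) \<xi>\<delta> \<mu> (?s \<mu>) N" if "\<mu> > 0" for \<mu>
  proof -
    interpret colliding \<rho>0 \<rho>1 \<xi>\<delta> \<mu> u0 u1 by unfold_locales (use assms u that in auto)
    show ?thesis using approx_solution_collision unfolding v_def .
  qed
  then have "\<exists>N. backward_energy (\<rho>0, u0) (\<rho>1, u1) \<xi>\<delta> ?s N" by (rule backward_energy_exists[OF iff])
  moreover have "converges_to_delta N
      (\<lambda>x t. if x < (u0 * sqrt \<rho>0 + u1 * sqrt \<rho>1) / (sqrt \<rho>0 + sqrt \<rho>1) * t then (\<rho>0, u0) else (\<rho>1, u1))
      (\<lambda>t. \<xi>\<delta> + sqrt (\<rho>0 * \<rho>1) * (u0 - u1) * t)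
      (\<lambda>t. (u0 * sqrt \<rho>0 + u1 * sqrt \<rho>1) / (sqrt \<rho>0 + sqrt \<rho>1) * t)"
    if "backward_energy (\<rho>0, u0) (\<rho>1, u1) \<xi>\<delta> v N" for v N
    by (rule colliding_limit[OF assms u]) (use that[unfolded iff] in \<open>auto elim: eventually_mono\<close>)
  ultimately show "let \<xi> = sqrt (\<rho>0 * \<rho>1) * (u0 - u1); y = (u0 * sqrt \<rho>0 + u1 * sqrt \<rho>1) / (sqrt \<rho>0 + sqrt \<rho>1)
     in (\<exists>N. backward_energy (\<rho>0, u0) (\<rho>1, u1) \<xi>\<delta> ?s N) \<and>
        (\<forall>v N. backward_energy (\<rho>0, u0) (\<rho>1, u1) \<xi>\<delta> v N \<longrightarrow>
           converges_to_delta N (\<lambda>x t. if x < y * t then (\<rho>0, u0) else (\<rho>1, u1)) (\<lambda>t. \<xi>\<delta> + \<xi> * t) (\<lambda>t. y * t))"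
    unfolding Let_def by blast
next
  assume u: "u0 \<le> u1"
  define s where "s = slowest u0 u1"
  have s: "u0 \<le> s" "s \<le> u1" using slowest(1)[OF u] by (auto simp: s_def)
  have iff: "backward_energy (\<rho>0, u0) (\<rho>1, u1) \<xi>\<delta> v N \<longleftrightarrow>
      (\<forall>\<^sub>F \<mu> in at_right 0. \<mu> > 0 \<and> v \<mu> = s \<and> approx_solution (\<rho>0, u0) (\<rho>1, u1) \<xi>\<delta> \<mu> s (N \<mu>))" for v N
    by (rule backward_energy_iff_selected[where s = "\<lambda>_. s"])
      (unfold s_def, rule separating_selection[OF assms _ _ u])
  have arg: "\<forall>\<^sub>F L in at_top. \<forall>\<^sub>F \<mu> in at_right 0.
      is_arg_min (initial_energy (\<rho>0, u0) (\<rho>1, u1) \<xi>\<delta> L \<mu>) (\<lambda>v. v \<in> {u0..u1}) s"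
    using eventually_gt_at_top[of 0]
  proof eventually_elim
    case (elim L)
    show ?case using eventually_small_mu[OF elim]
    proof eventually_elim
      case (elim \<mu>)
      have E: "initial_energy (\<rho>0, u0) (\<rho>1, u1) \<xi>\<delta> L \<mu> s \<le> initial_energy (\<rho>0, u0) (\<rho>1, u1) \<xi>\<delta> L \<mu> w"
        if "w \<in> {u0..u1}" for w
        using slowest(2)[OF u that] elim assms(3) by (simp add: initial_energy_eq s_def divide_right_mono)
      show ?case unfolding is_arg_min_def using s E by (auto simp: not_less)
    qed
  qed
  have "\<exists>N. backward_energy (\<rho>0, u0) (\<rho>1, u1) \<xi>\<delta> (\<lambda>\<mu>. s) N"
    by (rule backward_energy_exists) (simp_all add: iff approx_solution_exists[OF s])
  moreover have "locally_conserves_energy N \<and> converges_to_delta N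
      (\<lambda>x t. if x < u0 * t then (\<rho>0, u0) else if x < s * t then (0, x / t)
         else if x < u1 * t then (0, x / t) else (\<rho>1, u1)) (\<lambda>t. \<xi>\<delta>) (\<lambda>t. s * t)"
    if "backward_energy (\<rho>0, u0) (\<rho>1, u1) \<xi>\<delta> v N" for v N
  proof -
    have "\<forall>\<^sub>F \<mu> in at_right 0. \<mu> > 0 \<and> approx_solution (\<rho>0, u0) (\<rho>1, u1) \<xi>\<delta> \<mu> s (N \<mu>)"
      using that[unfolded iff] by (auto elim: eventually_mono)
    from separating_conserves_energy[OF s this] separating_limit[OF assms(3) s this]
    show ?thesis by (rule conjI)
  qed
  moreover have "sgn (u0 * u1) < 0 \<longrightarrow> s = 0" "sgn u0 \<ge> 0 \<and> sgn u1 \<ge> 0 \<longrightarrow> s = min u0 u1"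
      "sgn u0 \<le> 0 \<and> sgn u1 \<le> 0 \<longrightarrow> s = max u0 u1"
    using u by (auto simp: s_def slowest_def mult_less_0_iff)
  ultimately show "(\<exists>u\<delta>\<in>{u0..u1}.
          (\<forall>\<^sub>F L in at_top. \<forall>\<^sub>F \<mu> in at_right 0.
             is_arg_min (initial_energy (\<rho>0, u0) (\<rho>1, u1) \<xi>\<delta> L \<mu>) (\<lambda>v. v \<in> {u0..u1}) u\<delta>) \<and>
          (sgn (u0 * u1) < 0 \<longrightarrow> u\<delta> = 0) \<and>
          (sgn u0 \<ge> 0 \<and> sgn u1 \<ge> 0 \<longrightarrow> u\<delta> = min u0 u1) \<and>
          (sgn u0 \<le> 0 \<and> sgn u1 \<le> 0 \<longrightarrow> u\<delta> = max u0 u1) \<and>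
          (\<exists>N. backward_energy (\<rho>0, u0) (\<rho>1, u1) \<xi>\<delta> (\<lambda>\<mu>. u\<delta>) N) \<and>
          (\<forall>v N. backward_energy (\<rho>0, u0) (\<rho>1, u1) \<xi>\<delta> v N \<longrightarrow>
             locally_conserves_energy N \<and>
             converges_to_delta N
               (\<lambda>x t. if x < u0 * t then (\<rho>0, u0)
                      else if x < u\<delta> * t then (0, x / t)
                      else if x < u1 * t then (0, x / t)
                      else (\<rho>1, u1))
               (\<lambda>t. \<xi>\<delta>) (\<lambda>t. u\<delta> * t)))"
    using arg s by (intro bexI[of _ s] conjI) auto
qed

end
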